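(* Consider the port-Hamiltonian boundary node $(G,L,K)$ described in the context with $k=p$, i.e. on the spaces $(\mathbb{C}^p,X,\mathbb{C}^p)$, and assume that $2\,\mathrm{Re}\,\langle W_{B,1}g,W_Cg\rangle_{\mathbb{C}^p}\ge\langle\Xi g,g\rangle_{\mathbb{C}^{2n}}$ holds for all $g\in\ker(W_{B,2})$. Then the finite cost condition associated to the LQ optimal control problem for $(G,L,K)$ is satisfied and the optimal cost operator $\Pi$ satisfies $\Pi\le I$. Moreover, if $2\,\mathrm{Re}\,\langle W_{B,1}g,W_Cg\rangle_{\mathbb{C}^p}=\langle\Xi g,g\rangle_{\mathbb{C}^{2n}}$ for all $g\in\ker(W_{B,2})$ and if the partial differential equation $$\frac{\partial x}{\partial t}(\zeta,t)=P_1\frac{\partial}{\partial\zeta}(\mathcal{H}(\zeta)x(\zeta,t))+P_0(\mathcal{H}(\zeta)x(\zeta,t))$$ together with the boundary conditions $$\begin{bmatrix}\tilde W_{B,1}+\tilde W_C\\ \tilde W_{B,2}\end{bmatrix}\begin{bmatrix}\mathcal{H}(b)x(b,t)\\ \mathcal{H}(a)x(a,t)\end{bmatrix}=0$$ is strongly stable, then $\Pi=I$. In addition, the unique optimal control is given by $u^{\mathrm{opt}}(t)=-\tilde W_C\begin{bmatrix}\mathcal{H}(b)x^{\mathrm{opt}}(b,t)\\ \mathcal{H}(a)x^{\mathrm{opt}}(a,t)\end{bmatrix}$, $t\ge0$, where $x^{\mathrm{opt}}$ is subject to this partial differential equation with these boundary conditions. Furthermore, $\Pi=I$ satisfies the boundary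 node Riccati equation $$\langle Lx,\Pi x\rangle_X+\langle\Pi x,Lx\rangle_X+\|Gx\|_{\mathbb{C}^p}^2+\|Kx\|_{\mathbb{C}^p}^2=\|Nx\|_{\mathbb{C}^p}^2,\qquad x\in D(L),$$ with $N:D(L)\to\mathbb{C}^p$, $Nx=\left[\tilde W_{B,1}+\tilde W_C\right]\begin{bmatrix}\mathcal{H}(b)x(b)\\ \mathcal{H}(a)x(a)\end{bmatrix}$.
   Context: Port-Hamiltonian setting: $P_1=P_1^*\in\mathbb{C}^{n\times n}$ is invertible; $P_0\in\mathbb{C}^{n\times n}$; $\mathcal{H}\in L^\infty(a,b;\mathbb{C}^{n\times n})$ with $\mathcal{H}(\zeta)^*=\mathcal{H}(\zeta)\ge cI$ for some $c>0$ and a.e. $\zeta\in[a,b]$; $\tilde W_{B,1}\in\mathbb{C}^{p\times 2n}$, $\tilde W_{B,2}\in\mathbb{C}^{(n-p)\times 2n}$, $\tilde W_C\in\mathbb{C}^{k\times 2n}$. The state space is $X=L^2(a,b;\mathbb{C}^n)$ with inner product $\langle f,g\rangle_X=\langle f,\mathcal{H}g\rangle_{L^2(a,b;\mathbb{C}^n)}$. Set $$R_0=\frac{1}{\sqrt2}\begin{bmatrix}P_1&-P_1\\ I&I\end{bmatrix},\quad \Xi=\begin{bmatrix}0&I\\ I&0\end{bmatrix},\quad W_{B,1}=\tilde W_{B,1}R_0^{-1},\quad W_{B,2}=\tilde W_{B,2}R_0^{-1},\quad W_C=\tilde W_CR_0^{-1},$$ and $\tilde W_B=\begin{bmatrix}\tilde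 W_{B,1}\\ \tilde W_{B,2}\end{bmatrix}=[\tilde W_b\ \ \tilde W_a]$ with $\tilde W_b,\tilde W_a\in\mathbb{C}^{n\times n}$. Standing assumption: $\mathrm{rank}(\tilde W_B)=n$; in the diagonalization $P_1\mathcal{H}(\zeta)=S(\zeta)^{-1}\begin{bmatrix}\Lambda(\zeta)&0\\0&\Theta(\zeta)\end{bmatrix}S(\zeta)$, where $\Lambda$ and $\Theta$ are diagonal matrices containing the positive and negative eigenvalues of $P_1\mathcal{H}$ respectively, $S,\Lambda,\Theta$ are continuously differentiable; and $\tilde W_b\mathcal{H}(b)Z^+(b)\oplus\tilde W_a\mathcal{H}(a)Z^-(a)=\mathbb{C}^n$, where $Z^+(\zeta)$ (resp. $Z^-(\zeta)$) is the span of the eigenvectors of $P_1\mathcal{H}(\zeta)$ for positive (resp. negative) eigenvalues. Boundary node $(G,L,K)$ on $(\mathbb{C}^p,X,\mathbb{C}^k)$: $Lx=P_1\frac{\mathrm{d}}{\mathrm{d}\zeta}(\mathcal{H}x)+P_0(\mathcal{H}x)$, $D(L)=\{x\in X:\mathcal{H}x\in H^1(a,b;\mathbb{C}^n),\ \tilde W_{B,2}\begin{bmatrix}(\mathcal{H}x)(b)\\(\mathcal{H}x)(a)\end{bmatrix}=0\}$, $Gx=\tilde W_{B,1}\begin{bmatrix}(\mathcal{H}x)(b)\\(\mathcal{H}x)(a)\end{bmatrix}$, $Kx=\tilde W_C\begin{bmatrix}(\mathcal{H}x)(b)\\(\mathcal{H}x)(a)\end{bmatrix}$. LQ problem: minimize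 $J(x_0,u)=\int_0^\infty\|u(t)\|^2+\|y(t)\|^2\,\mathrm{d}t$ subject to $\dot x=Lx$, $Gx=u$, $y=Kx$, $x(0)=x_0\in X$. Here $(x,u,y)$ ranges over generalized solutions: limits of classical solutions $(x_k,u_k,y_k)$ ($x_k\in C^1([0,\infty);X)$, $x_k(t)\in D(L)$, $u_k,y_k$ continuous, equations holding for all $t\ge0$), with $x_k\to x$ in $X$ uniformly on bounded intervals and $u_k\to u$, $y_k\to y$ in $L^2$ on every $[0,\tau]$. The formulas for $u^{\mathrm{opt}},x^{\mathrm{opt}}$ are understood in this sense, with $x^{\mathrm{opt}}(\cdot,0)=x_0$. Finite cost condition: for every $x_0\in X$ there is at least one input $u$ with $J(x_0,u)<\infty$. Optimal cost operator: the operator $\Pi=\Pi^*\in\mathcal{L}(X)$ with $\langle x_0,\Pi x_0\rangle_X=\inf_{u\in L^2(0,\infty;\mathbb{C}^p)}J(x_0,u)$ for all $x_0\in X$; $\Pi\le I$ means $\langle x_0,\Pi x_0\rangle_X\le\|x_0\|_X^2$ for all $x_0$. Strong stability of the PDE with the stated boundary conditions means that the semigroup $(\mathbb{T}_t)_{t\ge0}$ generated by $L_{|\ker(G+K)}$ is strongly stable: $\|\mathbb{T}_tx_0\|_X\to0$ as $t\to\infty$ for every $x_0\in X$.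
   Formalization: Added sign conditions on P_0: Re⟨P_0 v,v⟩ ≤ 0 for the first part and P_0* = −P_0 for the "Moreover" part; without them the claim fails (P_1 = H = 1, P_0 = r > 0 on [0,1] gives ⟨x_0,Πx_0⟩ = ∫e^{2rζ}|x_0|² dζ). *)

theory Defs
  imports "HOL-Analysis.Analysis"
begin

section \<open>Complex vectors and matrices\<close>

definition cinner :: "complex^'m::finite \<Rightarrow> complex^'m \<Rightarrow> complex" where
  "cinner v w = (\<Sum>i\<in>UNIV. v $ i * cnj (w $ i))"

definition adjoint_mat :: "complex^'m::finite^'m \<Rightarrow> complex^'m^'m" where
  "adjoint_mat A = (\<chi> i j. cnj (A $ j $ i))"

text \<open>The index type \<open>'n + 'n\<close> realises \<open>\<complex>\<^sup>2\<^sup>n = \<complex>\<^sup>n \<times> \<complex>\<^sup>n\<close>.\<close>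

definition stack_vec :: "complex^'n::finite \<Rightarrow> complex^'n \<Rightarrow> complex^('n + 'n)" where
  "stack_vec v w = (\<chi> s. case s of Inl i \<Rightarrow> v $ i | Inr i \<Rightarrow> w $ i)"

definition block_mat ::
  "complex^'n::finite^'n \<Rightarrow> complex^'n^'n \<Rightarrow> complex^'n^'n \<Rightarrow> complex^'n^'n
    \<Rightarrow> complex^('n + 'n)^('n + 'n)" where
  "block_mat A B C D = (\<chi> r c.
     case r of
       Inl i \<Rightarrow> (case c of Inl j \<Rightarrow> A $ i $ j | Inr j \<Rightarrow> B $ i $ j)
     | Inr i \<Rightarrow> (case c of Inl j \<Rightarrow> C $ i $ j | Inr j \<Rightarrow> D $ i $ j))"

definition R0 :: "complex^'n::finite^'n \<Rightarrow> complex^('n + 'n)^('n + 'n)" where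
  "R0 P = (1 / sqrt 2) *\<^sub>R block_mat P (- P) (mat 1) (mat 1)"

definition Xi :: "complex^('n::finite + 'n)^('n + 'n)" where
  "Xi = block_mat 0 (mat 1) (mat 1) 0"

section \<open>Function spaces\<close>

text \<open>Elements of \<open>L\<^sup>2\<close> and of the state space are represented by functions; equality in the
  space is equality almost everywhere, and operators act on representatives.\<close>

definition L2 :: "real set \<Rightarrow> (real \<Rightarrow> complex^'m::finite) set" where
  "L2 A = {f. f \<in> borel_measurable (lebesgue_on A) \<and>
              integrable (lebesgue_on A) (\<lambda>t. (norm (f t))\<^sup>2)}"

definition L2_loc :: "(real \<Rightarrow> complex^'m::finite) set" where
  "L2_loc = {f. \<forall>\<tau>\<ge>0. f \<in> L2 {0..\<tau>}}"

definition weak_deriv :: "real \<Rightarrow> real \<Rightarrow> (real \<Rightarrow> complex^'m::finite) \<Rightarrow> (real \<Rightarrow> complex^'m) \<Rightarrow> bool" where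
  "weak_deriv a b z w \<longleftrightarrow>
     w \<in> L2 {a..b} \<and> (\<forall>\<zeta>\<in>{a..b}. (w has_integral (z \<zeta> - z a)) {a..\<zeta>})"

text \<open>The continuous representatives of the elements of \<open>H\<^sup>1(a,b)\<close>.\<close>

definition H1 :: "real \<Rightarrow> real \<Rightarrow> (real \<Rightarrow> complex^'m::finite) set" where
  "H1 a b = {z. \<exists>w. weak_deriv a b z w}"

definition C1_on :: "real \<Rightarrow> real \<Rightarrow> (real \<Rightarrow> 'v::real_normed_vector) \<Rightarrow> bool" where
  "C1_on a b f \<longleftrightarrow> (\<exists>D. continuous_on {a..b} D \<and>
     (\<forall>\<zeta>\<in>{a..b}. (f has_vector_derivative D \<zeta>) (at \<zeta> within {a..b})))"

section \<open>The data of a port-Hamiltonian boundary node\<close>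

text \<open>
  Here \<open>n = CARD('n)\<close> and \<open>p = CARD('p)\<close>. The \<open>n \<times> 2n\<close> matrix \<open>tWB\<close> is the stacked matrix of
  \<open>tWB1\<close> and \<open>tWB2\<close>. Its rows are split by an injection \<open>inrow :: 'p \<Rightarrow> 'n\<close>: the rows in
  \<open>range inrow\<close> form \<open>tWB1\<close>, the remaining \<open>n - p\<close> rows form \<open>tWB2\<close>. Since types are nonempty,
  an index type for the rows of \<open>tWB2\<close> would exclude \<open>p = n\<close>; therefore \<open>tWB2\<close> keeps the row
  index \<open>'n\<close>, with zero rows in the positions used by \<open>tWB1\<close>. Only its kernel is ever used.
\<close>

record ('n::finite, 'p::finite) phs =
  lb :: real
  ub :: real
  P1 :: "complex^'n^'n"
  P0 :: "complex^'n^'n"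
  Ham :: "real \<Rightarrow> complex^'n^'n"
  inrow :: "'p \<Rightarrow> 'n"
  tWB :: "complex^('n + 'n)^'n"
  tWC :: "complex^('n + 'n)^'p"

definition tWB1 :: "('n::finite, 'p::finite) phs \<Rightarrow> complex^('n + 'n)^'p" where
  "tWB1 S = (\<chi> i. tWB S $ inrow S i)"

definition tWB2 :: "('n::finite, 'p::finite) phs \<Rightarrow> complex^('n + 'n)^'n" where
  "tWB2 S = (\<chi> j. if j \<in> range (inrow S) then 0 else tWB S $ j)"

definition tWb :: "('n::finite, 'p::finite) phs \<Rightarrow> complex^'n^'n" where
  "tWb S = (\<chi> i j. tWB S $ i $ Inl j)"

definition tWa :: "('n::finite, 'p::finite) phs \<Rightarrow> complex^'n^'n" where
  "tWa S = (\<chi> i j. tWB S $ i $ Inr j)"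

definition WB1 :: "('n::finite, 'p::finite) phs \<Rightarrow> complex^('n + 'n)^'p" where
  "WB1 S = tWB1 S ** matrix_inv (R0 (P1 S))"

definition WB2 :: "('n::finite, 'p::finite) phs \<Rightarrow> complex^('n + 'n)^'n" where
  "WB2 S = tWB2 S ** matrix_inv (R0 (P1 S))"

definition WC :: "('n::finite, 'p::finite) phs \<Rightarrow> complex^('n + 'n)^'p" where
  "WC S = tWC S ** matrix_inv (R0 (P1 S))"

definition port_hamiltonian :: "('n::finite, 'p::finite) phs \<Rightarrow> bool" where
  "port_hamiltonian S \<longleftrightarrow>
     lb S < ub S \<and>
     adjoint_mat (P1 S) = P1 S \<and> invertible (P1 S) \<and>
     Ham S \<in> borel_measurable (lebesgue_on {lb S..ub S}) \<and>
     (\<exists>M. AE \<zeta> in lebesgue_on {lb S..ub S}. norm (Ham S \<zeta>) \<le> M) \<and>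
     (\<exists>c>0. AE \<zeta> in lebesgue_on {lb S..ub S}.
        adjoint_mat (Ham S \<zeta>) = Ham S \<zeta> \<and>
        (\<forall>v. Re (cinner (Ham S \<zeta> *v v) v) \<ge> c * (norm v)\<^sup>2)) \<and>
     inj (inrow S)"

definition Zplus :: "('n::finite, 'p::finite) phs \<Rightarrow> real \<Rightarrow> (complex^'n) set" where
  "Zplus S \<zeta> = vec.span {v. v \<noteq> 0 \<and> (\<exists>r>0. (P1 S ** Ham S \<zeta>) *v v = complex_of_real r *s v)}"

definition Zminus :: "('n::finite, 'p::finite) phs \<Rightarrow> real \<Rightarrow> (complex^'n) set" where
  "Zminus S \<zeta> = vec.span {v. v \<noteq> 0 \<and> (\<exists>r<0. (P1 S ** Ham S \<zeta>) *v v = complex_of_real r *s v)}"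

definition direct_sum_UNIV :: "(complex^'n::finite) set \<Rightarrow> (complex^'n) set \<Rightarrow> bool" where
  "direct_sum_UNIV U V \<longleftrightarrow> {u + v | u v. u \<in> U \<and> v \<in> V} = UNIV \<and> U \<inter> V = {0}"

text \<open>\<open>\<Delta> \<zeta>\<close> is the block matrix \<open>diag (\<Lambda> \<zeta>) (\<Theta> \<zeta>)\<close>; the index set \<open>I\<close> carries the block \<open>\<Lambda>\<close> of
  positive eigenvalues and its complement the block \<open>\<Theta>\<close> of negative ones (either may be empty).\<close>

definition standing_assumption :: "('n::finite, 'p::finite) phs \<Rightarrow> bool" where
  "standing_assumption S \<longleftrightarrow>
     rank (tWB S) = CARD('n) \<and>
     (\<exists>(Q :: real \<Rightarrow> complex^'n^'n) (\<Delta> :: real \<Rightarrow> complex^'n^'n) (I :: 'n set).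
        C1_on (lb S) (ub S) Q \<and> C1_on (lb S) (ub S) \<Delta> \<and>
        (\<forall>\<zeta>\<in>{lb S..ub S}.
           invertible (Q \<zeta>) \<and>
           (\<forall>i j. i \<noteq> j \<longrightarrow> \<Delta> \<zeta> $ i $ j = 0) \<and>
           (\<forall>i\<in>I. \<exists>r>0. \<Delta> \<zeta> $ i $ i = complex_of_real r) \<and>
           (\<forall>i\<in>-I. \<exists>r<0. \<Delta> \<zeta> $ i $ i = complex_of_real r) \<and>
           P1 S ** Ham S \<zeta> = matrix_inv (Q \<zeta>) ** \<Delta> \<zeta> ** Q \<zeta>)) \<and>
     direct_sum_UNIV
       ((\<lambda>v. tWb S *v (Ham S (ub S) *v v)) ` Zplus S (ub S))
       ((\<lambda>v. tWa S *v (Ham S (lb S) *v v)) ` Zminus S (lb S))"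

text \<open>
  The power balance on \<open>D(L)\<close> is \<open>2 Re \<langle>L x, x\<rangle> = \<langle>\<Xi> g, g\<rangle> + 2 Re \<integral> \<langle>P\<^sub>0 \<H> x, \<H> x\<rangle>\<close>, where \<open>g\<close> is
  \<open>R\<^sub>0\<close> applied to the boundary values of \<open>\<H> x\<close>. A condition on \<open>\<Xi>\<close>, \<open>W\<^sub>B\<close> and \<open>W\<^sub>C\<close> alone
  says nothing about the second term, so that passivity and energy preservation involve the
  usual port-Hamiltonian sign conditions on \<open>P\<^sub>0\<close>.
\<close>

definition P0_dissipative :: "('n::finite, 'p::finite) phs \<Rightarrow> bool" where
  "P0_dissipative S \<longleftrightarrow> (\<forall>v. Re (cinner (P0 S *v v) v) \<le> 0)"

definition P0_skew_adjoint :: "('n::finite, 'p::finite) phs \<Rightarrow> bool" where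
  "P0_skew_adjoint S \<longleftrightarrow> adjoint_mat (P0 S) = - P0 S"

section \<open>State space and boundary node\<close>

definition X :: "('n::finite, 'p::finite) phs \<Rightarrow> (real \<Rightarrow> complex^'n) set" where
  "X S = L2 {lb S..ub S}"

definition X_eq :: "('n::finite, 'p::finite) phs \<Rightarrow> (real \<Rightarrow> complex^'n) \<Rightarrow> (real \<Rightarrow> complex^'n) \<Rightarrow> bool" where
  "X_eq S f g \<longleftrightarrow> (AE \<zeta> in lebesgue_on {lb S..ub S}. f \<zeta> = g \<zeta>)"

definition X_inner :: "('n::finite, 'p::finite) phs \<Rightarrow> (real \<Rightarrow> complex^'n) \<Rightarrow> (real \<Rightarrow> complex^'n) \<Rightarrow> complex" where
  "X_inner S f g = (LINT \<zeta>|lebesgue_on {lb S..ub S}. cinner (f \<zeta>) (Ham S \<zeta> *v g \<zeta>))"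

definition X_norm :: "('n::finite, 'p::finite) phs \<Rightarrow> (real \<Rightarrow> complex^'n) \<Rightarrow> real" where
  "X_norm S f = sqrt (Re (X_inner S f f))"

text \<open>\<open>effort S x\<close> is the continuous representative of \<open>\<H> x\<close>, provided \<open>\<H> x \<in> H\<^sup>1\<close>. Its values are
  determined everywhere on the closed interval, so its boundary values do not depend on the choice.\<close>

definition is_effort :: "('n::finite, 'p::finite) phs \<Rightarrow> (real \<Rightarrow> complex^'n) \<Rightarrow> (real \<Rightarrow> complex^'n) \<Rightarrow> bool" where
  "is_effort S x z \<longleftrightarrow> z \<in> H1 (lb S) (ub S) \<and> X_eq S z (\<lambda>\<zeta>. Ham S \<zeta> *v x \<zeta>)"

definition effort :: "('n::finite, 'p::finite) phs \<Rightarrow> (real \<Rightarrow> complex^'n) \<Rightarrow> real \<Rightarrow> complex^'n" where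
  "effort S x = (SOME z. is_effort S x z)"

definition effort_deriv :: "('n::finite, 'p::finite) phs \<Rightarrow> (real \<Rightarrow> complex^'n) \<Rightarrow> real \<Rightarrow> complex^'n" where
  "effort_deriv S x = (SOME w. weak_deriv (lb S) (ub S) (effort S x) w)"

definition trace :: "('n::finite, 'p::finite) phs \<Rightarrow> (real \<Rightarrow> complex^'n) \<Rightarrow> complex^('n + 'n)" where
  "trace S x = stack_vec (effort S x (ub S)) (effort S x (lb S))"

definition DL :: "('n::finite, 'p::finite) phs \<Rightarrow> (real \<Rightarrow> complex^'n) set" where
  "DL S = {x \<in> X S. (\<exists>z. is_effort S x z) \<and> tWB2 S *v trace S x = 0}"

definition opL :: "('n::finite, 'p::finite) phs \<Rightarrow> (real \<Rightarrow> complex^'n) \<Rightarrow> real \<Rightarrow> complex^'n" where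
  "opL S x = (\<lambda>\<zeta>. P1 S *v effort_deriv S x \<zeta> + P0 S *v effort S x \<zeta>)"

definition opG :: "('n::finite, 'p::finite) phs \<Rightarrow> (real \<Rightarrow> complex^'n) \<Rightarrow> complex^'p" where
  "opG S x = tWB1 S *v trace S x"

definition opK :: "('n::finite, 'p::finite) phs \<Rightarrow> (real \<Rightarrow> complex^'n) \<Rightarrow> complex^'p" where
  "opK S x = tWC S *v trace S x"

definition opN :: "('n::finite, 'p::finite) phs \<Rightarrow> (real \<Rightarrow> complex^'n) \<Rightarrow> complex^'p" where
  "opN S x = (tWB1 S + tWC S) *v trace S x"

section \<open>Classical and generalized solutions\<close>

definition X_continuous :: "('n::finite, 'p::finite) phs \<Rightarrow> (real \<Rightarrow> real \<Rightarrow> complex^'n) \<Rightarrow> bool" where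
  "X_continuous S x \<longleftrightarrow> (\<forall>t\<ge>0. x t \<in> X S) \<and>
     (\<forall>t\<ge>0. ((\<lambda>s. X_norm S (\<lambda>\<zeta>. x s \<zeta> - x t \<zeta>)) \<longlongrightarrow> 0) (at t within {0..}))"

definition X_has_derivative ::
  "('n::finite, 'p::finite) phs \<Rightarrow> (real \<Rightarrow> real \<Rightarrow> complex^'n) \<Rightarrow> (real \<Rightarrow> real \<Rightarrow> complex^'n) \<Rightarrow> bool" where
  "X_has_derivative S x x' \<longleftrightarrow>
     (\<forall>t\<ge>0. ((\<lambda>s. X_norm S (\<lambda>\<zeta>. (x s \<zeta> - x t \<zeta>) /\<^sub>R (s - t) - x' t \<zeta>)) \<longlongrightarrow> 0) (at t within {0..}))"

definition classical_solution ::
  "('n::finite, 'p::finite) phs \<Rightarrow> (real \<Rightarrow> real \<Rightarrow> complex^'n) \<Rightarrow> (real \<Rightarrow> complex^'p) \<Rightarrow> (real \<Rightarrow> complex^'p) \<Rightarrow> bool" where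
  "classical_solution S x u y \<longleftrightarrow>
     X_continuous S x \<and>
     (\<exists>x'. X_continuous S x' \<and> X_has_derivative S x x' \<and> (\<forall>t\<ge>0. X_eq S (x' t) (opL S (x t)))) \<and>
     continuous_on {0..} u \<and> continuous_on {0..} y \<and>
     (\<forall>t\<ge>0. x t \<in> DL S \<and> opG S (x t) = u t \<and> opK S (x t) = y t)"

definition solution_limit ::
  "('n::finite, 'p::finite) phs
    \<Rightarrow> (nat \<Rightarrow> real \<Rightarrow> real \<Rightarrow> complex^'n) \<Rightarrow> (nat \<Rightarrow> real \<Rightarrow> complex^'p) \<Rightarrow> (nat \<Rightarrow> real \<Rightarrow> complex^'p)
    \<Rightarrow> (real \<Rightarrow> real \<Rightarrow> complex^'n) \<Rightarrow> (real \<Rightarrow> complex^'p) \<Rightarrow> (real \<Rightarrow> complex^'p) \<Rightarrow> bool" where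
  "solution_limit S xs us ys x u y \<longleftrightarrow>
     (\<forall>t\<ge>0. x t \<in> X S) \<and> u \<in> L2_loc \<and> y \<in> L2_loc \<and>
     (\<forall>\<tau>\<ge>0.
        uniform_limit {0..\<tau>} (\<lambda>k t. X_norm S (\<lambda>\<zeta>. xs k t \<zeta> - x t \<zeta>)) (\<lambda>_. 0) sequentially \<and>
        (\<lambda>k. LINT t|lebesgue_on {0..\<tau>}. (norm (us k t - u t))\<^sup>2) \<longlonglongrightarrow> 0 \<and>
        (\<lambda>k. LINT t|lebesgue_on {0..\<tau>}. (norm (ys k t - y t))\<^sup>2) \<longlonglongrightarrow> 0)"

definition generalized_solution ::
  "('n::finite, 'p::finite) phs \<Rightarrow> (real \<Rightarrow> real \<Rightarrow> complex^'n) \<Rightarrow> (real \<Rightarrow> complex^'p) \<Rightarrow> (real \<Rightarrow> complex^'p) \<Rightarrow> bool" where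
  "generalized_solution S x u y \<longleftrightarrow>
     (\<exists>xs us ys. (\<forall>k. classical_solution S (xs k) (us k) (ys k)) \<and>
                 solution_limit S xs us ys x u y)"

text \<open>Generalized solutions of the partial differential equation with the homogeneous boundary
  conditions \<open>(tWB1 + tWC) (trace x) = 0\<close> and \<open>tWB2 (trace x) = 0\<close>, together with the boundary
  signals \<open>u\<close> and \<open>y\<close> they produce; the second condition is part of \<open>x k t \<in> DL S\<close>.\<close>

definition closed_loop_solution ::
  "('n::finite, 'p::finite) phs \<Rightarrow> (real \<Rightarrow> real \<Rightarrow> complex^'n) \<Rightarrow> (real \<Rightarrow> complex^'p) \<Rightarrow> (real \<Rightarrow> complex^'p) \<Rightarrow> bool" where
  "closed_loop_solution S x u y \<longleftrightarrow>
     (\<exists>xs us ys. (\<forall>k. classical_solution S (xs k) (us k) (ys k) \<and>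
                      (\<forall>t\<ge>0. (tWB1 S + tWC S) *v trace S (xs k t) = 0)) \<and>
                 solution_limit S xs us ys x u y)"

section \<open>The linear-quadratic optimal control problem\<close>

definition running_cost :: "(real \<Rightarrow> complex^'p::finite) \<Rightarrow> (real \<Rightarrow> complex^'p) \<Rightarrow> ennreal" where
  "running_cost u y = (\<integral>\<^sup>+ t. ennreal ((norm (u t))\<^sup>2 + (norm (y t))\<^sup>2) \<partial>lebesgue_on {0..})"

text \<open>The output \<open>y\<close> belonging to \<open>x0\<close> and \<open>u\<close> is determined almost everywhere by well-posedness of
  the node, so the infimum is over a single cost; it is infinite if \<open>u\<close> is not an admissible
  input.\<close>

definition J :: "('n::finite, 'p::finite) phs \<Rightarrow> (real \<Rightarrow> complex^'n) \<Rightarrow> (real \<Rightarrow> complex^'p) \<Rightarrow> ennreal" where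
  "J S x0 u = (INF y\<in>{y. \<exists>x. generalized_solution S x u y \<and> X_eq S (x 0) x0}. running_cost u y)"

definition finite_cost_condition :: "('n::finite, 'p::finite) phs \<Rightarrow> bool" where
  "finite_cost_condition S \<longleftrightarrow> (\<forall>x0\<in>X S. \<exists>u. J S x0 u < \<infinity>)"

definition optimal_cost :: "('n::finite, 'p::finite) phs \<Rightarrow> (real \<Rightarrow> complex^'n) \<Rightarrow> ennreal" where
  "optimal_cost S x0 = (INF u\<in>L2 {0..}. J S x0 u)"

definition optimal_control :: "('n::finite, 'p::finite) phs \<Rightarrow> (real \<Rightarrow> complex^'n) \<Rightarrow> (real \<Rightarrow> complex^'p) \<Rightarrow> bool" where
  "optimal_control S x0 u \<longleftrightarrow> u \<in> L2 {0..} \<and> J S x0 u = optimal_cost S x0"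

definition optimal_trajectory ::
  "('n::finite, 'p::finite) phs \<Rightarrow> (real \<Rightarrow> complex^'n)
    \<Rightarrow> (real \<Rightarrow> real \<Rightarrow> complex^'n) \<Rightarrow> (real \<Rightarrow> complex^'p) \<Rightarrow> (real \<Rightarrow> complex^'p) \<Rightarrow> bool" where
  "optimal_trajectory S x0 x u y \<longleftrightarrow>
     generalized_solution S x u y \<and> X_eq S (x 0) x0 \<and>
     optimal_control S x0 u \<and> running_cost u y = optimal_cost S x0"

section \<open>Operators and semigroups on the state space\<close>

definition X_bounded_linear ::
  "('n::finite, 'p::finite) phs \<Rightarrow> ((real \<Rightarrow> complex^'n) \<Rightarrow> (real \<Rightarrow> complex^'n)) \<Rightarrow> bool" where
  "X_bounded_linear S A \<longleftrightarrow>
     (\<forall>f\<in>X S. A f \<in> X S) \<and>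
     (\<forall>f\<in>X S. \<forall>g\<in>X S. \<forall>c. X_eq S (A (\<lambda>\<zeta>. c *s f \<zeta> + g \<zeta>)) (\<lambda>\<zeta>. c *s A f \<zeta> + A g \<zeta>)) \<and>
     (\<exists>M. \<forall>f\<in>X S. X_norm S (A f) \<le> M * X_norm S f)"

definition X_self_adjoint ::
  "('n::finite, 'p::finite) phs \<Rightarrow> ((real \<Rightarrow> complex^'n) \<Rightarrow> (real \<Rightarrow> complex^'n)) \<Rightarrow> bool" where
  "X_self_adjoint S A \<longleftrightarrow> (\<forall>f\<in>X S. \<forall>g\<in>X S. X_inner S (A f) g = X_inner S f (A g))"

definition optimal_cost_operator ::
  "('n::finite, 'p::finite) phs \<Rightarrow> ((real \<Rightarrow> complex^'n) \<Rightarrow> (real \<Rightarrow> complex^'n)) \<Rightarrow> bool" where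
  "optimal_cost_operator S Pop \<longleftrightarrow>
     X_bounded_linear S Pop \<and> X_self_adjoint S Pop \<and>
     (\<forall>x0\<in>X S. \<exists>r\<ge>0. X_inner S x0 (Pop x0) = complex_of_real r \<and> ennreal r = optimal_cost S x0)"

definition le_identity ::
  "('n::finite, 'p::finite) phs \<Rightarrow> ((real \<Rightarrow> complex^'n) \<Rightarrow> (real \<Rightarrow> complex^'n)) \<Rightarrow> bool" where
  "le_identity S Pop \<longleftrightarrow> (\<forall>x0\<in>X S. Re (X_inner S x0 (Pop x0)) \<le> (X_norm S x0)\<^sup>2)"

definition is_identity ::
  "('n::finite, 'p::finite) phs \<Rightarrow> ((real \<Rightarrow> complex^'n) \<Rightarrow> (real \<Rightarrow> complex^'n)) \<Rightarrow> bool" where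
  "is_identity S Pop \<longleftrightarrow> (\<forall>x0\<in>X S. X_eq S (Pop x0) x0)"

definition boundary_node_Riccati ::
  "('n::finite, 'p::finite) phs \<Rightarrow> ((real \<Rightarrow> complex^'n) \<Rightarrow> (real \<Rightarrow> complex^'n)) \<Rightarrow> bool" where
  "boundary_node_Riccati S Pop \<longleftrightarrow>
     (\<forall>x\<in>DL S. X_inner S (opL S x) (Pop x) + X_inner S (Pop x) (opL S x)
        + complex_of_real ((norm (opG S x))\<^sup>2) + complex_of_real ((norm (opK S x))\<^sup>2)
      = complex_of_real ((norm (opN S x))\<^sup>2))"

definition C0_semigroup ::
  "('n::finite, 'p::finite) phs \<Rightarrow> (real \<Rightarrow> (real \<Rightarrow> complex^'n) \<Rightarrow> (real \<Rightarrow> complex^'n)) \<Rightarrow> bool" where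
  "C0_semigroup S T \<longleftrightarrow>
     (\<forall>t\<ge>0. X_bounded_linear S (T t)) \<and>
     (\<forall>f\<in>X S. X_eq S (T 0 f) f) \<and>
     (\<forall>s\<ge>0. \<forall>t\<ge>0. \<forall>f\<in>X S. X_eq S (T (s + t) f) (T s (T t f))) \<and>
     (\<forall>f\<in>X S. ((\<lambda>t. X_norm S (\<lambda>\<zeta>. T t f \<zeta> - f \<zeta>)) \<longlongrightarrow> 0) (at_right 0))"

text \<open>The infinitesimal generator, as a graph.\<close>

definition generator_graph ::
  "('n::finite, 'p::finite) phs \<Rightarrow> (real \<Rightarrow> (real \<Rightarrow> complex^'n) \<Rightarrow> (real \<Rightarrow> complex^'n))
    \<Rightarrow> ((real \<Rightarrow> complex^'n) \<times> (real \<Rightarrow> complex^'n)) set" where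
  "generator_graph S T = {(f, g). f \<in> X S \<and> g \<in> X S \<and>
     ((\<lambda>h. X_norm S (\<lambda>\<zeta>. (T h f \<zeta> - f \<zeta>) /\<^sub>R h - g \<zeta>)) \<longlongrightarrow> 0) (at_right 0)}"

text \<open>The graph of the restriction of \<open>L\<close> to \<open>ker (G + K)\<close>.\<close>

definition closed_loop_graph ::
  "('n::finite, 'p::finite) phs \<Rightarrow> ((real \<Rightarrow> complex^'n) \<times> (real \<Rightarrow> complex^'n)) set" where
  "closed_loop_graph S =
     {(f, g). f \<in> DL S \<and> opG S f + opK S f = 0 \<and> g \<in> X S \<and> X_eq S g (opL S f)}"

definition closed_loop_strongly_stable :: "('n::finite, 'p::finite) phs \<Rightarrow> bool" where
  "closed_loop_strongly_stable S \<longleftrightarrow>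
     (\<exists>T. C0_semigroup S T \<and> generator_graph S T = closed_loop_graph S \<and>
          (\<forall>x0\<in>X S. ((\<lambda>t. X_norm S (T t x0)) \<longlongrightarrow> 0) at_top))"

end

theory Submission
  imports Defs
begin

text \<open>
  With the boundary conditions \<open>u = - y\<close> the operator \<open>L\<close> becomes maximal dissipative for the energy
  form: the supply rate inequality gives \<open>2 Re \<langle>L x, x\<rangle> \<le> 2 Re \<langle>G x, K x\<rangle> = - \<parallel>G x\<parallel>\<^sup>2 - \<parallel>K x\<parallel>\<^sup>2\<close>, and the
  resolvent equation is an ordinary boundary value problem with as many conditions as unknowns. Hence
  every initial state has a closed-loop solution, and its cost is at most the initial energy. The
  infimum of the quadratic cost over the linear relation between initial states and admissible
  signals is then a bounded quadratic form, represented by \<open>\<Pi> \<le> I\<close>.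

  In the lossless case every solution satisfies
  \<open>\<parallel>x t\<parallel>\<^sup>2 + \<integral> (\<parallel>u\<parallel>\<^sup>2 + \<parallel>y\<parallel>\<^sup>2) = \<parallel>x 0\<parallel>\<^sup>2 + \<integral> \<parallel>u + y\<parallel>\<^sup>2\<close> over \<open>[0, t]\<close>. Comparing a solution with the decaying
  closed-loop solution from the same initial state shows that its cost exceeds \<open>\<parallel>x 0\<parallel>\<^sup>2\<close> by at least the
  squared distance of the signals, so the closed loop is optimal and the optimum is unique.
\<close>

section \<open>The Hilbert space of square integrable functions on the line\<close>

text \<open>The data are representatives, with \<open>Ham\<close> controlled only almost everywhere,
  while the argument needs complete spaces. Everything is moved into one quotient
  \<open>'m l2\<close> of square integrable functions on the whole line; states on the spatial
  interval and signals on time intervals enter by extension by zero (\<open>emb\<close>). The price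
  is that a class may be nonzero off the interval, which is why \<Gamma> is prescribed there too and
  the projection \<open>cut\<close> accompanies the states. The quotient is only a real Hilbert
  space, and the energy form \<open>ip\<close> is the real part of \<open>X_inner\<close>. Complex
  linearity of \<Pi> is won back at the end, from invariance of the cost under multiplication by the
  imaginary unit. Boundary traces are not continuous on the state space. They are controlled through
  the dissipated energy, which makes classical closed-loop signals continuous and approximating
  signals Cauchy on the half line. The semigroup of the stability hypothesis is tied to the
  constructed flows only through its generator; a uniqueness argument for classical flows carries
  the decay over.\<close>

lemma L2_measurable [measurable_dest]: "f \<in> L2 A \<Longrightarrow> f \<in> borel_measurable (lebesgue_on A)"
  by (simp add: L2_def)

lemma L2_integrable: "f \<in> L2 A \<Longrightarrow> integrable (lebesgue_on A) (\<lambda>t. (norm (f t))\<^sup>2)"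
  by (simp add: L2_def)

lemma integrable_power2_bound:
  fixes f :: "'a \<Rightarrow> 'b::{banach,second_countable_topology}"
  assumes "integrable M h" "f \<in> borel_measurable M" "AE t in M. (norm (f t))\<^sup>2 \<le> h t"
  shows "integrable M (\<lambda>t. (norm (f t))\<^sup>2)"
proof (rule Bochner_Integration.integrable_bound[OF assms(1)])
  show "(\<lambda>t. (norm (f t))\<^sup>2) \<in> borel_measurable M"
    using assms(2) by measurable
  show "AE t in M. norm ((norm (f t))\<^sup>2) \<le> norm (h t)"
    using assms(3) by eventually_elim auto
qed

lemma L2_bound:
  assumes "integrable (lebesgue_on A) h" "f \<in> borel_measurable (lebesgue_on A)"
    "AE t in lebesgue_on A. (norm (f t))\<^sup>2 \<le> h t"
  shows "f \<in> L2 A"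
  using integrable_power2_bound[OF assms] assms(2) by (simp add: L2_def)

lemma norm_add_power2_le: "(norm (x + y :: 'a::real_normed_vector))\<^sup>2 \<le> 2 * (norm x)\<^sup>2 + 2 * (norm y)\<^sup>2"
proof -
  have "(norm (x + y))\<^sup>2 \<le> (norm x + norm y)\<^sup>2"
    by (simp add: norm_triangle_ineq power_mono)
  also have "\<dots> \<le> 2 * (norm x)\<^sup>2 + 2 * (norm y)\<^sup>2"
    using sum_squares_bound[of "norm x" "norm y"] by (simp add: power2_sum)
  finally show ?thesis .
qed

lemma L2_add:
  assumes "f \<in> L2 A" "g \<in> L2 A" shows "(\<lambda>t. f t + g t) \<in> L2 A"
proof (rule L2_bound)
  show "integrable (lebesgue_on A) (\<lambda>t. 2 * (norm (f t))\<^sup>2 + 2 * (norm (g t))\<^sup>2)"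
    using assms[THEN L2_integrable] by simp
  show "(\<lambda>t. f t + g t) \<in> borel_measurable (lebesgue_on A)"
    using assms[THEN L2_measurable] by simp
qed (simp add: norm_add_power2_le)

lemma L2_bounded_op:
  fixes F :: "real \<Rightarrow> complex^'m::finite \<Rightarrow> complex^'k::finite"
  assumes "f \<in> L2 A" "(\<lambda>t. F t (f t)) \<in> borel_measurable (lebesgue_on A)"
    "AE t in lebesgue_on A. norm (F t (f t)) \<le> K * norm (f t)"
  shows "(\<lambda>t. F t (f t)) \<in> L2 A"
proof (rule L2_bound[OF _ assms(2)])
  show "integrable (lebesgue_on A) (\<lambda>t. K\<^sup>2 * (norm (f t))\<^sup>2)"
    using L2_integrable[OF assms(1)] by simp
  show "AE t in lebesgue_on A. (norm (F t (f t)))\<^sup>2 \<le> K\<^sup>2 * (norm (f t))\<^sup>2"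
    using assms(3)
  proof eventually_elim
    case (elim t)
    have "(norm (F t (f t)))\<^sup>2 \<le> (K * norm (f t))\<^sup>2"
      using elim by (intro power_mono) auto
    then show ?case by (simp add: power_mult_distrib)
  qed
qed

lemma L2_scaleR: "f \<in> L2 A \<Longrightarrow> (\<lambda>t. r *\<^sub>R f t) \<in> L2 A"
  by (rule L2_bounded_op[of f A "\<lambda>t. scaleR r" "\<bar>r\<bar>"]) (auto dest: L2_measurable)

lemma L2_zero [simp]: "(\<lambda>t. 0) \<in> L2 A"
  by (simp add: L2_def)

lemma L2_minus: "f \<in> L2 A \<Longrightarrow> (\<lambda>t. - f t) \<in> L2 A"
  using L2_scaleR[of f A "-1"] by simp

lemma L2_diff: "f \<in> L2 A \<Longrightarrow> g \<in> L2 A \<Longrightarrow> (\<lambda>t. f t - g t) \<in> L2 A"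
  using L2_add[OF _ L2_minus, of f A g] by simp

lemma L2_inner_integrable:
  assumes "f \<in> L2 A" "g \<in> L2 A"
  shows "integrable (lebesgue_on A) (\<lambda>t. f t \<bullet> g t)"
proof (rule Bochner_Integration.integrable_bound)
  show "integrable (lebesgue_on A) (\<lambda>t. (norm (f t))\<^sup>2 + (norm (g t))\<^sup>2)"
    using assms[THEN L2_integrable] by simp
  show "(\<lambda>t. f t \<bullet> g t) \<in> borel_measurable (lebesgue_on A)"
    using assms[THEN L2_measurable] by simp
  have "\<bar>x \<bullet> y\<bar> \<le> (norm x)\<^sup>2 + (norm y)\<^sup>2" for x y :: "complex^'a"
    using Cauchy_Schwarz_ineq2[of x y] sum_squares_bound[of "norm x" "norm y"]
      mult_nonneg_nonneg[OF norm_ge_zero[of x] norm_ge_zero[of y]] by linarith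
  then show "AE t in lebesgue_on A. norm (f t \<bullet> g t) \<le> norm ((norm (f t))\<^sup>2 + (norm (g t))\<^sup>2)"
    by simp
qed

lemma L2_AE_cong:
  assumes "f \<in> L2 A" "g \<in> borel_measurable (lebesgue_on A)" "AE t in lebesgue_on A. f t = g t"
  shows "g \<in> L2 A"
proof (rule L2_bound[OF L2_integrable[OF assms(1)] assms(2)])
  show "AE t in lebesgue_on A. (norm (g t))\<^sup>2 \<le> (norm (f t))\<^sup>2"
    using assms(3) by eventually_elim simp
qed

section \<open>The quotient modulo null sets and its Hilbert space structure\<close>

definition l2eq :: "(real \<Rightarrow> complex^'m::finite) \<Rightarrow> (real \<Rightarrow> complex^'m) \<Rightarrow> bool" where
  "l2eq f g \<longleftrightarrow> f \<in> L2 UNIV \<and> g \<in> L2 UNIV \<and> (AE t in lebesgue. f t = g t)"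

\<comment> \<open>A partial quotient: the relation is reflexive exactly on the square integrable
  functions, so every class consists of such functions and \<open>rep\<close> always lands in
  \<open>L2 UNIV\<close>.\<close>
quotient_type 'm l2 = "real \<Rightarrow> complex^'m::finite" / partial: l2eq
proof (rule part_equivpI)
  show "\<exists>f. l2eq f f" by (rule exI[of _ "\<lambda>_. 0"]) (simp add: l2eq_def)
  show "symp l2eq" by (auto simp: symp_def l2eq_def elim: eventually_mono)
  show "transp l2eq" by (auto simp: transp_def l2eq_def elim: eventually_elim2)
qed

abbreviation cls :: "(real \<Rightarrow> complex^'m::finite) \<Rightarrow> 'm l2" where "cls \<equiv> abs_l2"
abbreviation rep :: "'m::finite l2 \<Rightarrow> real \<Rightarrow> complex^'m" where "rep \<equiv> rep_l2"

lemma cls_rep [simp]: "cls (rep F) = F"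
  by (rule Quotient_abs_rep[OF Quotient_l2])

lemma rep_L2 [simp]: "rep F \<in> L2 UNIV"
  using Quotient_rep_reflp[OF Quotient_l2, of F] by (simp add: l2eq_def)

lemma cls_eq_iff: "f \<in> L2 UNIV \<Longrightarrow> g \<in> L2 UNIV \<Longrightarrow> cls f = cls g \<longleftrightarrow> (AE t in lebesgue. f t = g t)"
  using Quotient_rel[OF Quotient_l2, of f g] by (simp add: l2eq_def)

lemma AE_rep_cls: "f \<in> L2 UNIV \<Longrightarrow> AE t in lebesgue. rep (cls f) t = f t"
  using cls_eq_iff[of "rep (cls f)" f] by simp

text \<open>Since \<open>rep\<close> picks representatives arbitrarily, the operations commute with
  it only up to null sets. Identities between classes are therefore checked pointwise off finitely
  many null sets and concluded by this rule.\<close>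

lemma l2_eqI: "AE t in lebesgue. rep F t = rep G t \<Longrightarrow> F = G"
  using cls_eq_iff[of "rep F" "rep G"] by simp

lemma L2_UNIV_measurable [measurable_dest]: "f \<in> L2 UNIV \<Longrightarrow> f \<in> borel_measurable lebesgue"
  using L2_measurable[of f UNIV] by (simp add: lebesgue_on_UNIV_eq)

lemma L2_UNIV_integrable: "f \<in> L2 UNIV \<Longrightarrow> integrable lebesgue (\<lambda>t. (norm (f t))\<^sup>2)"
  using L2_integrable[of f UNIV] by (simp add: lebesgue_on_UNIV_eq)

lemma L2_UNIV_iff: "f \<in> L2 UNIV \<longleftrightarrow> f \<in> borel_measurable lebesgue \<and> integrable lebesgue (\<lambda>t. (norm (f t))\<^sup>2)"
  by (simp add: L2_def lebesgue_on_UNIV_eq)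

lemma rep_measurable [measurable]: "rep F \<in> borel_measurable lebesgue"
  by (rule L2_UNIV_measurable) simp

lemma L2_UNIV_inner_integrable:
  "f \<in> L2 UNIV \<Longrightarrow> g \<in> L2 UNIV \<Longrightarrow> integrable lebesgue (\<lambda>t. f t \<bullet> g t)"
  using L2_inner_integrable[of f UNIV g] by (simp add: lebesgue_on_UNIV_eq)

instantiation l2 :: (finite) real_vector
begin
definition "zero_l2 = cls (\<lambda>_. 0)"
definition "plus_l2 F G = cls (\<lambda>t. rep F t + rep G t)"
definition "uminus_l2 F = cls (\<lambda>t. - rep F t)"
definition "minus_l2 F G = cls (\<lambda>t. rep F t - rep G t)"
definition "scaleR_l2 r F = cls (\<lambda>t. r *\<^sub>R rep F t)"

lemma AE_rep_zero: "AE t in lebesgue. rep (0::'a l2) t = 0"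
  unfolding zero_l2_def by (rule AE_rep_cls) simp
lemma AE_rep_add: "AE t in lebesgue. rep (F + G :: 'a l2) t = rep F t + rep G t"
  unfolding plus_l2_def by (rule AE_rep_cls) (simp add: L2_add)
lemma AE_rep_uminus: "AE t in lebesgue. rep (- F :: 'a l2) t = - rep F t"
  unfolding uminus_l2_def by (rule AE_rep_cls) (simp add: L2_minus)
lemma AE_rep_diff: "AE t in lebesgue. rep (F - G :: 'a l2) t = rep F t - rep G t"
  unfolding minus_l2_def by (rule AE_rep_cls) (simp add: L2_diff)
lemma AE_rep_scaleR: "AE t in lebesgue. rep (r *\<^sub>R F :: 'a l2) t = r *\<^sub>R rep F t"
  unfolding scaleR_l2_def by (rule AE_rep_cls) (simp add: L2_scaleR)

instance
proof
  fix a b c :: "'a l2" and r s :: real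
  show "a + b + c = a + (b + c)"
    by (rule l2_eqI) (use AE_rep_add[of "a + b" c] AE_rep_add[of a b] AE_rep_add[of a "b + c"]
        AE_rep_add[of b c] in eventually_elim, simp)
  show "a + b = b + a"
    by (rule l2_eqI) (use AE_rep_add[of a b] AE_rep_add[of b a] in eventually_elim, simp)
  show "0 + a = a"
    by (rule l2_eqI) (use AE_rep_add[of 0 a] AE_rep_zero in eventually_elim, simp)
  show "- a + a = 0"
    by (rule l2_eqI) (use AE_rep_add[of "-a" a] AE_rep_uminus[of a] AE_rep_zero in eventually_elim, simp)
  show "a - b = a + - b"
    by (rule l2_eqI) (use AE_rep_add[of a "-b"] AE_rep_uminus[of b] AE_rep_diff[of a b] in eventually_elim, simp)
  show "r *\<^sub>R (a + b) = r *\<^sub>R a + r *\<^sub>R b"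
    by (rule l2_eqI) (use AE_rep_add[of a b] AE_rep_scaleR[of r "a + b"] AE_rep_scaleR[of r a]
        AE_rep_scaleR[of r b] AE_rep_add[of "r *\<^sub>R a" "r *\<^sub>R b"]
        in eventually_elim, simp add: scaleR_add_right)
  show "(r + s) *\<^sub>R a = r *\<^sub>R a + s *\<^sub>R a"
    by (rule l2_eqI) (use AE_rep_scaleR[of "r + s" a] AE_rep_scaleR[of r a]
        AE_rep_scaleR[of s a] AE_rep_add[of "r *\<^sub>R a" "s *\<^sub>R a"]
        in eventually_elim, simp add: scaleR_add_left)
  show "r *\<^sub>R s *\<^sub>R a = (r * s) *\<^sub>R a"
    by (rule l2_eqI) (use AE_rep_scaleR[of "r * s" a] AE_rep_scaleR[of r "s *\<^sub>R a"]
        AE_rep_scaleR[of s a] in eventually_elim, simp)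
  show "1 *\<^sub>R a = a"
    by (rule l2_eqI) (use AE_rep_scaleR[of 1 a] in eventually_elim, simp)
qed
end

instantiation l2 :: (finite) real_inner
begin
definition "inner_l2 F G = (LINT t|lebesgue. rep F t \<bullet> rep G t)"
definition "norm_l2 (F::'a l2) = sqrt (F \<bullet> F)"
definition "sgn_l2 (F::'a l2) = F /\<^sub>R norm F"
definition "dist_l2 (F::'a l2) G = norm (F - G)"
definition "uniformity_l2 = (INF e\<in>{0<..}. principal {(F::'a l2, G). dist F G < e})"
definition "open_l2 (U::'a l2 set) \<longleftrightarrow>
  (\<forall>F\<in>U. eventually (\<lambda>(F', G). F' = F \<longrightarrow> G \<in> U) uniformity)"

instance
proof
  fix x y z :: "'a l2" and r :: real
  show "sgn x = x /\<^sub>R norm x" by (rule sgn_l2_def)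
  show "dist x y = norm (x - y)" by (rule dist_l2_def)
  show "uniformity = (INF e\<in>{0<..}. principal {(F::'a l2, G). dist F G < e})"
    by (rule uniformity_l2_def)
  show "open U \<longleftrightarrow> (\<forall>F\<in>U. eventually (\<lambda>(F', G). F' = F \<longrightarrow> G \<in> U) uniformity)" for U :: "'a l2 set"
    by (rule open_l2_def)
  show "x \<bullet> y = y \<bullet> x" by (simp add: inner_l2_def inner_commute)
  have "(x + y) \<bullet> z = (LINT t|lebesgue. rep x t \<bullet> rep z t + rep y t \<bullet> rep z t)"
    unfolding inner_l2_def
    by (rule integral_cong_AE, simp, simp) (use AE_rep_add[of x y] in eventually_elim, simp add: inner_add_left)
  then show "(x + y) \<bullet> z = x \<bullet> z + y \<bullet> z"
    by (simp add: inner_l2_def L2_UNIV_inner_integrable)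
  have "(r *\<^sub>R x) \<bullet> y = (LINT t|lebesgue. r * (rep x t \<bullet> rep y t))"
    unfolding inner_l2_def
    by (rule integral_cong_AE, simp, simp) (use AE_rep_scaleR[of r x] in eventually_elim, simp)
  then show "(r *\<^sub>R x) \<bullet> y = r * (x \<bullet> y)" by (simp add: inner_l2_def)
  show "0 \<le> x \<bullet> x" by (simp add: inner_l2_def)
  have "x \<bullet> x = 0 \<longleftrightarrow> (AE t in lebesgue. rep x t \<bullet> rep x t = 0)"
    unfolding inner_l2_def by (rule integral_nonneg_eq_0_iff_AE) (simp_all add: L2_UNIV_inner_integrable)
  also have "\<dots> \<longleftrightarrow> (AE t in lebesgue. rep x t = 0)" by simp
  also have "\<dots> \<longleftrightarrow> x = 0"
  proof
    assume *: "AE t in lebesgue. rep x t = 0"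
    show "x = 0"
      by (rule l2_eqI) (use * AE_rep_zero[where 'a='a] in eventually_elim, simp)
  qed (simp add: AE_rep_zero)
  finally show "x \<bullet> x = 0 \<longleftrightarrow> x = 0" .
  show "norm x = sqrt (x \<bullet> x)" by (rule norm_l2_def)
qed
end

lemma norm_l2_power2: "(norm (F::'m::finite l2))\<^sup>2 = (LINT t|lebesgue. (norm (rep F t))\<^sup>2)"
  by (simp add: power2_norm_eq_inner inner_l2_def)

lemma norm_cls_power2: "f \<in> L2 UNIV \<Longrightarrow> (norm (cls f))\<^sup>2 = (LINT t|lebesgue. (norm (f t))\<^sup>2)"
  unfolding norm_l2_power2
  by (intro integral_cong_AE) (use AE_rep_cls[of f] in \<open>auto dest: L2_UNIV_measurable elim: eventually_mono\<close>)

lemma nn_integral_rep: "(\<integral>\<^sup>+t. ennreal ((norm (rep F t))\<^sup>2) \<partial>lebesgue) = ennreal ((norm F)\<^sup>2)"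
  unfolding norm_l2_power2 by (rule nn_integral_eq_integral) (simp_all add: L2_UNIV_integrable)

lemma nn_integral_rep_diff:
  "(\<integral>\<^sup>+t. ennreal ((norm (rep F t - rep G t))\<^sup>2) \<partial>lebesgue) = ennreal ((norm (F - G))\<^sup>2)"
  unfolding nn_integral_rep[symmetric]
  by (rule nn_integral_cong_AE) (use AE_rep_diff[of F G] in eventually_elim, simp)

text \<open>Riesz--Fischer: along a subsequence with geometrically decaying increments, the
  representatives converge almost everywhere, and Fatou's lemma identifies the limit.\<close>

lemma l2_fast_Cauchy_AE_convergent:
  fixes F :: "nat \<Rightarrow> 'm::finite l2"
  assumes "\<And>k. (norm (F (Suc k) - F k))\<^sup>2 \<le> (1/8)^k"
  shows "AE t in lebesgue. convergent (\<lambda>k. rep (F k) t)"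
proof -
  \<comment> \<open>The weights \<open>4^k\<close> are chosen between two demands: against squared
    increments of size \<open>(1/8)^k\<close> they still leave a summable \<open>(1/2)^k\<close>,
    and a finite weighted sum at \<open>t\<close> forces the increments at \<open>t\<close> below a
    multiple of \<open>(1/2)^k\<close>.\<close>
  let ?d = "\<lambda>k t. rep (F (Suc k)) t - rep (F k) t"
  have "(\<integral>\<^sup>+t. (\<Sum>k. ennreal (4^k * (norm (?d k t))\<^sup>2)) \<partial>lebesgue)
      = (\<Sum>k. \<integral>\<^sup>+t. ennreal (4^k * (norm (?d k t))\<^sup>2) \<partial>lebesgue)"
    by (rule nn_integral_suminf) measurable
  also have "\<dots> = (\<Sum>k. ennreal (4^k * (norm (F (Suc k) - F k))\<^sup>2))"
    by (simp add: ennreal_mult nn_integral_cmult nn_integral_rep_diff)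
  also have "\<dots> \<le> (\<Sum>k. ennreal ((1/2)^k))"
  proof (intro suminf_le ennreal_leI)
    fix k
    have "4^k * (norm (F (Suc k) - F k))\<^sup>2 \<le> 4^k * (1/8)^k" by (simp add: assms)
    also have "\<dots> = (1/2 :: real)^k" by (simp flip: power_mult_distrib)
    finally show "4^k * (norm (F (Suc k) - F k))\<^sup>2 \<le> (1/2)^k" .
  qed auto
  also have "\<dots> = ennreal 2"
    using suminf_geometric[of "1/2::real"] by (subst suminf_ennreal2) (simp_all add: summable_geometric)
  finally have "(\<integral>\<^sup>+t. (\<Sum>k. ennreal (4^k * (norm (?d k t))\<^sup>2)) \<partial>lebesgue) \<noteq> \<infinity>"
    by (auto simp: top_unique)
  then have "AE t in lebesgue. (\<Sum>k. ennreal (4^k * (norm (?d k t))\<^sup>2)) \<noteq> \<infinity>"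
    by (intro nn_integral_noteq_infinite) measurable
  then show ?thesis
  proof eventually_elim
    case (elim t)
    have ex: "\<exists>C\<ge>0. s = ennreal C" if "s \<noteq> \<infinity>" for s
      using that by (cases s) auto
    obtain C where C: "C \<ge> 0" "(\<Sum>k. ennreal (4^k * (norm (?d k t))\<^sup>2)) = ennreal C"
      using ex[OF elim] by (elim exE conjE)
    have *: "norm (?d k t) \<le> sqrt C * (1/2)^k" for k
    proof -
      have "(\<Sum>i\<in>{k}. ennreal (4^i * (norm (?d i t))\<^sup>2)) \<le> ennreal C"
        unfolding C(2)[symmetric] by (rule sum_le_suminf) auto
      then have "4^k * (norm (?d k t))\<^sup>2 \<le> C" using C(1) by simp
      moreover have "(2^k)\<^sup>2 = (4::real)^k"
        by (simp add: power2_eq_square flip: power_mult_distrib)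
      ultimately have "(2^k * norm (?d k t))\<^sup>2 \<le> C"
        by (simp only: power_mult_distrib)
      then have "2^k * norm (?d k t) \<le> sqrt C" by (rule real_le_rsqrt)
      then have "norm (?d k t) \<le> sqrt C / 2^k"
        by (subst pos_le_divide_eq) (simp_all only: mult.commute zero_less_power zero_less_numeral)
      then show ?thesis by (simp only: power_one_over divide_inverse mult_1 power_inverse)
    qed
    have "summable (\<lambda>k. sqrt C * (1/2)^k)"
      by (intro summable_mult summable_geometric) simp
    then have "summable (\<lambda>k. ?d k t)"
      by (rule summable_comparison_test') (rule *)
    then have "convergent (\<lambda>n. \<Sum>k<n. ?d k t)" by (simp add: summable_iff_convergent)
    moreover have "(\<Sum>k<n. ?d k t) = rep (F n) t - rep (F 0) t" for n
      by (rule sum_lessThan_telescope)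
    ultimately have "convergent (\<lambda>n. rep (F n) t - rep (F 0) t)" by simp
    then show ?case by (simp add: convergent_diff_const_right_iff)
  qed
qed

instance l2 :: (finite) complete_space
proof
  fix F :: "nat \<Rightarrow> 'a l2" assume F: "Cauchy F"
  have ex: "\<exists>N. \<forall>m\<ge>N. \<forall>n\<ge>N. (norm (F m - F n))\<^sup>2 \<le> (1/8)^k" for k
  proof -
    obtain N where N: "\<And>m n. m \<ge> N \<Longrightarrow> n \<ge> N \<Longrightarrow> norm (F m - F n) < sqrt ((1/8)^k)"
      using F[unfolded Cauchy_iff, rule_format, of "sqrt ((1/8)^k)"] by auto
    have "(norm (F m - F n))\<^sup>2 \<le> (1/8)^k" if "m \<ge> N" "n \<ge> N" for m n
      using power_mono[OF less_imp_le[OF N[OF that]], of 2] by simp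
    then show ?thesis by blast
  qed
  obtain N0 where N0: "\<And>k m n. m \<ge> N0 k \<Longrightarrow> n \<ge> N0 k \<Longrightarrow> (norm (F m - F n))\<^sup>2 \<le> (1/8)^k"
    using ex by metis
  \<comment> \<open>The sum dominates every \<open>N0 i\<close> with \<open>i \<le> k\<close>, so
    one index serves all earlier accuracies and no separate monotonicity of \<open>N0\<close> has to
    be arranged.\<close>
  define N where "N k = (\<Sum>i\<le>k. N0 i)" for k
  define G where "G k = F (N k)" for k
  have Nge: "N j \<ge> N0 k" if "k \<le> j" for j k
    unfolding N_def using that by (intro member_le_sum) auto
  have Gd: "(norm (G i - G j))\<^sup>2 \<le> (1/8)^k" if "i \<ge> k" "j \<ge> k" for i j k
    unfolding G_def by (rule N0) (use Nge that in auto)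
  have conv: "AE t in lebesgue. convergent (\<lambda>k. rep (G k) t)"
    by (rule l2_fast_Cauchy_AE_convergent) (rule Gd, auto)
  define f where "f t = lim (\<lambda>k. rep (G k) t)" for t
  have f_meas [measurable]: "f \<in> borel_measurable lebesgue"
    unfolding f_def by measurable
  \<comment> \<open>Fatou in \<open>j\<close> with \<open>k\<close> fixed. This one estimate does
    double duty: it puts \<open>f\<close> minus a representative into \<open>L2\<close>, hence also
    \<open>f\<close>, and it is the rate at which \<open>G\<close> converges.\<close>
  have bound: "(\<integral>\<^sup>+t. ennreal ((norm (f t - rep (G k) t))\<^sup>2) \<partial>lebesgue) \<le> ennreal ((1/8)^k)" for k
  proof -
    have "(\<integral>\<^sup>+t. ennreal ((norm (f t - rep (G k) t))\<^sup>2) \<partial>lebesgue)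
      = (\<integral>\<^sup>+t. liminf (\<lambda>j. ennreal ((norm (rep (G j) t - rep (G k) t))\<^sup>2)) \<partial>lebesgue)"
      using conv
    proof (intro nn_integral_cong_AE, eventually_elim)
      case (elim t)
      then have "(\<lambda>j. rep (G j) t) \<longlonglongrightarrow> f t" by (simp add: f_def convergent_LIMSEQ_iff)
      then have "(\<lambda>j. ennreal ((norm (rep (G j) t - rep (G k) t))\<^sup>2)) \<longlonglongrightarrow> ennreal ((norm (f t - rep (G k) t))\<^sup>2)"
        by (intro tendsto_intros)
      then show ?case by (rule lim_imp_Liminf[OF sequentially_bot, symmetric])
    qed
    also have "\<dots> \<le> liminf (\<lambda>j. \<integral>\<^sup>+t. ennreal ((norm (rep (G j) t - rep (G k) t))\<^sup>2) \<partial>lebesgue)"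
      by (rule nn_integral_liminf) measurable
    also have "\<dots> = liminf (\<lambda>j. ennreal ((norm (G j - G k))\<^sup>2))"
      by (simp add: nn_integral_rep_diff)
    also have "\<dots> \<le> ennreal ((1/8)^k)"
    proof -
      have "eventually (\<lambda>j. ennreal ((norm (G j - G k))\<^sup>2) \<le> ennreal ((1/8)^k)) sequentially"
        using eventually_ge_at_top[of k] by eventually_elim (auto intro!: ennreal_leI Gd)
      then have "liminf (\<lambda>j. ennreal ((norm (G j - G k))\<^sup>2)) \<le> liminf (\<lambda>j::nat. ennreal ((1/8)^k))"
        by (rule Liminf_mono)
      then show ?thesis by (simp add: Liminf_const)
    qed
    finally show ?thesis .
  qed
  have dL2: "(\<lambda>t. f t - rep (G k) t) \<in> L2 UNIV" for k
    unfolding L2_UNIV_iff using le_less_trans[OF bound[of k] ennreal_less_top]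
    by (auto intro!: integrableI_bounded)
  have fL2: "f \<in> L2 UNIV"
    using L2_add[OF dL2 rep_L2[of "G 0"], of 0] by simp
  have Gconv: "(norm (G k - cls f))\<^sup>2 \<le> (1/8)^k" for k
  proof -
    have "ennreal ((norm (cls f - G k))\<^sup>2) = (\<integral>\<^sup>+t. ennreal ((norm (rep (cls f) t - rep (G k) t))\<^sup>2) \<partial>lebesgue)"
      by (simp add: nn_integral_rep_diff)
    also have "\<dots> = (\<integral>\<^sup>+t. ennreal ((norm (f t - rep (G k) t))\<^sup>2) \<partial>lebesgue)"
      by (rule nn_integral_cong_AE) (use AE_rep_cls[OF fL2] in eventually_elim, simp)
    finally have "ennreal ((norm (cls f - G k))\<^sup>2) \<le> ennreal ((1/8)^k)"
      using bound[of k] by simp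
    then have "(norm (cls f - G k))\<^sup>2 \<le> (1/8)^k"
      by (subst (asm) ennreal_le_iff) simp_all
    then show ?thesis by (simp only: norm_minus_commute)
  qed
  have "F \<longlonglongrightarrow> cls f"
  proof (rule LIMSEQ_I)
    fix e :: real assume e: "e > 0"
    obtain k where k: "(1/8::real)^k < (e/2)\<^sup>2"
      using real_arch_pow_inv[of "(e/2)\<^sup>2" "1/8"] e by auto
    have lt: "norm x < e/2" if "(norm x)\<^sup>2 \<le> (1/8)^k" for x :: "'a l2"
      using that k e by (smt (verit) power2_le_imp_le half_gt_zero norm_ge_zero power_mono)
    have "norm (F n - cls f) < e" if "n \<ge> N k" for n
    proof -
      have "norm (F n - G k) < e/2"
        unfolding G_def by (rule lt, rule N0) (use that Nge[of k k] in auto)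
      moreover have "norm (G k - cls f) < e/2" by (rule lt, rule Gconv)
      ultimately show ?thesis using norm_triangle_ineq[of "F n - G k" "G k - cls f"] by simp
    qed
    then show "\<exists>no. \<forall>n\<ge>no. norm (F n - cls f) < e" by blast
  qed
  then show "convergent F" by (rule convergentI)
qed

instance l2 :: (finite) banach ..

section \<open>Extension by zero and restriction to measurable sets\<close>

definition emb :: "real set \<Rightarrow> (real \<Rightarrow> complex^'m::finite) \<Rightarrow> 'm l2" where
  "emb A f = cls (\<lambda>t. if t \<in> A then f t else 0)"

lemma emb_zero [simp]: "emb A (\<lambda>_. 0) = 0"
  by (simp add: emb_def zero_l2_def)

lemma cut_measurable_iff:
  assumes "A \<in> sets lebesgue"
  shows "(\<lambda>t. if t \<in> A then f t else (0::'b::euclidean_space)) \<in> borel_measurable lebesgue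
    \<longleftrightarrow> f \<in> borel_measurable (lebesgue_on A)"
  using borel_measurable_if[OF assms, of f] by simp

lemma cut_integrable_iff:
  assumes "A \<in> sets lebesgue"
  shows "integrable lebesgue (\<lambda>t. if t \<in> A then f t else (0::'b::euclidean_space)) \<longleftrightarrow> integrable (lebesgue_on A) f"
  using integrable_restrict_space[of A lebesgue f] assms by (simp add: indicator_scaleR_eq_if)

lemma cut_integral:
  assumes "A \<in> sets lebesgue"
  shows "(LINT t|lebesgue. (if t \<in> A then f t else (0::'b::euclidean_space))) = (LINT t|lebesgue_on A. f t)"
  using integral_restrict_space[of A lebesgue f] assms by (simp add: indicator_scaleR_eq_if)

lemma AE_cut_iff:
  assumes "A \<in> sets lebesgue"
  shows "(AE t in lebesgue_on A. P t) \<longleftrightarrow> (AE t in lebesgue. t \<in> A \<longrightarrow> P t)"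
  using assms by (simp add: AE_restrict_space_iff)

lemma cut_L2:
  assumes "A \<in> sets lebesgue"
  shows "(\<lambda>t. if t \<in> A then f t else 0) \<in> L2 UNIV \<longleftrightarrow> f \<in> L2 A"
proof -
  have "(\<lambda>t. (norm (if t \<in> A then f t else 0))\<^sup>2) = (\<lambda>t. if t \<in> A then (norm (f t))\<^sup>2 else 0)"
    by auto
  then show ?thesis
    by (simp add: L2_UNIV_iff cut_measurable_iff[OF assms] cut_integrable_iff[OF assms]) (simp add: L2_def)
qed

lemma L2_subset:
  assumes "f \<in> L2 B" "A \<subseteq> B" "A \<in> sets lebesgue" "B \<in> sets lebesgue"
  shows "f \<in> L2 A"
proof -
  let ?g = "\<lambda>t. if t \<in> B then f t else 0"
  have g: "?g \<in> L2 UNIV" using assms cut_L2 by blast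
  have "(\<lambda>t. if t \<in> A then f t else 0) \<in> L2 UNIV"
  proof (rule L2_bound[of _ "\<lambda>t. (norm (?g t))\<^sup>2"])
    show "integrable (lebesgue_on UNIV) (\<lambda>t. (norm (?g t))\<^sup>2)" by (rule L2_integrable[OF g])
    have *: "?g \<in> borel_measurable lebesgue" by (rule L2_UNIV_measurable[OF g])
    have "(\<lambda>t. if t \<in> A then ?g t else 0) \<in> borel_measurable lebesgue"
      by (rule measurable_If_set[OF * borel_measurable_const]) (use assms in simp)
    moreover have "(\<lambda>t. if t \<in> A then ?g t else 0) = (\<lambda>t. if t \<in> A then f t else 0)"
      using assms(2) by (auto simp: fun_eq_iff)
    ultimately show "(\<lambda>t. if t \<in> A then f t else 0) \<in> borel_measurable (lebesgue_on UNIV)"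
      by (simp add: lebesgue_on_UNIV_eq)
  qed (use assms(2) in auto)
  then show ?thesis using cut_L2[OF assms(3)] by blast
qed

lemma rep_L2_on [simp]: "A \<in> sets lebesgue \<Longrightarrow> rep F \<in> L2 A"
  by (rule L2_subset[of _ UNIV]) auto

context
  fixes A :: "real set"
  assumes A: "A \<in> sets lebesgue"
begin

lemma AE_rep_emb:
  "f \<in> L2 A \<Longrightarrow> AE t in lebesgue. rep (emb A f) t = (if t \<in> A then f t else 0)"
  unfolding emb_def by (rule AE_rep_cls) (simp add: cut_L2[OF A])

lemma AE_rep_emb_on:
  "f \<in> L2 A \<Longrightarrow> AE t in lebesgue_on A. rep (emb A f) t = f t"
  unfolding AE_cut_iff[OF A] by (drule AE_rep_emb) (auto elim: eventually_mono)

lemma emb_eq_iff: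
  assumes "f \<in> L2 A" "g \<in> L2 A"
  shows "emb A f = emb A g \<longleftrightarrow> (AE t in lebesgue_on A. f t = g t)"
  unfolding emb_def AE_cut_iff[OF A]
  by (subst cls_eq_iff) (auto simp: cut_L2[OF A] assms elim!: eventually_mono split: if_splits)

lemma emb_add:
  assumes "f \<in> L2 A" "g \<in> L2 A"
  shows "emb A (\<lambda>t. f t + g t) = emb A f + emb A g"
  by (rule l2_eqI)
    (use AE_rep_emb[OF L2_add[OF assms]] AE_rep_emb[OF assms(1)] AE_rep_emb[OF assms(2)]
      AE_rep_add[of "emb A f" "emb A g"] in eventually_elim, simp)

lemma emb_scaleR:
  assumes "f \<in> L2 A"
  shows "emb A (\<lambda>t. r *\<^sub>R f t) = r *\<^sub>R emb A f"
  by (rule l2_eqI)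
    (use AE_rep_emb[OF L2_scaleR[OF assms, of r]] AE_rep_emb[OF assms]
      AE_rep_scaleR[of r "emb A f"] in eventually_elim, simp)

lemma emb_diff:
  assumes "f \<in> L2 A" "g \<in> L2 A"
  shows "emb A (\<lambda>t. f t - g t) = emb A f - emb A g"
  by (rule l2_eqI)
    (use AE_rep_emb[OF L2_diff[OF assms]] AE_rep_emb[OF assms(1)] AE_rep_emb[OF assms(2)]
      AE_rep_diff[of "emb A f" "emb A g"] in eventually_elim, simp)

lemma norm_emb:
  assumes "f \<in> L2 A"
  shows "(norm (emb A f))\<^sup>2 = (LINT t|lebesgue_on A. (norm (f t))\<^sup>2)"
proof -
  have "(norm (emb A f))\<^sup>2 = (LINT t|lebesgue. (norm (if t \<in> A then f t else 0))\<^sup>2)"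
    unfolding emb_def by (rule norm_cls_power2) (simp add: cut_L2[OF A] assms)
  also have "\<dots> = (LINT t|lebesgue. (if t \<in> A then (norm (f t))\<^sup>2 else 0))"
    by (rule Bochner_Integration.integral_cong) auto
  finally show ?thesis by (simp add: cut_integral[OF A])
qed

end

section \<open>Multiplication operators with matrix-valued symbols\<close>

lemma continuous_on_matrix_vector_mult:
  fixes A :: "'x::topological_space \<Rightarrow> complex^'m::finite^'k::finite"
  shows "continuous_on T A \<Longrightarrow> continuous_on T f \<Longrightarrow> continuous_on T (\<lambda>t. A t *v f t)"
  unfolding matrix_vector_mult_def
  by (intro continuous_on_vec_lambda continuous_intros) auto

lemma measurable_matrix_vector_mult:
  fixes A :: "'x \<Rightarrow> complex^'m::finite^'k::finite"
  assumes "A \<in> borel_measurable M" "f \<in> borel_measurable M"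
  shows "(\<lambda>t. A t *v f t) \<in> borel_measurable M"
  by (rule borel_measurable_continuous_Pair[OF assms])
    (auto intro!: continuous_on_matrix_vector_mult continuous_intros)

text \<open>The bound is demanded at every point of the line, so that the symbol acts on any
  representative without exceptional sets. A density known only up to null sets has to be corrected
  before it qualifies.\<close>

definition bdd_mult :: "(real \<Rightarrow> complex^'m::finite^'k::finite) \<Rightarrow> real \<Rightarrow> bool" where
  "bdd_mult B K \<longleftrightarrow> B \<in> borel_measurable lebesgue \<and> (\<forall>t v. norm (B t *v v) \<le> K * norm v)"

definition mop :: "(real \<Rightarrow> complex^'m::finite^'k::finite) \<Rightarrow> 'm l2 \<Rightarrow> 'k l2" where
  "mop B F = cls (\<lambda>t. B t *v rep F t)"

lemma bdd_mult_L2: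
  assumes "bdd_mult B K" "f \<in> L2 A"
  shows "(\<lambda>t. B t *v f t) \<in> L2 A"
proof (rule L2_bounded_op[OF assms(2)])
  have "B \<in> borel_measurable (lebesgue_on A)"
    using assms(1) by (auto simp: bdd_mult_def intro: measurable_restrict_space1)
  then show "(\<lambda>t. B t *v f t) \<in> borel_measurable (lebesgue_on A)"
    by (rule measurable_matrix_vector_mult) (rule L2_measurable[OF assms(2)])
  show "AE t in lebesgue_on A. norm (B t *v f t) \<le> K * norm (f t)"
    using assms(1) by (simp add: bdd_mult_def)
qed

lemma AE_rep_mop:
  "bdd_mult B K \<Longrightarrow> AE t in lebesgue. rep (mop B F) t = B t *v rep F t"
  unfolding mop_def by (rule AE_rep_cls) (simp add: bdd_mult_L2)

lemma matrix_vector_mult_scaleR: "A *v (r *\<^sub>R v) = r *\<^sub>R (A *v v :: complex^'k::finite)"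
  by (simp add: matrix_vector_mult_def vec_eq_iff scaleR_sum_right)

lemma bounded_linear_mop:
  assumes "bdd_mult B K"
  shows "bounded_linear (mop B)"
proof (rule bounded_linear_intro[where K="\<bar>K\<bar>"])
  show "mop B (F + G) = mop B F + mop B G" for F G
    by (rule l2_eqI) (use AE_rep_mop[OF assms, of F] AE_rep_mop[OF assms, of G]
      AE_rep_mop[OF assms, of "F + G"] AE_rep_add[of "mop B F" "mop B G"] AE_rep_add[of F G]
      in eventually_elim, simp add: matrix_vector_right_distrib)
  show "mop B (r *\<^sub>R F) = r *\<^sub>R mop B F" for r F
    by (rule l2_eqI) (use AE_rep_mop[OF assms, of F] 
      AE_rep_mop[OF assms, of "r *\<^sub>R F"] AE_rep_scaleR[of r "mop B F"] AE_rep_scaleR[of r F]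
      in eventually_elim, simp add: matrix_vector_mult_scaleR)
  show "norm (mop B F) \<le> norm F * \<bar>K\<bar>" for F
  proof (rule power2_le_imp_le)
    have "(norm (mop B F))\<^sup>2 = (LINT t|lebesgue. (norm (B t *v rep F t))\<^sup>2)"
      unfolding mop_def by (rule norm_cls_power2) (simp add: bdd_mult_L2[OF assms])
    also have "\<dots> \<le> (LINT t|lebesgue. K\<^sup>2 * (norm (rep F t))\<^sup>2)"
    proof (rule integral_mono)
      show "integrable lebesgue (\<lambda>t. (norm (B t *v rep F t))\<^sup>2)"
        by (rule L2_UNIV_integrable) (simp add: bdd_mult_L2[OF assms])
      show "integrable lebesgue (\<lambda>t. K\<^sup>2 * (norm (rep F t))\<^sup>2)"
        by (simp add: L2_UNIV_integrable)
      show "(norm (B t *v rep F t))\<^sup>2 \<le> K\<^sup>2 * (norm (rep F t))\<^sup>2" for t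
        unfolding power_mult_distrib[symmetric]
        using assms by (intro power_mono) (auto simp: bdd_mult_def)
    qed
    also have "\<dots> = (norm F * \<bar>K\<bar>)\<^sup>2"
      by (simp add: norm_l2_power2 power_mult_distrib)
    finally show "(norm (mop B F))\<^sup>2 \<le> (norm F * \<bar>K\<bar>)\<^sup>2" .
  qed simp
qed

section \<open>Coercive symmetric forms\<close>

text \<open>An inner product equivalent to the given Banach norm, kept as a parameter: the type
  \<open>l2\<close> carries one fixed inner product, while the energy form is weighted and depends
  on the system.\<close>

locale coercive_form =
  fixes ip :: "'a::banach \<Rightarrow> 'a \<Rightarrow> real" and c :: real
  assumes bilinear: "bounded_bilinear ip"
    and sym: "ip x y = ip y x"
    and c_pos: "c > 0"
    and coercive: "c * (norm x)\<^sup>2 \<le> ip x x"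
begin

sublocale ip: bounded_bilinear ip by (rule bilinear)

lemma nonneg [simp]: "0 \<le> ip x x"
  using coercive[of x] c_pos by (meson order_trans mult_nonneg_nonneg less_imp_le zero_le_power2)

lemma eq_0_iff [simp]: "ip x x = 0 \<longleftrightarrow> x = 0"
  using coercive[of x] c_pos by (auto simp: ip.zero_left mult_le_0_iff)

lemma ip_diff_diff: "ip (x - y) (x - y) = ip x x - 2 * ip x y + ip y y"
  by (simp add: ip.diff_left ip.diff_right sym[of y x])

lemma ip_add_add: "ip (x + y) (x + y) = ip x x + 2 * ip x y + ip y y"
  by (simp add: ip.add_left ip.add_right sym[of y x])

lemma ip_scale: "ip (r *\<^sub>R x) (r *\<^sub>R x) = r\<^sup>2 * ip x x"
  by (simp add: ip.scaleR_left ip.scaleR_right power2_eq_square)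

lemma twice_ip_le: "2 * ip x y \<le> ip x x + ip y y"
  using nonneg[of "x - y"] unfolding ip_diff_diff by simp

lemma ip_add_le: "ip (x + y) (x + y) \<le> 2 * ip x x + 2 * ip y y"
  unfolding ip_add_add using twice_ip_le[of x y] by simp

lemma ip_diff_le: "ip (x - y) (x - y) \<le> 2 * ip x x + 2 * ip y y"
  using ip_add_le[of x "- y"] by (simp add: ip.minus_left ip.minus_right)

lemma Cauchy_Schwarz: "(ip x y)\<^sup>2 \<le> ip x x * ip y y"
proof (cases "y = 0")
  case False
  then have pos: "ip y y > 0" using nonneg[of y] eq_0_iff[of y] by linarith
  let ?r = "ip x y / ip y y"
  have "0 \<le> ip (x - ?r *\<^sub>R y) (x - ?r *\<^sub>R y)" by simp
  also have "\<dots> = ip x x - (ip x y)\<^sup>2 / ip y y"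
    unfolding ip_diff_diff ip_scale using pos by (simp add: ip.scaleR_right power2_eq_square)
  finally show ?thesis using pos by (simp add: pos_divide_le_eq)
qed (simp add: ip.zero_right)

lemma abs_ip_le: "\<bar>ip x y\<bar> \<le> sqrt (ip x x) * sqrt (ip y y)"
  using real_sqrt_le_mono[OF Cauchy_Schwarz[of x y]] by (simp add: real_sqrt_mult)

lemma norm_le: "norm x \<le> sqrt (ip x x) / sqrt c"
proof -
  have "(norm x)\<^sup>2 \<le> ip x x / c" using coercive[of x] c_pos by (simp add: field_simps)
  from real_le_rsqrt[OF this] show ?thesis by (simp add: real_sqrt_divide)
qed

lemma upper_bound: "\<exists>C>0. \<forall>x. ip x x \<le> C * (norm x)\<^sup>2"
proof -
  obtain K where "K > 0" "\<And>a b. norm (ip a b) \<le> norm a * norm b * K"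
    using ip.pos_bounded by blast
  then show ?thesis by (intro exI[of _ K]) (simp add: power2_eq_square mult.commute abs_le_iff)
qed

lemma sqrt_add_le: "sqrt (ip (x + y) (x + y)) \<le> sqrt (ip x x) + sqrt (ip y y)"
proof (rule real_le_lsqrt)
  show "ip (x + y) (x + y) \<le> (sqrt (ip x x) + sqrt (ip y y))\<^sup>2"
    using abs_ip_le[of x y] by (simp add: ip_add_add power2_sum)
qed simp_all

text \<open>The representing vector minimises \<open>ip x x - 2 * \<phi> x\<close> over \<open>V\<close>; minimising sequences are
  Cauchy by the parallelogram law.\<close>

lemma Riesz_on_subspace:
  assumes V: "subspace V" "closed V" and phi: "bounded_linear \<phi>"
  shows "\<exists>x\<in>V. \<forall>v\<in>V. ip x v = \<phi> v"
proof -
  interpret phi: bounded_linear \<phi> by (rule phi)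
  define F where "F x = ip x x - 2 * \<phi> x" for x
  define m where "m = Inf (F ` V)"
  obtain K where K: "K > 0" "\<And>x. norm (\<phi> x) \<le> norm x * K" using phi.pos_bounded by blast
  \<comment> \<open>Completing the square in \<open>norm x\<close>: coercivity and the bound on
    \<open>\<phi>\<close> give \<open>F x \<ge> c * (norm x)\<^sup>2 - 2 * K * norm x\<close>, whose
    minimum is the stated constant.\<close>
  have low: "- (K\<^sup>2 / c) \<le> F x" for x
  proof -
    have "0 \<le> c * (norm x - K / c)\<^sup>2" using c_pos by simp
    also have "\<dots> = c * (norm x)\<^sup>2 - 2 * (norm x * K) + K\<^sup>2 / c"
      using c_pos by (simp add: power2_eq_square field_simps)
    also have "\<dots> \<le> F x + K\<^sup>2 / c"
      using coercive[of x] K(2)[of x] by (auto simp: F_def)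
    finally show ?thesis by simp
  qed
  have bdd: "bdd_below (F ` V)" using low by (auto intro!: bdd_belowI2)
  have m_le: "m \<le> F x" if "x \<in> V" for x
    unfolding m_def using bdd that by (intro cInf_lower) auto
  have "\<exists>x\<in>V. F x < m + 1 / (Suc n)" for n :: nat
  proof -
    have "\<exists>y\<in>F ` V. y < m + 1 / (Suc n)"
      using cInf_lessD[of "F ` V" "m + 1 / (Suc n)"] subspace_0[OF V(1)] by (auto simp: m_def)
    then show ?thesis by auto
  qed
  then obtain x where x: "\<And>n. x n \<in> V" "\<And>n. F (x n) < m + 1 / (Suc n)" by metis
  \<comment> \<open>The linear part of \<open>F\<close> cancels in the parallelogram identity, so
    two nearly minimal points, whose midpoint is no better than \<open>m\<close>, must be
    close.\<close>
  have par: "F u + F v = 2 * F ((1/2) *\<^sub>R (u + v)) + ip (u - v) (u - v) / 2" for u v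
    by (simp add: F_def ip_scale ip_add_add ip_diff_diff phi.scaleR phi.add power2_eq_square)
      (simp add: field_simps)
  have dist: "c * (norm (x i - x j))\<^sup>2 \<le> 2 / (Suc i) + 2 / (Suc j)" for i j
  proof -
    have "m \<le> F ((1/2) *\<^sub>R (x i + x j))"
      by (intro m_le subspace_scale[OF V(1)] subspace_add[OF V(1)] x)
    then have "ip (x i - x j) (x i - x j) \<le> 2 / (Suc i) + 2 / (Suc j)"
      using par[of "x i" "x j"] x(2)[of i] x(2)[of j] by simp
    then show ?thesis using coercive[of "x i - x j"] by linarith
  qed
  have "Cauchy x"
  proof (rule CauchyI)
    fix e :: real assume e: "e > 0"
    obtain N where N: "4 / (c * e\<^sup>2) < real N" using reals_Archimedean2 by blast
    have "norm (x i - x j) < e" if "i \<ge> N" "j \<ge> N" for i j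
    proof -
      have N0: "real N > 0" using N c_pos e by (smt (verit) divide_pos_pos mult_pos_pos zero_less_power)
      have "2 / real (Suc i) \<le> 2 / N" "2 / real (Suc j) \<le> 2 / N"
        using that N0 by (auto intro!: divide_left_mono mult_pos_pos)
      then have "c * (norm (x i - x j))\<^sup>2 \<le> 4 / N" using dist[of i j] by simp
      also have "\<dots> < c * e\<^sup>2" using N N0 c_pos e by (simp add: field_simps)
      finally have "(norm (x i - x j))\<^sup>2 < e\<^sup>2" using c_pos by simp
      then show ?thesis using e by (simp add: power_less_imp_less_base)
    qed
    then show "\<exists>M. \<forall>i\<ge>M. \<forall>j\<ge>M. norm (x i - x j) < e" by blast
  qed
  then obtain u where u: "x \<longlonglongrightarrow> u" by (auto simp: Cauchy_convergent_iff convergent_def)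
  have uV: "u \<in> V" using closed_sequentially[OF V(2) _ u] x(1) by blast
  have "(\<lambda>n. F (x n)) \<longlonglongrightarrow> F u"
    unfolding F_def by (intro tendsto_intros ip.tendsto phi.tendsto u)
  moreover have "(\<lambda>n. m + 1 / (Suc n)) \<longlonglongrightarrow> m + 0"
    by (intro tendsto_intros LIMSEQ_inverse_real_of_nat[unfolded inverse_eq_divide])
  ultimately have "F u \<le> m + 0" by (rule LIMSEQ_le) (intro exI[of _ 0] allI impI less_imp_le x(2))
  then have min: "F u \<le> F v" if "v \<in> V" for v using m_le[OF that] by simp
  have "ip u v = \<phi> v" if v: "v \<in> V" for v
  proof (rule ccontr)
    assume ne: "ip u v \<noteq> \<phi> v"
    define a where "a = ip u v - \<phi> v"
    \<comment> \<open>The variation in direction \<open>v\<close> uses the step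
      \<open>- a / b\<close>. Adding 1 keeps the denominator positive even for
      \<open>v = 0\<close>.\<close>
    define b where "b = ip v v + 1"
    have b: "b > 0" "ip v v < b" unfolding b_def using nonneg[of v] by linarith+
    have expand: "F (u + r *\<^sub>R v) = F u + 2 * r * a + r\<^sup>2 * ip v v" for r
      by (simp add: F_def ip_add_add ip_scale phi.add phi.scaleR ip.scaleR_right ip.scaleR_left a_def power2_eq_square algebra_simps)
    have "F u \<le> F (u + (- a / b) *\<^sub>R v)"
      by (intro min subspace_add[OF V(1)] subspace_scale[OF V(1)] uV v)
    then have "2 * (a\<^sup>2 / b) \<le> (a / b)\<^sup>2 * ip v v"
      unfolding expand by (simp add: power2_eq_square)
    also have "\<dots> \<le> (a / b)\<^sup>2 * b" using b by (intro mult_left_mono) auto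
    also have "\<dots> = a\<^sup>2 / b" using b by (simp add: power2_eq_square)
    finally have "a\<^sup>2 / b \<le> 0" by simp
    then show False using ne b by (simp add: a_def divide_le_0_iff)
  qed
  then show ?thesis using uV by blast
qed

lemma projection:
  assumes "subspace V" "closed V"
  shows "\<exists>p\<in>V. \<forall>v\<in>V. ip (x - p) v = 0"
proof -
  obtain p where "p \<in> V" "\<forall>v\<in>V. ip p v = ip x v"
    using Riesz_on_subspace[OF assms ip.bounded_linear_right] by blast
  then show ?thesis by (intro bexI[of _ p]) (auto simp: ip.diff_left)
qed

lemma Riesz:
  assumes "bounded_linear \<phi>"
  shows "\<exists>x. \<forall>v. ip x v = \<phi> v"
  using Riesz_on_subspace[of UNIV \<phi>] assms by auto

end

lemma coercive_form_inner: "coercive_form ((\<bullet>) :: 'a::{real_inner,banach} \<Rightarrow> 'a \<Rightarrow> real) 1"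
  by (intro coercive_form.intro bounded_bilinear_inner) (auto simp: inner_commute power2_norm_eq_inner)

section \<open>Minimal elements in the fibres of a linear relation\<close>

lemma subspace_closure:
  fixes V :: "'a::real_normed_vector set"
  assumes V: "subspace V" shows "subspace (closure V)"
  unfolding subspace_def
proof (intro conjI ballI allI)
  show "0 \<in> closure V" using subspace_0[OF V] closure_subset by blast
next
  fix x y assume "x \<in> closure V" "y \<in> closure V"
  then obtain a b where "\<And>n. a n \<in> V" "a \<longlonglongrightarrow> x" "\<And>n. b n \<in> V" "b \<longlonglongrightarrow> y"
    by (auto simp: closure_sequential)
  then show "x + y \<in> closure V"
    by (auto simp: closure_sequential intro!: exI[of _ "\<lambda>n. a n + b n"] subspace_add[OF V] tendsto_intros)
next
  fix r x assume "x \<in> closure V"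
  then obtain a where "\<And>n. a n \<in> V" "a \<longlonglongrightarrow> x"
    by (auto simp: closure_sequential)
  then show "r *\<^sub>R x \<in> closure V"
    by (auto simp: closure_sequential intro!: exI[of _ "\<lambda>n. r *\<^sub>R a n"] subspace_scale[OF V] tendsto_intros)
qed

text \<open>Every fibre of the linear relation \<open>V\<close> has, up to closure, a unique element \<open>m\<close> of minimal norm;
  it is orthogonal to the fibre over \<open>0\<close>, so it depends linearly on the base point.\<close>

lemma (in coercive_form) minimal_cost_operator:
  fixes V :: "('a \<times> 'z::{real_inner,banach}) set"
  assumes V: "subspace V"
    and bound: "\<And>F. \<exists>Z. (F, Z) \<in> V \<and> (norm Z)\<^sup>2 \<le> ip F F"
  shows "\<exists>P. bounded_linear P \<and> (\<forall>F G. ip (P F) G = ip F (P G)) \<and>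
     (\<forall>F Z. (F, Z) \<in> V \<longrightarrow> ip F (P F) \<le> (norm Z)\<^sup>2) \<and>
     (\<forall>F. \<forall>e>0. \<exists>Z. (F, Z) \<in> V \<and> (norm Z)\<^sup>2 < ip F (P F) + e)"
proof -
  interpret z: coercive_form "(\<bullet>) :: 'z \<Rightarrow> 'z \<Rightarrow> real" 1 by (rule coercive_form_inner)
  define V0 where "V0 = {Z. (0, Z) \<in> V}"
  \<comment> \<open>\<open>V\<close> need not be closed, so the minimum over a fibre may fail to be
    attained. Projecting along the closure of the zero fibre still produces a linear selection
    \<open>m\<close>, at the cost that \<open>(F, m F)\<close> may lie outside
    \<open>V\<close>.\<close>
  define W where "W = closure V0"
  have V0: "subspace V0"
    using subspace_0[OF V] subspace_add[OF V, of "(0, _)" "(0, _)"] subspace_scale[OF V, of "(0, _)"]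
    by (auto simp: V0_def subspace_def zero_prod_def)
  have W: "subspace W" "closed W"
    unfolding W_def using V0 by (auto intro: subspace_closure)
  have Vdiff: "Z - Z' \<in> V0" if "(F, Z) \<in> V" "(F, Z') \<in> V" for F Z Z'
    using subspace_diff[OF V that] by (simp add: V0_def)
  have "\<exists>m. (\<exists>Z. (F, Z) \<in> V \<and> Z - m \<in> W) \<and> (\<forall>w\<in>W. m \<bullet> w = 0)" for F
  proof -
    obtain Z where Z: "(F, Z) \<in> V" using bound by blast
    obtain p where "p \<in> W" "\<forall>v\<in>W. (Z - p) \<bullet> v = 0" using z.projection[OF W] by blast
    then show ?thesis using Z by (intro exI[of _ "Z - p"]) auto
  qed
  then obtain m where m: "\<And>F. \<exists>Z. (F, Z) \<in> V \<and> Z - m F \<in> W" "\<And>F w. w \<in> W \<Longrightarrow> m F \<bullet> w = 0"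
    by metis
  have mW: "Z - m F \<in> W" if "(F, Z) \<in> V" for F Z
  proof -
    obtain Z' where Z': "(F, Z') \<in> V" "Z' - m F \<in> W" using m(1) by blast
    have "Z - Z' \<in> W" using Vdiff[OF that Z'(1)] closure_subset by (auto simp: W_def)
    from subspace_add[OF W(1) this Z'(2)] show ?thesis by simp
  qed
  have m_unique: "a = m F" if "(F, Z) \<in> V" "Z - a \<in> W" "\<And>w. w \<in> W \<Longrightarrow> a \<bullet> w = 0" for F Z a
  proof -
    have d: "a - m F \<in> W" using subspace_diff[OF W(1) mW[OF that(1)] that(2)] by simp
    then have "(a - m F) \<bullet> (a - m F) = 0"
      using m(2)[OF d, of F] that(3)[OF d] by (simp add: inner_diff_left)
    then show ?thesis by simp
  qed
  have pyth: "(norm Z)\<^sup>2 = (norm (m F))\<^sup>2 + (norm (Z - m F))\<^sup>2" if "(F, Z) \<in> V" for F Z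
  proof -
    have "m F \<bullet> (Z - m F) = 0" using m(2) mW[OF that] by blast
    then show ?thesis
      by (simp add: power2_norm_eq_inner inner_diff_left inner_diff_right inner_commute)
  qed
  have m_le: "(norm (m F))\<^sup>2 \<le> ip F F" for F
    using bound[of F] pyth[of F] by (smt (verit) zero_le_power2)
  obtain C where C: "C > 0" "\<And>x. ip x x \<le> C * (norm x)\<^sup>2" using upper_bound by blast
  have m_bl: "bounded_linear m"
  proof (rule bounded_linear_intro[where K="sqrt C"])
    fix F G
    obtain Z Z' where Z: "(F, Z) \<in> V" "(G, Z') \<in> V" using bound by meson
    have "m F + m G = m (F + G)"
    proof (rule m_unique)
      show "(F + G, Z + Z') \<in> V" using subspace_add[OF V Z] by simp
      show "(Z + Z') - (m F + m G) \<in> W"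
        using subspace_add[OF W(1) mW[OF Z(1)] mW[OF Z(2)]] by (simp add: algebra_simps)
    qed (simp add: inner_add_left m(2))
    then show "m (F + G) = m F + m G" by simp
  next
    fix r F
    obtain Z where Z: "(F, Z) \<in> V" using bound by meson
    have "r *\<^sub>R m F = m (r *\<^sub>R F)"
    proof (rule m_unique)
      show "(r *\<^sub>R F, r *\<^sub>R Z) \<in> V" using subspace_scale[OF V Z] by simp
      show "r *\<^sub>R Z - r *\<^sub>R m F \<in> W"
        using subspace_scale[OF W(1) mW[OF Z], of r] by (simp add: algebra_simps)
    qed (simp add: m(2))
    then show "m (r *\<^sub>R F) = r *\<^sub>R m F" by simp
  next
    fix F
    have "(norm (m F))\<^sup>2 \<le> (norm F * sqrt C)\<^sup>2"
      using m_le[of F] C(2)[of F] C(1) by (simp add: power_mult_distrib mult.commute)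
    then show "norm (m F) \<le> norm F * sqrt C"
      by (rule power2_le_imp_le) (use C(1) in simp)
  qed
  then interpret m: bounded_linear m .
  \<comment> \<open>\<open>P\<close> is the operator \<open>m* m\<close>, the adjoint being taken
    between the form \<open>ip\<close> and the inner product on the signal space. Symmetry of
    \<open>P\<close> is then automatic.\<close>
  have "\<exists>x. \<forall>v. ip x v = m F \<bullet> m v" for F
    by (rule Riesz) (rule bounded_linear_compose[OF bounded_linear_inner_right m_bl])
  then obtain P where P: "\<And>F G. ip (P F) G = m F \<bullet> m G" by metis
  have eqI: "x = y" if "\<And>v. ip x v = ip y v" for x y
  proof -
    have "ip (x - y) (x - y) = 0" using that[of "x - y"] by (simp only: ip.diff_left)
    then show ?thesis by (simp only: eq_0_iff right_minus_eq)
  qed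
  obtain K where K: "K > 0" "\<And>x. norm (m x) \<le> norm x * K" using m.pos_bounded by blast
  have P_bl: "bounded_linear P"
  proof (rule bounded_linear_intro[where K="K * K / c"])
    show "P (F + G) = P F + P G" for F G
      by (rule eqI) (simp add: P ip.add_left m.add inner_add_left)
    show "P (r *\<^sub>R F) = r *\<^sub>R P F" for r F
      by (rule eqI) (simp add: P ip.scaleR_left m.scaleR)
    fix F
    have "c * (norm (P F))\<^sup>2 \<le> m F \<bullet> m (P F)" using coercive[of "P F"] by (simp add: P)
    also have "\<dots> \<le> norm (m F) * norm (m (P F))" by (rule norm_cauchy_schwarz)
    also have "\<dots> \<le> (norm F * K) * (norm (P F) * K)"
      using K by (intro mult_mono) auto
    finally have "norm (P F) * norm (P F) \<le> norm (P F) * (norm F * (K * K / c))"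
      using c_pos by (simp add: power2_eq_square field_simps)
    moreover have "0 \<le> norm F * (K * K / c)" using K(1) c_pos by simp
    ultimately show "norm (P F) \<le> norm F * (K * K / c)"
      by (cases "norm (P F) = 0") (simp, simp only: mult_le_cancel_left norm_ge_zero, linarith)
  qed
  have ipP: "ip F (P F) = (norm (m F))\<^sup>2" for F
    using P[of F F] by (simp add: sym[of F] power2_norm_eq_inner)
  have "\<exists>Z. (F, Z) \<in> V \<and> (norm Z)\<^sup>2 < ip F (P F) + e" if e: "e > 0" for F e
  proof -
    obtain Z where Z: "(F, Z) \<in> V" using bound by meson
    \<comment> \<open>The defect \<open>Z - m F\<close> is approximated by an element of the zero
      fibre itself, not only of its closure; subtracting that element stays in the fibre over
      \<open>F\<close> and is nearly minimal by Pythagoras.\<close>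
    then have "Z - m F \<in> closure V0" using mW W_def by blast
    then obtain w where w: "w \<in> V0" "dist w (Z - m F) < sqrt e"
      using e closure_approachable[of "Z - m F" V0] real_sqrt_gt_zero by blast
    have V': "(F, Z - w) \<in> V" using subspace_diff[OF V Z, of "(0, w)"] w(1) by (simp add: V0_def)
    have "norm ((Z - w) - m F) < sqrt e"
      using w(2) by (simp add: dist_norm norm_minus_commute algebra_simps)
    then have "(norm ((Z - w) - m F))\<^sup>2 < (sqrt e)\<^sup>2" by (intro power_strict_mono) auto
    then have "(norm ((Z - w) - m F))\<^sup>2 < e" using e by simp
    then show ?thesis using V' pyth[OF V'] ipP[of F] by (intro exI[of _ "Z - w"]) simp
  qed
  moreover have "ip F (P F) \<le> (norm Z)\<^sup>2" if "(F, Z) \<in> V" for F Z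
    using pyth[OF that] ipP by simp
  moreover have "ip (P F) G = ip F (P G)" for F G
    using P[of F G] P[of G F] by (simp add: sym[of F] inner_commute)
  ultimately show ?thesis using P_bl by blast
qed

section \<open>Volterra integral equations\<close>

text \<open>Carries continuity and derivatives of indefinite integrals from compact intervals to the
  half line on which solutions live.\<close>

lemma at_within_atLeast_eq:
  fixes t :: real assumes "a \<le> t" "t < b"
  shows "at t within {a..} = at t within {a..b}"
  by (rule at_within_nhd[of t "{a - 1<..<b}"]) (use assms in auto)

lemma continuous_on_integral_atLeast:
  fixes f :: "real \<Rightarrow> 'a::banach"
  assumes "\<And>t. a \<le> t \<Longrightarrow> f integrable_on {a..t}"
  shows "continuous_on {a..} (\<lambda>t. integral {a..t} f)"
  unfolding continuous_on_eq_continuous_within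
proof
  fix t assume t: "t \<in> {a..}"
  then have "continuous_on {a..t+1} (\<lambda>t. integral {a..t} f)"
    by (intro indefinite_integral_continuous_1 assms) auto
  then have "continuous (at t within {a..t+1}) (\<lambda>t. integral {a..t} f)"
    using t by (auto simp: continuous_on_eq_continuous_within)
  then show "continuous (at t within {a..}) (\<lambda>t. integral {a..t} f)"
    using t at_within_atLeast_eq[of a t "t+1"] by simp
qed

lemma integral_has_vector_derivative_atLeast:
  fixes f :: "real \<Rightarrow> 'a::banach"
  assumes "continuous_on {a..} f" "a \<le> t"
  shows "((\<lambda>t. integral {a..t} f) has_vector_derivative f t) (at t within {a..})"
proof -
  have "((\<lambda>t. integral {a..t} f) has_vector_derivative f t) (at t within {a..t+1})"
    by (rule integral_has_vector_derivative)
      (use assms in \<open>auto intro: continuous_on_subset\<close>)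
  then show ?thesis using assms(2) at_within_atLeast_eq[of a t "t+1"] by simp
qed

lemma has_integral_exp_scaled:
  fixes k :: real assumes "k > 0" "a \<le> t"
  shows "((\<lambda>s. exp (k * (s - a))) has_integral (exp (k * (t - a)) - 1) / k) {a..t}"
proof -
  have "((\<lambda>s. exp (k * (s - a))) has_integral (exp (k * (t - a)) / k - exp (k * (a - a)) / k)) {a..t}"
    by (rule fundamental_theorem_of_calculus[OF assms(2)])
      (use assms in \<open>auto intro!: derivative_eq_intros simp flip: has_real_derivative_iff_has_vector_derivative\<close>)
  then show ?thesis by (simp add: diff_divide_distrib)
qed

text \<open>In the norm weighted by \<open>exp (- 2 * K * (t - a))\<close> the Volterra operator is a contraction.\<close>

lemma Volterra_solution_exists:
  fixes M :: "real \<Rightarrow> 'a::banach \<Rightarrow> 'a" and g :: "real \<Rightarrow> 'a"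
  assumes K: "K > 0"
    and lip: "\<And>t x y. norm (M t x - M t y) \<le> K * norm (x - y)"
    and M0: "\<And>t. M t 0 = 0"
    and int: "\<And>z t. continuous_on {a..} z \<Longrightarrow> a \<le> t \<Longrightarrow> (\<lambda>s. M s (z s)) integrable_on {a..t}"
    and g: "continuous_on {a..} g" "\<And>t. a \<le> t \<Longrightarrow> norm (g t) \<le> B"
  shows "\<exists>z. continuous_on {a..} z \<and> (\<forall>t\<ge>a. z t = g t + integral {a..t} (\<lambda>s. M s (z s)))"
proof -
  \<comment> \<open>Twice the Lipschitz constant: the integral of \<open>K * E\<close> over
    \<open>{a..t}\<close> is at most \<open>(K / k) * E t\<close>, which makes the contraction
    constant 1/2.\<close>
  define k where "k = 2 * K"
  have k: "k > 0" using K by (simp add: k_def)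
  define E where "E t = exp (k * (t - a))" for t
  have E_pos: "E t > 0" for t by (simp add: E_def)
  have E_cont: "continuous_on T E" for T unfolding E_def by (intro continuous_intros)
  define z where "z w = (\<lambda>t. E t *\<^sub>R apply_bcontfun w t)" for w :: "real \<Rightarrow>\<^sub>C 'a"
  have z_cont: "continuous_on T (z w)" for w T unfolding z_def by (intro continuous_intros E_cont) simp
  have z_int: "(\<lambda>s. M s (z w s)) integrable_on {a..t}" if "a \<le> t" for w t
    by (rule int[OF z_cont that])
  define V where "V w t = (1 / E t) *\<^sub>R (g t + integral {a..t} (\<lambda>s. M s (z w s)))" for w t
  have V_cont: "continuous_on {a..} (V w)" for w
    unfolding V_def using E_pos
    by (intro continuous_intros E_cont g continuous_on_integral_atLeast z_int) (auto simp: less_imp_neq[symmetric])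
  have V_diff: "norm (V w t - V w' t) \<le> dist w w' / 2" if t: "a \<le> t" for w w' t
  proof -
    have "norm (integral {a..t} (\<lambda>s. M s (z w s)) - integral {a..t} (\<lambda>s. M s (z w' s)))
        = norm (integral {a..t} (\<lambda>s. M s (z w s) - M s (z w' s)))"
      by (simp add: integral_diff z_int t)
    also have "\<dots> \<le> integral {a..t} (\<lambda>s. K * dist w w' * E s)"
    proof (rule integral_norm_bound_integral)
      show "(\<lambda>s. K * dist w w' * E s) integrable_on {a..t}"
        by (intro integrable_continuous_interval continuous_intros E_cont)
      fix s assume "s \<in> {a..t}"
      have "norm (M s (z w s) - M s (z w' s)) \<le> K * norm (z w s - z w' s)" by (rule lip)
      also have "\<dots> = K * (E s * dist (w s) (w' s))"
        using E_pos[of s] by (simp add: z_def dist_norm flip: scaleR_diff_right)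
      also have "\<dots> \<le> K * (E s * dist w w')"
        using K E_pos[of s] by (intro mult_left_mono dist_bounded) auto
      finally show "norm (M s (z w s) - M s (z w' s)) \<le> K * dist w w' * E s" by (simp add: ac_simps)
    qed (intro integrable_diff z_int t)
    also have "\<dots> = K * dist w w' * ((E t - 1) / k)"
      using has_integral_exp_scaled[OF k t] by (simp add: E_def integral_unique)
    also have "\<dots> \<le> E t * (dist w w' / 2)"
    proof -
      have "K * dist w w' * ((E t - 1) / k) = (E t - 1) * (dist w w' / 2)"
        using K by (simp add: k_def)
      also have "\<dots> \<le> E t * (dist w w' / 2)" by (intro mult_right_mono) auto
      finally show ?thesis .
    qed
    finally have *: "norm (integral {a..t} (\<lambda>s. M s (z w s)) - integral {a..t} (\<lambda>s. M s (z w' s)))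
      \<le> E t * (dist w w' / 2)" .
    have "norm (V w t - V w' t)
      = (1 / E t) * norm (integral {a..t} (\<lambda>s. M s (z w s)) - integral {a..t} (\<lambda>s. M s (z w' s)))"
      unfolding V_def scaleR_diff_right[symmetric] norm_scaleR using E_pos[of t] by simp
    also have "\<dots> \<le> (1 / E t) * (E t * (dist w w' / 2))"
      using E_pos[of t] by (intro mult_left_mono *) auto
    finally show ?thesis using E_pos[of t] by simp
  qed
  have V_bound: "norm (V w t) \<le> B + dist w 0 / 2" if "a \<le> t" for w t
  proof -
    have "norm (V 0 t) = norm (g t) / E t" by (simp add: V_def z_def M0 E_def)
    also have "\<dots> \<le> norm (g t) / 1"
      using that k by (intro divide_left_mono) (auto simp: E_def)
    also have "\<dots> \<le> B" using g(2)[OF that] by simp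
    finally show ?thesis using V_diff[OF that, of w 0] norm_triangle_ineq2[of "V w t" "V 0 t"] by linarith
  qed
  \<comment> \<open>The fixed point is sought among bounded continuous functions on the whole line,
    so \<open>V w\<close> is frozen at its value in \<open>a\<close> for earlier times.\<close>
  have V_bc: "(\<lambda>t. V w (max a t)) \<in> bcontfun" for w
  proof (rule bcontfun_normI)
    show "continuous_on UNIV (\<lambda>t. V w (max a t))"
      by (rule continuous_on_compose2[OF V_cont]) (auto intro!: continuous_intros)
    show "norm (V w (max a t)) \<le> B + dist w 0 / 2" for t by (rule V_bound) simp
  qed
  define T where "T w = Bcontfun (\<lambda>t. V w (max a t))" for w
  have T_app: "apply_bcontfun (T w) t = V w (max a t)" for w t
    unfolding T_def using Bcontfun_inverse[OF V_bc] by simp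
  have "\<exists>!w. T w = w"
  proof (rule banach_fix_type[of "1/2"])
    show "\<forall>x y. dist (T x) (T y) \<le> 1/2 * dist x y"
    proof (intro allI dist_bound)
      fix x y t
      show "dist (T x t) (T y t) \<le> 1/2 * dist x y"
        using V_diff[of "max a t" x y] by (simp add: T_app dist_norm[of "V x (max a t)"])
    qed
  qed auto
  then obtain w where w: "T w = w" by blast
  have "z w t = g t + integral {a..t} (\<lambda>s. M s (z w s))" if "a \<le> t" for t
  proof -
    have "apply_bcontfun w t = V w t" using T_app[of w t] w that by simp
    then show ?thesis using E_pos[of t] by (simp add: z_def V_def)
  qed
  then show ?thesis using z_cont by blast
qed

text \<open>At a point where the weighted size \<open>norm (z s) / E s\<close> is maximal, the
  integral equation bounds this maximum by half of itself, so it is zero.\<close>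

lemma Volterra_solution_unique:
  fixes M :: "real \<Rightarrow> 'a::banach \<Rightarrow> 'a"
  assumes K: "K > 0"
    and bnd: "\<And>t x. norm (M t x) \<le> K * norm x"
    and int: "\<And>t. t \<in> {a..b} \<Longrightarrow> (\<lambda>s. M s (z s)) integrable_on {a..t}"
    and z: "continuous_on {a..b} z" "\<And>t. t \<in> {a..b} \<Longrightarrow> z t = integral {a..t} (\<lambda>s. M s (z s))"
    and t: "t \<in> {a..b}"
  shows "z t = 0"
proof -
  define k where "k = 2 * K"
  have k: "k > 0" using K by (simp add: k_def)
  define E where "E t = exp (k * (t - a))" for t
  have E_pos: "E t > 0" for t by (simp add: E_def)
  have "continuous_on {a..b} (\<lambda>s. norm (z s) / E s)"
    unfolding E_def by (intro continuous_intros z) auto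
  then obtain s0 where s0: "s0 \<in> {a..b}" "\<And>s. s \<in> {a..b} \<Longrightarrow> norm (z s) / E s \<le> norm (z s0) / E s0"
    using continuous_attains_sup[of "{a..b}" "\<lambda>s. norm (z s) / E s"] t by auto
  define m where "m = norm (z s0) / E s0"
  have m: "m \<ge> 0" using E_pos[of s0] by (simp add: m_def)
  have zm: "norm (z s) \<le> m * E s" if "s \<in> {a..b}" for s
    using s0(2)[OF that] E_pos[of s] by (simp add: m_def pos_divide_le_eq)
  have "norm (z s0) \<le> integral {a..s0} (\<lambda>s. K * m * E s)"
    unfolding z(2)[OF s0(1)]
  proof (rule integral_norm_bound_integral)
    show "(\<lambda>s. K * m * E s) integrable_on {a..s0}"
      unfolding E_def by (intro integrable_continuous_interval continuous_intros)
    fix s assume s: "s \<in> {a..s0}"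
    have "norm (M s (z s)) \<le> K * norm (z s)" by (rule bnd)
    also have "\<dots> \<le> K * (m * E s)" using K s s0(1) by (intro mult_left_mono zm) auto
    finally show "norm (M s (z s)) \<le> K * m * E s" by (simp add: ac_simps)
  qed (rule int[OF s0(1)])
  also have "\<dots> = K * m * ((E s0 - 1) / k)"
    using has_integral_exp_scaled[OF k, of a s0] s0(1) by (simp add: E_def integral_unique)
  also have "\<dots> = m * (E s0 - 1) / 2" using K by (simp add: k_def)
  also have "\<dots> \<le> m * E s0 / 2" using m by (simp add: mult_left_mono)
  finally have "m * E s0 \<le> m * E s0 / 2" using E_pos[of s0] by (simp add: m_def)
  then have "m = 0" using m E_pos[of s0] by (simp add: mult_le_0_iff)
  then show ?thesis using zm[OF t] by simp
qed

section \<open>Maximal dissipative operators\<close>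

lemma has_real_derivative_at_interior:
  assumes "(f has_real_derivative d) (at t within {0..})" "t > 0"
  shows "(f has_real_derivative d) (at t)"
proof -
  have "at t within {0..} = at t"
    by (rule at_within_interior) (use assms(2) in simp)
  then show ?thesis using assms(1) by simp
qed

lemma derivative_nonpos_imp_le:
  fixes f :: "real \<Rightarrow> real"
  assumes d: "\<And>s. 0 \<le> s \<Longrightarrow> (f has_real_derivative f' s) (at s within {0..})"
    and "\<And>s. 0 \<le> s \<Longrightarrow> f' s \<le> 0" and t: "0 \<le> t"
  shows "f t \<le> f 0"
proof (rule DERIV_nonpos_imp_decreasing_open[OF t])
  show "\<exists>y. (f has_real_derivative y) (at s) \<and> y \<le> 0" if "0 < s" "s < t" for s
    using has_real_derivative_at_interior[OF d] assms(2)[of s] that by auto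
  have "continuous_on {0..} f"
    using d by (auto simp: continuous_on_eq_continuous_within intro: DERIV_continuous)
  then show "continuous_on {0..t} f" by (rule continuous_on_subset) auto
qed

text \<open>The function \<open>exp (- t) * f t - t * e\<close> is nonincreasing. The crude
  replacement of \<open>exp (- s) * e\<close> by \<open>e\<close> is harmless, because
  \<open>e\<close> will tend to zero in the application.\<close>

lemma Gronwall_inhomogeneous:
  fixes f :: "real \<Rightarrow> real"
  assumes d: "\<And>s. 0 \<le> s \<Longrightarrow> (f has_real_derivative f' s) (at s within {0..})"
    and le: "\<And>s. 0 \<le> s \<Longrightarrow> f' s \<le> f s + e" and e: "0 \<le> e" and t: "0 \<le> t"
  shows "f t \<le> exp t * (f 0 + t * e)"
proof -
  let ?g = "\<lambda>t. exp (- t) * f t - t * e"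
  have "?g t \<le> ?g 0"
  proof (rule derivative_nonpos_imp_le[OF _ _ t])
    fix s :: real assume s: "0 \<le> s"
    show "(?g has_real_derivative (exp (- s) * (f' s - f s) - e)) (at s within {0..})"
      by (auto intro!: derivative_eq_intros d[OF s] simp: algebra_simps)
    have "exp (- s) * (f' s - f s) \<le> exp (- s) * e" using le[OF s] by (intro mult_left_mono) auto
    also have "\<dots> \<le> 1 * e" using e s by (intro mult_right_mono) auto
    finally show "exp (- s) * (f' s - f s) - e \<le> 0" by simp
  qed
  then have "exp (- t) * f t \<le> f 0 + t * e" by simp
  then have "exp t * (exp (- t) * f t) \<le> exp t * (f 0 + t * e)" by (rule mult_left_mono) simp
  then show ?thesis by (simp add: mult.assoc[symmetric] flip: exp_add)
qed

lemma (in coercive_form) has_derivative_ip_self: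
  assumes "(x has_vector_derivative x') (at t within T)"
  shows "((\<lambda>t. ip (x t) (x t)) has_real_derivative 2 * ip (x t) x') (at t within T)"
  using ip.has_vector_derivative[OF assms assms]
  by (simp add: has_real_derivative_iff_has_vector_derivative sym[of x'])

text \<open>An operator given by its graph, since it is defined on part of the space. By linearity,
  single-valuedness at 0 suffices. The range condition is solvability of
  \<open>l x - A x = f\<close>; density of the domain is not postulated but derived below.\<close>

locale maximal_dissipative = coercive_form +
  fixes \<Gamma> :: "('a \<times> 'a) set"
  assumes subspace_graph: "subspace \<Gamma>"
    and single_valued: "(0, y) \<in> \<Gamma> \<Longrightarrow> y = 0"
    and dissipative: "(x, y) \<in> \<Gamma> \<Longrightarrow> ip x y \<le> 0"
    and range: "l > 0 \<Longrightarrow> \<exists>x. (x, l *\<^sub>R x - f) \<in> \<Gamma>"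
begin

lemma graph_add: "(x, y) \<in> \<Gamma> \<Longrightarrow> (x', y') \<in> \<Gamma> \<Longrightarrow> (x + x', y + y') \<in> \<Gamma>"
  using subspace_add[OF subspace_graph, of "(x, y)" "(x', y')"] by simp

lemma graph_diff: "(x, y) \<in> \<Gamma> \<Longrightarrow> (x', y') \<in> \<Gamma> \<Longrightarrow> (x - x', y - y') \<in> \<Gamma>"
  using subspace_diff[OF subspace_graph, of "(x, y)" "(x', y')"] by simp

lemma graph_scale: "(x, y) \<in> \<Gamma> \<Longrightarrow> (r *\<^sub>R x, r *\<^sub>R y) \<in> \<Gamma>"
  using subspace_scale[OF subspace_graph, of "(x, y)" r] by simp

section \<open>Resolvents of a maximal dissipative relation\<close>

definition res :: "real \<Rightarrow> 'a \<Rightarrow> 'a" where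
  "res l f = (SOME x. (x, l *\<^sub>R x - f) \<in> \<Gamma>)"

lemma res_graph: "l > 0 \<Longrightarrow> (res l f, l *\<^sub>R res l f - f) \<in> \<Gamma>"
  unfolding res_def by (rule someI_ex[OF range])

text \<open>Dissipativity, scaled by \<open>l\<close>, gives
  \<open>ip (l x) (l x) \<le> ip (l x) f\<close>. Stating it for an arbitrary solution
  \<open>x\<close> rather than for \<open>res l f\<close> lets the same estimate yield
  uniqueness.\<close>

lemma res_contraction:
  assumes l: "l > 0" and g: "(x, l *\<^sub>R x - f) \<in> \<Gamma>"
  shows "ip (l *\<^sub>R x) (l *\<^sub>R x) \<le> ip f f"
proof -
  have "ip (l *\<^sub>R x) (l *\<^sub>R x) \<le> ip (l *\<^sub>R x) f"
    using dissipative[OF graph_scale[OF g, of l]] l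
    by (simp add: ip.diff_right ip.scaleR_left ip.scaleR_right mult_le_0_iff)
  then show ?thesis using twice_ip_le[of "l *\<^sub>R x" f] by simp
qed

lemma res_unique:
  assumes l: "l > 0" and g: "(x, l *\<^sub>R x - f) \<in> \<Gamma>"
  shows "res l f = x"
proof -
  have "(res l f - x, l *\<^sub>R (res l f - x) - 0) \<in> \<Gamma>"
    using graph_diff[OF res_graph[OF l, of f] g] by (simp add: algebra_simps)
  from res_contraction[OF l this] have "ip (l *\<^sub>R (res l f - x)) (l *\<^sub>R (res l f - x)) = 0"
    using nonneg[of "l *\<^sub>R (res l f - x)"] by (simp only: ip.zero_left order_antisym)
  then show ?thesis using l by simp
qed

lemma res_ip_le: "l > 0 \<Longrightarrow> ip (l *\<^sub>R res l f) (l *\<^sub>R res l f) \<le> ip f f"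
  by (rule res_contraction[OF _ res_graph])

lemma bounded_linear_res:
  assumes l: "l > 0" shows "bounded_linear (res l)"
proof -
  obtain C where C: "C > 0" "\<And>x. ip x x \<le> C * (norm x)\<^sup>2" using upper_bound by blast
  show ?thesis
  proof (rule bounded_linear_intro[where K="sqrt (C / c) / l"])
    show "res l (f + g) = res l f + res l g" for f g
      using graph_add[OF res_graph[OF l, of f] res_graph[OF l, of g]]
      by (intro res_unique l) (simp add: algebra_simps)
    show "res l (r *\<^sub>R f) = r *\<^sub>R res l f" for r f
      using graph_scale[OF res_graph[OF l, of f], of r]
      by (intro res_unique l) (simp add: algebra_simps)
    fix f
    have "c * (norm (l *\<^sub>R res l f))\<^sup>2 \<le> C * (norm f)\<^sup>2"
      using coercive[of "l *\<^sub>R res l f"] res_ip_le[OF l, of f] C(2)[of f] by linarith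
    then have "(norm (l *\<^sub>R res l f))\<^sup>2 \<le> C / c * (norm f)\<^sup>2"
      using c_pos by (simp add: field_simps)
    then have "norm (l *\<^sub>R res l f) \<le> sqrt (C / c * (norm f)\<^sup>2)" (is "_ \<le> ?s") by (rule real_le_rsqrt)
    also have "?s = sqrt (C / c) * norm f" by (simp only: real_sqrt_mult real_sqrt_abs abs_norm_cancel)
    finally have "l * norm (res l f) \<le> sqrt (C / c) * norm f" using l by simp
    then show "norm (res l f) \<le> norm f * (sqrt (C / c) / l)"
      using l by (simp add: field_simps)
  qed
qed

text \<open>A pair \<open>(x, y)\<close> in the graph satisfies \<open>res 1 (x - y) = x\<close>, an
  equation between continuous maps that survives limits and leads back to the graph.\<close>

lemma graph_closed:
  assumes "\<And>n. (x n, y n) \<in> \<Gamma>" "x \<longlonglongrightarrow> x'" "y \<longlonglongrightarrow> y'"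
  shows "(x', y') \<in> \<Gamma>"
proof -
  interpret r: bounded_linear "res 1" by (rule bounded_linear_res) simp
  have eq: "res 1 (x n - y n) = x n" for n
    by (rule res_unique) (use assms(1) in auto)
  have "(\<lambda>n. res 1 (x n - y n)) \<longlonglongrightarrow> res 1 (x' - y')"
    by (intro r.tendsto tendsto_intros assms)
  then have "res 1 (x' - y') = x'"
    unfolding eq using assms(2) LIMSEQ_unique by blast
  then show ?thesis using res_graph[of 1 "x' - y'"] by simp
qed

text \<open>Let \<open>f - p\<close> be orthogonal to the closed range and \<open>?x\<close> its
  resolvent. Then \<open>?x\<close> itself lies in the range, so dissipativity reduces to
  \<open>ip ?x ?x \<le> 0\<close>; hence \<open>?x = 0\<close>, and single-valuedness gives
  \<open>f = p\<close>.\<close>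

lemma dense_res: "closure (range (res 1)) = UNIV"
proof -
  interpret r: bounded_linear "res 1" by (rule bounded_linear_res) simp
  let ?V = "closure (range (res 1))"
  have sub: "subspace (range (res 1))"
    using linear_subspace_image[OF r.linear subspace_UNIV] by simp
  have "f \<in> ?V" for f
  proof -
    obtain p where p: "p \<in> ?V" "\<And>v. v \<in> ?V \<Longrightarrow> ip (f - p) v = 0"
      using projection[of ?V f] sub by (auto intro: subspace_closure)
    let ?x = "res 1 (f - p)"
    have g: "(?x, ?x - (f - p)) \<in> \<Gamma>" using res_graph[of 1 "f - p"] by simp
    have "?x \<in> ?V" using closure_subset[of "range (res 1)"] by blast
    then have 0: "ip ?x (f - p) = 0" by (rule trans[OF sym p(2)])
    have "ip ?x ?x \<le> 0" using dissipative[OF g] 0 by (simp add: ip.diff_right)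
    then have "ip ?x ?x = 0" by (rule antisym[OF _ nonneg])
    then have "?x = 0" by simp
    then have "f - p = 0" using single_valued[of "- (f - p)"] g by simp
    then show ?thesis using p(1) by simp
  qed
  then show ?thesis by auto
qed

text \<open>A continuous map sends a dense set to a set dense in its range, and the range is dense
  already. Iterating it reaches the domains of higher powers.\<close>

lemma dense_res_image:
  assumes "closure D = UNIV" shows "closure (res 1 ` D) = UNIV"
proof -
  interpret r: bounded_linear "res 1" by (rule bounded_linear_res) simp
  have "res 1 ` closure D \<subseteq> closure (res 1 ` D)"
    by (intro image_closure_subset closed_closure closure_subset linear_continuous_on bounded_linear_res) simp
  then have "closure (range (res 1)) \<subseteq> closure (res 1 ` D)"
    using assms by (metis closed_closure closure_minimal)
  then show ?thesis using dense_res by auto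
qed

section \<open>Yosida approximations and their flows\<close>

definition yosida :: "real \<Rightarrow> 'a \<Rightarrow> 'a" where
  "yosida l f = l *\<^sub>R (l *\<^sub>R res l f - f)"

lemma yosida_graph: "l > 0 \<Longrightarrow> (l *\<^sub>R res l f, yosida l f) \<in> \<Gamma>"
  unfolding yosida_def by (rule graph_scale[OF res_graph])

lemma bounded_linear_yos: "l > 0 \<Longrightarrow> bounded_linear (yosida l)"
  unfolding yosida_def
  by (intro bounded_linear_scaleR_right[THEN bounded_linear_compose] bounded_linear_sub
      bounded_linear_res bounded_linear_ident)

lemma yosida_dissipative:
  assumes l: "l > 0" shows "ip f (yosida l f) \<le> 0"
proof -
  \<comment> \<open>Splits \<open>f\<close> into its resolvent part, on which the pair with
    \<open>yosida l f\<close> lies in the graph, and a multiple of \<open>yosida l f\<close> that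
    enters with a favourable sign.\<close>
  have f: "f = l *\<^sub>R res l f - (1/l) *\<^sub>R yosida l f" using l by (simp add: yosida_def)
  have "ip f (yosida l f) = ip (l *\<^sub>R res l f) (yosida l f) - (1/l) * ip (yosida l f) (yosida l f)"
    by (subst (1) f) (simp add: ip.diff_left ip.scaleR_left)
  also have "\<dots> \<le> 0" using dissipative[OF yosida_graph[OF l, of f]] l nonneg[of "yosida l f"]
    by (smt (verit) divide_nonneg_pos mult_nonneg_nonneg zero_le_divide_1_iff)
  finally show ?thesis .
qed

text \<open>The resolvent commutes with the operator on its domain. Read as
  \<open>l *\<^sub>R res l x - x = res l y\<close>, it shows convergence of
  \<open>l *\<^sub>R res l x\<close> to \<open>x\<close> at rate \<open>1 / l\<close>.\<close>

lemma res_scale_graph: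
  assumes l: "l > 0" and g: "(x, y) \<in> \<Gamma>"
  shows "l *\<^sub>R res l x = x + res l y"
proof -
  interpret r: bounded_linear "res l" by (rule bounded_linear_res[OF l])
  have "(x + res l y, l *\<^sub>R (x + res l y) - l *\<^sub>R x) \<in> \<Gamma>"
    using graph_add[OF g res_graph[OF l, of y]] by (simp add: algebra_simps)
  from res_unique[OF l this] show ?thesis by (simp add: r.scaleR)
qed

lemma yosida_on_graph: "l > 0 \<Longrightarrow> (x, y) \<in> \<Gamma> \<Longrightarrow> yosida l x = l *\<^sub>R res l y"
  using res_scale_graph by (simp add: yosida_def)

lemma res_commute:
  assumes l: "l > 0" and m: "m > 0"
  shows "res l (res m f) = res m (res l f)"
proof (cases "l = m")
  case False
  \<comment> \<open>The resolvent identity. Its right-hand side changes sign under exchange of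
    \<open>l\<close> and \<open>m\<close>, which is exactly commutation.\<close>
  have *: "(l - m) *\<^sub>R res l (res m f) = res m f - res l f" if l: "l > 0" and m: "m > 0" for l m
  proof -
    interpret r: bounded_linear "res l" by (rule bounded_linear_res[OF l])
    show ?thesis using res_scale_graph[OF l res_graph[OF m, of f]]
      by (simp add: r.diff r.scaleR algebra_simps)
  qed
  have "(l - m) *\<^sub>R res l (res m f) = (l - m) *\<^sub>R res m (res l f)"
    using *[OF l m] *[OF m l] by (metis minus_diff_eq scaleR_minus_left)
  then show ?thesis using False by simp
qed simp

lemma res_yosida_commute:
  assumes "l > 0" "m > 0" shows "res l (yosida m f) = yosida m (res l f)"
proof -
  interpret r: bounded_linear "res l" by (rule bounded_linear_res[OF assms(1)])
  show ?thesis by (simp add: yosida_def r.diff r.scaleR res_commute[OF assms])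
qed

lemma yosida_commute:
  assumes "l > 0" "m > 0" shows "yosida l (yosida m f) = yosida m (yosida l f)"
proof -
  interpret y: bounded_linear "yosida m" by (rule bounded_linear_yos[OF assms(2)])
  show ?thesis
    unfolding yosida_def[of l] by (simp add: y.scaleR y.diff res_yosida_commute[OF assms])
qed

definition yosida_flow :: "real \<Rightarrow> (real \<Rightarrow> 'a) \<Rightarrow> bool" where
  "yosida_flow l x \<longleftrightarrow> (\<forall>t\<ge>0. (x has_vector_derivative yosida l (x t)) (at t within {0..}))"

text \<open>The generator is bounded, so its flow solves a Volterra equation with constant
  inhomogeneity \<open>x0\<close>.\<close>

lemma yosida_flow_exists:
  assumes l: "l > 0" shows "\<exists>x. x 0 = x0 \<and> yosida_flow l x"
proof -
  interpret y: bounded_linear "yosida l" by (rule bounded_linear_yos[OF l])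
  obtain K where K: "K > 0" "\<And>x. norm (yosida l x) \<le> norm x * K" using y.pos_bounded by blast
  have cont: "continuous_on T (\<lambda>s. yosida l (z s))" if "continuous_on T z" for z :: "real \<Rightarrow> 'a" and T
    by (rule y.continuous_on[OF that])
  have "\<exists>z :: real \<Rightarrow> 'a. continuous_on {0..} z \<and> (\<forall>t\<ge>0. z t = x0 + integral {0..t} (\<lambda>s. yosida l (z s)))"
  proof (rule Volterra_solution_exists[where K=K and M="\<lambda>_. yosida l" and g="\<lambda>_. x0" and B="norm x0" and a=0])
    show "norm (yosida l x - yosida l y) \<le> K * norm (x - y)" for x y
      using K(2)[of "x - y"] by (simp add: y.diff mult.commute)
    show "(\<lambda>s. yosida l (z s)) integrable_on {0..t}" if "continuous_on {0..} z" for z :: "real \<Rightarrow> 'a" and t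
      by (intro integrable_continuous_interval cont continuous_on_subset[OF that]) simp
  qed (simp_all add: K(1) y.zero)
  then obtain z :: "real \<Rightarrow> 'a" where z: "continuous_on {0..} z"
    "\<forall>t\<ge>0. z t = x0 + integral {0..t} (\<lambda>s. yosida l (z s))"
    by blast
  have "(z has_vector_derivative yosida l (z t)) (at t within {0..})" if t: "t \<ge> 0" for t
  proof (rule has_vector_derivative_transform[where f="\<lambda>t. x0 + integral {0..t} (\<lambda>s. yosida l (z s))"])
    show "((\<lambda>t. x0 + integral {0..t} (\<lambda>s. yosida l (z s))) has_vector_derivative yosida l (z t)) (at t within {0..})"
      using integral_has_vector_derivative_atLeast[OF cont[OF z(1)] t]
        has_vector_derivative_const[of x0 "at t within {0..}"]
      by (auto intro!: derivative_eq_intros)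
  qed (use t z(2) in auto)
  then show ?thesis using z(2)[rule_format, of 0] unfolding yosida_flow_def by (intro exI[of _ z]) simp
qed

lemma yosida_flow_contraction:
  assumes l: "l > 0" and x: "yosida_flow l x" and t: "t \<ge> 0"
  shows "ip (x t) (x t) \<le> ip (x 0) (x 0)"
  by (rule derivative_nonpos_imp_le[OF has_derivative_ip_self _ t])
    (use x yosida_dissipative[OF l] in \<open>auto simp: yosida_flow_def mult_le_0_iff\<close>)

text \<open>Used twice: for \<open>B\<close> an approximation itself, which shows that the time
  derivative of a flow is a flow, and for \<open>B\<close> a difference of two approximations, which
  controls that difference along a flow.\<close>

lemma yosida_flow_bounded_linear:
  assumes x: "yosida_flow l x" and B: "bounded_linear B" and comm: "\<And>f. yosida l (B f) = B (yosida l f)"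
  shows "yosida_flow l (\<lambda>t. B (x t))"
  using x bounded_linear.has_vector_derivative[OF B] comm by (simp add: yosida_flow_def)

text \<open>The derivative of \<open>x - y\<close> is \<open>yosida l (x - y)\<close>, which is
  dissipative, plus the defect \<open>(yosida l - yosida m) y\<close>. By commutation the defect is
  itself a flow of \<open>yosida m\<close>, so its energy never exceeds the initial value
  \<open>e\<close>.\<close>

lemma yosida_flow_distance:
  assumes l: "l > 0" and m: "m > 0" and x: "yosida_flow l x" and y: "yosida_flow m y" and t: "t \<ge> 0"
    and e: "ip (yosida l (y 0) - yosida m (y 0)) (yosida l (y 0) - yosida m (y 0)) \<le> e"
  shows "ip (x t - y t) (x t - y t) \<le> exp t * (ip (x 0 - y 0) (x 0 - y 0) + t * e)"
proof (rule Gronwall_inhomogeneous[OF has_derivative_ip_self _ _ t])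
  let ?d = "\<lambda>s. yosida l (y s) - yosida m (y s)"
  interpret yl: bounded_linear "yosida l" by (rule bounded_linear_yos[OF l])
  interpret ym: bounded_linear "yosida m" by (rule bounded_linear_yos[OF m])
  have d: "yosida_flow m ?d"
  proof (rule yosida_flow_bounded_linear[OF y])
    show "bounded_linear (\<lambda>f. yosida l f - yosida m f)"
      by (intro bounded_linear_sub yl.bounded_linear ym.bounded_linear)
    show "yosida m (yosida l f - yosida m f) = yosida l (yosida m f) - yosida m (yosida m f)" for f
      by (simp add: ym.diff yosida_commute[OF l m])
  qed
  fix s :: real assume s: "s \<ge> 0"
  show "((\<lambda>s. x s - y s) has_vector_derivative (yosida l (x s - y s) + ?d s)) (at s within {0..})"
    using x y s unfolding yosida_flow_def by (auto intro!: derivative_eq_intros simp: yl.diff)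
  have "ip (?d s) (?d s) \<le> e" using yosida_flow_contraction[OF m d s] e by simp
  then show "2 * ip (x s - y s) (yosida l (x s - y s) + ?d s) \<le> ip (x s - y s) (x s - y s) + e"
    using yosida_dissipative[OF l, of "x s - y s"] twice_ip_le[of "x s - y s" "?d s"]
    by (simp add: ip.add_right)
next
  show "0 \<le> e" using e nonneg order_trans by blast
qed

text \<open>For \<open>x\<close> in the domain of the square,
  \<open>yosida l x = y + res l z\<close>; the common \<open>y\<close> cancels and the remaining
  resolvents are of order \<open>1 / l\<close> and \<open>1 / m\<close>.\<close>

lemma yosida_diff_le:
  assumes l: "l > 0" and m: "m > 0" and g: "(x, y) \<in> \<Gamma>" "(y, z) \<in> \<Gamma>"
  shows "ip (yosida l x - yosida m x) (yosida l x - yosida m x) \<le> (2 / l\<^sup>2 + 2 / m\<^sup>2) * ip z z"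
proof -
  have *: "ip (res l z) (res l z) \<le> ip z z / l\<^sup>2" if "l > 0" for l
    using res_ip_le[OF that, of z] that by (simp add: ip_scale field_simps)
  have "yosida l x - yosida m x = res l z - res m z"
    using yosida_on_graph[OF l g(1)] yosida_on_graph[OF m g(1)] res_scale_graph[OF l g(2)] res_scale_graph[OF m g(2)]
    by simp
  then have "ip (yosida l x - yosida m x) (yosida l x - yosida m x) \<le> 2 * ip (res l z) (res l z) + 2 * ip (res m z) (res m z)"
    using ip_diff_le by simp
  also have "\<dots> \<le> 2 * (ip z z / l\<^sup>2) + 2 * (ip z z / m\<^sup>2)" using *[OF l] *[OF m] by simp
  finally show ?thesis by (simp add: algebra_simps)
qed

text \<open>The flows of the Yosida approximations and their time derivatives are locally uniformly
  Cauchy for initial data in the domain of the third power.\<close>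

theorem classical_flow_exists:
  assumes x: "(x0, x1) \<in> \<Gamma>" "(x1, x2) \<in> \<Gamma>" "(x2, x3) \<in> \<Gamma>"
  shows "\<exists>x v. x 0 = x0 \<and> continuous_on {0..} v \<and>
     (\<forall>t\<ge>0. (x t, v t) \<in> \<Gamma> \<and> (x has_vector_derivative v t) (at t within {0..}))"
proof -
  define l where "l n = real (Suc n)" for n
  have l: "l n > 0" for n by (simp add: l_def)
  have "\<exists>x. x 0 = x0 \<and> yosida_flow (l n) x" for n by (rule yosida_flow_exists[OF l])
  then obtain X where X: "\<And>n. X n 0 = x0" "\<And>n. yosida_flow (l n) (X n)" by metis
  define V where "V n t = yosida (l n) (X n t)" for n t
  have V: "yosida_flow (l n) (V n)" for n
    unfolding V_def by (rule yosida_flow_bounded_linear[OF X(2) bounded_linear_yos[OF l]]) simp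
  have Xder: "(X n has_vector_derivative V n t) (at t within {0..})" if "t \<ge> 0" for n t
    using X(2) that by (simp add: yosida_flow_def V_def)
  have Vcont: "continuous_on {0..} (V n)" for n
    using V[of n] unfolding yosida_flow_def continuous_on_eq_continuous_within
    by (auto intro: has_vector_derivative_continuous)
  \<comment> \<open>One rate for both estimates: \<open>x2\<close> governs the flows,
    \<open>x3\<close> their time derivatives. The third power of the operator is needed because the
    derivative starts one power later.\<close>
  define e where "e n m = (2 / (l n)\<^sup>2 + 2 / (l m)\<^sup>2) * (ip x2 x2 + ip x3 x3)" for n m
  have e: "(2 / (l n)\<^sup>2 + 2 / (l m)\<^sup>2) * ip x2 x2 \<le> e n m" "(2 / (l n)\<^sup>2 + 2 / (l m)\<^sup>2) * ip x3 x3 \<le> e n m" for n m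
    unfolding e_def by (intro mult_left_mono; simp)+
  have e0: "e n m \<ge> 0" for n m unfolding e_def by simp
  have bX: "ip (X n t - X m t) (X n t - X m t) \<le> exp t * (1 + t) * e n m" if t: "t \<ge> 0" for n m t
  proof -
    have "ip (X n t - X m t) (X n t - X m t) \<le> exp t * (ip (X n 0 - X m 0) (X n 0 - X m 0) + t * e n m)"
      by (rule yosida_flow_distance[OF l l X(2) X(2) t])
        (use yosida_diff_le[OF l l x(1,2), of n m] e(1)[of n m] in \<open>simp add: X(1)\<close>)
    also have "\<dots> \<le> exp t * ((1 + t) * e n m)"
      using t e0 by (intro mult_left_mono) (auto simp: X(1) ip.zero_left algebra_simps)
    finally show ?thesis by simp
  qed
  have bV: "ip (V n t - V m t) (V n t - V m t) \<le> exp t * (1 + t) * e n m" if t: "t \<ge> 0" for n m t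
  proof -
    interpret rm: bounded_linear "res (l m)" by (rule bounded_linear_res[OF l])
    interpret yn: bounded_linear "yosida (l n)" by (rule bounded_linear_yos[OF l])
    interpret ym: bounded_linear "yosida (l m)" by (rule bounded_linear_yos[OF l])
    have V0: "V n 0 = yosida (l n) x0" for n by (simp add: V_def X)
    \<comment> \<open>The initial derivative is \<open>l m *\<^sub>R res (l m) x1\<close>. Pulling
      this contraction out reduces the defect at the initial derivative to the defect at
      \<open>x1\<close>.\<close>
    have "yosida (l n) (V m 0) - yosida (l m) (V m 0) = l m *\<^sub>R res (l m) (yosida (l n) x1 - yosida (l m) x1)"
      unfolding V0 yosida_on_graph[OF l x(1)]
      by (simp add: rm.diff scaleR_diff_right res_yosida_commute[OF l l] yn.scaleR ym.scaleR)
    then have "ip (yosida (l n) (V m 0) - yosida (l m) (V m 0)) (yosida (l n) (V m 0) - yosida (l m) (V m 0))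
      \<le> ip (yosida (l n) x1 - yosida (l m) x1) (yosida (l n) x1 - yosida (l m) x1)"
      using res_ip_le[OF l] by simp
    also have "\<dots> \<le> e n m" using yosida_diff_le[OF l l x(2,3), of n m] e(2)[of n m] by simp
    finally have "ip (V n t - V m t) (V n t - V m t) \<le> exp t * (ip (V n 0 - V m 0) (V n 0 - V m 0) + t * e n m)"
      by (rule yosida_flow_distance[OF l l V V t])
    also have "\<dots> \<le> exp t * (e n m + t * e n m)"
      using yosida_diff_le[OF l l x(1,2), of n m] e(1)[of n m] unfolding V0
      by (intro mult_left_mono add_right_mono) auto
    finally show ?thesis by (simp add: algebra_simps)
  qed
  have e_small: "\<exists>N. \<forall>n\<ge>N. \<forall>m\<ge>N. b * e n m < d" if "b \<ge> 0" "d > 0" for b d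
  proof -
    let ?C = "4 * (ip x2 x2 + ip x3 x3)"
    have "(\<lambda>n. b * (?C * (1 / (l n)\<^sup>2))) \<longlonglongrightarrow> b * (?C * 0)"
    proof (intro tendsto_mult tendsto_const)
      have "(\<lambda>n. (inverse (l n))\<^sup>2) \<longlonglongrightarrow> 0\<^sup>2"
        unfolding l_def by (intro tendsto_power LIMSEQ_inverse_real_of_nat)
      then show "(\<lambda>n. 1 / (l n)\<^sup>2) \<longlonglongrightarrow> 0" by (simp add: power_inverse inverse_eq_divide power_one_over)
    qed
    then have "eventually (\<lambda>n. b * (?C * (1 / (l n)\<^sup>2)) < d) sequentially"
      using that by (intro order_tendstoD) auto
    then obtain N where N: "b * (?C * (1 / (l N)\<^sup>2)) < d" by (auto simp: eventually_sequentially)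
    have "b * e n m < d" if "n \<ge> N" "m \<ge> N" for n m
    proof -
      have le: "2 / (l n)\<^sup>2 \<le> 2 / (l N)\<^sup>2" if "n \<ge> N" for n
        using that by (intro divide_left_mono power_mono mult_pos_pos) (auto simp: l_def)
      have "e n m \<le> (2 / (l N)\<^sup>2 + 2 / (l N)\<^sup>2) * (ip x2 x2 + ip x3 x3)"
        unfolding e_def using le[OF that(1)] le[OF that(2)] by (intro mult_right_mono) auto
      also have "\<dots> = ?C * (1 / (l N)\<^sup>2)" by (simp add: field_simps)
      finally show ?thesis using N \<open>b \<ge> 0\<close> by (meson mult_left_mono order_le_less_trans)
    qed
    then show ?thesis by blast
  qed
  have unif: "uniformly_Cauchy_on {0..T} Y"
    if Y: "\<And>n m t. t \<ge> 0 \<Longrightarrow> ip (Y n t - Y m t) (Y n t - Y m t) \<le> exp t * (1 + t) * e n m"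
      and T: "T \<ge> 0" for Y :: "nat \<Rightarrow> real \<Rightarrow> 'a" and T
  proof (rule uniformly_Cauchy_onI)
    fix d :: real assume d: "d > 0"
    obtain N where N: "\<And>n m. n \<ge> N \<Longrightarrow> m \<ge> N \<Longrightarrow> exp T * (1 + T) * e n m < c * d\<^sup>2"
      using e_small[of "exp T * (1 + T)" "c * d\<^sup>2"] c_pos d T by auto
    have "dist (Y n t) (Y m t) < d" if t: "t \<in> {0..T}" and nm: "n \<ge> N" "m \<ge> N" for t n m
    proof -
      have "c * (norm (Y n t - Y m t))\<^sup>2 \<le> exp t * (1 + t) * e n m"
        using coercive Y[of t n m] t order_trans by fastforce
      also have "\<dots> \<le> exp T * (1 + T) * e n m"
        using t e0 by (intro mult_mono mult_nonneg_nonneg) auto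
      also have "\<dots> < c * d\<^sup>2" by (rule N[OF nm])
      finally have "(norm (Y n t - Y m t))\<^sup>2 < d\<^sup>2" using c_pos by simp
      then show ?thesis using d by (simp add: dist_norm power_less_imp_less_base)
    qed
    then show "\<exists>N. \<forall>t\<in>{0..T}. \<forall>m\<ge>N. \<forall>n\<ge>N. dist (Y m t) (Y n t) < d" by blast
  qed
  define x where "x t = lim (\<lambda>n. X n t)" for t
  define v where "v t = lim (\<lambda>n. V n t)" for t
  have limU: "uniform_limit {0..T} Y (\<lambda>t. lim (\<lambda>n. Y n t)) sequentially"
    if "\<And>n m t. t \<ge> 0 \<Longrightarrow> ip (Y n t - Y m t) (Y n t - Y m t) \<le> exp t * (1 + t) * e n m"
      and T: "T \<ge> 0" for Y :: "nat \<Rightarrow> real \<Rightarrow> 'a" and T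
    using Cauchy_uniformly_convergent[OF unif[OF that]] uniformly_convergent_uniform_limit_iff by blast
  have ux: "uniform_limit {0..T} X x sequentially" and uv: "uniform_limit {0..T} V v sequentially"
    if T: "T \<ge> 0" for T
    unfolding x_def v_def by (rule limU[OF bX T], simp) (rule limU[OF bV T], simp)
  have lx: "(\<lambda>n. X n t) \<longlonglongrightarrow> x t" and lv: "(\<lambda>n. V n t) \<longlonglongrightarrow> v t" if "t \<ge> 0" for t
    using tendsto_uniform_limitI[OF ux[OF that], of t] tendsto_uniform_limitI[OF uv[OF that], of t] that by auto
  have vcontT: "continuous_on {0..T} v" if "T \<ge> 0" for T
    by (rule uniform_limit_theorem[OF _ uv[OF that]])
      (auto intro!: always_eventually continuous_on_subset[OF Vcont])
  have vcont: "continuous_on {0..} v"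
    unfolding continuous_on_eq_continuous_within
  proof
    fix t :: real assume "t \<in> {0..}"
    then show "continuous (at t within {0..}) v"
      using vcontT[of "t + 1"] at_within_atLeast_eq[of 0 t "t + 1"]
      by (auto simp: continuous_on_eq_continuous_within)
  qed
  have x_int: "x t = x0 + integral {0..t} v" if t: "t \<ge> 0" for t
  proof -
    have *: "X n t = x0 + integral {0..t} (V n)" for n
    proof -
      have "(V n has_integral (X n t - X n 0)) {0..t}"
        by (rule fundamental_theorem_of_calculus[OF t])
          (use Xder in \<open>auto intro!: has_vector_derivative_within_subset[where S="{0..}" and T="{0..t}"]\<close>)
      then show ?thesis by (simp add: integral_unique X(1))
    qed
    have "(\<lambda>n. x0 + integral {0..t} (V n)) \<longlonglongrightarrow> x0 + integral {0..t} v"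
    proof (intro tendsto_intros)
      obtain I J where IJ: "\<And>n. (V n has_integral I n) {0..t}" "(v has_integral J) {0..t}" "I \<longlonglongrightarrow> J"
      proof (rule uniform_limit_integral[OF uv[OF t]])
        show "continuous_on {0..t} (V n)" for n by (rule continuous_on_subset[OF Vcont]) auto
      qed auto
      then show "(\<lambda>n. integral {0..t} (V n)) \<longlonglongrightarrow> integral {0..t} v"
        using integral_unique[OF IJ(1)] integral_unique[OF IJ(2)] by simp
    qed
    then show ?thesis using lx[OF t] LIMSEQ_unique unfolding * by blast
  qed
  have "(x has_vector_derivative v t) (at t within {0..})" if t: "t \<ge> 0" for t
  proof (rule has_vector_derivative_transform[where f="\<lambda>t. x0 + integral {0..t} v"])
    show "((\<lambda>t. x0 + integral {0..t} v) has_vector_derivative v t) (at t within {0..})"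
      using integral_has_vector_derivative_atLeast[OF vcont t]
        has_vector_derivative_const[of x0 "at t within {0..}"]
      by (auto intro!: derivative_eq_intros)
  qed (use t x_int in auto)
  moreover have "(x t, v t) \<in> \<Gamma>" if t: "t \<ge> 0" for t
  proof (rule graph_closed[OF _ _ lv[OF t]])
    show "(l n *\<^sub>R res (l n) (X n t), V n t) \<in> \<Gamma>" for n unfolding V_def by (rule yosida_graph[OF l])
    \<comment> \<open>The approximating graph elements have first component
      \<open>l n *\<^sub>R res (l n) (X n t)\<close>, which differs from \<open>X n t\<close> by
      \<open>V n t / l n\<close> and so has the same limit; closedness of the graph then
      applies.\<close>
    have "l n *\<^sub>R res (l n) (X n t) = X n t + (1 / l n) *\<^sub>R V n t" for n
      using l[of n] by (simp add: V_def yosida_def)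
    moreover have "(\<lambda>n. X n t + (1 / l n) *\<^sub>R V n t) \<longlonglongrightarrow> x t + 0 *\<^sub>R v t"
      unfolding l_def by (intro tendsto_intros lx lv t LIMSEQ_inverse_real_of_nat[unfolded inverse_eq_divide])
    ultimately show "(\<lambda>n. l n *\<^sub>R res (l n) (X n t)) \<longlonglongrightarrow> x t" by simp
  qed
  moreover have "x 0 = x0" using x_int[of 0] by simp
  ultimately show ?thesis using vcont by blast
qed

definition smooth_domain :: "'a set" where
  "smooth_domain = {x0. \<exists>x1 x2 x3. (x0, x1) \<in> \<Gamma> \<and> (x1, x2) \<in> \<Gamma> \<and> (x2, x3) \<in> \<Gamma>}"

lemma dense_smooth_domain: "closure smooth_domain = UNIV"
proof -
  interpret r: bounded_linear "res 1" by (rule bounded_linear_res) simp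
  have g: "(res 1 f, res 1 f - f) \<in> \<Gamma>" for f using res_graph[of 1 f] by simp
  have "res 1 (res 1 (res 1 f)) \<in> smooth_domain" for f
  proof -
    let ?h = "res 1 f - f"
    let ?k = "res 1 ?h - ?h"
    have "(res 1 (res 1 (res 1 f)), res 1 (res 1 ?h)) \<in> \<Gamma>"
      using g[of "res 1 (res 1 f)"] by (simp add: r.diff)
    moreover have "(res 1 (res 1 ?h), res 1 ?k) \<in> \<Gamma>"
      using g[of "res 1 ?h"] by (simp add: r.diff)
    ultimately show ?thesis using g[of ?k] unfolding smooth_domain_def by blast
  qed
  then have "res 1 ` res 1 ` range (res 1) \<subseteq> smooth_domain" by auto
  then have "closure (res 1 ` res 1 ` range (res 1)) \<subseteq> closure smooth_domain" by (rule closure_mono)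
  then show ?thesis using dense_res_image[OF dense_res_image[OF dense_res]] by auto
qed

end

section \<open>Semigroups and their generators\<close>

text \<open>Baire: the closed sets on which all \<open>A n\<close> are bounded by \<open>k\<close>
  cover the space, so one of them contains a ball.\<close>

lemma uniform_boundedness:
  fixes A :: "nat \<Rightarrow> 'a::banach \<Rightarrow> 'b::real_normed_vector"
  assumes A: "\<And>n. bounded_linear (A n)" and bdd: "\<And>x. \<exists>C. \<forall>n. norm (A n x) \<le> C"
  shows "\<exists>M. \<forall>n x. norm (A n x) \<le> M * norm x"
proof -
  define C where "C k = {x. \<forall>n. norm (A n x) \<le> real k}" for k
  have closed: "closed (C k)" for k
  proof -
    have "C k = (\<Inter>n. {x. norm (A n x) \<le> real k})" by (auto simp: C_def)
    moreover have "closed {x. norm (A n x) \<le> real k}" for n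
      by (intro closed_Collect_le continuous_intros linear_continuous_on A)
    ultimately show ?thesis by auto
  qed
  have "x \<in> \<Union>(range C)" for x
  proof -
    obtain c where c: "\<And>n. norm (A n x) \<le> c" using bdd by blast
    obtain k where k: "c \<le> real k" using real_arch_simple by blast
    have "norm (A n x) \<le> real k" for n by (rule order_trans[OF c k])
    then show ?thesis by (auto simp: C_def)
  qed
  then have U: "\<Union>(range C) = UNIV" by auto
  have "\<exists>k. interior (C k) \<noteq> {}"
  proof (rule ccontr)
    assume "\<not> ?thesis"
    then have "euclidean interior_of \<Union>(range C) = {}"
      using completely_metrizable_space_euclidean[where 'a='a] closed
      by (intro Baire_category_alt) auto
    then show False unfolding U by simp
  qed
  then obtain k x0 where "x0 \<in> interior (C k)" by auto
  then obtain r where r: "r > 0" "ball x0 r \<subseteq> C k"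
    by (meson interior_subset open_contains_ball open_interior order_trans)
  have "norm (A n x) \<le> (4 * real k / r) * norm x" for n x
  proof (cases "x = 0")
    case True
    then show ?thesis using bounded_linear.linear[OF A[of n]] by (simp add: linear_0)
  next
    case False
    interpret A: bounded_linear "A n" by (rule A)
    \<comment> \<open>Scaled to length \<open>r / 2\<close>, so that \<open>x0 + y\<close> stays in
      the ball. The difference of two values bounded by \<open>k\<close> gives \<open>2 * k\<close>,
      and scaling back produces \<open>4 * k / r\<close>.\<close>
    define y where "y = (r / (2 * norm x)) *\<^sub>R x"
    have ny: "norm y = r / 2" using False r(1) by (simp add: y_def)
    have "x0 + y \<in> C k" "x0 \<in> C k" using r ny by (auto simp: subset_iff dist_norm)
    then have "norm (A n (x0 + y)) \<le> k" "norm (A n x0) \<le> k" by (auto simp: C_def)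
    then have "norm (A n y) \<le> 2 * k"
      using norm_triangle_ineq4[of "A n (x0 + y)" "A n x0"] by (simp add: A.add)
    moreover have "norm (A n y) = (r / (2 * norm x)) * norm (A n x)"
      using r(1) by (simp add: y_def A.scaleR)
    ultimately have "(r / (2 * norm x)) * norm (A n x) \<le> 2 * k" by simp
    then show ?thesis using r(1) False by (simp add: field_simps)
  qed
  then show ?thesis by blast
qed

text \<open>\<open>T 0\<close> need only be a projection, so that semigroups on a subspace are covered.\<close>

locale strongly_continuous_semigroup =
  fixes T :: "real \<Rightarrow> 'a::banach \<Rightarrow> 'a"
  assumes bounded_linear: "t \<ge> 0 \<Longrightarrow> bounded_linear (T t)"
    and semigroup: "s \<ge> 0 \<Longrightarrow> t \<ge> 0 \<Longrightarrow> T (s + t) x = T s (T t x)"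
    and strongly_continuous: "((\<lambda>h. T h x) \<longlongrightarrow> T 0 x) (at_right 0)"
begin

text \<open>Failure would give times \<open>t n\<close> tending to 0 with operator norms above
  \<open>n\<close>. Strong continuity bounds each orbit along these times, contradicting uniform
  boundedness.\<close>

lemma bounded_near_0: "\<exists>d>0. \<exists>M. \<forall>t\<in>{0..d}. \<forall>x. norm (T t x) \<le> M * norm x"
proof (rule ccontr)
  assume neg: "\<not> ?thesis"
  have "\<exists>t\<in>{0..1 / Suc n}. \<exists>x. norm (T t x) > real n * norm x" for n
    using neg by (force simp: not_le)
  then obtain t where t: "\<And>n. t n \<in> {0..1 / Suc n}" "\<And>n. \<exists>x. norm (T (t n) x) > real n * norm x" by metis
  have "\<exists>C. \<forall>n. norm (T (t n) x) \<le> C" for x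
  proof -
    have "\<forall>\<^sub>F h in at_right 0. norm (T h x) < norm (T 0 x) + 1"
      using tendsto_norm[OF strongly_continuous[of x]] by (rule order_tendstoD) simp
    then obtain b where b: "b > 0" "\<And>h. 0 < h \<Longrightarrow> h < b \<Longrightarrow> norm (T h x) < norm (T 0 x) + 1"
      unfolding eventually_at_right_field by auto
    obtain m :: nat where m: "1 / b < m" using reals_Archimedean2 by blast
    define C where "C = (\<Sum>n<m. norm (T (t n) x)) + (norm (T 0 x) + 1)"
    have S0: "0 \<le> (\<Sum>n<m. norm (T (t n) x))" by (intro sum_nonneg) simp
    have "norm (T (t n) x) \<le> C" for n
    proof (cases "n < m")
      case True
      then have "norm (T (t n) x) \<le> (\<Sum>n<m. norm (T (t n) x))" by (intro member_le_sum) auto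
      then show ?thesis unfolding C_def using norm_ge_zero[of "T 0 x"] by linarith
    next
      case False
      have "1 / b < Suc n" using False m by simp
      then have "1 / Suc n < b" using b(1) by (simp add: field_simps)
      then have tb: "t n < b" using t(1)[of n] by simp
      have "norm (T (t n) x) \<le> norm (T 0 x) + 1"
      \<comment> \<open>The right-sided limit says nothing about time 0 itself, which may occur
        among the \<open>t n\<close>; there the bound is immediate.\<close>
      proof (cases "t n = 0")
        case False
        then show ?thesis using b(2)[of "t n"] tb t(1)[of n] by simp
      qed simp
      then show ?thesis unfolding C_def using S0 by linarith
    qed
    then show ?thesis by blast
  qed
  then obtain M where M: "\<And>n x. norm (T (t n) x) \<le> M * norm x"
    using uniform_boundedness[of "\<lambda>n. T (t n)"] bounded_linear t(1) by force
  obtain n :: nat where n: "M \<le> n" using real_arch_simple by blast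
  obtain x where "norm (T (t n) x) > real n * norm x" using t(2) by blast
  moreover have "M * norm x \<le> n * norm x" using n by (simp add: mult_right_mono)
  ultimately show False using M[of n x] by linarith
qed

lemma locally_bounded: "\<exists>M\<ge>1. \<forall>t\<in>{0..\<tau>}. \<forall>x. norm (T t x) \<le> M * norm x"
proof -
  obtain d M where d: "d > 0" and M: "\<And>t x. t \<in> {0..d} \<Longrightarrow> norm (T t x) \<le> M * norm x"
    using bounded_near_0 by blast
  define M1 where "M1 = max M 1"
  have M1: "norm (T t x) \<le> M1 * norm x" if "t \<in> {0..d}" for t x
    using M[OF that, of x] by (rule order_trans) (simp add: M1_def mult_right_mono)
  have "\<forall>t\<in>{0..real (Suc n) * d}. \<forall>x. norm (T t x) \<le> M1 ^ Suc n * norm x" for n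
  proof (induction n)
    case 0
    then show ?case using M1 by simp
  next
    case (Suc n)
    show ?case
    proof (intro ballI allI)
      fix t x assume t: "t \<in> {0..real (Suc (Suc n)) * d}"
      show "norm (T t x) \<le> M1 ^ Suc (Suc n) * norm x"
      proof (cases "t \<le> d")
        case True
        have "norm (T t x) \<le> M1 * norm x" using True t by (intro M1) auto
        also have "\<dots> \<le> M1 ^ Suc (Suc n) * norm x"
          by (intro mult_right_mono self_le_power) (auto simp: M1_def)
        finally show ?thesis .
      next
        case False
        have "T t x = T d (T (t - d) x)" using semigroup[of d "t - d" x] False d by simp
        also have "norm \<dots> \<le> M1 * norm (T (t - d) x)" using d by (intro M1) auto
        also have "\<dots> \<le> M1 * (M1 ^ Suc n * norm x)"
          using Suc t False by (intro mult_left_mono) (auto simp: M1_def algebra_simps)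
        finally show ?thesis by simp
      qed
    qed
  qed
  moreover obtain n :: nat where n: "\<tau> / d \<le> n" using real_arch_simple by blast
  ultimately show ?thesis
  proof (intro exI[of _ "M1 ^ Suc n"] conjI ballI allI)
    show "1 \<le> M1 ^ Suc n" by (intro one_le_power) (simp add: M1_def)
    fix t x assume t: "t \<in> {0..\<tau>}"
    have "\<tau> \<le> real n * d" using n d by (simp add: field_simps)
    also have "\<dots> \<le> real (Suc n) * d" using d by simp
    finally have "t \<in> {0..real (Suc n) * d}" using t by auto
    then show "norm (T t x) \<le> M1 ^ Suc n * norm x"
      using \<open>\<And>n. \<forall>t\<in>{0..real (Suc n) * d}. \<forall>x. norm (T t x) \<le> M1 ^ Suc n * norm x\<close> by blast
  qed
qed

text \<open>\<open>s \<mapsto> T (\<tau> - s) (\<eta> s)\<close> has derivative zero.\<close>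

lemma classical_flow_unique:
  assumes der: "\<And>s. s \<ge> 0 \<Longrightarrow> (\<eta> has_vector_derivative w s) (at s within {0..})"
    and gen: "\<And>s. s \<ge> 0 \<Longrightarrow> ((\<lambda>h. (T h (\<eta> s) - \<eta> s) /\<^sub>R h) \<longlongrightarrow> w s) (at_right 0)"
    and fixed: "\<And>s. s \<ge> 0 \<Longrightarrow> T 0 (\<eta> s) = \<eta> s" "\<And>s. s \<ge> 0 \<Longrightarrow> T 0 (w s) = w s"
    and \<tau>: "\<tau> \<ge> 0"
  shows "T \<tau> (\<eta> 0) = \<eta> \<tau>"
proof -
  obtain M where M: "M \<ge> 1" "\<And>t x. t \<in> {0..\<tau>} \<Longrightarrow> norm (T t x) \<le> M * norm x" using locally_bounded by blast
  have M0: "M \<ge> 0" using M(1) by simp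
  define \<phi> where "\<phi> s = T (\<tau> - s) (\<eta> s)" for s
  have "(\<phi> has_vector_derivative 0) (at s within {0..\<tau>})" if s: "s \<in> {0..\<tau>}" for s
  proof -
    define q where "q r = (\<eta> r - \<eta> s) /\<^sub>R (r - s)" for r
    define b where "b h = (T h (\<eta> s) - \<eta> s) /\<^sub>R h" for h
    \<comment> \<open>One bound for increments of \<open>\<phi>\<close> on both sides of
      \<open>s\<close>. For \<open>r > s\<close> the first two terms suffice; for
      \<open>r < s\<close> the third is needed because the semigroup then acts on the increment of
      \<open>\<eta>\<close>.\<close>
    define B where "B r = M * (M * norm (q r - w s) + norm (b \<bar>r - s\<bar> - w s) + norm (T \<bar>r - s\<bar> (w s) - w s))" for r
    have q_lim: "(q \<longlongrightarrow> w s) (at s within {0..\<tau>})"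
    proof -
      have "(\<eta> has_vector_derivative w s) (at s within {0..\<tau>})"
        by (rule has_vector_derivative_within_subset[OF der]) (use s in auto)
      then have "((\<lambda>r. (1 / norm (r - s)) *\<^sub>R (\<eta> r - (\<eta> s + (r - s) *\<^sub>R w s))) \<longlongrightarrow> 0) (at s within {0..\<tau>})"
        by (simp add: has_vector_derivative_def has_derivative_within)
      then have "((\<lambda>r. q r - w s) \<longlongrightarrow> 0) (at s within {0..\<tau>})"
      proof (rule Lim_null_comparison[rotated, OF tendsto_norm_zero])
        show "\<forall>\<^sub>F r in at s within {0..\<tau>}. norm (q r - w s)
            \<le> norm ((1 / norm (r - s)) *\<^sub>R (\<eta> r - (\<eta> s + (r - s) *\<^sub>R w s)))"
          unfolding eventually_at_filter
        proof (intro always_eventually allI impI)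
          fix r assume "r \<noteq> s"
          then have "q r - w s = (1 / (r - s)) *\<^sub>R (\<eta> r - (\<eta> s + (r - s) *\<^sub>R w s))"
            by (simp add: q_def diff_diff_eq[symmetric] scaleR_diff_right[of _ "\<eta> r - \<eta> s"] inverse_eq_divide)
          then show "norm (q r - w s) \<le> norm ((1 / norm (r - s)) *\<^sub>R (\<eta> r - (\<eta> s + (r - s) *\<^sub>R w s)))" by simp
        qed
      qed
      then show ?thesis by (simp add: LIM_zero_iff)
    qed
    \<comment> \<open>The generator and strong continuity are known for positive times only, so both
      one-sided quotients are written in terms of the distance from \<open>r\<close> to
      \<open>s\<close>.\<close>
    have abs_lim: "filterlim (\<lambda>r. \<bar>r - s\<bar>) (at_right 0) (at s within {0..\<tau>})"
      unfolding filterlim_at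
    proof
      have "((\<lambda>r. \<bar>r - s\<bar>) \<longlongrightarrow> \<bar>s - s\<bar>) (at s within {0..\<tau>})" by (intro tendsto_intros)
      then show "((\<lambda>r. \<bar>r - s\<bar>) \<longlongrightarrow> 0) (at s within {0..\<tau>})" by simp
      show "\<forall>\<^sub>F r in at s within {0..\<tau>}. \<bar>r - s\<bar> \<in> {0<..} \<and> \<bar>r - s\<bar> \<noteq> 0"
        by (auto simp: eventually_at_filter)
    qed
    have s0: "s \<ge> 0" using s by simp
    have b_lim: "((\<lambda>r. b \<bar>r - s\<bar>) \<longlongrightarrow> w s) (at s within {0..\<tau>})"
      unfolding b_def by (rule filterlim_compose[OF gen[OF s0] abs_lim])
    have T_lim: "((\<lambda>r. T \<bar>r - s\<bar> (w s)) \<longlongrightarrow> w s) (at s within {0..\<tau>})"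
      using filterlim_compose[OF strongly_continuous abs_lim, of "w s"] fixed(2)[OF s0] by simp
    have "(B \<longlongrightarrow> M * (M * norm (w s - w s) + norm (w s - w s) + norm (w s - w s))) (at s within {0..\<tau>})"
      unfolding B_def by (intro tendsto_intros q_lim b_lim T_lim)
    then have B_lim: "(B \<longlongrightarrow> 0) (at s within {0..\<tau>})" by simp
    have le: "norm (\<phi> r - \<phi> s) \<le> \<bar>r - s\<bar> * B r" if r: "r \<in> {0..\<tau>}" "r \<noteq> s" for r
    proof -
      define h where "h = \<bar>r - s\<bar>"
      have h: "h > 0" "h \<le> \<tau>" using r s by (auto simp: h_def)
      interpret Th: bounded_linear "T h" by (rule bounded_linear) (use h in simp)
      have qe: "\<eta> r - \<eta> s = (r - s) *\<^sub>R q r" using r(2) by (simp add: q_def)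
      have be: "T h (\<eta> s) - \<eta> s = h *\<^sub>R b h" using h by (simp add: b_def)
      show ?thesis
      proof (cases "r > s")
        case True
        then have hr: "h = r - s" by (simp add: h_def)
        interpret Tr: bounded_linear "T (\<tau> - r)" by (rule bounded_linear) (use r in simp)
        have "\<phi> s = T (\<tau> - r) (T h (\<eta> s))"
          unfolding \<phi>_def using semigroup[of "\<tau> - r" h "\<eta> s"] r h by (simp add: hr)
        then have "\<phi> r - \<phi> s = T (\<tau> - r) ((\<eta> r - \<eta> s) - (T h (\<eta> s) - \<eta> s))" by (simp add: \<phi>_def Tr.diff)
        also have "(\<eta> r - \<eta> s) - (T h (\<eta> s) - \<eta> s) = h *\<^sub>R ((q r - w s) - (b h - w s))"
          unfolding qe be hr[symmetric] by (simp add: algebra_simps)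
        also have "norm (T (\<tau> - r) (h *\<^sub>R ((q r - w s) - (b h - w s)))) \<le> M * (h * (norm (q r - w s) + norm (b h - w s)))"
        proof (rule order_trans[OF M(2)])
          show "M * norm (h *\<^sub>R ((q r - w s) - (b h - w s))) \<le> M * (h * (norm (q r - w s) + norm (b h - w s)))"
            using M0 h norm_triangle_ineq4[of "q r - w s" "b h - w s"] by (intro mult_left_mono) auto
        qed (use r in auto)
        also have "\<dots> \<le> M * (h * (M * norm (q r - w s) + norm (b h - w s) + norm (T h (w s) - w s)))"
          using M(1) h mult_right_mono[OF M(1) norm_ge_zero[of "q r - w s"]]
          by (intro mult_left_mono) (auto intro: order_trans[OF _ le_add_same_cancel1[THEN iffD2, OF norm_ge_zero]])
        also have "\<dots> = \<bar>r - s\<bar> * B r" by (simp add: B_def h_def)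
        finally show ?thesis .
      next
        case False
        then have hr: "h = s - r" using r by (simp add: h_def)
        interpret Ts: bounded_linear "T (\<tau> - s)" by (rule bounded_linear) (use s in simp)
        have "\<phi> r = T (\<tau> - s) (T h (\<eta> r))"
          unfolding \<phi>_def using semigroup[of "\<tau> - s" h "\<eta> r"] s h by (simp add: hr)
        then have "\<phi> r - \<phi> s = T (\<tau> - s) (T h (\<eta> r) - \<eta> s)" by (simp add: \<phi>_def Ts.diff)
        also have "T h (\<eta> r) - \<eta> s = h *\<^sub>R ((b h - w s) - (T h (w s) - w s) - T h (q r - w s))"
        proof -
          \<comment> \<open>The generator limit is available at the fixed point
            \<open>\<eta> s\<close>, not at the moving \<open>\<eta> r\<close>; hence
            \<open>\<eta> r\<close> is first expanded around \<open>\<eta> s\<close>.\<close>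
          have "T h (\<eta> r) = T h (\<eta> s) - h *\<^sub>R T h (q r)"
          proof -
            have "\<eta> r = \<eta> s - h *\<^sub>R q r" using qe by (simp add: hr algebra_simps)
            then show ?thesis by (simp add: Th.diff Th.scaleR)
          qed
          then have "T h (\<eta> r) - \<eta> s = (T h (\<eta> s) - \<eta> s) - h *\<^sub>R T h (q r)" by simp
          then show ?thesis unfolding be by (simp add: Th.diff algebra_simps)
        qed
        also have "norm (T (\<tau> - s) (h *\<^sub>R ((b h - w s) - (T h (w s) - w s) - T h (q r - w s))))
            \<le> M * (h * (M * norm (q r - w s) + norm (b h - w s) + norm (T h (w s) - w s)))"
        proof (rule order_trans[OF M(2)])
          have "norm ((b h - w s) - (T h (w s) - w s) - T h (q r - w s))
              \<le> norm (b h - w s) + norm (T h (w s) - w s) + norm (T h (q r - w s))"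
            by (intro order_trans[OF norm_triangle_ineq4] add_right_mono norm_triangle_ineq4)
          also have "norm (T h (q r - w s)) \<le> M * norm (q r - w s)" using h by (intro M(2)) auto
          finally have f: "norm ((b h - w s) - (T h (w s) - w s) - T h (q r - w s))
              \<le> norm (b h - w s) + norm (T h (w s) - w s) + M * norm (q r - w s)" by simp
          show "M * norm (h *\<^sub>R ((b h - w s) - (T h (w s) - w s) - T h (q r - w s)))
              \<le> M * (h * (M * norm (q r - w s) + norm (b h - w s) + norm (T h (w s) - w s)))"
            unfolding norm_scaleR abs_of_pos[OF h(1)]
            by (intro mult_left_mono order_trans[OF f]) (use M0 h(1) in simp_all)
        qed (use s in auto)
        also have "\<dots> = \<bar>r - s\<bar> * B r" by (simp add: B_def h_def)
        finally show ?thesis .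
      qed
    qed
    have "((\<lambda>r. (1 / norm (r - s)) *\<^sub>R (\<phi> r - (\<phi> s + (r - s) *\<^sub>R 0))) \<longlongrightarrow> 0) (at s within {0..\<tau>})"
    proof (rule Lim_null_comparison[OF _ B_lim])
      show "\<forall>\<^sub>F r in at s within {0..\<tau>}. norm ((1 / norm (r - s)) *\<^sub>R (\<phi> r - (\<phi> s + (r - s) *\<^sub>R 0))) \<le> B r"
        unfolding eventually_at_filter
      proof (intro always_eventually allI impI)
        fix r assume r: "r \<noteq> s" "r \<in> {0..\<tau>}"
        have "norm (\<phi> r - \<phi> s) / \<bar>r - s\<bar> \<le> B r"
          using le[OF r(2,1)] r(1) by (subst pos_divide_le_eq) (auto simp: mult.commute)
        then show "norm ((1 / norm (r - s)) *\<^sub>R (\<phi> r - (\<phi> s + (r - s) *\<^sub>R 0))) \<le> B r" by simp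
      qed
    qed
    then show ?thesis by (simp add: has_vector_derivative_def has_derivative_within)
  qed
  then obtain k where k: "\<And>s. s \<in> {0..\<tau>} \<Longrightarrow> \<phi> s = k"
    using has_vector_derivative_zero_constant[of "{0..\<tau>}" \<phi>] by auto
  have "\<phi> 0 = \<phi> \<tau>" using k \<tau> by simp
  then show ?thesis using fixed(1)[OF \<tau>] by (simp add: \<phi>_def)
qed

end

section \<open>Functions with a square integrable weak derivative\<close>

lemma continuous_on_imp_L2:
  fixes f :: "real \<Rightarrow> complex^'m::finite"
  assumes "continuous_on {a..b} f"
  shows "f \<in> L2 {a..b}"
proof -
  have "integrable (lebesgue_on {a..b}) (\<lambda>t. (norm (f t))\<^sup>2)"
    by (intro integrable_continuous_real continuous_intros assms
      absolutely_integrable_imp_integrable absolutely_integrable_continuous_real) auto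
  moreover have "f \<in> borel_measurable (lebesgue_on {a..b})"
    by (intro continuous_imp_measurable_on_sets_lebesgue assms) auto
  ultimately show ?thesis by (simp add: L2_def)
qed

lemma L2_interval_integrable:
  assumes "f \<in> L2 {a..b}" shows "integrable (lebesgue_on {a..b}) f"
proof (rule Bochner_Integration.integrable_bound)
  show "integrable (lebesgue_on {a..b}) (\<lambda>t. 1 + (norm (f t))\<^sup>2)"
  proof (intro Bochner_Integration.integrable_add L2_integrable[OF assms])
    show "integrable (lebesgue_on {a..b}) (\<lambda>t. 1::real)"
      by (intro absolutely_integrable_imp_integrable absolutely_integrable_continuous_real) auto
  qed
  have "norm x \<le> 1 + (norm x)\<^sup>2" for x :: "complex^'a"
    using sum_squares_bound[of 1 "norm x"] norm_ge_zero[of x] by (simp, linarith)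
  then show "AE t in lebesgue_on {a..b}. norm (f t) \<le> norm (1 + (norm (f t))\<^sup>2)"
    by simp
qed (rule L2_measurable[OF assms])

lemma L2_interval_integrable_on: "f \<in> L2 {a..b} \<Longrightarrow> f integrable_on {a..b}"
  by (rule integrable_on_lebesgue_on[OF L2_interval_integrable]) auto

lemma lebesgue_on_integral_eq:
  fixes f :: "real \<Rightarrow> 'b::euclidean_space"
  assumes "integrable (lebesgue_on {a..b}) f"
  shows "integral\<^sup>L (lebesgue_on {a..b}) f = integral {a..b} f"
  using has_integral_integral_lebesgue_on[OF assms] by (simp add: integral_unique)

text \<open>This is what makes boundary values of a class meaningful: continuous representatives
  agree at the end points as well, provided the interval is nondegenerate.\<close>

lemma continuous_AE_eq_imp_eq:
  fixes f g :: "real \<Rightarrow> 'b::euclidean_space"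
  assumes "a < b" "continuous_on {a..b} f" "continuous_on {a..b} g"
    and AE: "AE t in lebesgue_on {a..b}. f t = g t" and t: "t \<in> {a..b}"
  shows "f t = g t"
proof -
  let ?h = "\<lambda>t. norm (f t - g t)"
  have cont: "continuous_on {a..b} ?h" by (intro continuous_intros assms)
  have int: "integrable (lebesgue_on {a..b}) ?h"
    by (intro absolutely_integrable_imp_integrable absolutely_integrable_continuous_real cont) auto
  have "integral\<^sup>L (lebesgue_on {a..b}) ?h = integral\<^sup>L (lebesgue_on {a..b}) (\<lambda>_. 0)"
    by (rule integral_cong_AE) (use AE int in \<open>auto elim: eventually_mono\<close>)
  then have "(?h has_integral 0) {a..b}"
    using has_integral_integral_lebesgue_on[OF int] by simp
  then have "?h t = 0"
    using has_integral_0_cbox_imp_0[of a b ?h t] cont assms(1) t by (simp add: box_real)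
  then show ?thesis by simp
qed

text \<open>Lebesgue differentiation: off a negligible set the averages of \<open>f\<close> over
  short intervals to the right converge to \<open>f\<close>, and all of them vanish.\<close>

lemma integral_zero_imp_AE_zero:
  fixes f :: "real \<Rightarrow> complex^'m::finite"
  assumes f: "f integrable_on {a..b}" and zero: "\<And>t. t \<in> {a..b} \<Longrightarrow> integral {a..t} f = 0"
  shows "AE t in lebesgue_on {a..b}. f t = 0"
proof -
  let ?g = "\<lambda>t. if t \<in> {a..b} then f t else 0"
  have "?g integrable_on UNIV" by (rule iffD2[OF integrable_restrict_UNIV f])
  then have "?g integrable_on cbox c d" for c d
    by (rule integrable_on_subcbox) simp
  then obtain N where N: "negligible N"
    "\<And>x e. \<lbrakk>x \<notin> N; 0 < e\<rbrakk> \<Longrightarrow> \<exists>d>0. \<forall>h. 0 < h \<and> h < d \<longrightarrow>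
        norm (integral (cbox x (x + h *\<^sub>R One)) ?g /\<^sub>R h ^ DIM(real) - ?g x) < e"
    by (rule integrable_ccontinuous_explicit) blast
  have "f x = 0" if x: "x \<in> {a<..<b}" "x \<notin> N" for x
  proof (rule ccontr)
    assume "f x \<noteq> 0"
    then obtain d where d: "d > 0" "\<And>h. 0 < h \<Longrightarrow> h < d \<Longrightarrow>
        norm (integral (cbox x (x + h *\<^sub>R One)) ?g /\<^sub>R h ^ DIM(real) - ?g x) < norm (f x)"
      using N(2)[OF x(2), of "norm (f x)"] by auto
    \<comment> \<open>Short enough for the differentiation estimate and not reaching beyond
      \<open>b\<close>, where the hypothesis gives no information.\<close>
    define h where "h = min (d / 2) (b - x)"
    have h: "0 < h" "h < d" "x + h \<le> b" using x d by (auto simp: h_def)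
    have "integral {a..x} f + integral {x..x + h} f = integral {a..x + h} f"
      by (rule Henstock_Kurzweil_Integration.integral_combine) (use x h in \<open>auto intro: integrable_on_subinterval[OF f]\<close>)
    then have "integral {x..x + h} f = 0" using zero x h by simp
    moreover have "integral {x..x + h} ?g = integral {x..x + h} f"
      by (rule integral_cong) (use x h in auto)
    ultimately show False using d(2)[OF h(1,2)] x by simp
  qed
  then have "{t. \<not> (t \<in> {a..b} \<longrightarrow> f t = 0)} \<subseteq> N \<union> {a, b}" by force
  moreover have "negligible (N \<union> {a, b})" using N(1) by simp
  ultimately have "AE t in lebesgue. t \<in> {a..b} \<longrightarrow> f t = 0"
    unfolding eventually_ae_filter_negligible by blast
  then show ?thesis by (simp add: AE_cut_iff)
qed

section \<open>Weak derivatives and integration by parts\<close>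

lemma weak_deriv_L2: "weak_deriv a b z w \<Longrightarrow> w \<in> L2 {a..b}"
  by (simp add: weak_deriv_def)

lemma weak_deriv_integral:
  assumes "weak_deriv a b z w" "t \<in> {a..b}"
  shows "z t = z a + integral {a..t} w"
proof -
  have "(w has_integral (z t - z a)) {a..t}" using assms by (auto simp: weak_deriv_def)
  from integral_unique[OF this] show ?thesis by simp
qed

lemma weak_derivI:
  assumes w: "w \<in> L2 {a..b}" and z: "\<And>t. t \<in> {a..b} \<Longrightarrow> z t = z a + integral {a..t} w"
  shows "weak_deriv a b z w"
  unfolding weak_deriv_def
proof (intro conjI ballI w)
  fix t assume t: "t \<in> {a..b}"
  have "w integrable_on {a..t}"
    using integrable_on_subinterval[OF L2_interval_integrable_on[OF w], of a t] t by auto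
  then show "(w has_integral (z t - z a)) {a..t}"
    using z[OF t] by (simp add: has_integral_iff)
qed

lemma weak_deriv_continuous:
  assumes "weak_deriv a b z w" shows "continuous_on {a..b} z"
proof -
  have "continuous_on {a..b} (\<lambda>t. z a + integral {a..t} w)"
    by (intro continuous_intros indefinite_integral_continuous_1 L2_interval_integrable_on
        weak_deriv_L2[OF assms])
  then show ?thesis
    by (rule continuous_on_eq) (rule weak_deriv_integral[OF assms, symmetric])
qed

lemma weak_deriv_increment:
  assumes "weak_deriv a b z w" "a \<le> s" "s \<le> t" "t \<le> b"
  shows "(w has_integral (z t - z s)) {s..t}"
proof -
  have w: "w integrable_on {a..b}" by (rule L2_interval_integrable_on[OF weak_deriv_L2[OF assms(1)]])
  have "integral {a..s} w + integral {s..t} w = integral {a..t} w"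
    by (rule Henstock_Kurzweil_Integration.integral_combine) (use assms in \<open>auto intro: integrable_on_subinterval[OF w]\<close>)
  then have "integral {s..t} w = z t - z s"
    using weak_deriv_integral[OF assms(1), of s] weak_deriv_integral[OF assms(1), of t] assms
    by (simp add: algebra_simps)
  moreover have "w integrable_on {s..t}"
    using assms by (auto intro: integrable_on_subinterval[OF w])
  ultimately show ?thesis by (simp add: has_integral_iff)
qed

lemma weak_deriv_unique:
  assumes "weak_deriv a b z w" "weak_deriv a b z' w'" "\<And>t. t \<in> {a..b} \<Longrightarrow> z t = z' t"
  shows "AE t in lebesgue_on {a..b}. w t = w' t"
proof -
  have w: "w integrable_on {a..b}" "w' integrable_on {a..b}"
    using assms by (auto intro: L2_interval_integrable_on weak_deriv_L2)
  have "AE t in lebesgue_on {a..b}. w t - w' t = 0"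
  proof (rule integral_zero_imp_AE_zero)
    fix t assume t: "t \<in> {a..b}"
    have "w integrable_on {a..t}" "w' integrable_on {a..t}"
      using w t by (auto intro: integrable_on_subinterval)
    then show "integral {a..t} (\<lambda>t. w t - w' t) = 0"
      using weak_deriv_integral[OF assms(1) t] weak_deriv_integral[OF assms(2) t] assms(3)[OF t]
        assms(3)[of a] t by (simp add: integral_diff)
  qed (intro integrable_diff w)
  then show ?thesis by (auto elim: eventually_mono)
qed

text \<open>Comparing increments with those of \<open>I\<close> on a fine equidistant partition.\<close>

lemma increment_bound_global:
  fixes D I :: "real \<Rightarrow> real"
  assumes ab: "a \<le> b" and d: "d > 0"
    and loc: "\<And>s t. a \<le> s \<Longrightarrow> s \<le> t \<Longrightarrow> t \<le> b \<Longrightarrow> t - s < d \<Longrightarrow> \<bar>D t - D s\<bar> \<le> I t - I s"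
  shows "\<bar>D b - D a\<bar> \<le> I b - I a"
proof -
  obtain n :: nat where n: "(b - a) / d < n" using reals_Archimedean2 by blast
  have n0: "n > 0" using n ab d by (cases n) (auto simp: field_simps)
  define p where "p k = a + real k * ((b - a) / n)" for k
  have step: "p (Suc k) - p k = (b - a) / n" for k by (simp add: p_def distrib_right add_divide_distrib)
  have small: "(b - a) / n < d" using n n0 d by (simp add: field_simps)
  have p_le: "p k \<le> b" if "k \<le> n" for k
  proof -
    have "real k * ((b - a) / n) \<le> real n * ((b - a) / n)"
      using that ab by (intro mult_right_mono) auto
    then show ?thesis using n0 by (simp add: p_def)
  qed
  have p_ge: "a \<le> p k" for k using ab by (simp add: p_def)
  have "\<bar>D (p k) - D a\<bar> \<le> I (p k) - I a" if "k \<le> n" for k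
    using that
  proof (induction k)
    case (Suc k)
    have "\<bar>D (p (Suc k)) - D (p k)\<bar> \<le> I (p (Suc k)) - I (p k)"
    proof (rule loc)
      have "0 \<le> (b - a) / n" using ab by simp
      then show "p k \<le> p (Suc k)" "p (Suc k) - p k < d" using step[of k] small by linarith+
    qed (use p_ge p_le[OF Suc.prems] in auto)
    then show ?case using Suc by simp
  qed (simp add: p_def)
  from this[of n] show ?thesis using n0 by (simp add: p_def)
qed

text \<open>A product rule obtained from increments alone, with no pointwise derivative of
  \<open>z\<close>. Over a short interval the increment of the form is exactly the integral of
  \<open>w\<close> against \<open>A (z t + z s)\<close>, and uniform continuity compares this with
  \<open>2 * A (z x)\<close>.\<close>

lemma weak_deriv_quadratic_form:
  fixes z w :: "real \<Rightarrow> complex^'m::finite"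
  assumes zw: "weak_deriv a b z w" and ab: "a \<le> b"
    and A: "bounded_linear A" and symA: "\<And>u v. A u \<bullet> v = u \<bullet> A v"
  shows "2 * integral\<^sup>L (lebesgue_on {a..b}) (\<lambda>t. A (w t) \<bullet> z t) = A (z b) \<bullet> z b - A (z a) \<bullet> z a"
proof -
  interpret A: bounded_linear A by (rule A)
  obtain K where K: "K > 0" "\<And>x. norm (A x) \<le> norm x * K" using A.pos_bounded by blast
  have zc: "continuous_on {a..b} z" by (rule weak_deriv_continuous[OF zw])
  have wL2: "w \<in> L2 {a..b}" by (rule weak_deriv_L2[OF zw])
  have AzL2: "(\<lambda>t. A (z t)) \<in> L2 {a..b}" by (intro continuous_on_imp_L2 A.continuous_on zc)
  let ?f = "\<lambda>t. w t \<bullet> A (z t)"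
  have fi: "integrable (lebesgue_on {a..b}) ?f" by (rule L2_inner_integrable[OF wL2 AzL2])
  have f_on: "?f integrable_on {a..b}" by (rule integrable_on_lebesgue_on[OF fi]) auto
  have wn_on: "(\<lambda>t. norm (w t)) integrable_on {a..b}"
    using integrable_on_lebesgue_on[OF integrable_norm[OF L2_interval_integrable[OF wL2]]] by simp
  have sub: "f integrable_on {s..t}" if "f integrable_on {a..b}" "a \<le> s" "t \<le> b"
    for f :: "real \<Rightarrow> real" and s t
    using that by (auto intro: integrable_on_subinterval)
  have comb: "integral {a..t} f - integral {a..s} f = integral {s..t} f"
    if "f integrable_on {a..b}" "a \<le> s" "s \<le> t" "t \<le> b" for f :: "real \<Rightarrow> real" and s t
    using Henstock_Kurzweil_Integration.integral_combine[of a s t f] that sub[OF that(1), of a t] by simp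
  define F where "F t = A (z t) \<bullet> z t" for t
  define D where "D t = F t - 2 * integral {a..t} ?f" for t
  have "\<bar>D b - D a\<bar> \<le> e" if e: "e > 0" for e
  proof -
    \<comment> \<open>Chosen so that the accumulated error is exactly \<open>e\<close>; the summand
      1 keeps it positive when \<open>w\<close> vanishes almost everywhere.\<close>
    define C where "C = 2 * K * (integral {a..b} (\<lambda>t. norm (w t)) + 1)"
    have I0: "integral {a..b} (\<lambda>t. norm (w t)) \<ge> 0" by (rule integral_nonneg[OF wn_on]) simp
    have C: "C > 0" using K(1) I0 by (simp add: C_def)
    have "uniformly_continuous_on {a..b} z" by (rule compact_uniformly_continuous[OF zc]) simp
    then obtain d where d: "d > 0"
      "\<And>s t. s \<in> {a..b} \<Longrightarrow> t \<in> {a..b} \<Longrightarrow> dist t s < d \<Longrightarrow> dist (z t) (z s) < e / C"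
      using e C unfolding uniformly_continuous_on_def by (metis divide_pos_pos)
    define r where "r = 2 * K * (e / C)"
    have r: "r \<ge> 0" using K(1) e C by (simp add: r_def)
    have "\<bar>D b - D a\<bar> \<le> r * integral {a..b} (\<lambda>t. norm (w t)) - r * integral {a..a} (\<lambda>t. norm (w t))"
    proof (rule increment_bound_global[OF ab d(1)])
      fix s t assume st: "a \<le> s" "s \<le> t" "t \<le> b" "t - s < d"
      have "(w has_integral (z t - z s)) {s..t}" by (rule weak_deriv_increment[OF zw st(1-3)])
      then have "((\<lambda>x. w x \<bullet> A (z t + z s)) has_integral ((z t - z s) \<bullet> A (z t + z s))) {s..t}"
        using has_integral_linear[OF _ bounded_linear_inner_left] by (force simp: o_def)
      \<comment> \<open>Symmetry of \<open>A\<close> removes the mixed terms, as in the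
        factorization of a difference of squares.\<close>
      moreover have "(z t - z s) \<bullet> A (z t + z s) = F t - F s"
        using symA[of "z s" "z t"]
        by (simp add: F_def A.add A.diff inner_diff_left inner_diff_right inner_add_right inner_commute)
      ultimately have F: "((\<lambda>x. w x \<bullet> A (z t + z s)) has_integral (F t - F s)) {s..t}" by simp
      have "(?f has_integral integral {s..t} ?f) {s..t}"
        using sub[OF f_on st(1,3)] by (rule integrable_integral)
      from has_integral_diff[OF F has_integral_mult_right[OF this, of 2]]
      have G: "((\<lambda>x. w x \<bullet> A (z t + z s) - 2 * (w x \<bullet> A (z x))) has_integral (D t - D s)) {s..t}"
        using comb[OF f_on st(1-3)] by (simp add: D_def algebra_simps)
      have "norm (D t - D s) \<le> integral {s..t} (\<lambda>x. r * norm (w x))"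
        unfolding integral_unique[OF G, symmetric]
      proof (rule integral_norm_bound_integral)
        show "(\<lambda>x. r * norm (w x)) integrable_on {s..t}"
          using sub[OF wn_on st(1,3)] by (intro integrable_on_mult_right)
        fix x assume x: "x \<in> {s..t}"
        have 1: "norm (z t - z x) \<le> e / C" "norm (z s - z x) \<le> e / C"
          using d(2)[of x t] d(2)[of x s] x st by (auto simp: dist_norm)
        have "w x \<bullet> A (z t + z s) - 2 * (w x \<bullet> A (z x)) = w x \<bullet> A ((z t - z x) + (z s - z x))"
          by (simp only: A.add A.diff inner_add_right inner_diff_right)
        also have "norm \<dots> \<le> norm (w x) * (norm ((z t - z x) + (z s - z x)) * K)"
          using Cauchy_Schwarz_ineq2[of "w x"] K(2)
          by (simp, meson mult_left_mono norm_ge_zero order_trans)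
        also have "\<dots> \<le> norm (w x) * ((e / C + e / C) * K)"
          using K(1) 1 by (intro mult_left_mono mult_right_mono order_trans[OF norm_triangle_ineq] add_mono) auto
        finally show "norm (w x \<bullet> A (z t + z s) - 2 * (w x \<bullet> A (z x))) \<le> r * norm (w x)"
          by (simp add: r_def ac_simps)
      qed (rule has_integral_integrable[OF G])
      also have "\<dots> = r * integral {a..t} (\<lambda>t. norm (w t)) - r * integral {a..s} (\<lambda>t. norm (w t))"
        using comb[OF wn_on st(1-3)] by (simp flip: right_diff_distrib)
      finally show "\<bar>D t - D s\<bar> \<le> r * integral {a..t} (\<lambda>t. norm (w t)) - r * integral {a..s} (\<lambda>t. norm (w t))"
        by simp
    qed
    also have "\<dots> = r * integral {a..b} (\<lambda>t. norm (w t))" by simp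
    also have "\<dots> \<le> r * (integral {a..b} (\<lambda>t. norm (w t)) + 1)" using r by (intro mult_left_mono) auto
    also have "\<dots> = e" using C K(1) I0 by (simp add: r_def C_def)
    finally show ?thesis .
  qed
  then have "\<bar>D b - D a\<bar> \<le> 0" by (meson field_le_epsilon add_0 order_refl dense_ge)
  then have "2 * integral {a..b} ?f = F b - F a" by (simp add: D_def)
  then show ?thesis using lebesgue_on_integral_eq[OF fi] by (simp add: F_def symA)
qed

section \<open>Complex matrices and the port variables\<close>

lemma Re_cinner: "Re (cinner v w) = v \<bullet> w"
  by (simp add: cinner_def inner_vec_def inner_complex_def)

lemma cinner_adjoint: "cinner (A *v u) v = cinner u (adjoint_mat A *v v)"
proof -
  have "cinner (A *v u) v = (\<Sum>i\<in>UNIV. \<Sum>j\<in>UNIV. A $ i $ j * u $ j * cnj (v $ i))"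
    by (simp add: cinner_def matrix_vector_mult_def sum_distrib_right)
  also have "\<dots> = (\<Sum>j\<in>UNIV. \<Sum>i\<in>UNIV. A $ i $ j * u $ j * cnj (v $ i))" by (rule sum.swap)
  also have "\<dots> = cinner u (adjoint_mat A *v v)"
    by (simp add: cinner_def matrix_vector_mult_def adjoint_mat_def sum_distrib_left ac_simps)
  finally show ?thesis .
qed

lemma adjoint_mat_inner: "(A *v u) \<bullet> v = u \<bullet> (adjoint_mat A *v v)"
  using arg_cong[OF cinner_adjoint[of A u v], of Re] by (simp add: Re_cinner)

lemma matrix_vector_mult_uminus: "(- A) *v v = - (A *v v :: complex^'k::finite)"
  by (simp add: matrix_vector_mult_def vec_eq_iff sum_negf)

lemma skew_adjoint_inner_self:
  assumes "adjoint_mat A = - A" shows "(A *v v) \<bullet> v = 0"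
  using adjoint_mat_inner[of A v v] assms by (simp add: matrix_vector_mult_uminus inner_commute)

lemma norm_smult_complex: "norm (c *s (v :: complex^'k::finite)) = norm c * norm v"
  by (simp add: norm_vec_def norm_mult L2_set_right_distrib)

lemma matrix_vector_mult_smult: "A *v (c *s v) = c *s (A *v v :: complex^'k::finite)"
  by (simp add: matrix_vector_mult_def vec_eq_iff sum_distrib_left mult.left_commute)

lemma linear_smult: "linear (\<lambda>v :: complex^'k::finite. c *s v)"
  by (rule linearI) (simp_all add: vec_eq_iff algebra_simps)

lemma linear_matrix_vector: "linear (\<lambda>v. A *v v :: complex^'k::finite)"
  by (rule linearI) (simp_all add: matrix_vector_right_distrib matrix_vector_mult_scaleR)

lemma bounded_linear_matrix_vector: "bounded_linear (\<lambda>v. A *v v :: complex^'k::finite)"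
  using linear_matrix_vector linear_conv_bounded_linear by blast

lemma bounded_linear_smult: "bounded_linear (\<lambda>v :: complex^'k::finite. c *s v)"
  using linear_smult linear_conv_bounded_linear by blast

lemma L2_linear:
  fixes T :: "complex^'m::finite \<Rightarrow> complex^'k::finite"
  assumes "f \<in> L2 A" "bounded_linear T"
  shows "(\<lambda>t. T (f t)) \<in> L2 A"
proof -
  obtain K where "\<And>x. norm (T x) \<le> norm x * K" using bounded_linear.bounded[OF assms(2)] by blast
  then show ?thesis
    by (intro L2_bounded_op[OF assms(1), of "\<lambda>_. T" K] borel_measurable_continuous_onI[THEN measurable_compose[OF L2_measurable[OF assms(1)]]]
        linear_continuous_on assms(2)) (simp add: mult.commute)
qed

section \<open>Block vectors and port variables\<close>

lemma sum_UNIV_sum_type: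
  "(\<Sum>s\<in>(UNIV :: ('a::finite + 'b::finite) set). f s) = (\<Sum>i\<in>UNIV. f (Inl i)) + (\<Sum>i\<in>UNIV. f (Inr i))"
  by (subst UNIV_Plus_UNIV[symmetric], subst sum.Plus) auto

lemma block_mat_stack_vec:
  "block_mat A B C D *v stack_vec v w = stack_vec (A *v v + B *v w) (C *v v + D *v w)"
  by (simp add: vec_eq_iff block_mat_def stack_vec_def matrix_vector_mult_def sum_UNIV_sum_type split: sum.split)

lemma stack_vec_inner: "stack_vec v w \<bullet> stack_vec v' w' = v \<bullet> v' + w \<bullet> w'"
  by (simp add: inner_vec_def stack_vec_def sum_UNIV_sum_type)

lemma stack_vec_smult_add:
  "stack_vec (c *s v + v') (c *s w + w') = c *s stack_vec v w + stack_vec v' w'"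
  by (simp add: vec_eq_iff stack_vec_def split: sum.split)

lemma stack_vec_surj: "\<exists>v w. \<tau> = stack_vec v w"
  by (rule exI[of _ "\<chi> i. \<tau> $ Inl i"], rule exI[of _ "\<chi> i. \<tau> $ Inr i"])
    (simp add: vec_eq_iff stack_vec_def split: sum.split)

lemma scaleR_matrix_vector: "(r *\<^sub>R A) *v v = r *\<^sub>R (A *v v :: complex^'k::finite)"
  by (simp add: matrix_vector_mult_def vec_eq_iff scaleR_sum_right)

lemma R0_stack_vec: "R0 P *v stack_vec v w = (1 / sqrt 2) *\<^sub>R stack_vec (P *v (v - w)) (v + w)"
  by (simp add: R0_def scaleR_matrix_vector block_mat_stack_vec matrix_vector_mult_uminus
      matrix_vector_mult_diff_distrib)

lemma matrix_inv_left: "invertible (A :: complex^'k::finite^'k) \<Longrightarrow> matrix_inv A ** A = mat 1"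
  unfolding invertible_def matrix_inv_def by (rule someI2_ex) auto

lemma invertible_kernel:
  fixes A :: "complex^'k::finite^'k"
  assumes "invertible A" "A *v v = 0" shows "v = 0"
proof -
  have "matrix_inv A *v (A *v v) = v"
    using assms(1) by (simp add: matrix_vector_mul_assoc matrix_inv_left)
  then show ?thesis using assms(2) by (simp add: matrix_vector_mult_0_right)
qed

lemma stack_vec_eq_0_iff: "stack_vec v w = 0 \<longleftrightarrow> v = 0 \<and> w = 0"
proof
  assume "stack_vec v w = 0"
  then have "v \<bullet> v + w \<bullet> w = 0" using stack_vec_inner[of v w v w] by simp
  then show "v = 0 \<and> w = 0"
    by (metis add_nonneg_eq_0_iff inner_eq_zero_iff inner_ge_zero)
qed (auto simp: vec_eq_iff stack_vec_def split: sum.split)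

lemma invertible_R0:
  assumes "invertible P" shows "invertible (R0 P)"
  unfolding invertible_left_inverse matrix_left_invertible_ker
proof (intro allI impI)
  fix \<tau> assume 0: "R0 P *v \<tau> = 0"
  obtain v w where \<tau>: "\<tau> = stack_vec v w" using stack_vec_surj by blast
  have "P *v (v - w) = 0" "v + w = 0"
    using 0 unfolding \<tau> R0_stack_vec by (simp_all add: stack_vec_eq_0_iff)
  then have "v - w = 0" "v + w = 0" using invertible_kernel[OF assms] by blast+
  then have "v + v = 0" "w = v" by simp_all
  then have "2 *\<^sub>R v = 0" "w = v" by (simp_all only: scaleR_2)
  then show "\<tau> = 0" unfolding \<tau> by (simp add: stack_vec_eq_0_iff)
qed

text \<open>Lets the matrices \<open>WB1\<close>, \<open>WB2\<close> and \<open>WC\<close>, which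
  act on port variables, be evaluated at \<open>R0\<close> of a trace as the original boundary
  matrices.\<close>

lemma R0_inv_cancel:
  assumes "invertible P" shows "(W ** matrix_inv (R0 P)) *v (R0 P *v \<tau>) = W *v \<tau>"
  using matrix_inv_left[OF invertible_R0[OF assms]]
  by (simp add: matrix_vector_mul_assoc matrix_mul_assoc[symmetric])

text \<open>The two off-diagonal blocks of \<open>Xi\<close> contribute equally, and their factor 2
  cancels the squared normalization of \<open>R0\<close>. Self-adjointness of \<open>P\<close> then
  removes the mixed terms of \<open>(v + w) \<bullet> (P *v (v - w))\<close>.\<close>

lemma Xi_R0_inner:
  assumes "adjoint_mat P = P"
  shows "(Xi *v (R0 P *v stack_vec v w)) \<bullet> (R0 P *v stack_vec v w) = (P *v v) \<bullet> v - (P *v w) \<bullet> w"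
proof -
  have P: "(P *v u) \<bullet> u' = u \<bullet> (P *v u')" for u u' using adjoint_mat_inner[of P u u'] assms by simp
  have "(Xi *v (R0 P *v stack_vec v w)) \<bullet> (R0 P *v stack_vec v w)
      = (v + w) \<bullet> (P *v (v - w))"
    by (simp add: R0_stack_vec Xi_def matrix_vector_mult_scaleR block_mat_stack_vec stack_vec_inner
        inner_commute[of "P *v (v - w)"] real_sqrt_mult_self mult.assoc[symmetric] matrix_vector_mult_0)
  also have "\<dots> = (P *v v) \<bullet> v - (P *v w) \<bullet> w"
    using P[of v w] P[of w v]
    by (simp add: matrix_vector_mult_diff_distrib inner_add_left inner_add_right inner_diff_left inner_diff_right inner_commute)
  finally show ?thesis .
qed

section \<open>Effort variables\<close>

lemma weak_deriv_combination:
  assumes "weak_deriv a b z w" "weak_deriv a b z' w'"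
  shows "weak_deriv a b (\<lambda>t. c *s z t + z' t) (\<lambda>t. c *s w t + w' t)"
  unfolding weak_deriv_def
proof (intro conjI ballI)
  show "(\<lambda>t. c *s w t + w' t) \<in> L2 {a..b}"
    by (intro L2_add L2_linear[OF _ bounded_linear_smult] weak_deriv_L2[OF assms(1)] weak_deriv_L2[OF assms(2)])
  fix t assume t: "t \<in> {a..b}"
  have "((\<lambda>t. c *s w t) has_integral c *s (z t - z a)) {a..t}"
    using has_integral_linear[OF _ bounded_linear_smult, of w "z t - z a" "{a..t}" c] assms(1) t
    by (auto simp: weak_deriv_def o_def)
  moreover have "(w' has_integral (z' t - z' a)) {a..t}" using assms(2) t by (simp add: weak_deriv_def)
  ultimately have "((\<lambda>t. c *s w t + w' t) has_integral (c *s (z t - z a) + (z' t - z' a))) {a..t}"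
    by (rule has_integral_add)
  moreover have "c *s (z t - z a) + (z' t - z' a) = c *s z t + z' t - (c *s z a + z' a)"
    by (simp add: vec_eq_iff algebra_simps)
  ultimately show "((\<lambda>t. c *s w t + w' t) has_integral (c *s z t + z' t - (c *s z a + z' a))) {a..t}"
    by (simp only:)
qed

lemma X_eq_refl [simp]: "X_eq S f f" by (simp add: X_eq_def)

lemma X_eq_sym: "X_eq S f g \<Longrightarrow> X_eq S g f"
  by (auto simp: X_eq_def elim: eventually_mono)

lemma X_eq_trans: "X_eq S f g \<Longrightarrow> X_eq S g h \<Longrightarrow> X_eq S f h"
  unfolding X_eq_def by (auto elim: eventually_elim2)

definition has_effort :: "('n::finite, 'p::finite) phs \<Rightarrow> (real \<Rightarrow> complex^'n) \<Rightarrow> bool" where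
  "has_effort S x \<longleftrightarrow> (\<exists>z. is_effort S x z)"

text \<open>The predicate depends on the class of the state only. As \<open>effort\<close> is a
  choice from this predicate, equivalent states get literally the same effort, so the congruence
  rules that follow are equalities of functions and vectors.\<close>

lemma is_effort_cong:
  assumes "X_eq S x y" shows "is_effort S x = is_effort S y"
proof -
  have "X_eq S z (\<lambda>\<zeta>. Ham S \<zeta> *v x \<zeta>) \<longleftrightarrow> X_eq S z (\<lambda>\<zeta>. Ham S \<zeta> *v y \<zeta>)" for z
  proof -
    have *: "X_eq S (\<lambda>\<zeta>. Ham S \<zeta> *v x \<zeta>) (\<lambda>\<zeta>. Ham S \<zeta> *v y \<zeta>)"
      using assms by (auto simp: X_eq_def elim: eventually_mono)
    then show ?thesis using X_eq_trans X_eq_sym by blast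
  qed
  then show ?thesis by (auto simp: is_effort_def)
qed

lemma effort_cong: "X_eq S x y \<Longrightarrow> effort S x = effort S y"
  unfolding effort_def by (simp add: is_effort_cong)

lemma trace_cong: "X_eq S x y \<Longrightarrow> trace S x = trace S y"
  unfolding trace_def by (simp add: effort_cong)

lemma opL_cong: "X_eq S x y \<Longrightarrow> opL S x = opL S y"
  unfolding opL_def effort_deriv_def by (simp add: effort_cong)

lemma DL_cong: "X_eq S x y \<Longrightarrow> y \<in> X S \<Longrightarrow> x \<in> DL S \<Longrightarrow> y \<in> DL S"
  unfolding DL_def using is_effort_cong trace_cong by fastforce

lemma DL_has_effort: "x \<in> DL S \<Longrightarrow> has_effort S x"
  by (simp add: DL_def has_effort_def)

lemma is_effort_effort: "has_effort S x \<Longrightarrow> is_effort S x (effort S x)"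
  unfolding has_effort_def effort_def by (rule someI_ex[of "is_effort S x"])

lemma weak_deriv_effort: "has_effort S x \<Longrightarrow> weak_deriv (lb S) (ub S) (effort S x) (effort_deriv S x)"
  unfolding effort_deriv_def
  by (rule someI_ex[of "weak_deriv (lb S) (ub S) (effort S x)"])
    (use is_effort_effort[of S x] in \<open>simp add: is_effort_def H1_def\<close>)

lemma effort_L2: "has_effort S x \<Longrightarrow> effort S x \<in> X S"
  unfolding X_def by (rule continuous_on_imp_L2[OF weak_deriv_continuous[OF weak_deriv_effort]])

lemma opL_X: "has_effort S x \<Longrightarrow> opL S x \<in> X S"
  unfolding opL_def X_def
  by (intro L2_add L2_linear[OF _ bounded_linear_matrix_vector] weak_deriv_L2[OF weak_deriv_effort]
      effort_L2[unfolded X_def])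

lemma is_effort_combination:
  assumes "is_effort S x z" "is_effort S y z'"
  shows "is_effort S (\<lambda>\<zeta>. c *s x \<zeta> + y \<zeta>) (\<lambda>\<zeta>. c *s z \<zeta> + z' \<zeta>)"
  unfolding is_effort_def
proof
  show "(\<lambda>\<zeta>. c *s z \<zeta> + z' \<zeta>) \<in> H1 (lb S) (ub S)"
  proof -
    obtain w w' where "weak_deriv (lb S) (ub S) z w" "weak_deriv (lb S) (ub S) z' w'"
      using assms by (auto simp: is_effort_def H1_def)
    from weak_deriv_combination[OF this] show ?thesis unfolding H1_def by blast
  qed
  have "X_eq S z (\<lambda>\<zeta>. Ham S \<zeta> *v x \<zeta>)" "X_eq S z' (\<lambda>\<zeta>. Ham S \<zeta> *v y \<zeta>)"
    using assms by (auto simp: is_effort_def)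
  then show "X_eq S (\<lambda>\<zeta>. c *s z \<zeta> + z' \<zeta>) (\<lambda>\<zeta>. Ham S \<zeta> *v (c *s x \<zeta> + y \<zeta>))"
    unfolding X_eq_def by eventually_elim (simp add: matrix_vector_right_distrib matrix_vector_mult_smult)
qed

text \<open>Any explicit continuous representative may be substituted for the chosen one at every
  point of the closed interval, in particular in the trace.\<close>

lemma effort_unique:
  assumes "lb S < ub S" and "is_effort S x z" and \<zeta>: "\<zeta> \<in> {lb S..ub S}"
  shows "effort S x \<zeta> = z \<zeta>"
proof (rule continuous_AE_eq_imp_eq[OF assms(1) _ _ _ \<zeta>])
  have e: "is_effort S x (effort S x)"
    using assms(2) by (intro is_effort_effort) (auto simp: has_effort_def)
  show "continuous_on {lb S..ub S} (effort S x)" "continuous_on {lb S..ub S} z"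
    using e assms(2) by (auto simp: is_effort_def H1_def intro: weak_deriv_continuous)
  have "X_eq S (effort S x) z"
    using e assms(2) X_eq_sym X_eq_trans unfolding is_effort_def by blast
  then show "AE \<zeta> in lebesgue_on {lb S..ub S}. effort S x \<zeta> = z \<zeta>" by (simp add: X_eq_def)
qed

context
  fixes S :: "('n::finite, 'p::finite) phs" and x y :: "real \<Rightarrow> complex^'n" and c :: complex
  assumes ord: "lb S < ub S" and x: "has_effort S x" and y: "has_effort S y"
begin

lemma effort_combination:
  assumes "\<zeta> \<in> {lb S..ub S}"
  shows "effort S (\<lambda>\<zeta>. c *s x \<zeta> + y \<zeta>) \<zeta> = c *s effort S x \<zeta> + effort S y \<zeta>"
  by (rule effort_unique[OF ord is_effort_combination[OF is_effort_effort[OF x] is_effort_effort[OF y]] assms])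

lemma has_effort_combination: "has_effort S (\<lambda>\<zeta>. c *s x \<zeta> + y \<zeta>)"
  using is_effort_combination[OF is_effort_effort[OF x] is_effort_effort[OF y]]
  by (auto simp: has_effort_def)

lemma trace_combination: "trace S (\<lambda>\<zeta>. c *s x \<zeta> + y \<zeta>) = c *s trace S x + trace S y"
  using ord by (simp add: trace_def effort_combination stack_vec_smult_add)

lemma opL_combination:
  "X_eq S (opL S (\<lambda>\<zeta>. c *s x \<zeta> + y \<zeta>)) (\<lambda>\<zeta>. c *s opL S x \<zeta> + opL S y \<zeta>)"
proof -
  have "AE \<zeta> in lebesgue_on {lb S..ub S}.
      effort_deriv S (\<lambda>\<zeta>. c *s x \<zeta> + y \<zeta>) \<zeta> = c *s effort_deriv S x \<zeta> + effort_deriv S y \<zeta>"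
    by (rule weak_deriv_unique[OF weak_deriv_effort[OF has_effort_combination]
          weak_deriv_combination[OF weak_deriv_effort[OF x] weak_deriv_effort[OF y]]])
      (rule effort_combination)
  moreover have "AE \<zeta> in lebesgue_on {lb S..ub S}. \<zeta> \<in> {lb S..ub S}"
    using AE_space[of "lebesgue_on {lb S..ub S}"] by simp
  ultimately show ?thesis
    unfolding X_eq_def opL_def
  proof eventually_elim
    case (elim \<zeta>)
    show ?case
      unfolding effort_combination[OF elim(2)] elim(1) matrix_vector_right_distrib matrix_vector_mult_smult
      by (simp add: vec_eq_iff algebra_simps)
  qed
qed

end

lemma DL_combination:
  assumes "lb S < ub S" "x \<in> DL S" "y \<in> DL S"
  shows "(\<lambda>\<zeta>. c *s x \<zeta> + y \<zeta>) \<in> DL S"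
  using has_effort_combination[OF assms(1) assms(2,3)[THEN DL_has_effort], of c] assms
  by (auto simp: DL_def trace_combination[OF assms(1) assms(2,3)[THEN DL_has_effort]] has_effort_def X_def
      matrix_vector_right_distrib matrix_vector_mult_smult intro!: L2_add L2_linear[OF _ bounded_linear_smult])

text \<open>Integration by parts with \<open>P1 S\<close> as the symmetric operator. The pairing
  with the effort rather than with \<open>x\<close> itself is the unweighted form of the energy
  pairing.\<close>

lemma power_balance:
  assumes ord: "lb S < ub S" and P1: "adjoint_mat (P1 S) = P1 S" and x: "has_effort S x"
  shows "2 * (LINT \<zeta>|lebesgue_on {lb S..ub S}. opL S x \<zeta> \<bullet> effort S x \<zeta>)
    = (P1 S *v effort S x (ub S)) \<bullet> effort S x (ub S) - (P1 S *v effort S x (lb S)) \<bullet> effort S x (lb S)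
      + 2 * (LINT \<zeta>|lebesgue_on {lb S..ub S}. (P0 S *v effort S x \<zeta>) \<bullet> effort S x \<zeta>)"
proof -
  let ?z = "effort S x" and ?w = "effort_deriv S x" and ?M = "lebesgue_on {lb S..ub S}"
  note zw = weak_deriv_effort[OF x]
  have zL2: "?z \<in> L2 {lb S..ub S}" using effort_L2[OF x] by (simp add: X_def)
  have "2 * (LINT \<zeta>|?M. (P1 S *v ?w \<zeta>) \<bullet> ?z \<zeta>) = (P1 S *v ?z (ub S)) \<bullet> ?z (ub S) - (P1 S *v ?z (lb S)) \<bullet> ?z (lb S)"
    by (rule weak_deriv_quadratic_form[OF zw _ bounded_linear_matrix_vector])
      (use ord P1 adjoint_mat_inner[of "P1 S"] in auto)
  moreover have "(LINT \<zeta>|?M. opL S x \<zeta> \<bullet> ?z \<zeta>)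
    = (LINT \<zeta>|?M. (P1 S *v ?w \<zeta>) \<bullet> ?z \<zeta>) + (LINT \<zeta>|?M. (P0 S *v ?z \<zeta>) \<bullet> ?z \<zeta>)"
    unfolding opL_def inner_add_left
    by (intro Bochner_Integration.integral_add L2_inner_integrable L2_linear[OF _ bounded_linear_matrix_vector]
        zL2 weak_deriv_L2[OF zw])
  ultimately show ?thesis by simp
qed

section \<open>The state space with its energy form\<close>

lemma borel_measurable_vecI:
  fixes f :: "'x \<Rightarrow> 'b::euclidean_space^'n::finite"
  assumes "\<And>i. (\<lambda>x. f x $ i) \<in> borel_measurable M"
  shows "f \<in> borel_measurable M"
proof (subst borel_measurable_euclidean_space, intro ballI)
  fix b :: "'b^'n" assume "b \<in> Basis"
  then obtain i u where b: "b = axis i u" by (auto simp: Basis_vec_def)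
  show "(\<lambda>x. f x \<bullet> b) \<in> borel_measurable M"
    unfolding b inner_axis by (intro borel_measurable_inner assms borel_measurable_const)
qed

lemma borel_measurable_vec_nth:
  fixes f :: "'x \<Rightarrow> 'b::euclidean_space^'n::finite"
  assumes "f \<in> borel_measurable M"
  shows "(\<lambda>x. f x $ i) \<in> borel_measurable M"
  by (rule measurable_compose[OF assms borel_measurable_continuous_onI])
    (intro continuous_on_component continuous_on_id)

lemma borel_measurable_det:
  fixes A :: "'x \<Rightarrow> complex^'n::finite^'n"
  assumes "A \<in> borel_measurable M"
  shows "(\<lambda>x. det (A x)) \<in> borel_measurable M"
proof -
  have "continuous_on UNIV (det :: complex^'n^'n \<Rightarrow> complex)"
    unfolding det_def by (intro continuous_intros)
  from measurable_compose[OF assms borel_measurable_continuous_onI[OF this]] show ?thesis .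
qed

text \<open>Cramer's rule writes each entry of the inverse as a quotient of determinants, which are
  polynomials in the entries.\<close>

lemma borel_measurable_matrix_inv:
  fixes A :: "'x \<Rightarrow> complex^'n::finite^'n"
  assumes A: "A \<in> borel_measurable M" and inv: "\<And>x. invertible (A x)"
  shows "(\<lambda>x. matrix_inv (A x)) \<in> borel_measurable M"
proof (intro borel_measurable_vecI)
  fix k j
  let ?b = "axis j 1 :: complex^'n"
  have "matrix_inv (A x) $ k $ j
     = det (\<chi> i l. if l = k then ?b $ i else A x $ i $ l) / det (A x)" for x
  proof -
    have "A x *v (matrix_inv (A x) *v ?b) = ?b"
      using matrix_inv_left[OF inv] matrix_left_right_inverse
      by (metis matrix_vector_mul_assoc matrix_vector_mul_lid)
    then have "matrix_inv (A x) *v ?b = (\<chi> k. det (\<chi> i l. if l = k then ?b $ i else A x $ i $ l) / det (A x))"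
      using cramer[of "A x"] inv invertible_det_nz by blast
    moreover have "(matrix_inv (A x) *v ?b) $ k = matrix_inv (A x) $ k $ j"
      by (simp add: matrix_vector_mult_def axis_def if_distrib[of "\<lambda>x. _ * x"] cong: if_cong)
    ultimately show ?thesis by simp
  qed
  moreover have "(\<lambda>x. det (\<chi> i l. if l = k then ?b $ i else A x $ i $ l) / det (A x)) \<in> borel_measurable M"
  proof (intro borel_measurable_divide borel_measurable_det A borel_measurable_vecI)
    fix i l
    show "(\<lambda>x. (\<chi> i l. if l = k then ?b $ i else A x $ i $ l) $ i $ l) \<in> borel_measurable M"
      using A by (cases "l = k") (auto intro!: borel_measurable_vec_nth)
  qed
  ultimately show "(\<lambda>x. matrix_inv (A x) $ k $ j) \<in> borel_measurable M" by simp
qed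

lemma matrix_vector_bound: "\<exists>B>0. \<forall>(A :: complex^'m::finite^'k::finite) v. norm (A *v v) \<le> norm A * norm v * B"
proof -
  have "bilinear (\<lambda>(A :: complex^'m^'k) v. A *v v)"
    unfolding bilinear_def
    by (auto intro!: linearI simp: matrix_vector_mult_add_rdistrib matrix_vector_right_distrib
        matrix_vector_mult_scaleR scaleR_matrix_vector)
  then have "bounded_bilinear (\<lambda>(A :: complex^'m^'k) v. A *v v)"
    by (simp add: bilinear_conv_bounded_bilinear)
  from bounded_bilinear.pos_bounded[OF this] show ?thesis by blast
qed

text \<open>\<open>Hm\<close> is the Hamiltonian density, corrected on a null set and extended by the identity, so
  that the bounds hold everywhere on the line.\<close>

locale phs_space =
  fixes S :: "('n::finite, 'p::finite) phs"
    and Hm :: "real \<Rightarrow> complex^'n^'n" and K c :: real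
  assumes ord: "lb S < ub S"
    and P1_adj: "adjoint_mat (P1 S) = P1 S" and P1_inv: "invertible (P1 S)"
    and inrow_inj: "inj (inrow S)"
    and Hm_bdd: "bdd_mult Hm K" and c_pos: "0 < c"
    and Hm_sym: "(Hm \<zeta> *v v) \<bullet> w = v \<bullet> (Hm \<zeta> *v w)"
    and Hm_coercive: "c * (norm v)\<^sup>2 \<le> (Hm \<zeta> *v v) \<bullet> v"
    and Hm_Ham: "AE \<zeta> in lebesgue_on {lb S..ub S}. Hm \<zeta> = Ham S \<zeta>"

lemma phs_space_exists:
  assumes "port_hamiltonian S" shows "\<exists>Hm K c. phs_space S Hm K c"
proof -
  let ?I = "{lb S..ub S}"
  obtain M where M: "AE \<zeta> in lebesgue_on ?I. norm (Ham S \<zeta>) \<le> M"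
    using assms unfolding port_hamiltonian_def by blast
  obtain c where c: "c > 0" "AE \<zeta> in lebesgue_on ?I. adjoint_mat (Ham S \<zeta>) = Ham S \<zeta> \<and>
      (\<forall>v. Re (cinner (Ham S \<zeta> *v v) v) \<ge> c * (norm v)\<^sup>2)"
    using assms unfolding port_hamiltonian_def by blast
  define good where "good \<zeta> \<longleftrightarrow> \<zeta> \<in> ?I \<and> norm (Ham S \<zeta>) \<le> M \<and> adjoint_mat (Ham S \<zeta>) = Ham S \<zeta> \<and>
      (\<forall>v. (Ham S \<zeta> *v v) \<bullet> v \<ge> c * (norm v)\<^sup>2)" for \<zeta>
  define Hm where "Hm \<zeta> = (if good \<zeta> then Ham S \<zeta> else mat 1)" for \<zeta>
  obtain B where B: "B > 0" "\<And>(A :: complex^'a^'a) v. norm (A *v v) \<le> norm A * norm v * B"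
    using matrix_vector_bound by blast
  have "AE \<zeta> in lebesgue_on ?I. \<zeta> \<in> ?I"
    using AE_space[of "lebesgue_on ?I"] by simp
  with M c(2) have good: "AE \<zeta> in lebesgue_on ?I. good \<zeta>"
    by eventually_elim (simp add: good_def Re_cinner)
  have "(\<lambda>\<zeta>. if \<zeta> \<in> ?I then Ham S \<zeta> else mat 1) \<in> borel_measurable lebesgue"
  proof -
    have "(\<lambda>\<zeta>. if \<zeta> \<in> ?I then Ham S \<zeta> else 0) \<in> borel_measurable lebesgue"
      using assms by (subst cut_measurable_iff) (auto simp: port_hamiltonian_def)
    then have "(\<lambda>\<zeta>. if \<zeta> \<in> ?I then (if \<zeta> \<in> ?I then Ham S \<zeta> else 0) else mat 1) \<in> borel_measurable lebesgue"
      by (rule measurable_If_set[OF _ borel_measurable_const]) simp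
    then show ?thesis by (rule measurable_cong[THEN iffD1, rotated]) auto
  qed
  \<comment> \<open>The set of good points involves a quantifier over all vectors and is not treated
    as measurable. Measurability of \<open>Hm\<close> comes from completeness of Lebesgue measure:
    it agrees almost everywhere with a plainly measurable function.\<close>
  moreover have "AE \<zeta> in lebesgue. (if \<zeta> \<in> ?I then Ham S \<zeta> else mat 1) = Hm \<zeta>"
    using good unfolding AE_cut_iff[of ?I, simplified]
    by (auto simp: Hm_def good_def elim!: eventually_mono)
  ultimately have meas: "Hm \<in> borel_measurable lebesgue" by (rule borel_measurable_AE)
  have Hm1: "norm (Hm \<zeta> *v v) \<le> (\<bar>M\<bar> * B + 1) * norm v" for \<zeta> v
  proof (cases "good \<zeta>")
    case True
    then have "norm (Hm \<zeta> *v v) \<le> norm (Ham S \<zeta>) * norm v * B" using B(2) by (simp add: Hm_def)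
    also have "\<dots> \<le> \<bar>M\<bar> * norm v * B"
      using True B(1) by (intro mult_right_mono) (auto simp: good_def)
    also have "\<dots> \<le> (\<bar>M\<bar> * B + 1) * norm v" by (simp add: algebra_simps)
    finally show ?thesis .
  qed (use B(1) in \<open>simp add: Hm_def algebra_simps\<close>)
  \<comment> \<open>Both constants are adjusted by 1 to accommodate the points where
    \<open>Hm\<close> is the identity.\<close>
  have "phs_space S Hm (\<bar>M\<bar> * B + 1) (min c 1)"
  proof
    show "lb S < ub S" "adjoint_mat (P1 S) = P1 S" "invertible (P1 S)" "inj (inrow S)"
      using assms by (auto simp: port_hamiltonian_def)
    show "bdd_mult Hm (\<bar>M\<bar> * B + 1)" using meas Hm1 by (simp add: bdd_mult_def)
    show "(Hm \<zeta> *v v) \<bullet> w = v \<bullet> (Hm \<zeta> *v w)" for \<zeta> v w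
      using adjoint_mat_inner[of "Ham S \<zeta>" v w] by (simp add: Hm_def good_def)
    show "min c 1 * (norm v)\<^sup>2 \<le> (Hm \<zeta> *v v) \<bullet> v" for \<zeta> v
    proof -
      have "min c 1 * (norm v)\<^sup>2 \<le> c * (norm v)\<^sup>2" "min c 1 * (norm v)\<^sup>2 \<le> 1 * (norm v)\<^sup>2"
        by (intro mult_right_mono; simp)+
      then show ?thesis by (auto simp: Hm_def good_def power2_norm_eq_inner intro: order_trans)
    qed
    show "AE \<zeta> in lebesgue_on ?I. Hm \<zeta> = Ham S \<zeta>"
      using good by eventually_elim (simp add: Hm_def)
  qed (use c in simp)
  then show ?thesis by blast
qed

section \<open>The energy form on the quotient\<close>

context phs_space
begin

abbreviation I :: "real set" where "I \<equiv> {lb S..ub S}"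
abbreviation e :: "(real \<Rightarrow> complex^'n) \<Rightarrow> 'n l2" where "e \<equiv> emb I"

text \<open>On embedded states this is the real part of \<open>X_inner\<close>. The density
  \<open>Hm\<close> extends it coercively to all classes on the line, so that the Hilbert space
  results apply without passing to a subspace.\<close>

definition ip :: "'n l2 \<Rightarrow> 'n l2 \<Rightarrow> real" where "ip F G = mop Hm F \<bullet> G"

lemma I_sets [simp]: "I \<in> sets lebesgue" by simp

lemma ip_integral: "ip F G = (LINT t|lebesgue. (Hm t *v rep F t) \<bullet> rep G t)"
  unfolding ip_def inner_l2_def
proof (rule integral_cong_AE)
  have "(\<lambda>t. Hm t *v rep F t) \<in> borel_measurable lebesgue"
    by (rule L2_UNIV_measurable[OF bdd_mult_L2[OF Hm_bdd rep_L2]])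
  then show "(\<lambda>t. (Hm t *v rep F t) \<bullet> rep G t) \<in> borel_measurable lebesgue" by measurable
  show "AE t in lebesgue. rep (mop Hm F) t \<bullet> rep G t = (Hm t *v rep F t) \<bullet> rep G t"
    using AE_rep_mop[OF Hm_bdd, of F] by eventually_elim simp
qed simp

lemma ip_integrable: "integrable lebesgue (\<lambda>t. (Hm t *v rep F t) \<bullet> rep G t)"
  by (intro L2_UNIV_inner_integrable bdd_mult_L2[OF Hm_bdd] rep_L2)

sublocale coercive_form ip c
proof (rule coercive_form.intro)
  interpret m: bounded_linear "mop Hm" by (rule bounded_linear_mop[OF Hm_bdd])
  show "bounded_bilinear ip"
  proof -
    have "ip = (\<lambda>F. (\<bullet>) (mop Hm F))" by (simp add: fun_eq_iff ip_def)
    then show ?thesis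
      using bounded_bilinear.comp1[OF bounded_bilinear_inner m.bounded_linear_axioms] by simp
  qed
  show "ip x y = ip y x" for x y
    unfolding ip_integral
    by (intro Bochner_Integration.integral_cong refl) (metis Hm_sym inner_commute)
  show "c > 0" by (rule c_pos)
  show "c * (norm x)\<^sup>2 \<le> ip x x" for x
    unfolding ip_integral norm_l2_power2 integral_mult_right_zero[symmetric]
    by (intro integral_mono ip_integrable integrable_mult_right L2_UNIV_integrable rep_L2 Hm_coercive)
qed

text \<open>Returns from \<open>Hm\<close> to the given \<open>Ham\<close>. Expressions in
  \<open>Ham\<close> are measurable because they equal measurable ones almost everywhere and the
  measure is complete.\<close>

lemma ip_emb:
  assumes "f \<in> X S" "g \<in> X S"
  shows "ip (e f) (e g) = (LINT t|lebesgue_on I. f t \<bullet> (Ham S t *v g t))"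
proof -
  have fg: "f \<in> L2 I" "g \<in> L2 I" using assms by (auto simp: X_def)
  have "ip (e f) (e g) = ip (e g) (e f)" by (rule sym)
  also have "\<dots> = (LINT t|lebesgue. (if t \<in> I then f t \<bullet> (Hm t *v g t) else 0))"
    unfolding ip_integral
  proof (rule integral_cong_AE)
    show "(\<lambda>t. (Hm t *v rep (e g) t) \<bullet> rep (e f) t) \<in> borel_measurable lebesgue"
      by (rule borel_measurable_integrable[OF ip_integrable])
    show "(\<lambda>t. if t \<in> I then f t \<bullet> (Hm t *v g t) else 0) \<in> borel_measurable lebesgue"
      unfolding cut_measurable_iff[OF I_sets]
      by (intro borel_measurable_integrable L2_inner_integrable fg bdd_mult_L2[OF Hm_bdd])
    show "AE t in lebesgue. (Hm t *v rep (e g) t) \<bullet> rep (e f) t = (if t \<in> I then f t \<bullet> (Hm t *v g t) else 0)"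
      using AE_rep_emb[OF I_sets fg(1)] AE_rep_emb[OF I_sets fg(2)]
      by eventually_elim (simp add: inner_commute)
  qed
  also have "\<dots> = (LINT t|lebesgue_on I. f t \<bullet> (Hm t *v g t))" by (rule cut_integral) simp
  also have "\<dots> = (LINT t|lebesgue_on I. f t \<bullet> (Ham S t *v g t))"
  proof (rule integral_cong_AE)
    show *: "(\<lambda>t. f t \<bullet> (Hm t *v g t)) \<in> borel_measurable (lebesgue_on I)"
      by (intro borel_measurable_integrable L2_inner_integrable fg bdd_mult_L2[OF Hm_bdd])
    show ae: "AE t in lebesgue_on I. f t \<bullet> (Hm t *v g t) = f t \<bullet> (Ham S t *v g t)"
      using Hm_Ham by eventually_elim simp
    have "AE t in lebesgue. (if t \<in> I then f t \<bullet> (Hm t *v g t) else 0) = (if t \<in> I then f t \<bullet> (Ham S t *v g t) else 0)"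
      using ae unfolding AE_cut_iff[OF I_sets] by eventually_elim auto
    with *[unfolded cut_measurable_iff[OF I_sets, symmetric]]
    show "(\<lambda>t. f t \<bullet> (Ham S t *v g t)) \<in> borel_measurable (lebesgue_on I)"
      unfolding cut_measurable_iff[OF I_sets, symmetric] by (rule borel_measurable_AE)
  qed
  finally show ?thesis .
qed

lemma Ham_L2: "f \<in> X S \<Longrightarrow> (\<lambda>t. Ham S t *v f t) \<in> X S"
proof -
  assume f: "f \<in> X S"
  have 1: "(\<lambda>t. Hm t *v f t) \<in> L2 I" using bdd_mult_L2[OF Hm_bdd] f by (simp add: X_def)
  have "AE t in lebesgue_on I. Hm t *v f t = Ham S t *v f t"
    using Hm_Ham by eventually_elim simp
  then have "AE t in lebesgue. (if t \<in> I then Hm t *v f t else 0) = (if t \<in> I then Ham S t *v f t else 0)"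
    unfolding AE_cut_iff[OF I_sets] by eventually_elim auto
  from borel_measurable_AE[OF _ this] 1 have "(\<lambda>t. Ham S t *v f t) \<in> borel_measurable (lebesgue_on I)"
    by (simp add: L2_def cut_measurable_iff[OF I_sets, symmetric])
  then show ?thesis unfolding X_def
    by (rule L2_AE_cong[OF 1]) (use Hm_Ham in eventually_elim, simp)
qed

text \<open>The imaginary part is the real part after multiplying the second argument by the
  imaginary unit. Hence \<open>X_inner\<close> is recovered from the real form
  \<open>ip\<close>.\<close>

lemma cinner_re_im: "cinner v w = complex_of_real (v \<bullet> w) + \<i> * complex_of_real (v \<bullet> (\<i> *s w))"
proof -
  have "cinner v (\<i> *s w) = - \<i> * cinner v w"
    by (simp add: cinner_def sum_distrib_left sum_negf ac_simps)
  then have "v \<bullet> (\<i> *s w) = Im (cinner v w)" unfolding Re_cinner[symmetric] by simp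
  then show ?thesis by (simp add: Re_cinner[symmetric] complex_eq_iff)
qed

lemma X_smult: "f \<in> X S \<Longrightarrow> (\<lambda>t. a *s f t) \<in> X S"
  unfolding X_def by (rule L2_linear[OF _ bounded_linear_smult])

lemma X_inner_eq:
  assumes "f \<in> X S" "g \<in> X S"
  shows "X_inner S f g = complex_of_real (ip (e f) (e g)) + \<i> * complex_of_real (ip (e f) (e (\<lambda>t. \<i> *s g t)))"
proof -
  have int: "integrable (lebesgue_on I) (\<lambda>t. f t \<bullet> (Ham S t *v g t))" if "g \<in> X S" for g
    using L2_inner_integrable[of f I] Ham_L2[OF that] assms(1) by (simp add: X_def)
  have i: "(\<lambda>t. \<i> *s g t) \<in> X S" by (rule X_smult[OF assms(2)])
  have "X_inner S f g = (LINT t|lebesgue_on I. complex_of_real (f t \<bullet> (Ham S t *v g t))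
      + \<i> * complex_of_real (f t \<bullet> (Ham S t *v (\<i> *s g t))))"
    unfolding X_inner_def by (subst cinner_re_im) (simp add: matrix_vector_mult_smult)
  also have "\<dots> = complex_of_real (LINT t|lebesgue_on I. f t \<bullet> (Ham S t *v g t))
      + \<i> * complex_of_real (LINT t|lebesgue_on I. f t \<bullet> (Ham S t *v (\<i> *s g t)))"
    using int[OF assms(2)] int[OF i]
    by (subst Bochner_Integration.integral_add) simp_all
  finally show ?thesis unfolding ip_emb[OF assms] ip_emb[OF assms(1) i] .
qed

lemma Re_X_inner: "f \<in> X S \<Longrightarrow> g \<in> X S \<Longrightarrow> Re (X_inner S f g) = ip (e f) (e g)"
  by (simp add: X_inner_eq)

lemma X_norm_eq: "f \<in> X S \<Longrightarrow> X_norm S f = sqrt (ip (e f) (e f))"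
  by (simp add: X_norm_def Re_X_inner)

lemma X_eq_iff: "f \<in> X S \<Longrightarrow> g \<in> X S \<Longrightarrow> X_eq S f g \<longleftrightarrow> e f = e g"
  by (simp add: X_eq_def X_def emb_eq_iff)

lemma X_diff: "f \<in> X S \<Longrightarrow> g \<in> X S \<Longrightarrow> (\<lambda>t. f t - g t) \<in> X S"
  unfolding X_def by (rule L2_diff)

lemma X_add: "f \<in> X S \<Longrightarrow> g \<in> X S \<Longrightarrow> (\<lambda>t. f t + g t) \<in> X S"
  unfolding X_def by (rule L2_add)

lemma X_combination: "f \<in> X S \<Longrightarrow> g \<in> X S \<Longrightarrow> (\<lambda>t. a *s f t + g t) \<in> X S"
  by (intro X_add X_smult)

lemma e_diff: "f \<in> X S \<Longrightarrow> g \<in> X S \<Longrightarrow> e (\<lambda>t. f t - g t) = e f - e g"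
  unfolding X_def by (rule emb_diff) simp_all

lemma e_add: "f \<in> X S \<Longrightarrow> g \<in> X S \<Longrightarrow> e (\<lambda>t. f t + g t) = e f + e g"
  unfolding X_def by (rule emb_add) simp_all

lemma rep_X [simp]: "rep F \<in> X S"
  unfolding X_def by simp

lemma X_eq_rep_e: "f \<in> X S \<Longrightarrow> X_eq S (rep (e f)) f"
  unfolding X_eq_def X_def by (rule AE_rep_emb_on) simp_all

lemma e_rep_e: "f \<in> X S \<Longrightarrow> e (rep (e f)) = e f"
  using X_eq_rep_e X_eq_iff by simp

text \<open>The weight is absorbed into the second argument, where \<open>Ham\<close> times the
  state is the effort almost everywhere. This opens the way to integration by parts.\<close>

lemma ip_effort:
  assumes "g \<in> X S" "x \<in> X S" "has_effort S x"
  shows "ip (e g) (e x) = (LINT t|lebesgue_on I. g t \<bullet> effort S x t)"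
  unfolding ip_emb[OF assms(1,2)]
proof (rule integral_cong_AE)
  show "(\<lambda>t. g t \<bullet> (Ham S t *v x t)) \<in> borel_measurable (lebesgue_on I)"
    using L2_inner_integrable[of g I] Ham_L2[OF assms(2)] assms(1)
    by (simp add: X_def borel_measurable_integrable)
  show "(\<lambda>t. g t \<bullet> effort S x t) \<in> borel_measurable (lebesgue_on I)"
    using L2_inner_integrable[of g I] effort_L2[OF assms(3)] assms(1)
    by (simp add: X_def borel_measurable_integrable)
  show "AE t in lebesgue_on I. g t \<bullet> (Ham S t *v x t) = g t \<bullet> effort S x t"
  proof -
    have "AE t in lebesgue_on I. effort S x t = Ham S t *v x t"
      using is_effort_effort[OF assms(3)] by (simp add: is_effort_def X_eq_def)
    then show ?thesis by eventually_elim simp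
  qed
qed

lemma ip_opL:
  assumes x: "x \<in> DL S"
  shows "2 * ip (e x) (e (opL S x)) = (Xi *v (R0 (P1 S) *v trace S x)) \<bullet> (R0 (P1 S) *v trace S x)
    + 2 * (LINT t|lebesgue_on I. (P0 S *v effort S x t) \<bullet> effort S x t)"
proof -
  have hx: "has_effort S x" and xX: "x \<in> X S" using x by (auto simp: DL_def has_effort_def)
  have "2 * ip (e x) (e (opL S x)) = 2 * ip (e (opL S x)) (e x)" by (simp add: sym)
  also have "\<dots> = 2 * (LINT t|lebesgue_on I. opL S x t \<bullet> effort S x t)"
    by (simp add: ip_effort opL_X hx xX)
  also have "\<dots> = (P1 S *v effort S x (ub S)) \<bullet> effort S x (ub S) - (P1 S *v effort S x (lb S)) \<bullet> effort S x (lb S)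
      + 2 * (LINT t|lebesgue_on I. (P0 S *v effort S x t) \<bullet> effort S x t)"
    by (rule power_balance[OF ord P1_adj hx])
  finally show ?thesis unfolding trace_def Xi_R0_inner[OF P1_adj] .
qed

lemma DL_kernel:
  assumes "x \<in> DL S" shows "WB2 S *v (R0 (P1 S) *v trace S x) = 0"
  unfolding WB2_def R0_inv_cancel[OF P1_inv] using assms by (simp add: DL_def)

lemma boundary_power:
  "Re (cinner (WB1 S *v (R0 (P1 S) *v trace S x)) (WC S *v (R0 (P1 S) *v trace S x))) = opG S x \<bullet> opK S x"
  unfolding WB1_def WC_def R0_inv_cancel[OF P1_inv] by (simp add: Re_cinner opG_def opK_def)

end

locale passive_phs = phs_space S Hm K c
  for S :: "('n::finite, 'p::finite) phs" and Hm :: "real \<Rightarrow> complex^'n^'n" and K c :: real +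
  assumes P0_diss: "P0_dissipative S"
    and supply_rate: "\<And>g. WB2 S *v g = 0 \<Longrightarrow> 2 * Re (cinner (WB1 S *v g) (WC S *v g)) \<ge> Re (cinner (Xi *v g) g)"
begin

lemma ip_opL_le:
  assumes x: "x \<in> DL S" shows "ip (e x) (e (opL S x)) \<le> opG S x \<bullet> opK S x"
proof -
  have "(LINT t|lebesgue_on I. (P0 S *v effort S x t) \<bullet> effort S x t) \<le> (LINT t|lebesgue_on I. 0)"
  proof (rule integral_mono)
    show "integrable (lebesgue_on I) (\<lambda>t. (P0 S *v effort S x t) \<bullet> effort S x t)"
      using effort_L2[OF DL_has_effort[OF x]] unfolding X_def
      by (intro L2_inner_integrable L2_linear[OF _ bounded_linear_matrix_vector])
    show "(P0 S *v effort S x t) \<bullet> effort S x t \<le> 0" for t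
      using P0_diss by (simp add: P0_dissipative_def Re_cinner)
  qed simp
  then show ?thesis
    using supply_rate[OF DL_kernel[OF x]] ip_opL[OF x] unfolding boundary_power by (simp add: Re_cinner)
qed

end

lemma (in phs_space) ip_opL_eq:
  assumes "P0_skew_adjoint S"
    and "\<forall>g. WB2 S *v g = 0 \<longrightarrow> 2 * Re (cinner (WB1 S *v g) (WC S *v g)) = Re (cinner (Xi *v g) g)"
    and x: "x \<in> DL S"
  shows "ip (e x) (e (opL S x)) = opG S x \<bullet> opK S x"
proof -
  have "(P0 S *v v) \<bullet> v = 0" for v
    using assms(1) skew_adjoint_inner_self by (simp add: P0_skew_adjoint_def)
  then show ?thesis
    using assms(2)[rule_format, OF DL_kernel[OF x]] ip_opL[OF x] unfolding boundary_power by (simp add: Re_cinner)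
qed

section \<open>The closed-loop operator is maximal dissipative\<close>

lemma of_real_smult: "complex_of_real r *s (v :: complex^'k::finite) = r *\<^sub>R v"
  by (simp add: vec_eq_iff scaleR_conv_of_real[where 'a=complex])

context phs_space
begin

lemma has_effort_zero: "has_effort S (\<lambda>_. 0)"
proof -
  have "weak_deriv (lb S) (ub S) (\<lambda>_. 0) (\<lambda>_. 0 :: complex^'n)" by (simp add: weak_deriv_def)
  then have "is_effort S (\<lambda>_. 0) (\<lambda>_. 0)" by (auto simp: is_effort_def H1_def X_eq_def)
  then show ?thesis by (auto simp: has_effort_def)
qed

lemma trace_zero: "trace S (\<lambda>_. 0) = 0"
  using trace_combination[OF ord has_effort_zero has_effort_zero, of "-1"] by simp

lemma opL_zero: "X_eq S (opL S (\<lambda>_. 0)) (\<lambda>_. 0)"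
proof -
  have "X_eq S (opL S (\<lambda>_. (-1) *s 0 + 0)) (\<lambda>t. (-1) *s opL S (\<lambda>_. 0) t + opL S (\<lambda>_. 0) t)"
    by (rule opL_combination[OF ord has_effort_zero has_effort_zero])
  moreover have "(\<lambda>_. (-1) *s 0 + 0) = (\<lambda>_ :: real. 0 :: complex^'n)" by (simp add: fun_eq_iff)
  ultimately show ?thesis by (simp only: vector_sneg_minus1[symmetric] left_minus)
qed

lemma DL_zero: "(\<lambda>_. 0) \<in> DL S"
  using has_effort_zero by (simp add: DL_def has_effort_def trace_zero X_def matrix_vector_mult_0_right)

lemma closed_loop_graph_zero: "((\<lambda>_. 0), (\<lambda>_. 0)) \<in> closed_loop_graph S"
  using opL_zero by (simp add: closed_loop_graph_def DL_zero opG_def opK_def trace_zero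
      matrix_vector_mult_0_right X_eq_sym) (simp add: X_def)

lemma closed_loop_graph_cong:
  assumes "(f, g) \<in> closed_loop_graph S" "X_eq S f f'" "f' \<in> X S" "X_eq S g g'" "g' \<in> X S"
  shows "(f', g') \<in> closed_loop_graph S"
  using assms DL_cong[OF assms(2,3)] trace_cong[OF assms(2)] opL_cong[OF assms(2)]
  by (auto simp: closed_loop_graph_def opG_def opK_def intro: X_eq_trans X_eq_sym)

lemma closed_loop_graph_combination:
  assumes "(f, g) \<in> closed_loop_graph S" "(f', g') \<in> closed_loop_graph S"
  shows "((\<lambda>t. a *s f t + f' t), (\<lambda>t. a *s g t + g' t)) \<in> closed_loop_graph S"
proof -
  have f: "f \<in> DL S" "f' \<in> DL S" and h: "has_effort S f" "has_effort S f'"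
    and bc: "opG S f + opK S f = 0" "opG S f' + opK S f' = 0"
    and g: "g \<in> X S" "g' \<in> X S" "X_eq S g (opL S f)" "X_eq S g' (opL S f')"
    using assms by (auto simp: closed_loop_graph_def intro: DL_has_effort)
  have "opG S (\<lambda>t. a *s f t + f' t) + opK S (\<lambda>t. a *s f t + f' t)
      = a *s (opG S f + opK S f) + (opG S f' + opK S f')"
    by (simp add: opG_def opK_def trace_combination[OF ord h] matrix_vector_right_distrib
        matrix_vector_mult_smult vector_add_ldistrib)
  moreover have "X_eq S (\<lambda>t. a *s g t + g' t) (opL S (\<lambda>t. a *s f t + f' t))"
  proof (rule X_eq_trans[OF _ X_eq_sym[OF opL_combination[OF ord h]]])
    show "X_eq S (\<lambda>t. a *s g t + g' t) (\<lambda>t. a *s opL S f t + opL S f' t)"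
      using g(3,4) unfolding X_eq_def by eventually_elim simp
  qed
  ultimately show ?thesis
    using DL_combination[OF ord f] X_combination[OF g(1,2)] by (simp add: closed_loop_graph_def bc)
qed

text \<open>The closed-loop operator on classes, continued by the zero operator off the interval:
  the first component is free there, the second must vanish. This keeps the relation single-valued
  and leaves the resolvent equation solvable off the interval.\<close>

definition \<Gamma> :: "('n l2 \<times> 'n l2) set" where
  "\<Gamma> = {(F, G). (rep F, rep G) \<in> closed_loop_graph S \<and> (AE t in lebesgue. t \<notin> I \<longrightarrow> rep G t = 0)}"

lemma AE_lebesgue_on: "AE t in lebesgue. P t \<Longrightarrow> AE t in lebesgue_on I. P t"
  unfolding AE_cut_iff[OF I_sets] by (auto elim: eventually_mono)

lemma rep_X_eqI: "AE t in lebesgue. f t = g t \<Longrightarrow> X_eq S f g"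
  unfolding X_eq_def by (rule AE_lebesgue_on)

lemma subspace_\<Gamma>: "subspace \<Gamma>"
proof -
  have zero: "(0, 0) \<in> \<Gamma>"
    unfolding \<Gamma>_def using AE_rep_zero[where 'a='n]
    by (auto intro!: closed_loop_graph_cong[OF closed_loop_graph_zero] rep_X_eqI elim: eventually_mono)
  have comb: "(r *\<^sub>R F + F', r *\<^sub>R G + G') \<in> \<Gamma>" if "(F, G) \<in> \<Gamma>" "(F', G') \<in> \<Gamma>" for r F G F' G'
  proof -
    have *: "AE t in lebesgue. complex_of_real r *s rep F t + rep F' t = rep (r *\<^sub>R F + F') t" for F F' :: "'n l2"
      using AE_rep_add[of "r *\<^sub>R F" F'] AE_rep_scaleR[of r F]
      by eventually_elim (simp add: of_real_smult)
    have g: "(rep F, rep G) \<in> closed_loop_graph S" "(rep F', rep G') \<in> closed_loop_graph S"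
      using that by (simp_all add: \<Gamma>_def)
    have "(rep (r *\<^sub>R F + F'), rep (r *\<^sub>R G + G')) \<in> closed_loop_graph S"
      by (rule closed_loop_graph_cong[OF closed_loop_graph_combination[OF g, where a="complex_of_real r"]
          rep_X_eqI[OF *] rep_X rep_X_eqI[OF *] rep_X])
    moreover have "AE t in lebesgue. t \<notin> I \<longrightarrow> rep (r *\<^sub>R G + G') t = 0"
    proof -
      have "AE t in lebesgue. t \<notin> I \<longrightarrow> rep G t = 0" "AE t in lebesgue. t \<notin> I \<longrightarrow> rep G' t = 0"
        using that by (auto simp: \<Gamma>_def)
      with *[of G G'] show ?thesis by eventually_elim (auto simp: of_real_smult)
    qed
    ultimately show ?thesis by (simp add: \<Gamma>_def)
  qed
  show ?thesis
    unfolding subspace_def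
  proof (intro conjI ballI allI)
    show "0 \<in> \<Gamma>" using zero by (simp add: zero_prod_def)
    show "x + y \<in> \<Gamma>" if "x \<in> \<Gamma>" "y \<in> \<Gamma>" for x y
      using comb[of "fst x" "snd x" "fst y" "snd y" 1] that by (simp add: plus_prod_def)
    show "r *\<^sub>R x \<in> \<Gamma>" if "x \<in> \<Gamma>" for r x
      using comb[of "fst x" "snd x" 0 0 r] that zero by (simp add: scaleR_prod_def)
  qed
qed

lemma \<Gamma>_single_valued: assumes "(0, G) \<in> \<Gamma>" shows "G = 0"
proof -
  have "X_eq S (rep 0) (\<lambda>_. 0 :: complex^'n)" by (rule rep_X_eqI[OF AE_rep_zero])
  from opL_cong[OF this] have "X_eq S (rep G) (opL S (\<lambda>_. 0))"
    using assms by (simp add: \<Gamma>_def closed_loop_graph_def)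
  then have "X_eq S (rep G) (\<lambda>_. 0)" by (rule X_eq_trans[OF _ opL_zero])
  then have "AE t in lebesgue. t \<in> I \<longrightarrow> rep G t = 0" by (simp add: X_eq_def AE_cut_iff)
  moreover have "AE t in lebesgue. t \<notin> I \<longrightarrow> rep G t = 0" using assms by (simp add: \<Gamma>_def)
  moreover note AE_rep_zero[where 'a='n]
  ultimately have "AE t in lebesgue. rep G t = rep 0 t" by eventually_elim auto
  then show ?thesis by (rule l2_eqI)
qed

text \<open>As \<open>G\<close> vanishes off the interval, the values of \<open>F\<close> there do
  not enter the form, and the pairing is that of the underlying state with
  \<open>opL\<close>.\<close>

lemma \<Gamma>_ip:
  assumes "(F, G) \<in> \<Gamma>" shows "ip F G = ip (e (rep F)) (e (opL S (rep F)))"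
proof -
  have "rep F \<in> DL S" "X_eq S (rep G) (opL S (rep F))"
    using assms by (auto simp: \<Gamma>_def closed_loop_graph_def)
  then have eG: "e (opL S (rep F)) = e (rep G)"
    using X_eq_iff[OF rep_X opL_X[OF DL_has_effort]] by metis
  have G: "e (rep G) = G"
  proof (rule l2_eqI)
    have "AE t in lebesgue. t \<notin> I \<longrightarrow> rep G t = 0" using assms by (simp add: \<Gamma>_def)
    moreover have "AE t in lebesgue. rep (e (rep G)) t = (if t \<in> I then rep G t else 0)"
      by (rule AE_rep_emb[OF I_sets]) simp
    ultimately show "AE t in lebesgue. rep (e (rep G)) t = rep G t"
      by eventually_elim auto
  qed
  have "ip G (e (rep F)) = ip G F"
    unfolding ip_integral
  proof (rule integral_cong_AE)
    show "AE t in lebesgue. (Hm t *v rep G t) \<bullet> rep (e (rep F)) t = (Hm t *v rep G t) \<bullet> rep F t"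
    proof -
      have "AE t in lebesgue. t \<notin> I \<longrightarrow> rep G t = 0" using assms by (simp add: \<Gamma>_def)
      moreover have "AE t in lebesgue. rep (e (rep F)) t = (if t \<in> I then rep F t else 0)"
        by (rule AE_rep_emb[OF I_sets]) simp
      ultimately show ?thesis by eventually_elim (auto simp: matrix_vector_mult_0_right)
    qed
  qed (rule borel_measurable_integrable[OF ip_integrable])+
  then show ?thesis unfolding eG G by (metis sym)
qed

text \<open>The \<open>n\<close> boundary conditions as one vector: the rows indexed by \<open>range (inrow S)\<close> carry those
  of \<open>tWB1 S + tWC S\<close>, the others those of \<open>tWB2 S\<close>.\<close>

definition bc :: "complex^('n + 'n) \<Rightarrow> complex^'n" where
  "bc \<tau> = (\<chi> j. if j \<in> range (inrow S) then ((tWB1 S + tWC S) *v \<tau>) $ inv (inrow S) j else (tWB2 S *v \<tau>) $ j)"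

lemma bc_eq_0_iff: "bc \<tau> = 0 \<longleftrightarrow> (tWB1 S + tWC S) *v \<tau> = 0 \<and> tWB2 S *v \<tau> = 0"
proof
  assume 0: "bc \<tau> = 0"
  have "((tWB1 S + tWC S) *v \<tau>) $ i = 0" for i
    using arg_cong[OF 0, of "\<lambda>v. v $ inrow S i"] inrow_inj by (simp add: bc_def)
  moreover have "(tWB2 S *v \<tau>) $ j = 0" for j
  proof (cases "j \<in> range (inrow S)")
    \<comment> \<open>The zero rows placed in \<open>tWB2 S\<close> at these positions make the
      condition vacuous.\<close>
    case True
    then show ?thesis by (simp add: matrix_vector_mult_def tWB2_def)
  next
    case False
    then show ?thesis using arg_cong[OF 0, of "\<lambda>v. v $ j"] by (simp add: bc_def)
  qed
  ultimately show "(tWB1 S + tWC S) *v \<tau> = 0 \<and> tWB2 S *v \<tau> = 0" by (simp add: vec_eq_iff)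
qed (simp add: bc_def vec_eq_iff)

lemma linear_bc: "linear bc"
  by (rule linearI)
    (simp_all add: bc_def vec_eq_iff matrix_vector_right_distrib matrix_vector_mult_scaleR)

section \<open>The resolvent equation as a boundary value problem\<close>

definition Hi :: "real \<Rightarrow> complex^'n^'n" where "Hi t = matrix_inv (Hm t)"

lemma Hm_invertible: "invertible (Hm t)"
  unfolding invertible_left_inverse matrix_left_invertible_ker
proof (intro allI impI)
  fix v assume "Hm t *v v = 0"
  then have "c * (norm v)\<^sup>2 \<le> 0" using Hm_coercive[of v t] by simp
  then show "v = 0" using c_pos by (simp add: mult_le_0_iff)
qed

lemma Hi_right: "Hm t *v (Hi t *v v) = v"
  using matrix_inv_left[OF Hm_invertible[of t]] matrix_left_right_inverse[of "Hi t" "Hm t"]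
  by (simp add: Hi_def matrix_vector_mul_assoc)

lemma Hi_bdd: "bdd_mult Hi (1 / c)"
  unfolding bdd_mult_def
proof (intro conjI allI)
  show "Hi \<in> borel_measurable lebesgue"
    unfolding Hi_def using Hm_bdd Hm_invertible by (intro borel_measurable_matrix_inv) (auto simp: bdd_mult_def)
  fix t v
  let ?u = "Hi t *v v"
  have "c * (norm ?u)\<^sup>2 \<le> v \<bullet> ?u" using Hm_coercive[of ?u t] by (simp add: Hi_right)
  also have "\<dots> \<le> norm v * norm ?u" by (rule norm_cauchy_schwarz)
  finally have le: "(c * norm ?u) * norm ?u \<le> norm v * norm ?u" by (simp add: power2_eq_square)
  have "c * norm ?u \<le> norm v"
  proof (cases "?u = 0")
    case False
    show ?thesis by (rule mult_right_le_imp_le[OF le]) (use False in simp)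
  qed simp
  then have "norm ?u \<le> norm v / c" using c_pos by (subst pos_le_divide_eq) (simp_all add: mult.commute)
  then show "norm ?u \<le> 1 / c * norm v" by simp
qed

abbreviation "P1i \<equiv> matrix_inv (P1 S)"

lemma P1i: "P1i *v (P1 S *v v) = v" "P1 S *v (P1i *v v) = v"
  using matrix_inv_left[OF P1_inv] matrix_left_right_inverse[of P1i "P1 S"]
  by (simp_all add: matrix_vector_mul_assoc)

text \<open>Right-hand side of the resolvent equation \<open>l x - L x = f\<close>, solved for the derivative of the effort.\<close>

definition rhs :: "real \<Rightarrow> real \<Rightarrow> complex^'n \<Rightarrow> complex^'n" where
  "rhs l t v = P1i *v (l *\<^sub>R (Hi t *v v) - P0 S *v v)"

lemma linear_rhs: "linear (rhs l t)"
  by (rule linearI)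
    (simp_all add: rhs_def matrix_vector_right_distrib matrix_vector_mult_scaleR algebra_simps
      matrix_vector_mult_diff_distrib)

lemma rhs_bound: "\<exists>B>0. \<forall>t v. norm (rhs l t v) \<le> B * norm v"
proof -
  obtain B1 where B1: "B1 > 0" "\<And>v. norm (P1i *v v) \<le> norm v * B1"
    using bounded_linear.pos_bounded[OF bounded_linear_matrix_vector[of P1i]] by blast
  obtain B0 where B0: "B0 > 0" "\<And>v. norm (P0 S *v v) \<le> norm v * B0"
    using bounded_linear.pos_bounded[OF bounded_linear_matrix_vector[of "P0 S"]] by blast
  have "norm (rhs l t v) \<le> ((\<bar>l\<bar> / c + B0) * B1) * norm v" for t v
  proof -
    have "norm (l *\<^sub>R (Hi t *v v) - P0 S *v v) \<le> \<bar>l\<bar> * (1 / c * norm v) + norm v * B0"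
    proof (rule order_trans[OF norm_triangle_ineq4 add_mono[OF _ B0(2)]])
      have "norm (Hi t *v v) \<le> 1 / c * norm v" using Hi_bdd by (simp add: bdd_mult_def)
      then show "norm (l *\<^sub>R (Hi t *v v)) \<le> \<bar>l\<bar> * (1 / c * norm v)"
        unfolding norm_scaleR by (rule mult_left_mono) simp
    qed
    also have "\<dots> = (\<bar>l\<bar> / c + B0) * norm v" by (simp add: algebra_simps)
    finally have "norm (l *\<^sub>R (Hi t *v v) - P0 S *v v) * B1 \<le> (\<bar>l\<bar> / c + B0) * norm v * B1"
      using B1(1) by (intro mult_right_mono) auto
    then show ?thesis using B1(2)[of "l *\<^sub>R (Hi t *v v) - P0 S *v v"] by (simp add: rhs_def mult_ac)
  qed
  moreover have "(\<bar>l\<bar> / c + B0) * B1 > 0" using B0 B1 c_pos by (simp add: add_nonneg_pos)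
  ultimately show ?thesis by blast
qed

lemma rhs_L2: "z \<in> L2 A \<Longrightarrow> (\<lambda>t. rhs l t (z t)) \<in> L2 A"
  unfolding rhs_def
  by (intro L2_linear[OF _ bounded_linear_matrix_vector] L2_diff L2_scaleR bdd_mult_L2[OF Hi_bdd])

lemma resolvent_ode:
  assumes f: "f \<in> X S"
  shows "\<exists>z. z (lb S) = z0 \<and> weak_deriv (lb S) (ub S) z (\<lambda>t. rhs l t (z t) - P1i *v f t)"
proof -
  let ?a = "lb S" and ?b = "ub S"
  have Pf: "(\<lambda>t. P1i *v f t) \<in> L2 {?a..?b}"
    using f unfolding X_def by (rule L2_linear[OF _ bounded_linear_matrix_vector])
  obtain B where B: "B > 0" "\<And>t v. norm (rhs l t v) \<le> B * norm v" using rhs_bound by blast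
  \<comment> \<open>The Volterra equation is posed on a half line, so the inhomogeneity is held
    constant beyond \<open>ub S\<close>. The coefficient \<open>Hi\<close> is already defined on the
    whole line.\<close>
  define g where "g t = z0 - integral {?a..min t ?b} (\<lambda>t. P1i *v f t)" for t
  have g_ab: "continuous_on {?a..?b} (\<lambda>t. z0 - integral {?a..t} (\<lambda>t. P1i *v f t))"
    by (intro continuous_intros indefinite_integral_continuous_1 L2_interval_integrable_on Pf)
  have g_cont: "continuous_on {?a..} g"
    unfolding g_def
    by (rule continuous_on_compose2[OF g_ab, of _ "\<lambda>t. min t ?b"]) (use ord in \<open>auto intro!: continuous_intros\<close>)
  obtain C where C: "\<And>t. t \<in> {?a..?b} \<Longrightarrow> norm (z0 - integral {?a..t} (\<lambda>t. P1i *v f t)) \<le> C"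
    using compact_imp_bounded[OF compact_continuous_image[OF g_ab compact_Icc]]
    unfolding bounded_iff by (metis imageI)
  have int: "(\<lambda>s. rhs l s (z s)) integrable_on {?a..t}" if "continuous_on {?a..} z" for z t
    by (intro L2_interval_integrable_on rhs_L2 continuous_on_imp_L2 continuous_on_subset[OF that]) simp
  have "\<exists>z. continuous_on {?a..} z \<and> (\<forall>t\<ge>?a. z t = g t + integral {?a..t} (\<lambda>s. rhs l s (z s)))"
  proof (rule Volterra_solution_exists[OF B(1) _ _ int g_cont])
    show "norm (rhs l t x - rhs l t y) \<le> B * norm (x - y)" for t x y
      using B(2)[of t "x - y"] by (simp add: linear_diff[OF linear_rhs])
    show "rhs l t 0 = 0" for t by (rule linear_0[OF linear_rhs])
    show "norm (g t) \<le> C" if "?a \<le> t" for t unfolding g_def using C[of "min t ?b"] that ord by auto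
  qed
  then obtain z where z: "continuous_on {?a..} z" "\<And>t. t \<ge> ?a \<Longrightarrow> z t = g t + integral {?a..t} (\<lambda>s. rhs l s (z s))"
    by blast
  have w: "(\<lambda>t. rhs l t (z t) - P1i *v f t) \<in> L2 {?a..?b}"
    by (intro L2_diff rhs_L2 Pf continuous_on_imp_L2 continuous_on_subset[OF z(1)]) auto
  have za: "z ?a = z0" using z(2)[of ?a] ord by (simp add: g_def min_def)
  have "weak_deriv ?a ?b z (\<lambda>t. rhs l t (z t) - P1i *v f t)"
  proof (rule weak_derivI[OF w])
    fix t assume t: "t \<in> {?a..?b}"
    have "(\<lambda>t. P1i *v f t) integrable_on {?a..t}"
      using integrable_on_subinterval[OF L2_interval_integrable_on[OF Pf]] t by auto
    then show "z t = z ?a + integral {?a..t} (\<lambda>t. rhs l t (z t) - P1i *v f t)"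
      using z(2)[of t] t int[OF z(1)] by (simp add: za g_def integral_diff min_def)
  qed
  then show ?thesis using za by blast
qed

lemma resolvent_ode_unique:
  assumes z: "weak_deriv (lb S) (ub S) z (\<lambda>t. rhs l t (z t))" and 0: "z (lb S) = 0" and t: "t \<in> I"
  shows "z t = 0"
proof -
  obtain B where B: "B > 0" "\<And>t v. norm (rhs l t v) \<le> B * norm v" using rhs_bound by blast
  show ?thesis
  proof (rule Volterra_solution_unique[OF B _ weak_deriv_continuous[OF z] _ t])
    show "(\<lambda>s. rhs l s (z s)) integrable_on {lb S..t}" if "t \<in> I" for t
      using integrable_on_subinterval[OF L2_interval_integrable_on[OF weak_deriv_L2[OF z]]] that by auto
    show "z t = integral {lb S..t} (\<lambda>s. rhs l s (z s))" if "t \<in> I" for t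
      using weak_deriv_integral[OF z that] 0 by simp
  qed
qed

text \<open>The unknown of the equation is the effort \<open>z\<close>; the state is recovered as
  \<open>Hi\<close> times \<open>z\<close>. Requiring this only up to \<open>X_eq\<close> leaves the
  values of \<open>x\<close> off the interval free for the caller.\<close>

lemma resolvent_ode_graph:
  assumes f: "f \<in> X S" and z: "weak_deriv (lb S) (ub S) z (\<lambda>t. rhs l t (z t) - P1i *v f t)"
    and bc: "bc (stack_vec (z (ub S)) (z (lb S))) = 0"
    and x: "x \<in> X S" "X_eq S x (\<lambda>t. Hi t *v z t)"
  shows "(x, \<lambda>t. l *\<^sub>R x t - f t) \<in> closed_loop_graph S"
proof -
  have "X_eq S z (\<lambda>t. Ham S t *v x t)"
    using x(2) Hm_Ham unfolding X_eq_def by eventually_elim (metis Hi_right)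
  then have eff: "is_effort S x z" using z by (auto simp: is_effort_def H1_def)
  then have he: "has_effort S x" by (auto simp: has_effort_def)
  have ez: "effort S x t = z t" if "t \<in> I" for t by (rule effort_unique[OF ord eff that])
  then have tr: "trace S x = stack_vec (z (ub S)) (z (lb S))" using ord by (simp add: trace_def)
  have "AE t in lebesgue_on I. effort_deriv S x t = rhs l t (z t) - P1i *v f t"
    by (rule weak_deriv_unique[OF weak_deriv_effort[OF he] z ez])
  moreover have "AE t in lebesgue_on I. t \<in> I"
    using AE_space[of "lebesgue_on I"] by simp
  ultimately have "X_eq S (\<lambda>t. l *\<^sub>R x t - f t) (opL S x)"
    using x(2) unfolding X_eq_def opL_def
    by eventually_elim (simp add: ez rhs_def P1i matrix_vector_mult_diff_distrib)
  moreover have "(\<lambda>t. l *\<^sub>R x t - f t) \<in> X S" using x(1) f unfolding X_def by (intro L2_diff L2_scaleR)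
  moreover have "x \<in> DL S" "opG S x + opK S x = 0"
    using bc x(1) eff unfolding bc_eq_0_iff
    by (auto simp: DL_def tr opG_def opK_def matrix_vector_mult_add_rdistrib)
  ultimately show ?thesis by (simp add: closed_loop_graph_def)
qed

end

context passive_phs
begin

lemma closed_loop_bound:
  assumes "x \<in> DL S" "opG S x + opK S x = 0"
  shows "2 * ip (e x) (e (opL S x)) + (norm (opG S x))\<^sup>2 + (norm (opK S x))\<^sup>2 \<le> 0"
proof -
  have "opK S x = - opG S x" using assms(2) by (simp add: add_eq_0_iff)
  then show ?thesis using ip_opL_le[OF assms(1)] by (simp add: power2_norm_eq_inner)
qed

lemma \<Gamma>_dissipative:
  assumes "(F, G) \<in> \<Gamma>" shows "ip F G \<le> 0"
  using \<Gamma>_ip[OF assms] closed_loop_bound[of "rep F"] assms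
  by (auto simp: \<Gamma>_def closed_loop_graph_def) (smt (verit) zero_le_power2)

text \<open>For \<open>l > 0\<close> dissipativity makes the boundary value problem injective; being a linear system of
  \<open>n\<close> equations in \<open>n\<close> unknowns, it is solvable.\<close>

lemma \<Gamma>_range:
  assumes l: "l > 0" shows "\<exists>F. (F, l *\<^sub>R F - G) \<in> \<Gamma>"
proof -
  let ?a = "lb S" and ?b = "ub S"
  have "\<exists>z. z ?a = z0 \<and> weak_deriv ?a ?b z (\<lambda>t. rhs l t (z t))" for z0
    using resolvent_ode[of "\<lambda>_. 0" z0 l] by (simp add: X_def matrix_vector_mult_0_right)
  then obtain sol where sol: "\<And>z0. sol z0 ?a = z0"
    "\<And>z0. weak_deriv ?a ?b (sol z0) (\<lambda>t. rhs l t (sol z0 t))" by metis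
  \<comment> \<open>The solutions are arbitrary choices; their linearity in the initial value comes
    from uniqueness, applied to a combination that starts at 0.\<close>
  have lin: "sol (r *\<^sub>R u + v) ?b = r *\<^sub>R sol u ?b + sol v ?b" for r u v
  proof -
    let ?d = "\<lambda>t. (-1) *s sol (r *\<^sub>R u + v) t + (complex_of_real r *s sol u t + sol v t)"
    have "weak_deriv ?a ?b ?d
        (\<lambda>t. (-1) *s rhs l t (sol (r *\<^sub>R u + v) t) + (complex_of_real r *s rhs l t (sol u t) + rhs l t (sol v t)))"
      by (intro weak_deriv_combination sol)
    moreover have "(-1) *s rhs l t (sol (r *\<^sub>R u + v) t) + (complex_of_real r *s rhs l t (sol u t) + rhs l t (sol v t))
        = rhs l t (?d t)" for t
    proof -
      show ?thesis
        by (simp add: of_real_smult vector_sneg_minus1[symmetric] linear_add[OF linear_rhs] linear_diff[OF linear_rhs]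
            linear_scale[OF linear_rhs] linear_neg[OF linear_rhs])
    qed
    ultimately have "weak_deriv ?a ?b ?d (\<lambda>t. rhs l t (?d t))" by simp
    moreover have "?d ?a = 0" by (simp add: sol of_real_smult vector_sneg_minus1[symmetric])
    ultimately have "?d ?b = 0" using resolvent_ode_unique[of ?d l ?b] ord by auto
    then show ?thesis by (simp add: of_real_smult vector_sneg_minus1[symmetric])
  qed
  \<comment> \<open>The shooting map: from the initial effort at \<open>lb S\<close> to the residual
    in the boundary conditions.\<close>
  define T where "T z0 = bc (stack_vec (sol z0 ?b) z0)" for z0
  have T_comb: "T (r *\<^sub>R u + v) = r *\<^sub>R T u + T v" for r u v
  proof -
    have "stack_vec (sol (r *\<^sub>R u + v) ?b) (r *\<^sub>R u + v) = r *\<^sub>R stack_vec (sol u ?b) u + stack_vec (sol v ?b) v"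
      unfolding lin by (simp add: vec_eq_iff stack_vec_def split: sum.split)
    then show ?thesis unfolding T_def by (simp add: linear_add[OF linear_bc] linear_scale[OF linear_bc])
  qed
  have linT: "linear T"
  proof -
    have T0: "T 0 = 0" using T_comb[of "-1" 0 0] by simp
    show ?thesis by (rule linearI) (use T_comb[of 1] T_comb[of _ _ 0] T0 in auto)
  qed
  \<comment> \<open>A kernel element yields a closed-loop state with \<open>L x = l x\<close>, for
    which the dissipation bound reads \<open>l * ip (e x) (e x) \<le> 0\<close>.\<close>
  have "inj T"
    unfolding linear_injective_0[OF linT]
  proof (intro allI impI)
    fix z0 assume 0: "T z0 = 0"
    define x where "x t = Hi t *v sol z0 t" for t
    have x: "x \<in> X S"
      unfolding X_def x_def by (intro bdd_mult_L2[OF Hi_bdd] continuous_on_imp_L2 weak_deriv_continuous[OF sol(2)])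
    have "(x, \<lambda>t. l *\<^sub>R x t - 0) \<in> closed_loop_graph S"
      by (rule resolvent_ode_graph[OF _ _ _ x, where z="sol z0"])
        (use sol(2)[of z0] 0 in \<open>auto simp: X_def matrix_vector_mult_0_right T_def sol(1) x_def[abs_def]\<close>)
    then have D: "x \<in> DL S" "opG S x + opK S x = 0" and eq: "X_eq S (\<lambda>t. l *\<^sub>R x t) (opL S x)"
      by (auto simp: closed_loop_graph_def)
    have lx: "(\<lambda>t. l *\<^sub>R x t) \<in> X S" using x unfolding X_def by (rule L2_scaleR)
    have "e (opL S x) = e (\<lambda>t. l *\<^sub>R x t)"
      using eq X_eq_iff[OF lx opL_X[OF DL_has_effort[OF D(1)]]] by simp
    also have "\<dots> = l *\<^sub>R e x" using x unfolding X_def by (intro emb_scaleR) simp_all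
    finally have "2 * (l * ip (e x) (e x)) + (norm (opG S x))\<^sup>2 + (norm (opK S x))\<^sup>2 \<le> 0"
      using closed_loop_bound[OF D] by (simp add: ip.scaleR_right)
    then have "l * ip (e x) (e x) \<le> 0"
      using zero_le_power2[of "norm (opG S x)"] zero_le_power2[of "norm (opK S x)"] by linarith
    then have "ip (e x) (e x) \<le> 0" using l by (simp add: mult_le_0_iff)
    then have "ip (e x) (e x) = 0" by (rule antisym[OF _ nonneg])
    then have "e x = 0" by simp
    also have "0 = e (\<lambda>_. 0)"
      by simp
    finally have "X_eq S x (\<lambda>_. 0)" using X_eq_iff[OF x, of "\<lambda>_. 0"] by (simp add: X_def)
    then have "AE t in lebesgue_on I. sol z0 t = 0"
      unfolding X_eq_def x_def by eventually_elim (metis Hi_right matrix_vector_mult_0_right)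
    from continuous_AE_eq_imp_eq[OF ord weak_deriv_continuous[OF sol(2)] _ this, of ?a]
    show "z0 = 0" using ord sol(1)[of z0] by simp
  qed
  then have surj: "surj T" by (rule linear_inj_imp_surj[OF linT])
  obtain zp where zp: "zp ?a = 0" "weak_deriv ?a ?b zp (\<lambda>t. rhs l t (zp t) - P1i *v rep G t)"
    using resolvent_ode[of "rep G" 0 l] by auto
  \<comment> \<open>The homogeneous solution is chosen to cancel the boundary residual left by the
    particular solution \<open>zp\<close>.\<close>
  obtain z0 where z0: "T z0 = - bc (stack_vec (zp ?b) 0)" using surj by (metis surjD)
  define z where "z t = sol z0 t + zp t" for t
  have "weak_deriv ?a ?b (\<lambda>t. 1 *s sol z0 t + zp t) (\<lambda>t. 1 *s rhs l t (sol z0 t) + (rhs l t (zp t) - P1i *v rep G t))"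
    by (intro weak_deriv_combination sol zp)
  then have z: "weak_deriv ?a ?b z (\<lambda>t. rhs l t (z t) - P1i *v rep G t)"
    by (simp add: z_def[abs_def] linear_add[OF linear_rhs] add_diff_eq)
  have "stack_vec (z ?b) (z ?a) = stack_vec (sol z0 ?b) z0 + stack_vec (zp ?b) 0"
    by (simp add: z_def sol zp vec_eq_iff stack_vec_def split: sum.split)
  then have bc: "bc (stack_vec (z ?b) (z ?a)) = 0"
    using z0 by (simp add: T_def linear_add[OF linear_bc])
  \<comment> \<open>Off the interval the operator is zero, so the resolvent equation there is
    \<open>l x = G\<close>.\<close>
  define x where "x t = (if t \<in> I then Hi t *v z t else (1 / l) *\<^sub>R rep G t)" for t
  have HiL2: "(\<lambda>t. Hi t *v z t) \<in> L2 I"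
    by (intro bdd_mult_L2[OF Hi_bdd] continuous_on_imp_L2 weak_deriv_continuous[OF z])
  have xL2: "x \<in> L2 UNIV"
  proof -
    have "x = (\<lambda>t. (if t \<in> I then Hi t *v z t else 0) + (if t \<in> - I then (1 / l) *\<^sub>R rep G t else 0))"
      by (auto simp: x_def fun_eq_iff)
    moreover have "(\<lambda>t. (if t \<in> I then Hi t *v z t else 0)) \<in> L2 UNIV" by (rule iffD2[OF cut_L2[OF I_sets] HiL2])
    moreover have "(\<lambda>t. (if t \<in> - I then (1 / l) *\<^sub>R rep G t else 0)) \<in> L2 UNIV"
      by (rule iffD2[OF cut_L2]) (simp_all add: L2_scaleR)
    ultimately show ?thesis using L2_add by fastforce
  qed
  have repx: "AE t in lebesgue. rep (cls x) t = x t" by (rule AE_rep_cls[OF xL2])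
  have xX: "x \<in> X S" unfolding X_def by (rule L2_subset[OF xL2]) auto
  have xeq: "X_eq S x (\<lambda>t. Hi t *v z t)"
    unfolding X_eq_def x_def AE_cut_iff[OF I_sets] by simp
  have g: "(x, \<lambda>t. l *\<^sub>R x t - rep G t) \<in> closed_loop_graph S"
    by (rule resolvent_ode_graph[OF rep_X z bc xX xeq])
  have lxG: "AE t in lebesgue. l *\<^sub>R x t - rep G t = rep (l *\<^sub>R cls x - G) t"
    using AE_rep_diff[of "l *\<^sub>R cls x" G] AE_rep_scaleR[of l "cls x"] repx by eventually_elim simp
  have "(rep (cls x), rep (l *\<^sub>R cls x - G)) \<in> closed_loop_graph S"
    by (rule closed_loop_graph_cong[OF g]) (use repx lxG in \<open>auto intro!: rep_X_eqI elim: eventually_mono\<close>)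
  moreover have "AE t in lebesgue. t \<notin> I \<longrightarrow> rep (l *\<^sub>R cls x - G) t = 0"
    using lxG by eventually_elim (use l in \<open>auto simp: x_def\<close>)
  ultimately show ?thesis by (auto simp: \<Gamma>_def)
qed

sublocale cl: maximal_dissipative ip c \<Gamma>
  by unfold_locales (auto intro: subspace_\<Gamma> \<Gamma>_single_valued \<Gamma>_dissipative \<Gamma>_range)

end

section \<open>Classical and generalized solutions\<close>

lemma has_vector_derivative_within_iff_quotient:
  fixes f :: "real \<Rightarrow> 'a::real_normed_vector"
  shows "(f has_vector_derivative D) (at t within T) \<longleftrightarrow>
    ((\<lambda>s. (f s - f t) /\<^sub>R (s - t) - D) \<longlongrightarrow> 0) (at t within T)"
proof -
  have "(f has_vector_derivative D) (at t within T) \<longleftrightarrow>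
    ((\<lambda>s. norm ((1 / norm (s - t)) *\<^sub>R (f s - (f t + (s - t) *\<^sub>R D)))) \<longlongrightarrow> 0) (at t within T)"
    by (simp add: has_vector_derivative_def has_derivative_within bounded_linear_scaleR_left
        tendsto_norm_zero_iff del: norm_scaleR)
  also have "\<dots> \<longleftrightarrow> ((\<lambda>s. norm ((f s - f t) /\<^sub>R (s - t) - D)) \<longlongrightarrow> 0) (at t within T)"
  proof (rule tendsto_cong)
    show "\<forall>\<^sub>F s in at t within T. norm ((1 / norm (s - t)) *\<^sub>R (f s - (f t + (s - t) *\<^sub>R D)))
        = norm ((f s - f t) /\<^sub>R (s - t) - D)"
      unfolding eventually_at_filter
    proof (intro always_eventually allI impI)
      fix s assume "s \<noteq> t"
      then have "(f s - f t) /\<^sub>R (s - t) - D = (1 / (s - t)) *\<^sub>R (f s - (f t + (s - t) *\<^sub>R D))"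
        by (simp add: diff_diff_eq[symmetric] scaleR_diff_right[of _ "f s - f t"] inverse_eq_divide)
      then show "norm ((1 / norm (s - t)) *\<^sub>R (f s - (f t + (s - t) *\<^sub>R D))) = norm ((f s - f t) /\<^sub>R (s - t) - D)"
        by simp
    qed
  qed
  finally show ?thesis by (simp add: tendsto_norm_zero_iff)
qed

lemma (in coercive_form) tendsto_sqrt_ip_iff:
  "((\<lambda>s. sqrt (ip (w s) (w s))) \<longlongrightarrow> 0) F \<longleftrightarrow> (w \<longlongrightarrow> 0) F"
proof
  assume "((\<lambda>s. sqrt (ip (w s) (w s))) \<longlongrightarrow> 0) F"
  then have "((\<lambda>s. sqrt (ip (w s) (w s)) / sqrt c) \<longlongrightarrow> 0 / sqrt c) F"
    using c_pos by (intro tendsto_intros) auto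
  then show "(w \<longlongrightarrow> 0) F"
    using Lim_null_comparison[OF always_eventually[OF allI[OF norm_le]], of w F] by simp
next
  assume "(w \<longlongrightarrow> 0) F"
  then have "((\<lambda>s. sqrt (ip (w s) (w s))) \<longlongrightarrow> sqrt (ip 0 0)) F"
    by (intro tendsto_real_sqrt ip.tendsto)
  then show "((\<lambda>s. sqrt (ip (w s) (w s))) \<longlongrightarrow> 0) F" by (simp add: ip.zero_left)
qed

lemma norm_power2_tendsto_0_iff: "((\<lambda>k. (norm (w k))\<^sup>2) \<longlongrightarrow> 0) F \<longleftrightarrow> (w \<longlongrightarrow> 0) F"
proof
  assume "((\<lambda>k. (norm (w k))\<^sup>2) \<longlongrightarrow> 0) F"
  then have "((\<lambda>k. sqrt ((norm (w k))\<^sup>2)) \<longlongrightarrow> sqrt 0) F" by (rule tendsto_real_sqrt)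
  then show "(w \<longlongrightarrow> 0) F" by (simp add: tendsto_norm_zero_iff)
next
  assume "(w \<longlongrightarrow> 0) F"
  then have "((\<lambda>k. (norm (w k))\<^sup>2) \<longlongrightarrow> (norm (0 :: 'b))\<^sup>2) F" by (intro tendsto_intros)
  then show "((\<lambda>k. (norm (w k))\<^sup>2) \<longlongrightarrow> 0) F" by simp
qed

section \<open>Signal energies on finite intervals and on the half line\<close>

abbreviation "N t f \<equiv> (norm (emb {0..t} f))\<^sup>2"

lemma L2_locD: "f \<in> L2_loc \<Longrightarrow> 0 \<le> t \<Longrightarrow> f \<in> L2 {0..t}"
  by (simp add: L2_loc_def)

lemma continuous_on_imp_L2_loc: "continuous_on {0..} f \<Longrightarrow> f \<in> L2_loc"
  unfolding L2_loc_def by (auto intro!: continuous_on_imp_L2 intro: continuous_on_subset)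

lemma L2_loc_combination: "f \<in> L2_loc \<Longrightarrow> g \<in> L2_loc \<Longrightarrow> (\<lambda>t. a *s f t + g t) \<in> L2_loc"
  unfolding L2_loc_def by (auto intro!: L2_add L2_linear[OF _ bounded_linear_smult])

lemma L2_halfline_loc: "f \<in> L2 {0..} \<Longrightarrow> f \<in> L2_loc"
  unfolding L2_loc_def by (auto intro: L2_subset)

lemma emb_smult_add_norm_le:
  assumes "A \<in> sets lebesgue" "f \<in> L2 A" "g \<in> L2 A"
  shows "norm (emb A (\<lambda>t. a *s f t + g t)) \<le> norm a * norm (emb A f) + norm (emb A g)"
proof -
  have af: "(\<lambda>t. a *s f t) \<in> L2 A" by (rule L2_linear[OF assms(2) bounded_linear_smult])
  have "(norm (emb A (\<lambda>t. a *s f t)))\<^sup>2 = (norm a * norm (emb A f))\<^sup>2"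
    by (simp add: norm_emb[OF assms(1) af] norm_emb[OF assms(1,2)] power_mult_distrib norm_smult_complex)
  then have "norm (emb A (\<lambda>t. a *s f t)) = norm a * norm (emb A f)" by simp
  then show ?thesis
    unfolding emb_add[OF assms(1) af assms(3)] using norm_triangle_ineq by metis
qed

text \<open>Polarization. The supplied energy is rewritten through norms of embedded signals, which
  pass directly to the limits defining generalized solutions.\<close>

lemma twice_inner_integral:
  assumes "continuous_on {0..} u" "continuous_on {0..} y" "0 \<le> t"
  shows "integral {0..t} (\<lambda>s. 2 * (u s \<bullet> y s)) = N t (\<lambda>s. u s + y s) - N t u - N t (y :: real \<Rightarrow> complex^'m::finite)"
proof -
  have L: "u \<in> L2 {0..t}" "y \<in> L2 {0..t}"
    using assms by (auto intro!: continuous_on_imp_L2 intro: continuous_on_subset)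
  have i: "integrable (lebesgue_on {0..t}) (\<lambda>s. u s \<bullet> y s)" by (rule L2_inner_integrable[OF L])
  have "N t (\<lambda>s. u s + y s) = (LINT s|lebesgue_on {0..t}. (norm (u s))\<^sup>2 + 2 * (u s \<bullet> y s) + (norm (y s))\<^sup>2)"
    unfolding norm_emb[OF _ L2_add[OF L], simplified]
    by (intro Bochner_Integration.integral_cong refl)
      (simp add: power2_norm_eq_inner inner_add_left inner_add_right inner_commute)
  also have "\<dots> = N t u + 2 * (LINT s|lebesgue_on {0..t}. u s \<bullet> y s) + N t y"
    using L2_integrable[OF L(1)] L2_integrable[OF L(2)] i L by (simp add: norm_emb)
  finally show ?thesis using lebesgue_on_integral_eq[OF i] by simp
qed

text \<open>Fatou along the cut-offs to \<open>{0..real n}\<close>; the same pointwise limit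
  provides measurability on the half line.\<close>

lemma L2_halflineI:
  fixes f :: "real \<Rightarrow> complex^'m::finite"
  assumes f: "f \<in> L2_loc" and C: "\<And>t. 0 \<le> t \<Longrightarrow> N t f \<le> C"
  shows "f \<in> L2 {0..}" and "(norm (emb {0..} f))\<^sup>2 \<le> C"
proof -
  let ?F = "\<lambda>n t. if t \<in> {0..real n} then f t else 0" and ?G = "\<lambda>t. if t \<in> {0..} then f t else 0"
  have FL2: "?F n \<in> L2 UNIV" for n using cut_L2[of "{0..real n}" f] L2_locD[OF f] by simp
  have lim: "(\<lambda>n. ?F n t) \<longlonglongrightarrow> ?G t" for t
  proof (rule tendsto_eventually)
    obtain m where "t \<le> real m" using real_arch_simple by blast
    then show "\<forall>\<^sub>F n in sequentially. ?F n t = ?G t"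
      by (intro eventually_sequentiallyI[of m]) auto
  qed
  have Gm: "?G \<in> borel_measurable lebesgue"
    by (rule borel_measurable_LIMSEQ_metric[OF L2_UNIV_measurable[OF FL2] lim])
  have "(\<integral>\<^sup>+t. ennreal ((norm (?G t))\<^sup>2) \<partial>lebesgue)
      = (\<integral>\<^sup>+t. liminf (\<lambda>n. ennreal ((norm (?F n t))\<^sup>2)) \<partial>lebesgue)"
  proof (rule nn_integral_cong)
    fix t
    have "(\<lambda>n. ennreal ((norm (?F n t))\<^sup>2)) \<longlonglongrightarrow> ennreal ((norm (?G t))\<^sup>2)"
      by (intro tendsto_intros lim)
    then show "ennreal ((norm (?G t))\<^sup>2) = liminf (\<lambda>n. ennreal ((norm (?F n t))\<^sup>2))"
      by (rule lim_imp_Liminf[OF sequentially_bot, symmetric])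
  qed
  also have "\<dots> \<le> liminf (\<lambda>n. \<integral>\<^sup>+t. ennreal ((norm (?F n t))\<^sup>2) \<partial>lebesgue)"
    by (rule nn_integral_liminf) (use L2_UNIV_measurable[OF FL2] in measurable)
  also have "\<dots> = liminf (\<lambda>n. ennreal (N (real n) f))"
    by (simp only: nn_integral_eq_integral[OF L2_UNIV_integrable[OF FL2]] zero_le_power2
        norm_cls_power2[OF FL2, symmetric] emb_def eventually_True)
  also have "\<dots> \<le> liminf (\<lambda>n. ennreal C)"
    by (intro Liminf_mono always_eventually allI ennreal_leI C) simp
  finally have le: "(\<integral>\<^sup>+t. ennreal ((norm (?G t))\<^sup>2) \<partial>lebesgue) \<le> ennreal C" by (simp add: Liminf_const)
  have G2: "?G \<in> L2 UNIV"
    unfolding L2_UNIV_iff using Gm le_less_trans[OF le ennreal_less_top]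
    by (auto intro!: integrableI_bounded)
  then show L2: "f \<in> L2 {0..}" by (rule iffD1[OF cut_L2, rotated]) simp
  have "0 \<le> C" using C[of 0] by (meson order_refl order_trans zero_le_power2)
  moreover have "ennreal ((norm (emb {0..} f))\<^sup>2) = (\<integral>\<^sup>+t. ennreal ((norm (?G t))\<^sup>2) \<partial>lebesgue)"
    unfolding emb_def norm_cls_power2[OF G2]
    by (rule nn_integral_eq_integral[OF L2_UNIV_integrable[OF G2], symmetric]) simp
  ultimately show "(norm (emb {0..} f))\<^sup>2 \<le> C" using le by (metis ennreal_le_iff)
qed

lemma N_mono:
  assumes "f \<in> L2 B" "{0..t} \<subseteq> B" "B \<in> sets lebesgue"
  shows "N t f \<le> (norm (emb B f))\<^sup>2"
proof -
  have A: "f \<in> L2 {0..t}" by (rule L2_subset[OF assms(1,2)]) (use assms in auto)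
  have eq: "N t f = (LINT s|lebesgue. (if s \<in> {0..t} then (norm (f s))\<^sup>2 else 0))"
    using norm_emb[OF _ A] cut_integral[of "{0..t}" "\<lambda>s. (norm (f s))\<^sup>2"] by simp
  have eq': "(norm (emb B f))\<^sup>2 = (LINT s|lebesgue. (if s \<in> B then (norm (f s))\<^sup>2 else 0))"
    using norm_emb[OF _ assms(1)] cut_integral[of B "\<lambda>s. (norm (f s))\<^sup>2"] assms(3) by simp
  show ?thesis unfolding eq eq'
    using cut_integrable_iff[of "{0..t}" "\<lambda>s. (norm (f s))\<^sup>2"] cut_integrable_iff[of B "\<lambda>s. (norm (f s))\<^sup>2"]
      L2_integrable[OF A] L2_integrable[OF assms(1)] assms(2,3)
    by (intro integral_mono) (auto simp: subset_iff)
qed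

text \<open>The sequence is increasing and bounded. A gap \<open>r\<close> below the half-line
  energy would persist for all times and contradict \<open>L2_halflineI\<close>, which bounds that
  energy by any common bound of the partial ones.\<close>

lemma N_tendsto_halfline:
  assumes "f \<in> L2 {0..}"
  shows "((\<lambda>n. N (real n) f) \<longlongrightarrow> (norm (emb {0..} f))\<^sup>2) sequentially"
proof (rule increasing_LIMSEQ)
  show "N (real n) f \<le> N (real (Suc n)) f" for n
    by (rule N_mono) (auto intro: L2_locD[OF L2_halfline_loc[OF assms]])
  show "N (real n) f \<le> (norm (emb {0..} f))\<^sup>2" for n by (rule N_mono[OF assms]) auto
  fix r :: real assume r: "r > 0"
  show "\<exists>n. (norm (emb {0..} f))\<^sup>2 \<le> N (real n) f + r"
  proof (rule ccontr)
    assume "\<not> ?thesis"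
    then have lt: "N (real n) f < (norm (emb {0..} f))\<^sup>2 - r" for n by (auto simp: not_le algebra_simps)
    have "N t f \<le> (norm (emb {0..} f))\<^sup>2 - r" if "t \<ge> 0" for t
    proof -
      obtain n where n: "t \<le> real n" using real_arch_simple by blast
      have "N t f \<le> N (real n) f"
        by (rule N_mono) (use n L2_locD[OF L2_halfline_loc[OF assms]] in auto)
      then show ?thesis by (rule order_trans[OF _ less_imp_le[OF lt]])
    qed
    from L2_halflineI(2)[OF L2_halfline_loc[OF assms] this] r show False by simp
  qed
qed

section \<open>Solutions as curves in the Hilbert space\<close>

context phs_space
begin

abbreviation nrm :: "'n l2 \<Rightarrow> real" where "nrm F \<equiv> sqrt (ip F F)"

lemma X_norm_diff: "f \<in> X S \<Longrightarrow> g \<in> X S \<Longrightarrow> X_norm S (\<lambda>t. f t - g t) = nrm (e f - e g)"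
  by (simp add: X_norm_eq X_diff e_diff)

lemma X_continuous_iff:
  "X_continuous S x \<longleftrightarrow> (\<forall>t\<ge>0. x t \<in> X S) \<and> continuous_on {0..} (\<lambda>t. e (x t))"
proof -
  have "((\<lambda>s. X_norm S (\<lambda>\<zeta>. x s \<zeta> - x t \<zeta>)) \<longlongrightarrow> 0) (at t within {0..})
      \<longleftrightarrow> ((\<lambda>s. e (x s)) \<longlongrightarrow> e (x t)) (at t within {0..})"
    if x: "\<forall>t\<ge>0. x t \<in> X S" and t: "t \<ge> 0" for t
  proof -
    have "((\<lambda>s. X_norm S (\<lambda>\<zeta>. x s \<zeta> - x t \<zeta>)) \<longlongrightarrow> 0) (at t within {0..})
        \<longleftrightarrow> ((\<lambda>s. nrm (e (x s) - e (x t))) \<longlongrightarrow> 0) (at t within {0..})"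
      by (rule tendsto_cong) (use x t in \<open>auto simp: eventually_at_filter X_norm_diff\<close>)
    also have "\<dots> \<longleftrightarrow> ((\<lambda>s. e (x s) - e (x t)) \<longlongrightarrow> 0) (at t within {0..})" by (rule tendsto_sqrt_ip_iff)
    finally show ?thesis by (simp add: LIM_zero_iff)
  qed
  then show ?thesis unfolding X_continuous_def continuous_on_def by auto
qed

lemma X_has_derivative_iff:
  assumes x: "\<forall>t\<ge>0. x t \<in> X S" "\<forall>t\<ge>0. x' t \<in> X S"
  shows "X_has_derivative S x x' \<longleftrightarrow>
    (\<forall>t\<ge>0. ((\<lambda>t. e (x t)) has_vector_derivative e (x' t)) (at t within {0..}))"
proof -
  have "((\<lambda>s. X_norm S (\<lambda>\<zeta>. (x s \<zeta> - x t \<zeta>) /\<^sub>R (s - t) - x' t \<zeta>)) \<longlongrightarrow> 0) (at t within {0..})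
      \<longleftrightarrow> ((\<lambda>t. e (x t)) has_vector_derivative e (x' t)) (at t within {0..})" if t: "t \<ge> 0" for t
  proof -
    have *: "X_norm S (\<lambda>\<zeta>. (x s \<zeta> - x t \<zeta>) /\<^sub>R (s - t) - x' t \<zeta>)
        = nrm ((e (x s) - e (x t)) /\<^sub>R (s - t) - e (x' t))" if s: "s \<ge> 0" for s
    proof -
      have d: "(\<lambda>\<zeta>. x s \<zeta> - x t \<zeta>) \<in> X S" using X_diff x s t by blast
      have dq: "(\<lambda>\<zeta>. (x s \<zeta> - x t \<zeta>) /\<^sub>R (s - t)) \<in> X S" using d unfolding X_def by (rule L2_scaleR)
      have "e (\<lambda>\<zeta>. (x s \<zeta> - x t \<zeta>) /\<^sub>R (s - t)) = (e (x s) - e (x t)) /\<^sub>R (s - t)"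
        using emb_scaleR[OF I_sets, of "\<lambda>\<zeta>. x s \<zeta> - x t \<zeta>"] d e_diff x s t by (simp add: X_def)
      then show ?thesis using X_norm_diff[OF dq] x(2) t by simp
    qed
    have "((\<lambda>s. X_norm S (\<lambda>\<zeta>. (x s \<zeta> - x t \<zeta>) /\<^sub>R (s - t) - x' t \<zeta>)) \<longlongrightarrow> 0) (at t within {0..})
      \<longleftrightarrow> ((\<lambda>s. nrm ((e (x s) - e (x t)) /\<^sub>R (s - t) - e (x' t))) \<longlongrightarrow> 0) (at t within {0..})"
      by (rule tendsto_cong) (use * in \<open>auto simp: eventually_at_filter\<close>)
    then show ?thesis unfolding tendsto_sqrt_ip_iff has_vector_derivative_within_iff_quotient .
  qed
  then show ?thesis unfolding X_has_derivative_def by simp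
qed

lemma DL_X: "x \<in> DL S \<Longrightarrow> x \<in> X S" by (simp add: DL_def)

lemma DL_opL_X: "x \<in> DL S \<Longrightarrow> opL S x \<in> X S" by (intro opL_X DL_has_effort)

text \<open>The derivative required by the definition is determined up to null sets, so
  \<open>opL S (x t)\<close> itself can take its place. What remains is an ordinary differentiable
  curve of classes.\<close>

lemma classical_solution_iff:
  "classical_solution S x u y \<longleftrightarrow>
    (\<forall>t\<ge>0. x t \<in> DL S \<and> opG S (x t) = u t \<and> opK S (x t) = y t \<and>
      ((\<lambda>t. e (x t)) has_vector_derivative e (opL S (x t))) (at t within {0..})) \<and>
    continuous_on {0..} (\<lambda>t. e (opL S (x t))) \<and> continuous_on {0..} u \<and> continuous_on {0..} y"
  (is "?L \<longleftrightarrow> ?R")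
proof
  assume L: ?L
  then obtain x' where x': "X_continuous S x'" "X_has_derivative S x x'" "\<forall>t\<ge>0. X_eq S (x' t) (opL S (x t))"
    unfolding classical_solution_def by blast
  have D: "\<forall>t\<ge>0. x t \<in> DL S" using L by (simp add: classical_solution_def)
  have x'X: "\<forall>t\<ge>0. x' t \<in> X S" and x'c: "continuous_on {0..} (\<lambda>t. e (x' t))"
    using x'(1) by (auto simp: X_continuous_iff)
  have eq: "e (x' t) = e (opL S (x t))" if "t \<ge> 0" for t
    using x'(3) x'X D DL_opL_X X_eq_iff that by blast
  have "continuous_on {0..} (\<lambda>t. e (opL S (x t)))"
    by (rule continuous_on_eq[OF x'c]) (simp add: eq)
  moreover have "((\<lambda>t. e (x t)) has_vector_derivative e (opL S (x t))) (at t within {0..})" if "t \<ge> 0" for t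
    using x'(2) X_has_derivative_iff[of x x'] D DL_X x'X that by (auto simp flip: eq)
  ultimately show ?R using L by (simp add: classical_solution_def)
next
  assume R: ?R
  have X: "\<forall>t\<ge>0. x t \<in> X S" "\<forall>t\<ge>0. opL S (x t) \<in> X S" using R DL_X DL_opL_X by auto
  have "continuous_on {0..} (\<lambda>t. e (x t))"
    using R unfolding continuous_on_eq_continuous_within by (auto intro: has_vector_derivative_continuous)
  then have "X_continuous S x" using X by (simp add: X_continuous_iff)
  moreover have "X_continuous S (\<lambda>t. opL S (x t))" using X R by (simp add: X_continuous_iff)
  moreover have "X_has_derivative S x (\<lambda>t. opL S (x t))"
    using R X by (simp add: X_has_derivative_iff)
  ultimately show ?L unfolding classical_solution_def using R
    by (intro conjI exI[of _ "\<lambda>t. opL S (x t)"]) auto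
qed

lemma ip_e_smult:
  assumes "f \<in> X S" shows "ip (e (\<lambda>t. a *s f t)) (e (\<lambda>t. a *s f t)) = (norm a)\<^sup>2 * ip (e f) (e f)"
proof -
  have "(a *s v) \<bullet> (A *v (a *s v)) = (norm a)\<^sup>2 * (v \<bullet> (A *v v))" for v :: "complex^'n" and A
  proof -
    have "cinner (a *s v) (A *v (a *s v)) = (a * cnj a) * cinner v (A *v v)"
      by (simp add: matrix_vector_mult_smult) (simp add: cinner_def sum_distrib_left ac_simps)
    then show ?thesis
      unfolding Re_cinner[symmetric] complex_norm_square[symmetric] by simp
  qed
  then show ?thesis by (simp add: ip_emb assms X_smult)
qed

lemma nrm_combination_le:
  assumes "f \<in> X S" "g \<in> X S"
  shows "nrm (e (\<lambda>t. a *s f t + g t)) \<le> norm a * nrm (e f) + nrm (e g)"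
  unfolding e_add[OF X_smult[OF assms(1)] assms(2)]
  using sqrt_add_le[of "e (\<lambda>t. a *s f t)" "e g"]
  by (simp add: ip_e_smult[OF assms(1)] real_sqrt_mult)

text \<open>The type \<open>l2\<close> knows real scalars only. Complex ones act through the
  multiplication operator with constant symbol \<open>mat a\<close>, which is all that
  differentiating a combination requires.\<close>

lemma bounded_linear_e_smult:
  "\<exists>T. bounded_linear T \<and> (\<forall>f\<in>X S. e (\<lambda>t. a *s f t) = T (e f))"
proof -
  have *: "mat a *v v = a *s v" for v :: "complex^'n"
    by (simp add: matrix_vector_mult_def mat_def vec_eq_iff if_distrib[of "\<lambda>x. x * _"] cong: if_cong)
  have b: "bdd_mult (\<lambda>_. mat a :: complex^'n^'n) (norm a)"
    by (simp add: bdd_mult_def * norm_smult_complex)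
  have "e (\<lambda>t. a *s f t) = mop (\<lambda>_. mat a) (e f)" if "f \<in> X S" for f
  proof (rule l2_eqI)
    have f: "f \<in> L2 I" "(\<lambda>t. a *s f t) \<in> L2 I" using that X_smult by (auto simp: X_def)
    show "AE t in lebesgue. rep (e (\<lambda>t. a *s f t)) t = rep (mop (\<lambda>_. mat a) (e f)) t"
      using AE_rep_emb[OF I_sets f(2)] AE_rep_emb[OF I_sets f(1)] AE_rep_mop[OF b, of "e f"]
      by eventually_elim (simp add: *)
  qed
  then show ?thesis using bounded_linear_mop[OF b] by blast
qed

lemma classical_solution_combination:
  assumes "classical_solution S x u y" "classical_solution S x2 u2 y2"
  shows "classical_solution S (\<lambda>t \<zeta>. a *s x t \<zeta> + x2 t \<zeta>) (\<lambda>t. a *s u t + u2 t) (\<lambda>t. a *s y t + y2 t)"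
proof -
  note A = assms(1)[unfolded classical_solution_iff] and B = assms(2)[unfolded classical_solution_iff]
  obtain T where T: "bounded_linear T" "\<And>f. f \<in> X S \<Longrightarrow> e (\<lambda>t. a *s f t) = T (e f)"
    using bounded_linear_e_smult by blast
  have comb: "e (\<lambda>t. a *s f t + g t) = T (e f) + e g" if "f \<in> X S" "g \<in> X S" for f g
    using that by (simp add: e_add X_smult T(2))
  have D: "x t \<in> DL S" "x2 t \<in> DL S" "has_effort S (x t)" "has_effort S (x2 t)" if "t \<ge> 0" for t
    using A B that by (auto intro: DL_has_effort)
  have opL: "e (opL S (\<lambda>\<zeta>. a *s x t \<zeta> + x2 t \<zeta>)) = T (e (opL S (x t))) + e (opL S (x2 t))" if t: "t \<ge> 0" for t
  proof -
    have "e (opL S (\<lambda>\<zeta>. a *s x t \<zeta> + x2 t \<zeta>)) = e (\<lambda>\<zeta>. a *s opL S (x t) \<zeta> + opL S (x2 t) \<zeta>)"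
      using opL_combination[OF ord D(3,4)[OF t], of a]
      by (subst (asm) X_eq_iff) (auto intro: X_combination DL_opL_X DL_combination[OF ord] D[OF t])
    then show ?thesis using comb D t by (simp add: DL_opL_X)
  qed
  show ?thesis
    unfolding classical_solution_iff
  proof (intro conjI allI impI)
    fix t :: real assume t: "t \<ge> 0"
    show "(\<lambda>\<zeta>. a *s x t \<zeta> + x2 t \<zeta>) \<in> DL S" by (rule DL_combination[OF ord D(1,2)[OF t]])
    show "opG S (\<lambda>\<zeta>. a *s x t \<zeta> + x2 t \<zeta>) = a *s u t + u2 t"
      "opK S (\<lambda>\<zeta>. a *s x t \<zeta> + x2 t \<zeta>) = a *s y t + y2 t"
      using A B t by (auto simp: opG_def opK_def trace_combination[OF ord D(3,4)[OF t]]
          matrix_vector_right_distrib matrix_vector_mult_smult)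
    have "((\<lambda>t. T (e (x t)) + e (x2 t)) has_vector_derivative T (e (opL S (x t))) + e (opL S (x2 t))) (at t within {0..})"
      using A B t by (intro has_vector_derivative_add bounded_linear.has_vector_derivative[OF T(1)]) auto
    then show "((\<lambda>t. e (\<lambda>\<zeta>. a *s x t \<zeta> + x2 t \<zeta>)) has_vector_derivative
        e (opL S (\<lambda>\<zeta>. a *s x t \<zeta> + x2 t \<zeta>))) (at t within {0..})"
      unfolding opL[OF t]
      by (rule has_vector_derivative_transform[rotated -1]) (use t comb D DL_X in auto)
  next
    have "continuous_on {0..} (\<lambda>t. T (e (opL S (x t))) + e (opL S (x2 t)))"
      using A B by (intro continuous_on_add bounded_linear.continuous_on[OF T(1)]) auto
    then show "continuous_on {0..} (\<lambda>t. e (opL S (\<lambda>\<zeta>. a *s x t \<zeta> + x2 t \<zeta>)))"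
      by (rule continuous_on_eq) (simp add: opL)
    show "continuous_on {0..} (\<lambda>t. a *s u t + u2 t)" "continuous_on {0..} (\<lambda>t. a *s y t + y2 t)"
      using A B by (auto intro!: continuous_on_add bounded_linear.continuous_on[OF bounded_linear_smult])
  qed
qed

lemma classical_L2_loc:
  assumes "classical_solution S x u y" shows "u \<in> L2_loc" "y \<in> L2_loc" "\<And>t. t \<ge> 0 \<Longrightarrow> x t \<in> X S"
  using assms continuous_on_imp_L2_loc DL_X unfolding classical_solution_iff by blast+

lemma solution_limit_iff:
  assumes cl: "\<And>k. classical_solution S (xs k) (us k) (ys k)"
    and x: "\<forall>t\<ge>0. x t \<in> X S" and uy: "u \<in> L2_loc" "y \<in> L2_loc"
  shows "solution_limit S xs us ys x u y \<longleftrightarrow> (\<forall>\<tau>\<ge>0.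
    uniform_limit {0..\<tau>} (\<lambda>k t. nrm (e (xs k t) - e (x t))) (\<lambda>_. 0) sequentially \<and>
    (\<lambda>k. emb {0..\<tau>} (us k)) \<longlonglongrightarrow> emb {0..\<tau>} u \<and> (\<lambda>k. emb {0..\<tau>} (ys k)) \<longlonglongrightarrow> emb {0..\<tau>} y)"
proof -
  have u: "(\<lambda>k. LINT t|lebesgue_on {0..\<tau>}. (norm (vs k t - v t))\<^sup>2) \<longlonglongrightarrow> 0 \<longleftrightarrow>
      (\<lambda>k. emb {0..\<tau>} (vs k)) \<longlonglongrightarrow> emb {0..\<tau>} v"
    if "\<And>k. vs k \<in> L2_loc" "v \<in> L2_loc" "\<tau> \<ge> 0" for vs and v :: "real \<Rightarrow> complex^'p" and \<tau>
  proof -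
    have L: "vs k \<in> L2 {0..\<tau>}" "v \<in> L2 {0..\<tau>}" for k using that L2_locD by auto
    have "(LINT t|lebesgue_on {0..\<tau>}. (norm (vs k t - v t))\<^sup>2) = (norm (emb {0..\<tau>} (vs k) - emb {0..\<tau>} v))\<^sup>2" for k
      using norm_emb[OF _ L2_diff[OF L(1)[of k] L(2)]] emb_diff[OF _ L(1)[of k] L(2)] by simp
    then show ?thesis
      by (simp add: norm_power2_tendsto_0_iff LIM_zero_iff)
  qed
  have xl: "uniform_limit {0..\<tau>} (\<lambda>k t. X_norm S (\<lambda>\<zeta>. xs k t \<zeta> - x t \<zeta>)) (\<lambda>_. 0) sequentially \<longleftrightarrow>
    uniform_limit {0..\<tau>} (\<lambda>k t. nrm (e (xs k t) - e (x t))) (\<lambda>_. 0) sequentially" if "\<tau> \<ge> 0" for \<tau>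
    by (rule uniform_limit_cong) (use classical_L2_loc[OF cl] x in \<open>auto intro!: always_eventually X_norm_diff\<close>)
  show ?thesis
    unfolding solution_limit_def using x uy u[OF classical_L2_loc(1)[OF cl]] u[OF classical_L2_loc(2)[OF cl]] xl
    by (auto simp: atLeastAtMost_def[symmetric])
qed

lemma solution_limitD:
  assumes cl: "\<And>k. classical_solution S (xs k) (us k) (ys k)" and l: "solution_limit S xs us ys x u y"
  shows "\<And>t. t \<ge> 0 \<Longrightarrow> x t \<in> X S" "u \<in> L2_loc" "y \<in> L2_loc"
    "\<And>\<tau>. \<tau> \<ge> 0 \<Longrightarrow> uniform_limit {0..\<tau>} (\<lambda>k t. nrm (e (xs k t) - e (x t))) (\<lambda>_. 0) sequentially"
    "\<And>\<tau>. \<tau> \<ge> 0 \<Longrightarrow> (\<lambda>k. emb {0..\<tau>} (us k)) \<longlonglongrightarrow> emb {0..\<tau>} u"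
    "\<And>\<tau>. \<tau> \<ge> 0 \<Longrightarrow> (\<lambda>k. emb {0..\<tau>} (ys k)) \<longlonglongrightarrow> emb {0..\<tau>} y"
    "\<And>t. t \<ge> 0 \<Longrightarrow> (\<lambda>k. e (xs k t)) \<longlonglongrightarrow> e (x t)"
proof -
  show *: "\<And>t. t \<ge> 0 \<Longrightarrow> x t \<in> X S" "u \<in> L2_loc" "y \<in> L2_loc" using l by (auto simp: solution_limit_def)
  have "\<forall>t\<ge>0. x t \<in> X S" using * by blast
  note L = iffD1[OF solution_limit_iff[OF cl this *(2,3)] l]
  show u: "\<And>\<tau>. \<tau> \<ge> 0 \<Longrightarrow> uniform_limit {0..\<tau>} (\<lambda>k t. nrm (e (xs k t) - e (x t))) (\<lambda>_. 0) sequentially"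
    "\<And>\<tau>. \<tau> \<ge> 0 \<Longrightarrow> (\<lambda>k. emb {0..\<tau>} (us k)) \<longlonglongrightarrow> emb {0..\<tau>} u"
    "\<And>\<tau>. \<tau> \<ge> 0 \<Longrightarrow> (\<lambda>k. emb {0..\<tau>} (ys k)) \<longlonglongrightarrow> emb {0..\<tau>} y"
    using L by auto
  show "(\<lambda>k. e (xs k t)) \<longlonglongrightarrow> e (x t)" if t: "t \<ge> 0" for t
  proof -
    have "(\<lambda>k. nrm (e (xs k t) - e (x t))) \<longlonglongrightarrow> 0"
      by (rule tendsto_uniform_limitI[OF u(1)[OF t]]) (use t in auto)
    then show ?thesis unfolding tendsto_sqrt_ip_iff LIM_zero_iff .
  qed
qed

lemma solution_limit_combination:
  assumes cl: "\<And>k. classical_solution S (xs k) (us k) (ys k)" and l: "solution_limit S xs us ys x u y"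
    and cl2: "\<And>k. classical_solution S (xs2 k) (us2 k) (ys2 k)" and l2: "solution_limit S xs2 us2 ys2 x2 u2 y2"
  shows "solution_limit S (\<lambda>k t \<zeta>. a *s xs k t \<zeta> + xs2 k t \<zeta>) (\<lambda>k t. a *s us k t + us2 k t) (\<lambda>k t. a *s ys k t + ys2 k t)
    (\<lambda>t \<zeta>. a *s x t \<zeta> + x2 t \<zeta>) (\<lambda>t. a *s u t + u2 t) (\<lambda>t. a *s y t + y2 t)"
proof -
  note L = solution_limitD[OF cl l] and L2 = solution_limitD[OF cl2 l2]
  note C = classical_L2_loc[OF cl] and C2 = classical_L2_loc[OF cl2]
  have sig: "(\<lambda>k. emb {0..\<tau>} (\<lambda>t. a *s vs k t + vs2 k t)) \<longlonglongrightarrow> emb {0..\<tau>} (\<lambda>t. a *s v t + v2 t)"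
    if vs: "\<And>k. vs k \<in> L2_loc" "v \<in> L2_loc" "\<And>k. vs2 k \<in> L2_loc" "v2 \<in> L2_loc" and \<tau>: "\<tau> \<ge> 0"
      and c: "(\<lambda>k. emb {0..\<tau>} (vs k)) \<longlonglongrightarrow> emb {0..\<tau>} v" "(\<lambda>k. emb {0..\<tau>} (vs2 k)) \<longlonglongrightarrow> emb {0..\<tau>} v2"
    for vs vs2 and v v2 :: "real \<Rightarrow> complex^'p" and \<tau>
  proof -
    have m: "{0..\<tau>} \<in> sets lebesgue" by simp
    have V: "vs k \<in> L2 {0..\<tau>}" "v \<in> L2 {0..\<tau>}" "vs2 k \<in> L2 {0..\<tau>}" "v2 \<in> L2 {0..\<tau>}" for k
      using vs \<tau> by (auto intro: L2_locD)
    have Vc: "(\<lambda>t. a *s vs k t + vs2 k t) \<in> L2 {0..\<tau>}" "(\<lambda>t. a *s v t + v2 t) \<in> L2 {0..\<tau>}" for k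
      by (intro L2_add V L2_linear[OF _ bounded_linear_smult])+
    have b: "norm (emb {0..\<tau>} (\<lambda>t. a *s vs k t + vs2 k t) - emb {0..\<tau>} (\<lambda>t. a *s v t + v2 t))
        \<le> norm a * norm (emb {0..\<tau>} (vs k) - emb {0..\<tau>} v) + norm (emb {0..\<tau>} (vs2 k) - emb {0..\<tau>} v2)" for k
    proof -
      have "emb {0..\<tau>} (\<lambda>t. a *s vs k t + vs2 k t) - emb {0..\<tau>} (\<lambda>t. a *s v t + v2 t)
          = emb {0..\<tau>} (\<lambda>t. a *s (vs k t - v t) + (vs2 k t - v2 t))"
        by (subst emb_diff[OF m Vc, symmetric]) (simp add: algebra_simps)
      then show ?thesis
        using emb_smult_add_norm_le[OF m L2_diff[OF V(1)[of k] V(2)] L2_diff[OF V(3)[of k] V(4)], of a]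
        by (simp add: emb_diff[OF m V(1) V(2)] emb_diff[OF m V(3) V(4)])
    qed
    have "(\<lambda>k. norm a * norm (emb {0..\<tau>} (vs k) - emb {0..\<tau>} v) + norm (emb {0..\<tau>} (vs2 k) - emb {0..\<tau>} v2)) \<longlonglongrightarrow> norm a * 0 + 0"
      using c by (intro tendsto_intros) (simp_all add: tendsto_norm_zero_iff LIM_zero_iff)
    then have "(\<lambda>k. norm a * norm (emb {0..\<tau>} (vs k) - emb {0..\<tau>} v) + norm (emb {0..\<tau>} (vs2 k) - emb {0..\<tau>} v2)) \<longlonglongrightarrow> 0"
      by (simp only: mult_zero_right add_0)
    from Lim_null_comparison[OF always_eventually[OF allI[OF b]] this]
    have "(\<lambda>k. emb {0..\<tau>} (\<lambda>t. a *s vs k t + vs2 k t) - emb {0..\<tau>} (\<lambda>t. a *s v t + v2 t)) \<longlonglongrightarrow> 0" .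
    then show ?thesis by (simp add: LIM_zero_iff)
  qed
  have xlim: "uniform_limit {0..\<tau>} (\<lambda>k t. nrm (e (\<lambda>\<zeta>. a *s xs k t \<zeta> + xs2 k t \<zeta>) - e (\<lambda>\<zeta>. a *s x t \<zeta> + x2 t \<zeta>))) (\<lambda>_. 0) sequentially"
    if \<tau>: "\<tau> \<ge> 0" for \<tau>
  proof (rule uniform_limitI)
    fix r :: real assume r: "r > 0"
    \<comment> \<open>The denominator exceeds \<open>norm a + 1\<close>, so that the total error
      \<open>norm a * r' + r'\<close> is strictly below \<open>r\<close>.\<close>
    define r' where "r' = r / (norm a + 2)"
    have p: "norm a + 2 > 0" using norm_ge_zero[of a] by linarith
    have "norm a * r' + 2 * r' = (norm a + 2) * r'" by (simp only: distrib_right)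
    also have "\<dots> = r" unfolding r'_def times_divide_eq_right
      by (rule nonzero_mult_div_cancel_left) (use p in linarith)
    finally have sum: "norm a * r' + 2 * r' = r" .
    have r'0: "r' > 0" unfolding r'_def by (rule divide_pos_pos[OF r p])
    have r': "norm a * r' + r' < r" using sum r'0 by linarith
    show "\<forall>\<^sub>F k in sequentially. \<forall>t\<in>{0..\<tau>}.
       dist (nrm (e (\<lambda>\<zeta>. a *s xs k t \<zeta> + xs2 k t \<zeta>) - e (\<lambda>\<zeta>. a *s x t \<zeta> + x2 t \<zeta>))) 0 < r"
      using uniform_limitD[OF L(4)[OF \<tau>] r'0] uniform_limitD[OF L2(4)[OF \<tau>] r'0]
    proof eventually_elim
      case (elim k)
      show ?case
      proof
        fix t assume t: "t \<in> {0..\<tau>}"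
        then have X: "xs k t \<in> X S" "x t \<in> X S" "xs2 k t \<in> X S" "x2 t \<in> X S"
          using C(3) C2(3) L(1) L2(1) by auto
        have "e (\<lambda>\<zeta>. a *s xs k t \<zeta> + xs2 k t \<zeta>) - e (\<lambda>\<zeta>. a *s x t \<zeta> + x2 t \<zeta>)
            = e (\<lambda>\<zeta>. a *s (xs k t \<zeta> - x t \<zeta>) + (xs2 k t \<zeta> - x2 t \<zeta>))"
          by (subst e_diff[OF X_combination[OF X(1,3)] X_combination[OF X(2,4)], symmetric]) (simp add: algebra_simps)
        then have "nrm (e (\<lambda>\<zeta>. a *s xs k t \<zeta> + xs2 k t \<zeta>) - e (\<lambda>\<zeta>. a *s x t \<zeta> + x2 t \<zeta>))
            \<le> norm a * nrm (e (xs k t) - e (x t)) + nrm (e (xs2 k t) - e (x2 t))"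
          using nrm_combination_le[OF X_diff[OF X(1,2)] X_diff[OF X(3,4)], of a] by (simp add: e_diff X)
        also have "\<dots> \<le> norm a * r' + r'"
          using elim t by (intro add_mono mult_left_mono) (auto simp: less_imp_le)
        finally show "dist (nrm (e (\<lambda>\<zeta>. a *s xs k t \<zeta> + xs2 k t \<zeta>) - e (\<lambda>\<zeta>. a *s x t \<zeta> + x2 t \<zeta>))) 0 < r"
          using r' by simp
      qed
    qed
  qed
  show ?thesis
    by (subst solution_limit_iff[OF classical_solution_combination[OF cl cl2]])
      (auto intro!: X_combination L L2 L2_loc_combination xlim sig C C2)
qed

lemma generalized_solution_combination:
  assumes "generalized_solution S x u y" "generalized_solution S x2 u2 y2"
  shows "generalized_solution S (\<lambda>t \<zeta>. a *s x t \<zeta> + x2 t \<zeta>) (\<lambda>t. a *s u t + u2 t) (\<lambda>t. a *s y t + y2 t)"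
proof -
  obtain xs us ys where 1: "\<And>k. classical_solution S (xs k) (us k) (ys k)" "solution_limit S xs us ys x u y"
    using assms(1) unfolding generalized_solution_def by blast
  obtain xs2 us2 ys2 where 2: "\<And>k. classical_solution S (xs2 k) (us2 k) (ys2 k)" "solution_limit S xs2 us2 ys2 x2 u2 y2"
    using assms(2) unfolding generalized_solution_def by blast
  show ?thesis
    unfolding generalized_solution_def
    by (rule exI[of _ "\<lambda>k t \<zeta>. a *s xs k t \<zeta> + xs2 k t \<zeta>"], rule exI[of _ "\<lambda>k t. a *s us k t + us2 k t"],
        rule exI[of _ "\<lambda>k t. a *s ys k t + ys2 k t"])
      (intro conjI allI classical_solution_combination 1 2 solution_limit_combination)
qed

lemma generalized_solutionD:
  assumes "generalized_solution S x u y"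
  shows "\<And>t. t \<ge> 0 \<Longrightarrow> x t \<in> X S" "u \<in> L2_loc" "y \<in> L2_loc"
  using assms unfolding generalized_solution_def solution_limit_def by auto

text \<open>The derivative of stored minus supplied energy is the defect in the power balance, so
  its sign is read off from the estimates for \<open>ip (e x) (e (opL S x))\<close>.\<close>

lemma energy_derivative:
  assumes cl: "classical_solution S x u y" and s: "s \<ge> 0"
  shows "((\<lambda>t. ip (e (x t)) (e (x t)) - integral {0..t} (\<lambda>s. 2 * (u s \<bullet> y s))) has_real_derivative
     2 * ip (e (x s)) (e (opL S (x s))) - 2 * (opG S (x s) \<bullet> opK S (x s))) (at s within {0..})"
proof -
  note C = cl[unfolded classical_solution_iff]
  have c: "continuous_on {0..} (\<lambda>s. 2 * (u s \<bullet> y s))" using C by (intro continuous_intros) auto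
  show ?thesis
    using integral_has_vector_derivative_atLeast[OF c s] C s
    by (intro DERIV_diff has_derivative_ip_self) (auto simp: has_real_derivative_iff_has_vector_derivative)
qed

end

section \<open>Energy balance and closed-loop solutions\<close>

context phs_space
begin

text \<open>Every term is continuous under the convergence defining generalized solutions. The
  closed set \<open>A\<close> is a parameter so that both directions of the energy balance share
  this passage to the limit.\<close>

lemma generalized_energy_limit:
  assumes g: "generalized_solution S x u y" and t: "t \<ge> 0"
    and closed: "closed A"
    and A: "\<And>x u y. classical_solution S x u y \<Longrightarrow>
      ip (e (x t)) (e (x t)) + N t u + N t y - ip (e (x 0)) (e (x 0)) - N t (\<lambda>s. u s + y s) \<in> A"
  shows "ip (e (x t)) (e (x t)) + N t u + N t y - ip (e (x 0)) (e (x 0)) - N t (\<lambda>s. u s + y s) \<in> A"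
proof -
  obtain xs us ys where cl: "\<And>k. classical_solution S (xs k) (us k) (ys k)" and l: "solution_limit S xs us ys x u y"
    using g unfolding generalized_solution_def by blast
  note L = solution_limitD[OF cl l] and C = classical_L2_loc[OF cl]
  have add: "emb {0..t} (\<lambda>s. us k s + ys k s) = emb {0..t} (us k) + emb {0..t} (ys k)" for k
    using C(1)[of k] C(2)[of k] t by (intro emb_add L2_locD) auto
  have add': "emb {0..t} (\<lambda>s. u s + y s) = emb {0..t} u + emb {0..t} y"
    using L(2,3) t by (intro emb_add L2_locD) auto
  have "(\<lambda>k. ip (e (xs k t)) (e (xs k t)) + N t (us k) + N t (ys k) - ip (e (xs k 0)) (e (xs k 0))
       - N t (\<lambda>s. us k s + ys k s))
    \<longlonglongrightarrow> ip (e (x t)) (e (x t)) + N t u + N t y - ip (e (x 0)) (e (x 0)) - N t (\<lambda>s. u s + y s)"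
    unfolding add add' by (intro tendsto_intros ip.tendsto L t order_refl)
  from closed_sequentially[OF closed _ this] A[OF cl] show ?thesis by blast
qed

lemma energy_ge:
  assumes skew: "P0_skew_adjoint S"
    and eq: "\<forall>g. WB2 S *v g = 0 \<longrightarrow> 2 * Re (cinner (WB1 S *v g) (WC S *v g)) = Re (cinner (Xi *v g) g)"
    and g: "generalized_solution S x u y" and t: "t \<ge> 0"
  shows "ip (e (x 0)) (e (x 0)) + N t (\<lambda>s. u s + y s) \<le> ip (e (x t)) (e (x t)) + N t u + N t y"
proof -
  have "ip (e (x t)) (e (x t)) + N t u + N t y - ip (e (x 0)) (e (x 0)) - N t (\<lambda>s. u s + y s) \<in> {0..}"
  proof (rule generalized_energy_limit[OF g t closed_atLeast])
    fix x u y assume cl: "classical_solution S x u y"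
    note C = cl[unfolded classical_solution_iff]
    let ?f = "\<lambda>t. ip (e (x t)) (e (x t)) - integral {0..t} (\<lambda>s. 2 * (u s \<bullet> y s))"
    have "- ?f t \<le> - ?f 0"
    proof (rule derivative_nonpos_imp_le[OF DERIV_minus[OF energy_derivative[OF cl]] _ t])
      show "- (2 * ip (e (x s)) (e (opL S (x s))) - 2 * (opG S (x s) \<bullet> opK S (x s))) \<le> 0" if "0 \<le> s" for s
        using ip_opL_eq[OF skew eq, of "x s"] C that by simp
    qed
    then show "ip (e (x t)) (e (x t)) + N t u + N t y - ip (e (x 0)) (e (x 0)) - N t (\<lambda>s. u s + y s) \<in> {0..}"
      using twice_inner_integral[of u y t] C t by simp
  qed
  then show ?thesis by simp
qed

end

context passive_phs
begin

lemma energy_le: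
  assumes g: "generalized_solution S x u y" and t: "t \<ge> 0"
  shows "ip (e (x t)) (e (x t)) + N t u + N t y \<le> ip (e (x 0)) (e (x 0)) + N t (\<lambda>s. u s + y s)"
proof -
  have "ip (e (x t)) (e (x t)) + N t u + N t y - ip (e (x 0)) (e (x 0)) - N t (\<lambda>s. u s + y s) \<in> {..0}"
  proof (rule generalized_energy_limit[OF g t closed_atMost])
    fix x u y assume cl: "classical_solution S x u y"
    note C = cl[unfolded classical_solution_iff]
    let ?f = "\<lambda>t. ip (e (x t)) (e (x t)) - integral {0..t} (\<lambda>s. 2 * (u s \<bullet> y s))"
    have "?f t \<le> ?f 0"
    proof (rule derivative_nonpos_imp_le[OF energy_derivative[OF cl] _ t])
      show "2 * ip (e (x s)) (e (opL S (x s))) - 2 * (opG S (x s) \<bullet> opK S (x s)) \<le> 0" if "0 \<le> s" for s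
        using ip_opL_le[of "x s"] C that by simp
    qed
    then show "ip (e (x t)) (e (x t)) + N t u + N t y - ip (e (x 0)) (e (x 0)) - N t (\<lambda>s. u s + y s) \<in> {..0}"
      using twice_inner_integral[of u y t] C t by simp
  qed
  then show ?thesis by simp
qed

end

context phs_space
begin

lemma classical_imp_generalized:
  assumes cl: "classical_solution S x u y" shows "generalized_solution S x u y"
proof -
  note C = classical_L2_loc[OF cl]
  have "solution_limit S (\<lambda>_. x) (\<lambda>_. u) (\<lambda>_. y) x u y"
    by (rule iffD2[OF solution_limit_iff[OF cl _ C(1,2)]])
      (use C(3) in \<open>auto simp: ip.zero_left intro!: uniform_limit_const\<close>)
  then show ?thesis using cl unfolding generalized_solution_def
    by (intro exI[of _ "\<lambda>_. x"] exI[of _ "\<lambda>_. u"] exI[of _ "\<lambda>_. y"]) simp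
qed

text \<open>The projection onto classes supported in the interval. States are exactly the elements
  of its range, whereas \<open>rep F\<close> for a general class carries information off the
  interval.\<close>

definition cut :: "'n l2 \<Rightarrow> 'n l2" where "cut F = e (rep F)"

lemma AE_rep_cut: "AE t in lebesgue. rep (cut F) t = (if t \<in> I then rep F t else 0)"
  unfolding cut_def by (rule AE_rep_emb[OF I_sets]) simp

lemma cut_e: "f \<in> X S \<Longrightarrow> cut (e f) = e f"
  by (simp add: cut_def e_rep_e)

lemma bounded_linear_cut: "bounded_linear cut"
proof (rule bounded_linear_intro[where K=1])
  show "cut (F + G) = cut F + cut G" for F G
    by (rule l2_eqI) (use AE_rep_cut[of F] AE_rep_cut[of G] AE_rep_cut[of "F + G"] AE_rep_add[of F G]
      AE_rep_add[of "cut F" "cut G"] in eventually_elim, simp)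
  show "cut (r *\<^sub>R F) = r *\<^sub>R cut F" for r F
    by (rule l2_eqI) (use AE_rep_cut[of F] AE_rep_cut[of "r *\<^sub>R F"] AE_rep_scaleR[of r F]
      AE_rep_scaleR[of r "cut F"] in eventually_elim, simp)
  show "norm (cut F) \<le> norm F * 1" for F
  proof -
    have "(norm (cut F))\<^sup>2 \<le> (norm F)\<^sup>2"
      unfolding norm_l2_power2
      by (intro integral_mono_AE L2_UNIV_integrable rep_L2) (use AE_rep_cut[of F] in eventually_elim, simp)
    then show ?thesis by (simp add: power2_le_iff_abs_le)
  qed
qed

lemma ip_cut_le: "ip (cut F) (cut F) \<le> ip F F"
  unfolding ip_integral
proof (intro integral_mono_AE ip_integrable)
  have nn: "0 \<le> (Hm t *v v) \<bullet> v" for t v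
    using Hm_coercive[of v t] c_pos by (meson order_trans mult_nonneg_nonneg less_imp_le zero_le_power2)
  show "AE t in lebesgue. (Hm t *v rep (cut F) t) \<bullet> rep (cut F) t \<le> (Hm t *v rep F t) \<bullet> rep F t"
    using AE_rep_cut[of F] by eventually_elim (simp add: nn)
qed

lemma e_rep_add: "e (rep (F + G)) = e (rep F) + e (rep G)"
  using linear_add[OF bounded_linear.linear[OF bounded_linear_cut]] by (simp add: cut_def)

end

context passive_phs
begin

text \<open>The trace is not bounded by the state norm, but in closed loop the dissipation
  inequality controls the signals by state and derivative together. Applied to a difference of
  states, it makes signals inherit continuity in time.\<close>

lemma closed_loop_signal_bound:
  assumes f: "f \<in> DL S" "opG S f + opK S f = 0" and g: "g \<in> DL S" "opG S g + opK S g = 0"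
  shows "(norm (opG S f - opG S g))\<^sup>2 + (norm (opK S f - opK S g))\<^sup>2
    \<le> 2 * (nrm (e f - e g) * nrm (e (opL S f) - e (opL S g)))"
proof -
  let ?d = "\<lambda>t. (-1) *s g t + f t"
  have h: "has_effort S g" "has_effort S f" using f g by (auto intro: DL_has_effort)
  have neg: "(-1) *s v + w = w - v" for v w :: "complex^'k"
    by (simp add: vec_eq_iff)
  have d: "?d \<in> DL S" by (rule DL_combination[OF ord g(1) f(1)])
  have G: "opG S ?d = opG S f - opG S g" and K: "opK S ?d = opK S f - opK S g"
    by (simp_all only: opG_def opK_def trace_combination[OF ord h] matrix_vector_right_distrib
        matrix_vector_mult_smult) (simp_all only: neg)
  have "opK S f = - opG S f" "opK S g = - opG S g" using f(2) g(2) by (simp_all add: add_eq_0_iff)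
  then have "opG S ?d + opK S ?d = 0" unfolding G K by simp
  note b = closed_loop_bound[OF d this]
  have ed: "e ?d = e f - e g"
    unfolding neg by (rule e_diff) (use f g DL_X in auto)
  have "e (opL S ?d) = e (\<lambda>t. (-1) *s opL S g t + opL S f t)"
    by (rule iffD1[OF X_eq_iff[OF DL_opL_X[OF d] X_combination[OF DL_opL_X[OF g(1)] DL_opL_X[OF f(1)]]]
          opL_combination[OF ord h]])
  also have "\<dots> = e (opL S f) - e (opL S g)"
    unfolding neg by (rule e_diff) (use f g DL_opL_X in auto)
  finally have "2 * ip (e f - e g) (e (opL S f) - e (opL S g)) + (norm (opG S f - opG S g))\<^sup>2 + (norm (opK S f - opK S g))\<^sup>2 \<le> 0"
    using b unfolding G K ed by simp
  then show ?thesis using abs_ip_le[of "e f - e g" "e (opL S f) - e (opL S g)"] by simp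
qed

lemma continuous_on_from_bound:
  fixes u :: "real \<Rightarrow> 'v::real_normed_vector"
  assumes a: "continuous_on {0..} a" and b: "continuous_on {0..} b"
    and le: "\<And>s t. s \<ge> 0 \<Longrightarrow> t \<ge> 0 \<Longrightarrow> (norm (u s - u t))\<^sup>2 \<le> 2 * (nrm (a s - a t) * nrm (b s - b t))"
  shows "continuous_on {0..} u"
  unfolding continuous_on_def
proof
  fix t :: real assume t: "t \<in> {0..}"
  have lim: "((\<lambda>s. nrm (a s - a t)) \<longlongrightarrow> 0) (at t within {0..})" "((\<lambda>s. nrm (b s - b t)) \<longlongrightarrow> 0) (at t within {0..})"
    using a b t unfolding tendsto_sqrt_ip_iff LIM_zero_iff by (auto simp: continuous_on_def)
  have "((\<lambda>s. 2 * (nrm (a s - a t) * nrm (b s - b t))) \<longlongrightarrow> 2 * (0 * 0)) (at t within {0..})"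
    by (intro tendsto_intros lim)
  then have lim2: "((\<lambda>s. 2 * (nrm (a s - a t) * nrm (b s - b t))) \<longlongrightarrow> 0) (at t within {0..})" by simp
  have ev: "\<forall>\<^sub>F s in at t within {0..}. norm ((norm (u s - u t))\<^sup>2) \<le> 2 * (nrm (a s - a t) * nrm (b s - b t))"
    unfolding eventually_at_filter by (rule always_eventually) (use le t in auto)
  have "((\<lambda>s. (norm (u s - u t))\<^sup>2) \<longlongrightarrow> 0) (at t within {0..})"
    by (rule Lim_null_comparison[OF ev lim2])
  then show "(u \<longlongrightarrow> u t) (at t within {0..})"
    unfolding norm_power2_tendsto_0_iff LIM_zero_iff .
qed

text \<open>The abstract flow lives on all classes; \<open>cut\<close> turns it into a curve of
  states. The flow \<open>\<xi>\<close> and its derivative are returned along with the solution,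
  since the comparison with the given semigroup works at the level of \<Gamma>.\<close>

lemma classical_closed_loop_exists:
  assumes "F \<in> cl.smooth_domain"
  shows "\<exists>\<xi> v x. \<xi> 0 = F \<and> (\<forall>t\<ge>0. (\<xi> t, v t) \<in> \<Gamma> \<and> (\<xi> has_vector_derivative v t) (at t within {0..})) \<and>
    continuous_on {0..} v \<and> x = (\<lambda>t. rep (\<xi> t)) \<and>
    classical_solution S x (\<lambda>t. opG S (x t)) (\<lambda>t. opK S (x t)) \<and>
    (\<forall>t\<ge>0. opG S (x t) + opK S (x t) = 0)"
proof -
  obtain \<xi> v where \<xi>: "\<xi> 0 = F" "continuous_on {0..} v"
    "\<And>t. t \<ge> 0 \<Longrightarrow> (\<xi> t, v t) \<in> \<Gamma>" "\<And>t. t \<ge> 0 \<Longrightarrow> (\<xi> has_vector_derivative v t) (at t within {0..})"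
    using assms cl.classical_flow_exists unfolding cl.smooth_domain_def by blast
  define x where "x t = rep (\<xi> t)" for t
  interpret cut: bounded_linear cut by (rule bounded_linear_cut)
  have g: "(x t, rep (v t)) \<in> closed_loop_graph S" if "t \<ge> 0" for t
    using \<xi>(3)[OF that] by (simp add: \<Gamma>_def x_def)
  have D: "x t \<in> DL S" "opG S (x t) + opK S (x t) = 0" "X_eq S (rep (v t)) (opL S (x t))" if "t \<ge> 0" for t
    using g[OF that] by (auto simp: closed_loop_graph_def)
  have ex: "e (x t) = cut (\<xi> t)" for t by (simp add: x_def cut_def)
  have eL: "e (opL S (x t)) = cut (v t)" if "t \<ge> 0" for t
    using D(3)[OF that] X_eq_iff[OF rep_X DL_opL_X[OF D(1)[OF that]]] by (simp add: cut_def)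
  have der: "((\<lambda>t. e (x t)) has_vector_derivative e (opL S (x t))) (at t within {0..})" if "t \<ge> 0" for t
    unfolding ex eL[OF that] by (rule cut.has_vector_derivative[OF \<xi>(4)[OF that]])
  have cx: "continuous_on {0..} (\<lambda>t. e (x t))"
    using der unfolding continuous_on_eq_continuous_within by (auto intro: has_vector_derivative_continuous)
  have cL: "continuous_on {0..} (\<lambda>t. e (opL S (x t)))"
    by (rule continuous_on_eq[OF cut.continuous_on[OF \<xi>(2)]]) (simp add: eL)
  have "continuous_on {0..} (\<lambda>t. opG S (x t))"
    by (rule continuous_on_from_bound[OF cx cL], rule order_trans[OF _ closed_loop_signal_bound]) (use D in auto)
  moreover have "continuous_on {0..} (\<lambda>t. opK S (x t))"
    by (rule continuous_on_from_bound[OF cx cL], rule order_trans[OF _ closed_loop_signal_bound]) (use D in auto)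
  ultimately have "classical_solution S x (\<lambda>t. opG S (x t)) (\<lambda>t. opK S (x t))"
    unfolding classical_solution_iff using D der cL by auto
  moreover have "x = (\<lambda>t. rep (\<xi> t))" by (simp add: x_def fun_eq_iff)
  ultimately show ?thesis using \<xi> D(2) by blast
qed

text \<open>Closed-loop solutions depend continuously on the initial state, with the signals measured
  in the norm of the whole half line; so they extend from smooth to arbitrary initial states.\<close>

definition closed_loop_limit ::
  "'n l2 \<Rightarrow> (nat \<Rightarrow> real \<Rightarrow> 'n l2) \<Rightarrow> (real \<Rightarrow> real \<Rightarrow> complex^'n) \<Rightarrow> (real \<Rightarrow> complex^'p) \<Rightarrow> (real \<Rightarrow> complex^'p) \<Rightarrow> bool" where
  "closed_loop_limit F \<xi> x u y \<longleftrightarrow> closed_loop_solution S x u y \<and> e (x 0) = cut F \<and> u \<in> L2 {0..} \<and> y \<in> L2 {0..} \<and>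
    (\<forall>t. y t = - u t) \<and>
    (\<forall>k. \<xi> k 0 \<in> cl.smooth_domain \<and> (\<exists>v. continuous_on {0..} v \<and> (\<forall>t\<ge>0. (\<xi> k t, v t) \<in> \<Gamma> \<and> (\<xi> k has_vector_derivative v t) (at t within {0..})))) \<and>
    (\<forall>r>0. \<exists>k. \<forall>t\<ge>0. nrm (cut (\<xi> k t) - e (x t)) < r)"

text \<open>The approximating flows are kept in the conclusion because they approach
  \<open>x\<close> uniformly over all nonnegative times: that uniformity is what lets their decay
  pass to \<open>x\<close>.\<close>

lemma closed_loop_solution_exists: "\<exists>\<xi> x u y. closed_loop_limit F \<xi> x u y"
proof -
  obtain G where G: "\<And>k. G k \<in> cl.smooth_domain" "G \<longlonglongrightarrow> F"
    using cl.dense_smooth_domain by (metis UNIV_I closure_sequential)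
  have "\<exists>\<xi> v x. \<xi> 0 = G k \<and> (\<forall>t\<ge>0. (\<xi> t, v t) \<in> \<Gamma> \<and> (\<xi> has_vector_derivative v t) (at t within {0..})) \<and>
    continuous_on {0..} v \<and> x = (\<lambda>t. rep (\<xi> t)) \<and>
    classical_solution S x (\<lambda>t. opG S (x t)) (\<lambda>t. opK S (x t)) \<and>
    (\<forall>t\<ge>0. opG S (x t) + opK S (x t) = 0)" for k
    by (rule classical_closed_loop_exists[OF G(1)])
  then obtain \<xi> v xs where A: "\<And>k. \<xi> k 0 = G k"
    "\<And>k t. t \<ge> 0 \<Longrightarrow> (\<xi> k t, v k t) \<in> \<Gamma> \<and> (\<xi> k has_vector_derivative v k t) (at t within {0..})"
    "\<And>k. continuous_on {0..} (v k)" "\<And>k. xs k = (\<lambda>t. rep (\<xi> k t))"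
    "\<And>k. classical_solution S (xs k) (\<lambda>t. opG S (xs k t)) (\<lambda>t. opK S (xs k t))"
    "\<And>k t. t \<ge> 0 \<Longrightarrow> opG S (xs k t) + opK S (xs k t) = 0"
    by metis
  define us where "us k t = opG S (xs k t)" for k t
  define ys where "ys k t = opK S (xs k t)" for k t
  have cls: "classical_solution S (xs k) (us k) (ys k)" for k using A(5)[of k] by (simp add: us_def[abs_def] ys_def[abs_def])
  have ex: "e (xs k t) = cut (\<xi> k t)" for k t by (simp add: A(4) cut_def)
  have uy: "ys k t = - us k t" if "t \<ge> 0" for k t using A(6)[OF that, of k] by (simp add: us_def ys_def add_eq_0_iff)
  note C = classical_L2_loc[OF cls]
  interpret cut: bounded_linear cut by (rule bounded_linear_cut)
  \<comment> \<open>The energy estimate for the difference of two approximations. In closed loop the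
    sum of the signals vanishes, so the initial distance bounds state and signal distances at once,
    independently of \<open>t\<close>.\<close>
  have en: "ip (e (xs k t) - e (xs j t)) (e (xs k t) - e (xs j t)) + N t (\<lambda>s. us k s - us j s) + N t (\<lambda>s. ys k s - ys j s)
      \<le> ip (cut (G k - G j)) (cut (G k - G j))" if t: "t \<ge> 0" for k j t
  proof -
    have neg: "(-1) *s v + w = w - v" for v w :: "complex^'k" by (simp add: vec_eq_iff)
    have g: "generalized_solution S (\<lambda>t \<zeta>. xs k t \<zeta> - xs j t \<zeta>) (\<lambda>t. us k t - us j t) (\<lambda>t. ys k t - ys j t)"
      using generalized_solution_combination[OF classical_imp_generalized[OF cls[of j]] classical_imp_generalized[OF cls[of k]], of "-1"]
      unfolding neg .
    have z: "N t (\<lambda>s. us k s - us j s + (ys k s - ys j s)) = 0"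
    proof -
      have "emb {0..t} (\<lambda>s. us k s - us j s + (ys k s - ys j s)) = emb {0..t} (\<lambda>s. 0)"
        unfolding emb_def by (rule arg_cong[where f=cls]) (auto simp: uy)
      also have "\<dots> = 0" by simp
      finally show ?thesis by simp
    qed
    have ed: "e (\<lambda>\<zeta>. xs k t \<zeta> - xs j t \<zeta>) = e (xs k t) - e (xs j t)" if "t \<ge> 0" for t
      by (rule e_diff) (use C that in auto)
    show ?thesis
      using energy_le[OF g t] by (simp only: z ed[OF t] ed[OF order_refl] ex A(1) cut.diff[symmetric])
  qed
  have en1: "ip (e (xs k t)) (e (xs k t)) + N t (us k) + N t (ys k) \<le> ip (cut (G k)) (cut (G k))" if t: "t \<ge> 0" for k t
  proof -
    have "emb {0..t} (\<lambda>s. us k s + ys k s) = emb {0..t} (\<lambda>s. 0)"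
      unfolding emb_def by (rule arg_cong[where f=cls]) (auto simp: uy)
    also have "\<dots> = 0" by simp
    finally show ?thesis using energy_le[OF classical_imp_generalized[OF cls[of k]] t] by (simp add: ex A(1))
  qed
  have half: "us k \<in> L2 {0..}" for k
    by (rule L2_halflineI(1)[OF C(1), of _ "ip (cut (G k)) (cut (G k))"])
      (use en1[of _ k] in \<open>smt (verit) nonneg zero_le_power2\<close>)
  have dnorm: "(norm (emb {0..} (us k) - emb {0..} (us j)))\<^sup>2 \<le> ip (cut (G k - G j)) (cut (G k - G j))" for k j
  proof -
    have "(norm (emb {0..} (\<lambda>s. us k s - us j s)))\<^sup>2 \<le> ip (cut (G k - G j)) (cut (G k - G j))"
    proof (rule L2_halflineI(2))
      show "(\<lambda>s. us k s - us j s) \<in> L2_loc" by (intro L2_halfline_loc L2_diff half)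
      show "N t (\<lambda>s. us k s - us j s) \<le> ip (cut (G k - G j)) (cut (G k - G j))" if "0 \<le> t" for t
        using en[OF that, of k j] by (smt (verit) nonneg zero_le_power2)
    qed
    then show ?thesis by (simp add: emb_diff half)
  qed
  have small: "\<exists>M. \<forall>k\<ge>M. \<forall>j\<ge>M. ip (cut (G k - G j)) (cut (G k - G j)) < r" if r: "r > 0" for r
  proof -
    obtain B where B: "B > 0" "\<And>x. ip x x \<le> B * (norm x)\<^sup>2" using upper_bound by blast
    have "sqrt (r / B) > 0" using r B by simp
    then obtain M where M: "\<And>k j. k \<ge> M \<Longrightarrow> j \<ge> M \<Longrightarrow> norm (G k - G j) < sqrt (r / B)"
      using LIMSEQ_imp_Cauchy[OF G(2)] unfolding Cauchy_iff by blast
    have "ip (cut (G k - G j)) (cut (G k - G j)) < r" if "k \<ge> M" "j \<ge> M" for k j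
    proof -
      have "(norm (G k - G j))\<^sup>2 < (sqrt (r / B))\<^sup>2"
        using M[OF that] by (intro power_strict_mono) auto
      then have "B * (norm (G k - G j))\<^sup>2 < r" using r B(1) by (simp add: field_simps)
      then show ?thesis using ip_cut_le[of "G k - G j"] B(2)[of "G k - G j"] by linarith
    qed
    then show ?thesis by blast
  qed
  have CauchyI': "Cauchy w" if le: "\<And>k j. c' * (norm (w k - w j))\<^sup>2 \<le> ip (cut (G k - G j)) (cut (G k - G j))" and c': "c' > 0"
    for w :: "nat \<Rightarrow> 'v::real_normed_vector" and c' :: real
  proof (rule CauchyI)
    fix r :: real assume r: "r > 0"
    obtain M where M: "\<And>k j. k \<ge> M \<Longrightarrow> j \<ge> M \<Longrightarrow> ip (cut (G k - G j)) (cut (G k - G j)) < c' * r\<^sup>2"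
      using small[of "c' * r\<^sup>2"] r c' by auto
    have "norm (w k - w j) < r" if kj: "k \<ge> M" "j \<ge> M" for k j
    proof -
      have "c' * (norm (w k - w j))\<^sup>2 < c' * r\<^sup>2" using M[OF kj] le[of k j] by linarith
      then have "(norm (w k - w j))\<^sup>2 < r\<^sup>2" using c' by simp
      then show ?thesis using r by (simp add: power_less_imp_less_base)
    qed
    then show "\<exists>M. \<forall>m\<ge>M. \<forall>n\<ge>M. norm (w m - w n) < r" by blast
  qed
  have "Cauchy (\<lambda>k. emb {0..} (us k))"
    by (rule CauchyI'[of 1]) (use dnorm in auto)
  then obtain U where U: "(\<lambda>k. emb {0..} (us k)) \<longlonglongrightarrow> U" by (auto simp: Cauchy_convergent_iff convergent_def)
  define u where "u = rep U"
  \<comment> \<open>Chosen as an exact negative at every time, so that the sum of the signals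
    vanishes identically and not only almost everywhere.\<close>
  define y where "y t = - u t" for t
  have uL: "u \<in> L2 {0..}" by (simp add: u_def)
  have yL: "y \<in> L2 {0..}" unfolding y_def[abs_def] by (rule L2_minus[OF uL])
  have "\<exists>X. (\<lambda>k. e (xs k t)) \<longlonglongrightarrow> X" if t: "t \<ge> 0" for t
  proof -
    have "Cauchy (\<lambda>k. e (xs k t))"
    proof (rule CauchyI'[OF _ c_pos])
      show "c * (norm (e (xs k t) - e (xs j t)))\<^sup>2 \<le> ip (cut (G k - G j)) (cut (G k - G j))" for k j
        using en[OF t, of k j] coercive[of "e (xs k t) - e (xs j t)"] by (smt (verit) zero_le_power2)
    qed
    then show ?thesis by (auto simp: Cauchy_convergent_iff convergent_def)
  qed
  then obtain X0 where X0: "\<And>t. t \<ge> 0 \<Longrightarrow> (\<lambda>k. e (xs k t)) \<longlonglongrightarrow> X0 t" by metis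
  define x where "x t = rep (X0 t)" for t
  have exX: "e (x t) = X0 t" if "t \<ge> 0" for t
  proof -
    have "(\<lambda>k. cut (e (xs k t))) \<longlonglongrightarrow> cut (X0 t)" by (rule cut.tendsto[OF X0[OF that]])
    then have "(\<lambda>k. e (xs k t)) \<longlonglongrightarrow> cut (X0 t)" using C(3) that by (simp add: cut_e)
    then show ?thesis using X0[OF that] LIMSEQ_unique by (auto simp: x_def cut_def)
  qed
  have xX: "x t \<in> X S" for t by (simp add: x_def)
  have unif: "\<exists>M. \<forall>k\<ge>M. \<forall>t\<ge>0. nrm (e (xs k t) - e (x t)) < r" if r: "r > 0" for r
  proof -
    obtain M where M: "\<And>k j. k \<ge> M \<Longrightarrow> j \<ge> M \<Longrightarrow> ip (cut (G k - G j)) (cut (G k - G j)) < (r/2)\<^sup>2"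
      using small[of "(r/2)\<^sup>2"] r by auto
    have "nrm (e (xs k t) - e (x t)) < r" if k: "k \<ge> M" and t: "t \<ge> 0" for k t
    proof -
      have "(\<lambda>j. ip (e (xs k t) - e (xs j t)) (e (xs k t) - e (xs j t))) \<longlonglongrightarrow> ip (e (xs k t) - e (x t)) (e (xs k t) - e (x t))"
        unfolding exX[OF t] by (intro ip.tendsto tendsto_intros X0 t)
      moreover have "\<exists>M. \<forall>j\<ge>M. ip (e (xs k t) - e (xs j t)) (e (xs k t) - e (xs j t)) \<le> (r/2)\<^sup>2"
        using en[OF t, of k] M[OF k] by (intro exI[of _ M]) (smt (verit) zero_le_power2)
      ultimately have "ip (e (xs k t) - e (x t)) (e (xs k t) - e (x t)) \<le> (r/2)\<^sup>2"
        by (rule LIMSEQ_le_const2)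
      then have "nrm (e (xs k t) - e (x t)) \<le> r/2" using r by (intro real_le_lsqrt) auto
      then show ?thesis using r by simp
    qed
    then show ?thesis by blast
  qed
  have emb0: "(\<lambda>k. emb {0..\<tau>} (us k)) \<longlonglongrightarrow> emb {0..\<tau>} u" if \<tau>: "\<tau> \<ge> 0" for \<tau>
  proof -
    \<comment> \<open>The limit class might a priori have mass at negative times. Truncation to the
      half line is continuous and fixes all approximants, hence fixes the limit.\<close>
    have eu: "emb {0..} u = U"
    proof -
      have "bounded_linear (\<lambda>F :: 'p l2. emb {0..} (rep F))"
      proof (rule bounded_linear_intro[where K=1])
        fix F G :: "'p l2" and r :: real
        have m: "{0::real..} \<in> sets lebesgue" by simp
        have *: "AE t in lebesgue. rep (emb {0..} (rep F)) t = (if t \<in> {0..} then rep F t else 0)" for F :: "'p l2"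
          by (rule AE_rep_emb[OF m]) simp
        show "emb {0..} (rep (F + G)) = emb {0..} (rep F) + emb {0..} (rep G)"
          by (rule l2_eqI) (use *[of F] *[of G] *[of "F + G"] AE_rep_add[of F G]
            AE_rep_add[of "emb {0..} (rep F)" "emb {0..} (rep G)"] in eventually_elim, simp)
        show "emb {0..} (rep (r *\<^sub>R F)) = r *\<^sub>R emb {0..} (rep F)"
          by (rule l2_eqI) (use *[of F] *[of "r *\<^sub>R F"] AE_rep_scaleR[of r F]
            AE_rep_scaleR[of r "emb {0..} (rep F)"] in eventually_elim, simp)
        have "(norm (emb {0..} (rep F)))\<^sup>2 \<le> (norm F)\<^sup>2"
          unfolding norm_l2_power2
          by (intro integral_mono_AE L2_UNIV_integrable rep_L2) (use *[of F] in eventually_elim, simp)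
        then show "norm (emb {0..} (rep F)) \<le> norm F * 1" by (simp add: power2_le_iff_abs_le)
      qed
      then have "(\<lambda>k. emb {0..} (rep (emb {0..} (us k)))) \<longlonglongrightarrow> emb {0..} (rep U)"
        by (rule bounded_linear.tendsto[OF _ U])
      moreover have "emb {0..} (rep (emb {0..} (us k))) = emb {0..} (us k)" for k
        using emb_eq_iff[of "{0..}" "rep (emb {0..} (us k))" "us k"] AE_rep_emb_on[of "{0..}" "us k"] half by simp
      ultimately have "(\<lambda>k. emb {0..} (us k)) \<longlonglongrightarrow> emb {0..} (rep U)" by simp
      then show ?thesis using U LIMSEQ_unique unfolding u_def by blast
    qed
    have le: "norm (emb {0..\<tau>} (us k) - emb {0..\<tau>} u) \<le> norm (emb {0..} (us k) - U)" for k
    proof -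
      have "us k \<in> L2 {0..\<tau>}" "u \<in> L2 {0..\<tau>}" using half uL \<tau> by (auto intro: L2_locD L2_halfline_loc)
      then have "(norm (emb {0..\<tau>} (us k) - emb {0..\<tau>} u))\<^sup>2 = N \<tau> (\<lambda>s. us k s - u s)" by (simp add: emb_diff)
      also have "\<dots> \<le> (norm (emb {0..} (\<lambda>s. us k s - u s)))\<^sup>2" by (rule N_mono[OF L2_diff[OF half uL]]) auto
      also have "\<dots> = (norm (emb {0..} (us k) - U))\<^sup>2" by (simp add: emb_diff half uL eu)
      finally show ?thesis by (simp add: power2_le_iff_abs_le)
    qed
    have "(\<lambda>k. norm (emb {0..} (us k) - U)) \<longlonglongrightarrow> 0" using U by (simp add: tendsto_norm_zero_iff LIM_zero_iff)
    from Lim_null_comparison[OF always_eventually[OF allI[OF le]] this] show ?thesis by (simp add: LIM_zero_iff)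
  qed
  have emb_y: "emb {0..\<tau>} (ys k) = - emb {0..\<tau>} (us k)" if \<tau>: "\<tau> \<ge> 0" for \<tau> k
  proof -
    have "emb {0..\<tau>} (ys k) = emb {0..\<tau>} (\<lambda>t. (-1) *\<^sub>R us k t)"
      unfolding emb_def by (rule arg_cong[where f=cls]) (auto simp: uy)
    also have "\<dots> = (-1) *\<^sub>R emb {0..\<tau>} (us k)" by (rule emb_scaleR) (use C(1) \<tau> in \<open>auto intro: L2_locD\<close>)
    finally show ?thesis by simp
  qed
  have emb_y': "emb {0..\<tau>} y = - emb {0..\<tau>} u" if \<tau>: "\<tau> \<ge> 0" for \<tau>
    using emb_scaleR[of "{0..\<tau>}" u "-1"] L2_locD[OF L2_halfline_loc[OF uL] \<tau>] by (simp add: y_def[abs_def])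
  have "solution_limit S xs us ys x u y"
  proof (rule iffD2[OF solution_limit_iff[OF cls _ L2_halfline_loc[OF uL] L2_halfline_loc[OF yL]]]; (intro allI impI conjI)?)
    show "x t \<in> X S" for t by (rule xX)
  next
    fix \<tau> :: real assume \<tau>: "\<tau> \<ge> 0"
    show "uniform_limit {0..\<tau>} (\<lambda>k t. nrm (e (xs k t) - e (x t))) (\<lambda>_. 0) sequentially"
    proof (rule uniform_limitI)
      fix r :: real assume "r > 0"
      then obtain M where "\<forall>k\<ge>M. \<forall>t\<ge>0. nrm (e (xs k t) - e (x t)) < r" using unif by blast
      then show "\<forall>\<^sub>F k in sequentially. \<forall>t\<in>{0..\<tau>}. dist (nrm (e (xs k t) - e (x t))) 0 < r"
        by (intro eventually_sequentiallyI[of M]) auto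
    qed
    show "(\<lambda>k. emb {0..\<tau>} (us k)) \<longlonglongrightarrow> emb {0..\<tau>} u" by (rule emb0[OF \<tau>])
    show "(\<lambda>k. emb {0..\<tau>} (ys k)) \<longlonglongrightarrow> emb {0..\<tau>} y"
      unfolding emb_y[OF \<tau>] emb_y'[OF \<tau>] by (rule tendsto_minus[OF emb0[OF \<tau>]])
  qed
  moreover have "(tWB1 S + tWC S) *v trace S (xs k t) = 0" if "t \<ge> 0" for k t
    using A(6)[OF that, of k] by (simp add: opG_def opK_def matrix_vector_mult_add_rdistrib)
  ultimately have "closed_loop_solution S x u y"
    unfolding closed_loop_solution_def using cls by blast
  moreover have "e (x 0) = cut F"
  proof -
    have "(\<lambda>k. e (xs k 0)) \<longlonglongrightarrow> cut F" unfolding ex A(1) by (rule cut.tendsto[OF G(2)])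
    then show ?thesis using X0[of 0] exX[of 0] LIMSEQ_unique by auto
  qed
  moreover have "\<xi> k 0 \<in> cl.smooth_domain \<and> (\<exists>v. continuous_on {0..} v \<and> (\<forall>t\<ge>0. (\<xi> k t, v t) \<in> \<Gamma> \<and> (\<xi> k has_vector_derivative v t) (at t within {0..})))" for k
    using G(1) A(1-3) by metis
  moreover have "\<exists>k. \<forall>t\<ge>0. nrm (cut (\<xi> k t) - e (x t)) < r" if "r > 0" for r
    using unif[OF that] unfolding ex by blast
  ultimately have "closed_loop_limit F \<xi> x u y"
    unfolding closed_loop_limit_def using uL yL by (auto simp: y_def)
  then show ?thesis by blast
qed

lemma closed_loop_imp_generalized:
  "closed_loop_solution S x u y \<Longrightarrow> generalized_solution S x u y"
  unfolding closed_loop_solution_def generalized_solution_def by blast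

end

section \<open>Stability of closed-loop solutions\<close>

context phs_space
begin

lemma X_zero: "(\<lambda>_. 0) \<in> X S" by (simp add: X_def)

lemma e_zero: "e (\<lambda>_. 0) = 0"
  by simp

lemma e_of_real_smult: "f \<in> X S \<Longrightarrow> e (\<lambda>t. complex_of_real r *s f t) = r *\<^sub>R e f"
  unfolding of_real_smult X_def by (rule emb_scaleR) simp_all

text \<open>An operator on representatives respects equality almost everywhere because of its norm
  bound: a state of zero energy is mapped to one of zero energy. Linearity extends this to
  differences, so the operator descends to classes.\<close>

lemma X_bounded_linear_lift:
  assumes A: "X_bounded_linear S A"
  shows "f \<in> X S \<Longrightarrow> e (A (rep (e f))) = e (A f)"
    and "bounded_linear (\<lambda>F. e (A (rep F)))"
proof -
  have AX: "\<And>f. f \<in> X S \<Longrightarrow> A f \<in> X S"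
    and lin: "\<And>f g a. f \<in> X S \<Longrightarrow> g \<in> X S \<Longrightarrow> X_eq S (A (\<lambda>\<zeta>. a *s f \<zeta> + g \<zeta>)) (\<lambda>\<zeta>. a *s A f \<zeta> + A g \<zeta>)"
    using A unfolding X_bounded_linear_def by blast+
  obtain M0 where M0: "\<And>f. f \<in> X S \<Longrightarrow> X_norm S (A f) \<le> M0 * X_norm S f"
    using A unfolding X_bounded_linear_def by blast
  \<comment> \<open>The bound provided by the definition may be negative when all state norms
    vanish; the maximum makes it usable in products.\<close>
  define M where "M = max M0 0"
  have M: "nrm (e (A f)) \<le> M * nrm (e f)" if f: "f \<in> X S" for f
  proof -
    have "nrm (e (A f)) \<le> M0 * nrm (e f)" using M0[OF f] f AX[OF f] by (simp add: X_norm_eq)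
    also have "\<dots> \<le> M * nrm (e f)" by (intro mult_right_mono) (auto simp: M_def)
    finally show ?thesis .
  qed
  have elin: "e (A (\<lambda>\<zeta>. a *s f \<zeta> + g \<zeta>)) = e (\<lambda>\<zeta>. a *s A f \<zeta> + A g \<zeta>)" if "f \<in> X S" "g \<in> X S" for f g a
    by (rule iffD1[OF X_eq_iff lin]) (intro AX X_combination that)+
  have zero: "e (A f) = 0" if "f \<in> X S" "e f = 0" for f
  proof -
    have "nrm (e (A f)) \<le> 0" using M[OF that(1)] that(2) by (simp add: ip.zero_left)
    then have "ip (e (A f)) (e (A f)) \<le> 0" by simp
    then have "ip (e (A f)) (e (A f)) = 0" by (rule antisym[OF _ nonneg])
    then show ?thesis by simp
  qed
  have neg: "(-1) *s v + w = w - v" for v w :: "complex^'n" by (simp add: vec_eq_iff)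
  have cong: "e (A f) = e (A g)" if "f \<in> X S" "g \<in> X S" "e f = e g" for f g
  proof -
    have "e (A (\<lambda>t. (-1) *s g t + f t)) = 0"
      unfolding neg by (rule zero) (use that in \<open>auto intro: X_diff simp: e_diff\<close>)
    then have "e (\<lambda>t. A f t - A g t) = 0" using elin[OF that(2,1), of "-1"] unfolding neg by simp
    then show ?thesis using that AX by (simp add: e_diff)
  qed
  show "e (A (rep (e f))) = e (A f)" if "f \<in> X S" by (rule cong) (use that in \<open>auto simp: e_rep_e\<close>)
  interpret cut: bounded_linear cut by (rule bounded_linear_cut)
  obtain C where C: "C > 0" "\<And>x. ip x x \<le> C * (norm x)\<^sup>2" using upper_bound by blast
  obtain K where K: "\<And>F. norm (cut F) \<le> norm F * K" using cut.bounded by blast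
  show "bounded_linear (\<lambda>F. e (A (rep F)))"
  proof (rule bounded_linear_intro[where K="M * sqrt C / sqrt c * K"])
    fix F G
    have "e (A (rep (F + G))) = e (A (\<lambda>t. 1 *s rep F t + rep G t))"
      by (rule cong) (use X_combination[of "rep F" "rep G" 1] in \<open>auto simp: e_add e_rep_add\<close>)
    also have "\<dots> = e (A (rep F)) + e (A (rep G))" using elin[of "rep F" "rep G" 1] by (simp add: e_add AX)
    finally show "e (A (rep (F + G))) = e (A (rep F)) + e (A (rep G))" .
  next
    fix r F
    have r: "(\<lambda>t. complex_of_real r *s rep F t + 0) \<in> X S" using X_combination[OF rep_X X_zero] .
    have "e (A (rep (r *\<^sub>R F))) = e (A (\<lambda>t. complex_of_real r *s rep F t + 0))"
    proof (rule cong)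
      show "e (rep (r *\<^sub>R F)) = e (\<lambda>t. complex_of_real r *s rep F t + 0)"
        using cut.scaleR[of r F] by (simp add: cut_def e_of_real_smult)
    qed (simp_all only: rep_X r)
    also have "\<dots> = e (\<lambda>t. complex_of_real r *s A (rep F) t) + e (A (\<lambda>_. 0))"
      using elin[OF rep_X X_zero, of "complex_of_real r" F] by (simp add: e_add X_smult AX X_zero)
    also have "\<dots> = r *\<^sub>R e (A (rep F))"
      using zero[OF X_zero e_zero] by (simp add: e_of_real_smult AX)
    finally show "e (A (rep (r *\<^sub>R F))) = r *\<^sub>R e (A (rep F))" .
  next
    fix F
    have M_nn: "M \<ge> 0" by (simp add: M_def)
    have "norm (e (A (rep F))) \<le> nrm (e (A (rep F))) / sqrt c" by (rule norm_le)
    also have "\<dots> \<le> M * nrm (cut F) / sqrt c"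
      using M[of "rep F"] c_pos by (intro divide_right_mono) (auto simp: cut_def)
    also have "\<dots> \<le> M * (sqrt C * norm (cut F)) / sqrt c"
    proof (intro divide_right_mono mult_left_mono M_nn)
      have "nrm (cut F) \<le> sqrt (C * (norm (cut F))\<^sup>2)" by (rule real_sqrt_le_mono[OF C(2)])
      also have "\<dots> = sqrt C * norm (cut F)" by (simp only: real_sqrt_mult real_sqrt_abs abs_norm_cancel)
      finally show "nrm (cut F) \<le> sqrt C * norm (cut F)" .
    qed (use c_pos in simp)
    also have "\<dots> \<le> M * (sqrt C * (norm F * K)) / sqrt c"
      by (intro divide_right_mono mult_left_mono M_nn K) (use C(1) c_pos in simp_all)
    finally show "norm (e (A (rep F))) \<le> norm F * (M * sqrt C / sqrt c * K)" by (simp add: ac_simps)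
  qed
qed

text \<open>The hypothesis speaks about some semigroup with the right generator. A classical flow in
  \<Gamma> is a differentiable curve on which that generator acts as the derivative, so uniqueness
  identifies it with an orbit, and orbits decay.\<close>

lemma closed_loop_flow_stable:
  assumes stable: "closed_loop_strongly_stable S"
    and \<xi>: "\<And>t. t \<ge> 0 \<Longrightarrow> (\<xi> t, v t) \<in> \<Gamma>" "\<And>t. t \<ge> 0 \<Longrightarrow> (\<xi> has_vector_derivative v t) (at t within {0..})"
  shows "((\<lambda>t. nrm (cut (\<xi> t))) \<longlongrightarrow> 0) at_top"
proof -
  obtain T where T: "C0_semigroup S T" "generator_graph S T = closed_loop_graph S"
    "\<And>x0. x0 \<in> X S \<Longrightarrow> ((\<lambda>t. X_norm S (T t x0)) \<longlongrightarrow> 0) at_top"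
    using stable unfolding closed_loop_strongly_stable_def by blast
  have Tb: "X_bounded_linear S (T t)" if "t \<ge> 0" for t using T(1) that by (simp add: C0_semigroup_def)
  have TX: "T t f \<in> X S" if "t \<ge> 0" "f \<in> X S" for t f using Tb[OF that(1)] that(2) by (simp add: X_bounded_linear_def)
  have T0: "e (T 0 f) = e f" if "f \<in> X S" for f
    using T(1) that X_eq_iff[OF TX that] by (auto simp: C0_semigroup_def)
  interpret cut: bounded_linear cut by (rule bounded_linear_cut)
  \<comment> \<open>The semigroup on classes. Its value at time 0 is the projection
    \<open>cut\<close>, not the identity.\<close>
  define B where "B t F = e (T t (rep F))" for t F
  have Be: "B t (e f) = e (T t f)" if "t \<ge> 0" "f \<in> X S" for t f
    unfolding B_def by (rule X_bounded_linear_lift(1)[OF Tb[OF that(1)] that(2)])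
  \<comment> \<open>The divisor \<open>k\<close> is left general so that one translation serves
    twice: \<open>k h = h\<close> for the generator, and \<open>k h = 1\<close> with limit 0 for
    strong continuity.\<close>
  have lim_iff: "((\<lambda>h. X_norm S (\<lambda>\<zeta>. (T h f \<zeta> - f \<zeta>) /\<^sub>R k h - g \<zeta>)) \<longlongrightarrow> 0) (at_right 0) \<longleftrightarrow>
      ((\<lambda>h. (e (T h f) - e f) /\<^sub>R k h) \<longlongrightarrow> e g) (at_right 0)" if f: "f \<in> X S" "g \<in> X S" for f g and k :: "real \<Rightarrow> real"
  proof -
    have *: "X_norm S (\<lambda>\<zeta>. (T h f \<zeta> - f \<zeta>) /\<^sub>R k h - g \<zeta>) = nrm ((e (T h f) - e f) /\<^sub>R k h - e g)" if "h > 0" for h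
    proof -
      have d: "(\<lambda>\<zeta>. T h f \<zeta> - f \<zeta>) \<in> X S" using that f by (intro X_diff TX) auto
      then have "(\<lambda>\<zeta>. (T h f \<zeta> - f \<zeta>) /\<^sub>R k h) \<in> X S" unfolding X_def by (rule L2_scaleR)
      moreover have "e (\<lambda>\<zeta>. (T h f \<zeta> - f \<zeta>) /\<^sub>R k h) = (e (T h f) - e f) /\<^sub>R k h"
        using emb_scaleR[OF I_sets, of "\<lambda>\<zeta>. T h f \<zeta> - f \<zeta>"] d e_diff[OF TX f(1), of h] f that by (simp add: X_def)
      ultimately show ?thesis using X_norm_diff f(2) by simp
    qed
    have "((\<lambda>h. X_norm S (\<lambda>\<zeta>. (T h f \<zeta> - f \<zeta>) /\<^sub>R k h - g \<zeta>)) \<longlongrightarrow> 0) (at_right 0) \<longleftrightarrow>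
      ((\<lambda>h. nrm ((e (T h f) - e f) /\<^sub>R k h - e g)) \<longlongrightarrow> 0) (at_right 0)"
      by (rule tendsto_cong) (use * in \<open>auto simp: eventually_at_filter\<close>)
    then show ?thesis unfolding tendsto_sqrt_ip_iff LIM_zero_iff .
  qed
  interpret B: strongly_continuous_semigroup B
  proof (rule strongly_continuous_semigroup.intro)
    show "bounded_linear (B t)" if "t \<ge> 0" for t
      unfolding B_def by (rule X_bounded_linear_lift(2)[OF Tb[OF that]])
    show "B (s + t) F = B s (B t F)" if st: "s \<ge> 0" "t \<ge> 0" for s t F
    proof -
      have "X_eq S (T (s + t) (rep F)) (T s (T t (rep F)))" using T(1) st by (simp add: C0_semigroup_def)
      then have "e (T (s + t) (rep F)) = e (T s (T t (rep F)))"
        by (subst (asm) X_eq_iff) (use st in \<open>auto intro!: TX\<close>)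
      then show ?thesis using Be[OF st(1) TX[OF st(2) rep_X]] by (simp add: B_def)
    qed
    show "((\<lambda>h. B h F) \<longlongrightarrow> B 0 F) (at_right 0)" for F
    proof -
      have "((\<lambda>h. X_norm S (\<lambda>\<zeta>. T h (rep F) \<zeta> - rep F \<zeta>)) \<longlongrightarrow> 0) (at_right 0)"
        using T(1) by (simp add: C0_semigroup_def)
      then have "((\<lambda>h. (e (T h (rep F)) - e (rep F)) /\<^sub>R 1) \<longlongrightarrow> e (\<lambda>_. 0)) (at_right 0)"
        by (subst lim_iff[symmetric]) (simp_all add: X_zero)
      then show ?thesis by (simp add: e_zero LIM_zero_iff B_def T0)
    qed
  qed
  have flow: "B \<tau> (cut (\<xi> 0)) = cut (\<xi> \<tau>)" if \<tau>: "\<tau> \<ge> 0" for \<tau>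
  proof (rule B.classical_flow_unique[where \<eta>="\<lambda>s. cut (\<xi> s)" and w="\<lambda>s. cut (v s)", OF _ _ _ _ \<tau>])
    fix s :: real assume s: "s \<ge> 0"
    show "((\<lambda>s. cut (\<xi> s)) has_vector_derivative cut (v s)) (at s within {0..})"
      by (rule cut.has_vector_derivative[OF \<xi>(2)[OF s]])
    show "B 0 (cut (\<xi> s)) = cut (\<xi> s)" "B 0 (cut (v s)) = cut (v s)"
      by (simp_all add: cut_def Be T0)
    have "(rep (\<xi> s), rep (v s)) \<in> generator_graph S T"
      using \<xi>(1)[OF s] unfolding T(2) by (simp add: \<Gamma>_def)
    then have "((\<lambda>h. (e (T h (rep (\<xi> s))) - e (rep (\<xi> s))) /\<^sub>R h) \<longlongrightarrow> e (rep (v s))) (at_right 0)"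
      using lim_iff[OF rep_X rep_X, where k="\<lambda>h. h"] by (simp add: generator_graph_def)
    then show "((\<lambda>h. (B h (cut (\<xi> s)) - cut (\<xi> s)) /\<^sub>R h) \<longlongrightarrow> cut (v s)) (at_right 0)"
      unfolding cut_def
      by (rule Lim_transform_eventually) (auto simp: eventually_at_filter Be)
  qed
  have "((\<lambda>t. X_norm S (T t (rep (\<xi> 0)))) \<longlongrightarrow> 0) at_top" by (rule T(3)[OF rep_X])
  then show ?thesis
  proof (rule Lim_transform_eventually)
    show "\<forall>\<^sub>F t in at_top. X_norm S (T t (rep (\<xi> 0))) = nrm (cut (\<xi> t))"
      using eventually_ge_at_top[of 0]
    proof eventually_elim
      case (elim t)
      have "cut (\<xi> t) = e (T t (rep (\<xi> 0)))" using flow[OF elim] Be[OF elim rep_X] by (simp add: cut_def)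
      then show ?case using X_norm_eq[OF TX[OF elim rep_X]] by simp
    qed
  qed
qed

end

context passive_phs
begin

lemma closed_loop_limit_stable:
  assumes stable: "closed_loop_strongly_stable S" and a: "closed_loop_limit F \<xi> x u y"
  shows "((\<lambda>t. nrm (e (x t))) \<longlongrightarrow> 0) at_top"
proof (rule tendstoI)
  fix r :: real assume r: "r > 0"
  then obtain k where k: "\<And>t. t \<ge> 0 \<Longrightarrow> nrm (cut (\<xi> k t) - e (x t)) < r / 2"
    using a unfolding closed_loop_limit_def by (metis half_gt_zero)
  obtain v where "\<And>t. t \<ge> 0 \<Longrightarrow> (\<xi> k t, v t) \<in> \<Gamma>" "\<And>t. t \<ge> 0 \<Longrightarrow> (\<xi> k has_vector_derivative v t) (at t within {0..})"
    using a unfolding closed_loop_limit_def by metis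
  from closed_loop_flow_stable[OF stable this]
  have "\<forall>\<^sub>F t in at_top. nrm (cut (\<xi> k t)) < r / 2" by (rule order_tendstoD(2)[OF _ half_gt_zero[OF r]])
  then show "\<forall>\<^sub>F t in at_top. dist (nrm (e (x t))) 0 < r"
    using eventually_ge_at_top[of 0]
  proof eventually_elim
    case (elim t)
    have "nrm (e (x t)) \<le> nrm (cut (\<xi> k t)) + nrm (cut (\<xi> k t) - e (x t))"
    proof -
      have "ip (e (x t) - cut (\<xi> k t)) (e (x t) - cut (\<xi> k t)) = ip (cut (\<xi> k t) - e (x t)) (cut (\<xi> k t) - e (x t))"
        by (simp add: ip_diff_diff sym[of "e (x t)" "cut (\<xi> k t)"])
      then show ?thesis using sqrt_add_le[of "cut (\<xi> k t)" "e (x t) - cut (\<xi> k t)"] by simp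
    qed
    then show ?case using k[OF elim(2)] elim(1) by simp
  qed
qed

lemma closed_loop_limitD:
  assumes "closed_loop_limit F \<xi> x u y"
  shows "closed_loop_solution S x u y" "generalized_solution S x u y" "e (x 0) = cut F"
    "u \<in> L2 {0..}" "y \<in> L2 {0..}" "\<And>t. u t + y t = 0"
  using assms closed_loop_imp_generalized unfolding closed_loop_limit_def by auto

lemma closed_loop_limit_cost:
  assumes a: "closed_loop_limit F \<xi> x u y"
  shows "(norm (emb {0..} u))\<^sup>2 + (norm (emb {0..} y))\<^sup>2 \<le> ip (cut F) (cut F)"
proof (rule LIMSEQ_le_const2)
  note D = closed_loop_limitD[OF a]
  show "(\<lambda>n. N (real n) u + N (real n) y) \<longlonglongrightarrow> (norm (emb {0..} u))\<^sup>2 + (norm (emb {0..} y))\<^sup>2"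
    by (intro tendsto_add N_tendsto_halfline D)
  have z: "N t (\<lambda>s. u s + y s) = 0" for t
    by (simp add: D(6))
  have "N (real n) u + N (real n) y \<le> ip (cut F) (cut F)" for n
  proof -
    have "ip (e (x (real n))) (e (x (real n))) + N (real n) u + N (real n) y \<le> ip (cut F) (cut F)"
      using energy_le[OF D(2), of "real n"] by (simp add: z D(3))
    then show ?thesis using nonneg[of "e (x (real n))"] by linarith
  qed
  then show "\<exists>M. \<forall>n\<ge>M. N (real n) u + N (real n) y \<le> ip (cut F) (cut F)" by blast
qed

text \<open>Split \<open>x\<close> into the closed-loop solution \<open>xc\<close> and a remainder \<open>d\<close> starting at \<open>0\<close>. The energy
  of \<open>d\<close> stays bounded while \<open>xc\<close> decays, so the cross term vanishes in the limit.\<close>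

lemma cost_lower_bound:
  assumes skew: "P0_skew_adjoint S"
    and eq: "\<forall>g. WB2 S *v g = 0 \<longrightarrow> 2 * Re (cinner (WB1 S *v g) (WC S *v g)) = Re (cinner (Xi *v g) g)"
    and stable: "closed_loop_strongly_stable S" and a: "closed_loop_limit F \<xi> xc uc yc"
    and g: "generalized_solution S x u y" and uy: "u \<in> L2 {0..}" "y \<in> L2 {0..}" and x0: "e (x 0) = cut F"
  shows "ip (cut F) (cut F) + (norm (emb {0..} (\<lambda>t. u t - uc t)))\<^sup>2 + (norm (emb {0..} (\<lambda>t. y t - yc t)))\<^sup>2
      \<le> (norm (emb {0..} u))\<^sup>2 + (norm (emb {0..} y))\<^sup>2"
    and "t \<ge> 0 \<Longrightarrow> ip (e (x t) - e (xc t)) (e (x t) - e (xc t)) \<le> N t (\<lambda>s. u s + y s)"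
proof -
  note D = closed_loop_limitD[OF a]
  have neg: "(-1) *s v + w = w - v" for v w :: "complex^'k::finite" by (simp add: vec_eq_iff)
  have gd: "generalized_solution S (\<lambda>t \<zeta>. x t \<zeta> - xc t \<zeta>) (\<lambda>t. u t - uc t) (\<lambda>t. y t - yc t)"
    using generalized_solution_combination[OF D(2) g, of "-1"] unfolding neg .
  have ed: "e (\<lambda>\<zeta>. x t \<zeta> - xc t \<zeta>) = e (x t) - e (xc t)" if "t \<ge> 0" for t
    by (rule e_diff) (use generalized_solutionD(1)[OF g that] generalized_solutionD(1)[OF D(2) that] in auto)
  let ?v = "\<lambda>s. u s + y s" and ?\<delta> = "\<lambda>t. u t - uc t" and ?\<eta> = "\<lambda>t. y t - yc t"
  \<comment> \<open>The closed-loop signals sum to zero, so subtracting them does not change the sum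
    of the signals of \<open>x\<close>.\<close>
  have vd: "(\<lambda>s. ?\<delta> s + ?\<eta> s) = ?v"
    by (rule ext) (simp only: add_diff_add[symmetric] D(6) diff_zero)
  have le_d: "ip (e (x t) - e (xc t)) (e (x t) - e (xc t)) + N t ?\<delta> + N t ?\<eta> \<le> N t ?v" if "t \<ge> 0" for t
    using energy_le[OF gd that] unfolding vd by (simp add: ed that x0 D(3) ip.zero_left)
  then show "ip (e (x t) - e (xc t)) (e (x t) - e (xc t)) \<le> N t ?v" if "t \<ge> 0"
    using that by (smt (verit) zero_le_power2)
  define V where "V = norm (emb {0..} ?v)"
  have vL: "?v \<in> L2 {0..}" by (rule L2_add[OF uy])
  \<comment> \<open>Expand the energy of \<open>x t\<close> around \<open>xc t\<close> in the lower
    energy balance. The energy of the remainder is at most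
    \<open>N t ?v - N t ?\<delta> - N t ?\<eta>\<close>, so \<open>N t ?v\<close> cancels and the
    signal distances appear on the left.\<close>
  have fin: "ip (cut F) (cut F) + N t ?\<delta> + N t ?\<eta> \<le> (nrm (e (xc t)))\<^sup>2 + 2 * (nrm (e (xc t)) * V) + N t u + N t y"
    if t: "t \<ge> 0" for t
  proof -
    let ?c = "e (xc t)" and ?d = "e (x t) - e (xc t)"
    have ge: "ip (cut F) (cut F) + N t ?v \<le> ip (e (x t)) (e (x t)) + N t u + N t y"
      using energy_ge[OF skew eq g t] by (simp add: x0)
    have "ip (e (x t)) (e (x t)) = ip ?c ?c + 2 * ip ?c ?d + ip ?d ?d"
      using ip_add_add[of ?c ?d] by simp
    moreover have "ip ?c ?d \<le> nrm ?c * V"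
    proof -
      have "ip ?d ?d \<le> N t ?v" using le_d[OF t] by (smt (verit) zero_le_power2)
      also have "\<dots> \<le> V\<^sup>2" unfolding V_def by (rule N_mono[OF vL]) auto
      finally have "nrm ?d \<le> V" unfolding V_def by (intro real_le_lsqrt) auto
      then have "nrm ?c * nrm ?d \<le> nrm ?c * V" by (intro mult_left_mono) auto
      then show ?thesis using abs_ip_le[of ?c ?d] by linarith
    qed
    moreover have "(nrm ?c)\<^sup>2 = ip ?c ?c" by simp
    ultimately show ?thesis using ge le_d[OF t] by linarith
  qed
  have nlim: "(\<lambda>n. nrm (e (xc (real n)))) \<longlonglongrightarrow> 0"
    by (rule filterlim_compose[OF closed_loop_limit_stable[OF stable a] filterlim_real_sequentially])
  have up: "(\<lambda>n. (nrm (e (xc (real n))))\<^sup>2 + 2 * (nrm (e (xc (real n))) * V) + N (real n) u + N (real n) y)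
      \<longlonglongrightarrow> 0\<^sup>2 + 2 * (0 * V) + (norm (emb {0..} u))\<^sup>2 + (norm (emb {0..} y))\<^sup>2"
    by (intro tendsto_intros nlim N_tendsto_halfline uy)
  have low: "(\<lambda>n. ip (cut F) (cut F) + N (real n) ?\<delta> + N (real n) ?\<eta>) \<longlonglongrightarrow>
      ip (cut F) (cut F) + (norm (emb {0..} ?\<delta>))\<^sup>2 + (norm (emb {0..} ?\<eta>))\<^sup>2"
    by (intro tendsto_intros N_tendsto_halfline L2_diff uy D)
  have "ip (cut F) (cut F) + (norm (emb {0..} ?\<delta>))\<^sup>2 + (norm (emb {0..} ?\<eta>))\<^sup>2
      \<le> 0\<^sup>2 + 2 * (0 * V) + (norm (emb {0..} u))\<^sup>2 + (norm (emb {0..} y))\<^sup>2"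
    by (rule LIMSEQ_le[OF low up]) (use fin in auto)
  then show "ip (cut F) (cut F) + (norm (emb {0..} ?\<delta>))\<^sup>2 + (norm (emb {0..} ?\<eta>))\<^sup>2
      \<le> (norm (emb {0..} u))\<^sup>2 + (norm (emb {0..} y))\<^sup>2" by simp
qed

end

section \<open>The optimal cost operator\<close>

lemma nn_integral_norm_power2:
  assumes "A \<in> sets lebesgue" "f \<in> L2 A"
  shows "(\<integral>\<^sup>+t. ennreal ((norm (f t))\<^sup>2) \<partial>lebesgue_on A) = ennreal ((norm (emb A f))\<^sup>2)"
  unfolding norm_emb[OF assms] by (rule nn_integral_eq_integral[OF L2_integrable[OF assms(2)]]) simp

lemma running_cost_eq:
  assumes "u \<in> L2 {0..}" "y \<in> L2 {0..}"
  shows "running_cost u y = ennreal ((norm (emb {0..} u))\<^sup>2 + (norm (emb {0..} y))\<^sup>2)"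
proof -
  have "running_cost u y = (\<integral>\<^sup>+t. ennreal ((norm (u t))\<^sup>2) + ennreal ((norm (y t))\<^sup>2) \<partial>lebesgue_on {0..})"
    unfolding running_cost_def by (intro nn_integral_cong) simp
  also have "\<dots> = (\<integral>\<^sup>+t. ennreal ((norm (u t))\<^sup>2) \<partial>lebesgue_on {0..}) + (\<integral>\<^sup>+t. ennreal ((norm (y t))\<^sup>2) \<partial>lebesgue_on {0..})"
  proof -
    note [measurable] = L2_measurable[OF assms(1)] L2_measurable[OF assms(2)]
    show ?thesis by (rule nn_integral_add) measurable
  qed
  finally show ?thesis by (simp add: nn_integral_norm_power2 assms)
qed

text \<open>The signals of a generalized solution are known to be measurable and square integrable
  on bounded intervals only. The finite cost bounds all of these energies, and
  \<open>L2_halflineI\<close> passes to the half line.\<close>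

lemma running_cost_finite_imp_L2:
  assumes "u \<in> L2_loc" "y \<in> L2_loc" "running_cost u y < \<infinity>"
  shows "u \<in> L2 {0..}" "y \<in> L2 {0..}"
proof -
  obtain C where C: "C \<ge> 0" "running_cost u y = ennreal C"
    using assms(3) by (cases "running_cost u y") auto
  have *: "f \<in> L2 {0..}" if f: "f \<in> L2_loc" and le: "\<And>t. (norm (f t))\<^sup>2 \<le> (norm (u t))\<^sup>2 + (norm (y t))\<^sup>2"
    for f :: "real \<Rightarrow> complex^'a"
  proof (rule L2_halflineI(1)[OF f])
    fix t :: real assume t: "0 \<le> t"
    have "ennreal (N t f) = (\<integral>\<^sup>+s. ennreal ((norm (f s))\<^sup>2) \<partial>lebesgue_on {0..t})"
      by (rule nn_integral_norm_power2[symmetric]) (use f t in \<open>auto intro: L2_locD\<close>)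
    also have "\<dots> = (\<integral>\<^sup>+s. ennreal ((norm (f s))\<^sup>2) * indicator {0..t} s \<partial>lebesgue)"
      by (rule nn_integral_restrict_space) simp
    also have "\<dots> \<le> (\<integral>\<^sup>+s. ennreal ((norm (u s))\<^sup>2 + (norm (y s))\<^sup>2) * indicator {0..} s \<partial>lebesgue)"
      using le by (intro nn_integral_mono) (auto simp: indicator_def simp del: ennreal_plus intro!: ennreal_leI)
    also have "\<dots> = running_cost u y"
      unfolding running_cost_def by (rule nn_integral_restrict_space[symmetric]) simp
    finally show "N t f \<le> C" unfolding C(2) using C(1) by (simp add: ennreal_le_iff)
  qed
  show "u \<in> L2 {0..}" "y \<in> L2 {0..}" using assms(1,2) by (auto intro: *)
qed

section \<open>Admissible signals and the cost form\<close>

context phs_space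
begin

lemma ip_cut: "ip (cut F) G = ip F (cut G)"
  unfolding ip_integral
proof (rule integral_cong_AE)
  show "AE t in lebesgue. (Hm t *v rep (cut F) t) \<bullet> rep G t = (Hm t *v rep F t) \<bullet> rep (cut G) t"
    using AE_rep_cut[of F] AE_rep_cut[of G]
    by eventually_elim (simp add: matrix_vector_mult_0_right)
qed (rule borel_measurable_integrable[OF ip_integrable])+

lemma ip_e_imaginary:
  assumes f: "f \<in> X S" and g: "g \<in> X S"
  shows "ip (e (\<lambda>t. \<i> *s f t)) (e g) = - ip (e f) (e (\<lambda>t. \<i> *s g t))"
proof -
  have "(\<i> *s v) \<bullet> w = - (v \<bullet> (\<i> *s w))" for v w :: "complex^'n"
  proof -
    have "cinner (\<i> *s v) w = - cinner v (\<i> *s w)"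
      by (simp add: cinner_def sum_negf flip: sum_negf) (simp add: ac_simps)
    then show ?thesis unfolding Re_cinner[symmetric] by simp
  qed
  then show ?thesis
    by (simp add: ip_emb X_smult f g matrix_vector_mult_smult)
qed

text \<open>The linear relation between initial states and finite-cost signals; the squared norm of
  the signal pair is the cost. Arbitrary classes occur on the left and are matched through
  \<open>cut\<close>, so the relation has every class in its domain.\<close>

definition admissible :: "('n l2 \<times> ('p l2 \<times> 'p l2)) set" where
  "admissible = {(F, (U, Y)). \<exists>x u y. generalized_solution S x u y \<and> u \<in> L2 {0..} \<and> y \<in> L2 {0..} \<and>
     e (x 0) = cut F \<and> U = emb {0..} u \<and> Y = emb {0..} y}"

lemma admissible_combination:
  assumes 1: "generalized_solution S x u y" "u \<in> L2 {0..}" "y \<in> L2 {0..}" "e (x 0) = cut F"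
    and 2: "generalized_solution S x' u' y'" "u' \<in> L2 {0..}" "y' \<in> L2 {0..}" "e (x' 0) = cut F'"
  shows "(r *\<^sub>R F + F', (r *\<^sub>R emb {0..} u + emb {0..} u', r *\<^sub>R emb {0..} y + emb {0..} y')) \<in> admissible"
proof -
  interpret cut: bounded_linear cut by (rule bounded_linear_cut)
  let ?a = "complex_of_real r"
  have "generalized_solution S (\<lambda>t \<zeta>. ?a *s x t \<zeta> + x' t \<zeta>) (\<lambda>t. ?a *s u t + u' t) (\<lambda>t. ?a *s y t + y' t)"
    by (rule generalized_solution_combination[OF 1(1) 2(1)])
  moreover have X: "x 0 \<in> X S" "x' 0 \<in> X S"
    using generalized_solutionD(1)[OF 1(1)] generalized_solutionD(1)[OF 2(1)] by auto
  then have "e (\<lambda>\<zeta>. ?a *s x 0 \<zeta> + x' 0 \<zeta>) = cut (r *\<^sub>R F + F')"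
    by (simp add: e_add X_smult e_of_real_smult 1(4) 2(4) cut.add cut.scaleR)
  moreover have *: "(\<lambda>t. ?a *s f t + g t) \<in> L2 {0..}" "emb {0..} (\<lambda>t. ?a *s f t + g t) = r *\<^sub>R emb {0..} f + emb {0..} g"
    if "f \<in> L2 {0..}" "g \<in> L2 {0..}" for f g :: "real \<Rightarrow> complex^'p"
    unfolding of_real_smult using that by (auto intro: L2_add L2_scaleR simp: emb_add emb_scaleR L2_scaleR)
  ultimately show ?thesis unfolding admissible_def
    using *[OF 1(2) 2(2)] *[OF 1(3) 2(3)] by (auto 0 4)
qed

end

context passive_phs
begin

lemma admissible_bound: "\<exists>Z. (F, Z) \<in> admissible \<and> (norm Z)\<^sup>2 \<le> ip F F"
proof -
  obtain \<xi> x u y where a: "closed_loop_limit F \<xi> x u y" using closed_loop_solution_exists by blast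
  note D = closed_loop_limitD[OF a]
  have "(F, (emb {0..} u, emb {0..} y)) \<in> admissible" unfolding admissible_def using D by blast
  moreover have "(norm (emb {0..} u, emb {0..} y))\<^sup>2 \<le> ip F F"
    using closed_loop_limit_cost[OF a] ip_cut_le[of F] by (simp add: norm_Pair)
  ultimately show ?thesis by blast
qed

lemma subspace_admissible: "subspace admissible"
proof -
  have comb: "(r *\<^sub>R F + F', r *\<^sub>R Z + Z') \<in> admissible" if "(F, Z) \<in> admissible" "(F', Z') \<in> admissible" for r F Z F' Z'
    using that unfolding admissible_def
    by (auto dest: admissible_combination[of _ _ _ F _ _ _ F' r] simp: admissible_def)
  have zero: "(0, 0) \<in> admissible"
  proof -
    \<comment> \<open>The bound at initial class 0 leaves no signal but 0, so the zero pair is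
      admissible.\<close>
    obtain Z where Z: "(0, Z) \<in> admissible" "(norm Z)\<^sup>2 \<le> ip 0 0" using admissible_bound by blast
    then have "Z = 0" by (simp add: ip.zero_left)
    then show ?thesis using Z(1) by simp
  qed
  show ?thesis
    unfolding subspace_def
  proof (intro conjI ballI allI)
    show "0 \<in> admissible" using zero by (simp add: zero_prod_def)
    show "x + y \<in> admissible" if "x \<in> admissible" "y \<in> admissible" for x y
      using comb[of "fst x" "snd x" "fst y" "snd y" 1] that by (simp add: plus_prod_def)
    show "r *\<^sub>R x \<in> admissible" if "x \<in> admissible" for r x
      using comb[of "fst x" "snd x" 0 0 r] that zero by (simp add: scaleR_prod_def)
  qed
qed

text \<open>Translates the nested infimum over inputs and outputs into an infimum over the relation.
  Pairs of infinite running cost satisfy the lower bound trivially, and all others belong to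
  \<open>admissible\<close>.\<close>

lemma optimal_cost_eq:
  assumes x0: "x0 \<in> X S"
    and le: "\<And>Z. (e x0, Z) \<in> admissible \<Longrightarrow> q \<le> (norm Z)\<^sup>2"
    and approx: "\<And>r. r > 0 \<Longrightarrow> \<exists>Z. (e x0, Z) \<in> admissible \<and> (norm Z)\<^sup>2 < q + r" and q: "q \<ge> 0"
  shows "optimal_cost S x0 = ennreal q"
proof (rule antisym)
  show "optimal_cost S x0 \<le> ennreal q"
  proof (rule ennreal_le_epsilon)
    fix r :: real assume "0 < r"
    then obtain Z where Z: "(e x0, Z) \<in> admissible" "(norm Z)\<^sup>2 < q + r" using approx by blast
    then obtain x u y where s: "generalized_solution S x u y" "u \<in> L2 {0..}" "y \<in> L2 {0..}" "e (x 0) = cut (e x0)"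
      "Z = (emb {0..} u, emb {0..} y)" unfolding admissible_def by auto
    have "X_eq S (x 0) x0" using s(4) X_eq_iff[OF generalized_solutionD(1)[OF s(1) order_refl] x0] by (simp add: cut_e x0)
    then have "J S x0 u \<le> running_cost u y" unfolding J_def using s(1) by (intro INF_lower) blast
    also have "\<dots> = ennreal ((norm Z)\<^sup>2)" using s(2,3,5) by (simp add: running_cost_eq norm_Pair)
    also have "\<dots> \<le> ennreal (q + r)" using Z(2) by (intro ennreal_leI) simp
    finally have "J S x0 u \<le> ennreal q + ennreal r" using q \<open>0 < r\<close> by simp
    then show "optimal_cost S x0 \<le> ennreal q + ennreal r"
      unfolding optimal_cost_def using s(2) by (meson INF_lower2)
  qed
  show "ennreal q \<le> optimal_cost S x0"
    unfolding optimal_cost_def J_def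
  proof (intro INF_greatest)
    fix u y assume u: "u \<in> L2 {0..}" and "y \<in> {y. \<exists>x. generalized_solution S x u y \<and> X_eq S (x 0) x0}"
    then obtain x where g: "generalized_solution S x u y" "X_eq S (x 0) x0" by blast
    show "ennreal q \<le> running_cost u y"
    proof (cases "running_cost u y < \<infinity>")
      case True
      note L = running_cost_finite_imp_L2[OF generalized_solutionD(2,3)[OF g(1)] True]
      have "e (x 0) = cut (e x0)"
        using g(2) X_eq_iff[OF generalized_solutionD(1)[OF g(1) order_refl] x0] by (simp add: cut_e x0)
      then have "(e x0, (emb {0..} u, emb {0..} y)) \<in> admissible" unfolding admissible_def using g(1) L by blast
      from le[OF this] show ?thesis unfolding running_cost_eq[OF L] by (intro ennreal_leI) (simp add: norm_Pair)
    qed (simp add: less_top[symmetric])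
  qed
qed

text \<open>The system is complex linear although the relation is treated as a real subspace.
  Multiplication by the imaginary unit preserves the cost, which is the extra symmetry the cost
  operator inherits.\<close>

lemma admissible_imaginary:
  assumes f: "f \<in> X S" and Z: "(e f, Z) \<in> admissible"
  shows "\<exists>Z'. (e (\<lambda>t. \<i> *s f t), Z') \<in> admissible \<and> norm Z' = norm Z"
proof -
  obtain x u y where s: "generalized_solution S x u y" "u \<in> L2 {0..}" "y \<in> L2 {0..}" "e (x 0) = cut (e f)"
    "Z = (emb {0..} u, emb {0..} y)" using Z unfolding admissible_def by auto
  \<comment> \<open>A generalized solution that is identically zero, needed because the combination
    rule always adds a second solution.\<close>
  have z: "generalized_solution S (\<lambda>t \<zeta>. (-1) *s x t \<zeta> + x t \<zeta>) (\<lambda>t. (-1) *s u t + u t) (\<lambda>t. (-1) *s y t + y t)"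
    by (rule generalized_solution_combination[OF s(1) s(1)])
  have j: "\<i> *s v + ((-1) *s v + v) = \<i> *s v" for v :: "complex^'k::finite" by (simp add: vec_eq_iff)
  have g: "generalized_solution S (\<lambda>t \<zeta>. \<i> *s x t \<zeta>) (\<lambda>t. \<i> *s u t) (\<lambda>t. \<i> *s y t)"
    using generalized_solution_combination[OF s(1) z, of "\<i>"] unfolding j .
  have L: "(\<lambda>t. \<i> *s v t) \<in> L2 {0..}" "norm (emb {0..} (\<lambda>t. \<i> *s v t)) = norm (emb {0..} v)"
    if v: "v \<in> L2 {0..}" for v :: "real \<Rightarrow> complex^'p"
  proof -
    show iv: "(\<lambda>t. \<i> *s v t) \<in> L2 {0..}" by (rule L2_linear[OF v bounded_linear_smult])
    have "(norm (emb {0..} (\<lambda>t. \<i> *s v t)))\<^sup>2 = (norm (emb {0..} v))\<^sup>2"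
      using norm_emb[OF _ iv] norm_emb[OF _ v] by (simp add: norm_smult_complex)
    then show "norm (emb {0..} (\<lambda>t. \<i> *s v t)) = norm (emb {0..} v)" by simp
  qed
  have "e (\<lambda>\<zeta>. \<i> *s x 0 \<zeta>) = cut (e (\<lambda>t. \<i> *s f t))"
  proof -
    have x: "x 0 \<in> X S" using generalized_solutionD(1)[OF s(1)] by simp
    obtain T where T: "\<And>f. f \<in> X S \<Longrightarrow> e (\<lambda>t. \<i> *s f t) = T (e f)" using bounded_linear_e_smult by blast
    have "e (x 0) = e f" using s(4) f by (simp add: cut_e)
    then have "e (\<lambda>\<zeta>. \<i> *s x 0 \<zeta>) = e (\<lambda>t. \<i> *s f t)" by (simp only: T[OF x] T[OF f])
    then show ?thesis using cut_e[OF X_smult[OF f]] by simp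
  qed
  then have "(e (\<lambda>t. \<i> *s f t), (emb {0..} (\<lambda>t. \<i> *s u t), emb {0..} (\<lambda>t. \<i> *s y t))) \<in> admissible"
    unfolding admissible_def using g L s by blast
  then show ?thesis using L s by (intro exI[of _ "(emb {0..} (\<lambda>t. \<i> *s u t), emb {0..} (\<lambda>t. \<i> *s y t))"]) (simp add: norm_Pair)
qed

text \<open>The minimal cost operator is real linear and symmetric for \<open>ip\<close>. Invariance
  of the cost under multiplication by the imaginary unit, polarized, shows that it commutes with
  this multiplication; complex linearity and self-adjointness for \<open>X_inner\<close>
  follow.\<close>

lemma optimal_cost_operator_exists: "\<exists>Pop. optimal_cost_operator S Pop"
proof -
  obtain P where bl: "bounded_linear P" and sa: "\<And>F G. ip (P F) G = ip F (P G)"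
    and low: "\<And>F Z. (F, Z) \<in> admissible \<Longrightarrow> ip F (P F) \<le> (norm Z)\<^sup>2"
    and approx: "\<And>F r. r > 0 \<Longrightarrow> \<exists>Z. (F, Z) \<in> admissible \<and> (norm Z)\<^sup>2 < ip F (P F) + r"
    using minimal_cost_operator[OF subspace_admissible admissible_bound] by blast
  interpret P: bounded_linear P by (rule bl)
  interpret cut: bounded_linear cut by (rule bounded_linear_cut)
  let ?B = "\<lambda>f g. ip (e f) (P (e g))" and ?j = "\<lambda>f t. \<i> *s f t"
  have jX: "?j f \<in> X S" if "f \<in> X S" for f by (rule X_smult[OF that])
  have jj: "e (?j (?j f)) = - e f" if "f \<in> X S" for f
  proof -
    have "?j (?j f) = (\<lambda>t. complex_of_real (-1) *s f t)" by (simp add: fun_eq_iff vec_eq_iff)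
    then show ?thesis using e_of_real_smult[OF that, of "-1"] by simp
  qed
  \<comment> \<open>A nearly optimal signal for \<open>?j f\<close>, multiplied by the imaginary
    unit, serves the initial state \<open>- f\<close> at equal cost, and the form does not see the
    sign. Applying this to \<open>?j f\<close> as well gives equality.\<close>
  have Q_le: "?B f f \<le> ?B (?j f) (?j f)" if f: "f \<in> X S" for f
  proof (rule field_le_epsilon)
    fix r :: real assume "0 < r"
    then obtain Z where Z: "(e (?j f), Z) \<in> admissible" "(norm Z)\<^sup>2 < ?B (?j f) (?j f) + r" using approx by blast
    obtain Z' where "(e (?j (?j f)), Z') \<in> admissible" "norm Z' = norm Z"
      using admissible_imaginary[OF jX[OF f] Z(1)] by blast
    then show "?B f f \<le> ?B (?j f) (?j f) + r"
      using low[of "e (?j (?j f))" Z'] Z(2) unfolding jj[OF f]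
      by (simp add: P.neg ip.minus_left ip.minus_right)
  qed
  have Q: "?B (?j f) (?j f) = ?B f f" if f: "f \<in> X S" for f
    using Q_le[OF f] Q_le[OF jX[OF f]] unfolding jj[OF f] by (simp add: P.neg ip.minus_left ip.minus_right)
  have pol: "?B (?j f) (?j g) = ?B f g" if f: "f \<in> X S" and g: "g \<in> X S" for f g
  proof -
    have s: "?B g f = ?B f g" for f g using sa[of "e f" "e g"] sym by metis
    have 1: "e (\<lambda>t. f t + g t) = e f + e g" by (rule e_add[OF f g])
    have 2: "e (?j (\<lambda>t. f t + g t)) = e (?j f) + e (?j g)"
      using e_add[OF jX[OF f] jX[OF g]] by (simp add: vector_add_ldistrib)
    have "?B (?j f) (?j f) + 2 * ?B (?j f) (?j g) + ?B (?j g) (?j g) = ?B f f + 2 * ?B f g + ?B g g"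
      using Q[OF X_add[OF f g]] unfolding 1 2 by (simp add: P.add ip.add_left ip.add_right s[of f g] s[of "?j f" "?j g"])
    then show ?thesis using Q[OF f] Q[OF g] by simp
  qed
  define Pop where "Pop f = rep (P (e f))" for f
  have PopX: "Pop f \<in> X S" for f by (simp add: Pop_def)
  have ePop: "e (Pop f) = cut (P (e f))" for f by (simp add: Pop_def cut_def)
  have ipPop: "ip (e f) (e (Pop g)) = ?B f g" if "f \<in> X S" for f g
    unfolding ePop ip_cut[symmetric] cut_e[OF that] ..
  have ipj: "ip (e f) (e (?j (Pop g))) = ?B f (?j g)" if f: "f \<in> X S" and g: "g \<in> X S" for f g
  proof -
    have "ip (e f) (e (?j (Pop g))) = - ip (e (?j f)) (e (Pop g))" using ip_e_imaginary[OF f PopX] by simp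
    also have "\<dots> = - ?B (?j f) g" by (simp add: ipPop jX f)
    also have "\<dots> = - ?B (?j (?j f)) (?j g)" by (simp only: pol[OF jX[OF f] g])
    also have "\<dots> = ?B f (?j g)" unfolding jj[OF f] by (simp add: ip.minus_left)
    finally show ?thesis .
  qed
  \<comment> \<open>The commutation is known weakly, against arbitrary states; testing with the
    difference of both sides makes it an identity of classes.\<close>
  have ePopj: "e (Pop (?j g)) = e (?j (Pop g))" if g: "g \<in> X S" for g
  proof -
    let ?d = "\<lambda>t. Pop (?j g) t - ?j (Pop g) t"
    have d: "?d \<in> X S" by (intro X_diff PopX jX)
    have ed: "e ?d = e (Pop (?j g)) - e (?j (Pop g))" by (intro e_diff PopX jX)
    have "ip (e ?d) (e ?d) = 0"
      unfolding ed by (subst ip.diff_right) (simp add: ed[symmetric] ipPop[OF d] ipj[OF d g])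
    then show ?thesis unfolding ed by simp
  qed
  have real_comb: "e (\<lambda>t. a *s f t) = Re a *\<^sub>R e f + Im a *\<^sub>R e (?j f)" if f: "f \<in> X S" for a f
  proof -
    have "(\<lambda>t. a *s f t) = (\<lambda>t. complex_of_real (Re a) *s f t + complex_of_real (Im a) *s ?j f t)"
      using complex_eq[of a] by (simp add: fun_eq_iff vec_eq_iff) (metis distrib_right mult.assoc mult.commute)
    then show ?thesis
      by (simp only: e_add[OF X_smult[OF f] X_smult[OF jX[OF f]]] e_of_real_smult[OF f] e_of_real_smult[OF jX[OF f]])
  qed
  have "X_bounded_linear S Pop"
    unfolding X_bounded_linear_def
  proof (intro conjI ballI allI)
    show "Pop f \<in> X S" for f by (rule PopX)
  next
    fix f g a assume f: "f \<in> X S" and g: "g \<in> X S"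
    have "e (Pop (\<lambda>\<zeta>. a *s f \<zeta> + g \<zeta>)) = Re a *\<^sub>R e (Pop f) + Im a *\<^sub>R e (Pop (?j f)) + e (Pop g)"
      by (simp only: ePop e_add[OF X_smult[OF f] g] real_comb[OF f, of a] P.add P.scaleR cut.add cut.scaleR)
    also have "\<dots> = e (\<lambda>\<zeta>. a *s Pop f \<zeta> + Pop g \<zeta>)"
      by (simp only: ePopj[OF f] e_add[OF X_smult[OF PopX] PopX] real_comb[OF PopX, of a])
    finally show "X_eq S (Pop (\<lambda>\<zeta>. a *s f \<zeta> + g \<zeta>)) (\<lambda>\<zeta>. a *s Pop f \<zeta> + Pop g \<zeta>)"
      by (subst X_eq_iff) (auto intro: PopX X_combination)
  next
    obtain C where C: "C > 0" "\<And>x. ip x x \<le> C * (norm x)\<^sup>2" using upper_bound by blast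
    obtain K where K: "K > 0" "\<And>x. norm (P x) \<le> norm x * K" using P.pos_bounded by blast
    show "\<exists>M. \<forall>f\<in>X S. X_norm S (Pop f) \<le> M * X_norm S f"
    proof (intro exI[of _ "sqrt C * K / sqrt c"] ballI)
      fix f assume f: "f \<in> X S"
      have "X_norm S (Pop f) = nrm (cut (P (e f)))" by (simp add: X_norm_eq PopX ePop)
      also have "\<dots> \<le> nrm (P (e f))" by (rule real_sqrt_le_mono[OF ip_cut_le])
      also have "\<dots> \<le> sqrt (C * (norm (P (e f)))\<^sup>2)" by (rule real_sqrt_le_mono[OF C(2)])
      also have "\<dots> = sqrt C * norm (P (e f))" by (simp only: real_sqrt_mult real_sqrt_abs abs_norm_cancel)
      also have "\<dots> \<le> sqrt C * (norm (e f) * K)" using C(1) by (intro mult_left_mono K) auto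
      also have "\<dots> \<le> sqrt C * (nrm (e f) / sqrt c * K)"
        using C(1) K(1) by (intro mult_left_mono mult_right_mono norm_le) auto
      finally show "X_norm S (Pop f) \<le> sqrt C * K / sqrt c * X_norm S f" by (simp add: X_norm_eq f ac_simps)
    qed
  qed
  moreover have "X_self_adjoint S Pop"
    unfolding X_self_adjoint_def
  proof (intro ballI)
    fix f g assume f: "f \<in> X S" and g: "g \<in> X S"
    have *: "ip (e (Pop f)) (e h) = ?B f h" if "h \<in> X S" for h
      using ipPop[OF that, of f] sym sa by metis
    show "X_inner S (Pop f) g = X_inner S f (Pop g)"
      by (simp add: X_inner_eq PopX f g * jX ipPop ipj)
  qed
  moreover have "\<exists>r\<ge>0. X_inner S x0 (Pop x0) = complex_of_real r \<and> ennreal r = optimal_cost S x0"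
    if x0: "x0 \<in> X S" for x0
  proof (intro exI conjI)
    show nn: "0 \<le> ?B x0 x0"
    proof (rule field_le_epsilon)
      fix r :: real assume "0 < r"
      from approx[OF this, of "e x0"] obtain Z :: "'p l2 \<times> 'p l2" where "(norm Z)\<^sup>2 < ?B x0 x0 + r" by blast
      then show "0 \<le> ?B x0 x0 + r" using zero_le_power2[of "norm Z"] by linarith
    qed
    show "ennreal (?B x0 x0) = optimal_cost S x0"
      by (rule optimal_cost_eq[symmetric, OF x0 low approx nn])
    have s: "?B g f = ?B f g" for f g using sa[of "e f" "e g"] sym by metis
    \<comment> \<open>Invariance and symmetry make this number equal to its own negative. It is the
      imaginary part of the inner product, which is therefore real.\<close>
    have "?B x0 (?j x0) = ?B (?j x0) (?j (?j x0))" by (rule pol[symmetric, OF x0 jX[OF x0]])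
    also have "\<dots> = - ?B x0 (?j x0)" unfolding jj[OF x0] using s[of x0 "?j x0"] by (simp add: P.neg ip.minus_right)
    finally have "?B x0 (?j x0) = 0" by simp
    then show "X_inner S x0 (Pop x0) = complex_of_real (?B x0 x0)"
      by (simp add: X_inner_eq PopX x0 ipPop ipj)
  qed
  ultimately show ?thesis unfolding optimal_cost_operator_def by blast
qed

lemma optimal_cost_le: "x0 \<in> X S \<Longrightarrow> optimal_cost S x0 \<le> ennreal (ip (e x0) (e x0))"
proof -
  assume x0: "x0 \<in> X S"
  obtain \<xi> x u y where a: "closed_loop_limit (e x0) \<xi> x u y" using closed_loop_solution_exists by blast
  note D = closed_loop_limitD[OF a]
  have "X_eq S (x 0) x0"
    using D(3) X_eq_iff[OF generalized_solutionD(1)[OF D(2) order_refl] x0] by (simp add: cut_e x0)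
  then have "J S x0 u \<le> running_cost u y" unfolding J_def using D(2) by (intro INF_lower) blast
  also have "\<dots> \<le> ennreal (ip (e x0) (e x0))"
    using closed_loop_limit_cost[OF a] unfolding running_cost_eq[OF D(4,5)] by (intro ennreal_leI) (simp add: cut_e x0)
  finally show ?thesis unfolding optimal_cost_def using D(4) by (meson INF_lower2)
qed

lemma finite_cost: "finite_cost_condition S"
  unfolding finite_cost_condition_def
proof
  fix x0 assume "x0 \<in> X S"
  then have "optimal_cost S x0 < \<infinity>" using optimal_cost_le ennreal_less_top le_less_trans by (metis infinity_ennreal_def)
  then show "\<exists>u. J S x0 u < \<infinity>" unfolding optimal_cost_def by (auto simp: INF_less_iff)
qed

lemma optimal_cost_operator_le_identity:
  assumes "optimal_cost_operator S Pop" shows "le_identity S Pop"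
  unfolding le_identity_def
proof
  fix x0 assume x0: "x0 \<in> X S"
  obtain r where r: "r \<ge> 0" "X_inner S x0 (Pop x0) = complex_of_real r" "ennreal r = optimal_cost S x0"
    using assms x0 unfolding optimal_cost_operator_def by blast
  have "ennreal r \<le> ennreal (ip (e x0) (e x0))" using optimal_cost_le[OF x0] r(3) by simp
  then have "r \<le> ip (e x0) (e x0)" by simp
  then show "Re (X_inner S x0 (Pop x0)) \<le> (X_norm S x0)\<^sup>2" by (simp add: r(2) X_norm_eq x0)
qed

end

section \<open>The lossless case\<close>

locale lossless_phs = passive_phs +
  assumes P0_skew: "P0_skew_adjoint S"
    and lossless: "\<forall>g. WB2 S *v g = 0 \<longrightarrow> 2 * Re (cinner (WB1 S *v g) (WC S *v g)) = Re (cinner (Xi *v g) g)"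
    and stable: "closed_loop_strongly_stable S"
begin

lemmas lower_bound = cost_lower_bound[OF P0_skew lossless stable]

lemma optimal_cost_lossless:
  assumes x0: "x0 \<in> X S" shows "optimal_cost S x0 = ennreal (ip (e x0) (e x0))"
proof (rule antisym[OF optimal_cost_le[OF x0]])
  obtain \<xi> xc uc yc where a: "closed_loop_limit (e x0) \<xi> xc uc yc" using closed_loop_solution_exists by blast
  show "ennreal (ip (e x0) (e x0)) \<le> optimal_cost S x0"
    unfolding optimal_cost_def J_def
  proof (intro INF_greatest)
    fix u y assume "u \<in> L2 {0..}" and "y \<in> {y. \<exists>x. generalized_solution S x u y \<and> X_eq S (x 0) x0}"
    then obtain x where g: "generalized_solution S x u y" "X_eq S (x 0) x0" by blast
    show "ennreal (ip (e x0) (e x0)) \<le> running_cost u y"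
    proof (cases "running_cost u y < \<infinity>")
      case True
      note L = running_cost_finite_imp_L2[OF generalized_solutionD(2,3)[OF g(1)] True]
      have "e (x 0) = cut (e x0)"
        using g(2) X_eq_iff[OF generalized_solutionD(1)[OF g(1) order_refl] x0] by (simp add: cut_e x0)
      from lower_bound(1)[OF a g(1) L this] show ?thesis
        unfolding running_cost_eq[OF L] cut_e[OF x0] by (intro ennreal_leI) (smt (verit) zero_le_power2)
    qed (simp add: less_top[symmetric])
  qed
qed

lemma optimal_trajectory_exists:
  assumes x0: "x0 \<in> X S" shows "\<exists>x u y. optimal_trajectory S x0 x u y"
proof -
  obtain \<xi> x u y where a: "closed_loop_limit (e x0) \<xi> x u y" using closed_loop_solution_exists by blast
  note D = closed_loop_limitD[OF a]
  have eq: "X_eq S (x 0) x0"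
    using D(3) X_eq_iff[OF generalized_solutionD(1)[OF D(2) order_refl] x0] by (simp add: cut_e x0)
  have "running_cost u y \<le> optimal_cost S x0"
    using closed_loop_limit_cost[OF a] unfolding running_cost_eq[OF D(4,5)] optimal_cost_lossless[OF x0]
    by (intro ennreal_leI) (simp add: cut_e x0)
  moreover have "J S x0 u \<le> running_cost u y" unfolding J_def using D(2) eq by (intro INF_lower) blast
  moreover have "optimal_cost S x0 \<le> J S x0 u" unfolding optimal_cost_def using D(4) by (rule INF_lower)
  ultimately have "optimal_trajectory S x0 x u y"
    unfolding optimal_trajectory_def optimal_control_def using D(2,4) eq by auto
  then show ?thesis by blast
qed

lemma emb_eq_0_iff:
  fixes f :: "real \<Rightarrow> complex^'k::finite"
  assumes "f \<in> L2 {0..}" shows "emb {0..} f = 0 \<longleftrightarrow> (AE t in lebesgue_on {0..}. f t = 0)"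
  using emb_eq_iff[of "{0..}" f "\<lambda>_. 0"] assms by simp

text \<open>Optimality of \<open>u\<close> fixes \<open>J\<close>, itself an infimum over outputs,
  so a matching output is only available up to a cost excess \<open>r\<close>. The lower bound turns
  this excess into a bound for the distance of the inputs.\<close>

lemma optimal_control_eq:
  assumes x0: "x0 \<in> X S" and a: "closed_loop_limit (e x0) \<xi> xc uc yc" and opt: "optimal_control S x0 u"
  shows "AE t in lebesgue_on {0..}. u t = uc t"
proof -
  note D = closed_loop_limitD[OF a]
  have u: "u \<in> L2 {0..}" and J: "J S x0 u = ennreal (ip (e x0) (e x0))"
    using opt by (simp_all add: optimal_control_def optimal_cost_lossless[OF x0])
  have "(norm (emb {0..} (\<lambda>t. u t - uc t)))\<^sup>2 \<le> 0 + r" if r: "r > 0" for r :: real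
  proof -
    have "J S x0 u < ennreal (ip (e x0) (e x0) + r)" unfolding J using r by (intro ennreal_lessI) (auto intro: add_nonneg_pos)
    then obtain x y where g: "generalized_solution S x u y" "X_eq S (x 0) x0"
      "running_cost u y < ennreal (ip (e x0) (e x0) + r)"
      unfolding J_def INF_less_iff by blast
    have "running_cost u y < \<infinity>" by (rule less_le_trans[OF g(3)]) simp
    note L = running_cost_finite_imp_L2[OF generalized_solutionD(2,3)[OF g(1)] this]
    have "e (x 0) = cut (e x0)"
      using g(2) X_eq_iff[OF generalized_solutionD(1)[OF g(1) order_refl] x0] by (simp add: cut_e x0)
    from lower_bound(1)[OF a g(1) L this]
    have lb: "ip (e x0) (e x0) + (norm (emb {0..} (\<lambda>t. u t - uc t)))\<^sup>2 + (norm (emb {0..} (\<lambda>t. y t - yc t)))\<^sup>2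
      \<le> (norm (emb {0..} u))\<^sup>2 + (norm (emb {0..} y))\<^sup>2" by (simp add: cut_e x0)
    have "(norm (emb {0..} u))\<^sup>2 + (norm (emb {0..} y))\<^sup>2 < ip (e x0) (e x0) + r"
      using g(3) unfolding running_cost_eq[OF L] by (subst (asm) ennreal_less_iff) auto
    then show ?thesis using lb zero_le_power2[of "norm (emb {0..} (\<lambda>t. y t - yc t))"] by linarith
  qed
  then have "(norm (emb {0..} (\<lambda>t. u t - uc t)))\<^sup>2 \<le> 0" by (rule field_le_epsilon)
  then have "emb {0..} (\<lambda>t. u t - uc t) = 0" by simp
  then show ?thesis unfolding emb_eq_0_iff[OF L2_diff[OF u D(4)]] by simp
qed

text \<open>Equality of costs forces both signals to agree with those of the constructed closed
  loop. Then their sum vanishes almost everywhere, and the second part of the lower bound forces the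
  states to agree as well.\<close>

lemma optimal_trajectory_closed_loop:
  assumes x0: "x0 \<in> X S" and opt: "optimal_trajectory S x0 x u y"
  shows "closed_loop_solution S x u y \<and> (AE t in lebesgue_on {0..}. u t = - y t)"
proof -
  obtain \<xi> xc uc yc where a: "closed_loop_limit (e x0) \<xi> xc uc yc" using closed_loop_solution_exists by blast
  note D = closed_loop_limitD[OF a]
  have g: "generalized_solution S x u y" "X_eq S (x 0) x0"
    and rc: "running_cost u y = ennreal (ip (e x0) (e x0))"
    using opt by (simp_all add: optimal_trajectory_def optimal_cost_lossless[OF x0])
  note G = generalized_solutionD[OF g(1)]
  have "running_cost u y < \<infinity>" by (simp add: rc)
  note L = running_cost_finite_imp_L2[OF G(2,3) this]
  have x0': "e (x 0) = cut (e x0)" using g(2) X_eq_iff[OF G(1)[OF order_refl] x0] by (simp add: cut_e x0)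
  have "(norm (emb {0..} u))\<^sup>2 + (norm (emb {0..} y))\<^sup>2 = ip (e x0) (e x0)"
    using rc unfolding running_cost_eq[OF L] by (subst (asm) ennreal_inj) auto
  with lower_bound(1)[OF a g(1) L x0']
  have "(norm (emb {0..} (\<lambda>t. u t - uc t)))\<^sup>2 + (norm (emb {0..} (\<lambda>t. y t - yc t)))\<^sup>2 \<le> 0"
    by (simp add: cut_e x0)
  then have z: "emb {0..} (\<lambda>t. u t - uc t) = 0" "emb {0..} (\<lambda>t. y t - yc t) = 0"
    by (simp_all add: sum_power2_le_zero_iff)
  have u: "AE t in lebesgue_on {0..}. u t = uc t" and y: "AE t in lebesgue_on {0..}. y t = yc t"
    using z unfolding emb_eq_0_iff[OF L2_diff[OF L(1) D(4)]] emb_eq_0_iff[OF L2_diff[OF L(2) D(5)]] by simp_all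
  have AE_sub: "AE t in lebesgue_on {0..\<tau>}. P t" if "AE t in lebesgue_on {0..}. P t" for P and \<tau> :: real
  proof -
    have "{0::real..} \<in> sets lebesgue" "{0..\<tau>} \<in> sets lebesgue" by simp_all
    note m = this
    from that[unfolded AE_cut_iff[OF m(1)]] show ?thesis
      unfolding AE_cut_iff[OF m(2)] by eventually_elim auto
  qed
  have uy: "AE t in lebesgue_on {0..}. u t + y t = 0"
    using u y by eventually_elim (simp add: D(6))
  have "e (x t) = e (xc t)" if t: "t \<ge> 0" for t
  proof -
    have "emb {0..t} (\<lambda>s. u s + y s) = emb {0..t} (\<lambda>_. 0)"
      using AE_sub[OF uy] G(2,3) t by (subst emb_eq_iff) (auto intro: L2_add L2_locD)
    then have "N t (\<lambda>s. u s + y s) = 0" by simp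
    then have "ip (e (x t) - e (xc t)) (e (x t) - e (xc t)) \<le> 0"
      using lower_bound(2)[OF a g(1) L x0' t] by simp
    then have "ip (e (x t) - e (xc t)) (e (x t) - e (xc t)) = 0" by (rule antisym[OF _ nonneg])
    then show ?thesis by simp
  qed
  note ex = this
  \<comment> \<open>The limit relation sees classes only, so the classical solutions approximating
    the constructed closed loop also approximate the given trajectory.\<close>
  obtain xs us ys where cl: "\<And>k. classical_solution S (xs k) (us k) (ys k)"
    "\<And>k t. t \<ge> 0 \<Longrightarrow> (tWB1 S + tWC S) *v trace S (xs k t) = 0" and lim: "solution_limit S xs us ys xc uc yc"
    using D(1) unfolding closed_loop_solution_def by blast
  note LD = solution_limitD[OF cl(1) lim]
  have eu: "emb {0..\<tau>} u = emb {0..\<tau>} uc" "emb {0..\<tau>} y = emb {0..\<tau>} yc" if "\<tau> \<ge> 0" for \<tau>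
    using AE_sub[OF u] AE_sub[OF y] G(2,3) LD(2,3) that by (auto simp: emb_eq_iff L2_locD)
  have "solution_limit S xs us ys x u y"
  proof (rule iffD2[OF solution_limit_iff[OF cl(1) _ G(2,3)]]; (intro allI impI conjI)?)
    show "x t \<in> X S" if "t \<ge> 0" for t by (rule G(1)[OF that])
    fix \<tau> :: real assume \<tau>: "\<tau> \<ge> 0"
    show "uniform_limit {0..\<tau>} (\<lambda>k t. nrm (e (xs k t) - e (x t))) (\<lambda>_. 0) sequentially"
      using LD(4)[OF \<tau>] by (rule uniform_limit_cong[THEN iffD1, rotated 2]) (auto simp: ex)
    show "(\<lambda>k. emb {0..\<tau>} (us k)) \<longlonglongrightarrow> emb {0..\<tau>} u" "(\<lambda>k. emb {0..\<tau>} (ys k)) \<longlonglongrightarrow> emb {0..\<tau>} y"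
      unfolding eu[OF \<tau>] by (rule LD(5)[OF \<tau>], rule LD(6)[OF \<tau>])
  qed
  then have "closed_loop_solution S x u y" unfolding closed_loop_solution_def using cl by blast
  moreover have "AE t in lebesgue_on {0..}. u t = - y t" using uy by eventually_elim (simp add: add_eq_0_iff2)
  ultimately show ?thesis ..
qed

text \<open>The quadratic forms of \<open>Pop\<close> and of the identity coincide, and
  self-adjointness allows polarization. The resulting weak identity is tested with the difference
  \<open>Pop f - f\<close>.\<close>

lemma optimal_cost_operator_is_identity:
  assumes P: "optimal_cost_operator S Pop" shows "is_identity S Pop"
  unfolding is_identity_def
proof
  fix f assume f: "f \<in> X S"
  have bl: "X_bounded_linear S Pop" and sa: "X_self_adjoint S Pop"
    using P by (simp_all add: optimal_cost_operator_def)
  have PX: "Pop f \<in> X S" if "f \<in> X S" for f using bl that by (simp add: X_bounded_linear_def)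
  interpret B: bounded_linear "\<lambda>F. e (Pop (rep F))" by (rule X_bounded_linear_lift(2)[OF bl])
  have Be: "e (Pop (rep (e f))) = e (Pop f)" if "f \<in> X S" for f by (rule X_bounded_linear_lift(1)[OF bl that])
  have q: "ip (e f) (e (Pop f)) = ip (e f) (e f)" if f: "f \<in> X S" for f
  proof -
    obtain r where r: "r \<ge> 0" "X_inner S f (Pop f) = complex_of_real r" "ennreal r = optimal_cost S f"
      using P f unfolding optimal_cost_operator_def by blast
    have "r = ip (e f) (e f)" using r(1,3) unfolding optimal_cost_lossless[OF f] by simp
    then show ?thesis using Re_X_inner[OF f PX[OF f]] by (simp add: r(2))
  qed
  have pol: "ip (e g) (e (Pop f)) = ip (e g) (e f)" if g: "g \<in> X S" for g
  proof -
    have add: "e (Pop (\<lambda>t. f t + g t)) = e (Pop f) + e (Pop g)"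
      using B.add[of "e f" "e g"] Be[OF f] Be[OF g] Be[OF X_add[OF f g]] by (simp add: e_add f g)
    have "ip (e (Pop f)) (e g) = ip (e f) (e (Pop g))"
      using arg_cong[of _ _ Re, OF sa[unfolded X_self_adjoint_def, rule_format, OF f g]]
      by (simp add: Re_X_inner f g PX)
    then have s: "ip (e f) (e (Pop g)) = ip (e g) (e (Pop f))" by (metis sym)
    show ?thesis
      using q[OF X_add[OF f g]] q[OF f] q[OF g] s sym[of "e f" "e g"]
      unfolding add by (simp add: e_add f g ip.add_left ip.add_right)
  qed
  let ?d = "\<lambda>t. Pop f t - f t"
  have d: "?d \<in> X S" "e ?d = e (Pop f) - e f" using f PX by (auto simp: X_diff e_diff)
  have "ip (e ?d) (e ?d) = 0"
    using pol[OF d(1)] by (subst (2) d(2)) (simp add: ip.diff_right)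
  then have "e (Pop f) = e f" using d(2) by simp
  then show "X_eq S (Pop f) f" using X_eq_iff[OF PX[OF f] f] by simp
qed

lemma Riccati:
  assumes P: "optimal_cost_operator S Pop" shows "boundary_node_Riccati S Pop"
  unfolding boundary_node_Riccati_def
proof
  fix x assume x: "x \<in> DL S"
  have xX: "x \<in> X S" and LX: "opL S x \<in> X S" by (rule DL_X[OF x], rule DL_opL_X[OF x])
  have PX: "Pop x \<in> X S" using P xX by (simp add: optimal_cost_operator_def X_bounded_linear_def)
  have ePx: "e (Pop x) = e x"
    using optimal_cost_operator_is_identity[OF P] X_eq_iff[OF PX xX] xX by (simp add: is_identity_def)
  have ej: "e (\<lambda>t. \<i> *s Pop x t) = e (\<lambda>t. \<i> *s x t)"
  proof -
    obtain T where "\<And>f. f \<in> X S \<Longrightarrow> e (\<lambda>t. \<i> *s f t) = T (e f)" using bounded_linear_e_smult by blast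
    then show ?thesis by (simp add: PX xX ePx)
  qed
  \<comment> \<open>Multiplication by the imaginary unit is skew for \<open>ip\<close>, so the
    imaginary parts of the two inner products are opposite and only twice the real part
    remains.\<close>
  have "ip (e x) (e (\<lambda>t. \<i> *s opL S x t)) = - ip (e (opL S x)) (e (\<lambda>t. \<i> *s x t))"
    using ip_e_imaginary[OF xX LX] by (simp add: sym[of "e (opL S x)"])
  then have "X_inner S (opL S x) (Pop x) + X_inner S (Pop x) (opL S x) = complex_of_real (2 * ip (e x) (e (opL S x)))"
    by (simp add: X_inner_eq LX PX ePx ej sym[of "e (opL S x)" "e x"])
  moreover have "2 * ip (e x) (e (opL S x)) = 2 * (opG S x \<bullet> opK S x)"
    using ip_opL_eq[OF P0_skew lossless x] by simp
  moreover have "(norm (opN S x))\<^sup>2 = 2 * (opG S x \<bullet> opK S x) + (norm (opG S x))\<^sup>2 + (norm (opK S x))\<^sup>2"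
    unfolding opN_def opG_def opK_def matrix_vector_mult_add_rdistrib
    by (simp add: power2_norm_eq_inner inner_add_left inner_add_right inner_commute)
  ultimately show "X_inner S (opL S x) (Pop x) + X_inner S (Pop x) (opL S x)
        + complex_of_real ((norm (opG S x))\<^sup>2) + complex_of_real ((norm (opK S x))\<^sup>2)
      = complex_of_real ((norm (opN S x))\<^sup>2)"
    by (simp only: of_real_add[symmetric])
qed

end

text \<open>Operators, controls and trajectories are determined only up to null sets. The
  conclusions are therefore phrased for every optimal object, together with the existence of
  one.\<close>

theorem theorem7:
  fixes S :: "('n::finite, 'p::finite) phs"
  assumes "port_hamiltonian S"
    and "standing_assumption S"
    and "P0_dissipative S"
    and "\<And>g. WB2 S *v g = 0 \<Longrightarrow> 2 * Re (cinner (WB1 S *v g) (WC S *v g)) \<ge> Re (cinner (Xi *v g) g)"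
  shows "finite_cost_condition S \<and>
    (\<exists>Pop. optimal_cost_operator S Pop) \<and>
    (\<forall>Pop. optimal_cost_operator S Pop \<longrightarrow> le_identity S Pop) \<and>
    (P0_skew_adjoint S \<and>
     (\<forall>g. WB2 S *v g = 0 \<longrightarrow> 2 * Re (cinner (WB1 S *v g) (WC S *v g)) = Re (cinner (Xi *v g) g)) \<and>
     closed_loop_strongly_stable S
     \<longrightarrow>
     (\<forall>Pop. optimal_cost_operator S Pop \<longrightarrow> is_identity S Pop \<and> boundary_node_Riccati S Pop) \<and>
     (\<forall>x0\<in>X S.
        (\<exists>x u y. optimal_trajectory S x0 x u y) \<and>
        (\<forall>u u'. optimal_control S x0 u \<and> optimal_control S x0 u' \<longrightarrow>
           (AE t in lebesgue_on {0..}. u t = u' t)) \<and>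
        (\<forall>x u y. optimal_trajectory S x0 x u y \<longrightarrow>
           closed_loop_solution S x u y \<and> (AE t in lebesgue_on {0..}. u t = - y t))))"
proof -
  obtain Hm K c where "phs_space S Hm K c" using phs_space_exists[OF assms(1)] by blast
  then interpret phs_space S Hm K c .
  interpret passive_phs S Hm K c
    by unfold_locales (use assms(3,4) in auto)
  show ?thesis
  proof (intro conjI impI)
    show "finite_cost_condition S" by (rule finite_cost)
    show "\<exists>Pop. optimal_cost_operator S Pop" by (rule optimal_cost_operator_exists)
    show "\<forall>Pop. optimal_cost_operator S Pop \<longrightarrow> le_identity S Pop"
      using optimal_cost_operator_le_identity by blast
  next
    assume h: "P0_skew_adjoint S \<and>
     (\<forall>g. WB2 S *v g = 0 \<longrightarrow> 2 * Re (cinner (WB1 S *v g) (WC S *v g)) = Re (cinner (Xi *v g) g)) \<and>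
     closed_loop_strongly_stable S"
    interpret lossless_phs S Hm K c
      by unfold_locales (use h in auto)
    show "\<forall>Pop. optimal_cost_operator S Pop \<longrightarrow> is_identity S Pop \<and> boundary_node_Riccati S Pop"
      using optimal_cost_operator_is_identity Riccati by blast
    show "\<forall>x0\<in>X S.
        (\<exists>x u y. optimal_trajectory S x0 x u y) \<and>
        (\<forall>u u'. optimal_control S x0 u \<and> optimal_control S x0 u' \<longrightarrow>
           (AE t in lebesgue_on {0..}. u t = u' t)) \<and>
        (\<forall>x u y. optimal_trajectory S x0 x u y \<longrightarrow>
           closed_loop_solution S x u y \<and> (AE t in lebesgue_on {0..}. u t = - y t))"
    proof (intro ballI conjI allI impI)
      fix x0 assume x0: "x0 \<in> X S"
      show "\<exists>x u y. optimal_trajectory S x0 x u y" by (rule optimal_trajectory_exists[OF x0])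
      fix u u' assume u: "optimal_control S x0 u \<and> optimal_control S x0 u'"
      obtain \<xi> xc uc yc where a: "closed_loop_limit (e x0) \<xi> xc uc yc" using closed_loop_solution_exists by blast
      have "AE t in lebesgue_on {0..}. u t = uc t" "AE t in lebesgue_on {0..}. u' t = uc t"
        using optimal_control_eq[OF x0 a] u by blast+
      then show "AE t in lebesgue_on {0..}. u t = u' t" by eventually_elim simp
    next
      fix x0 x u y assume "x0 \<in> X S" "optimal_trajectory S x0 x u y"
      from optimal_trajectory_closed_loop[OF this]
      show "closed_loop_solution S x u y" "AE t in lebesgue_on {0..}. u t = - y t" by auto
    qed
  qed
qed

end
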